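(* Let $X$ be a complex Banach space. The following assertions are equivalent: (i) $X$ is $H^1$-projective. (ii) There exist a constant $\lambda$, a set $I$ and a metric surjection $\sigma:\ell^1(I)\to X$ such that $\tilde\sigma:\widetilde H^1(\ell^1(I))\to\widetilde H^1(X)$ is a $\lambda$-surjection. (iii) Every surjection (i.e. surjective bounded linear operator) $\rho$ from some Banach space $Y$ onto $X$ induces a surjection $\tilde\rho:\widetilde H^1(Y)\to\widetilde H^1(X)$. Moreover, the smallest $\lambda$ satisfying (ii) is equal to $\eta(X)$.
   Context: All Banach spaces are complex. Let $\mathbb{T}$ be the unit circle with normalized Haar measure $dm$. For a Banach space $X$, $\widetilde H^1(X)$ is the closure in the Bochner space $L^1(\mathbb{T};X)$ of the set of $X$-valued analytic polynomials $\sum_{k=0}^n z^k x_k$ ($n\in\mathbb{N}$, $x_k\in X$), with the $L^1(\mathbb{T};X)$-norm; $H^1=\widetilde H^1(\mathbb{C})$ is the scalar Hardy space. $\hat\otimes$ denotes the (completed) projective tensor product of Banach spaces. There is a canonical norm-one inclusion map $H^1\hat\otimes X\hookrightarrow\widetilde H^1(X)$ sending $h\otimes x$ to the function $h(\cdot)x$. $X$ is called $H^1$-projective if this map is surjective; equivalently, if there is a constant $c$ such that $\|F\|_{H^1\hat\otimes X}\le c\,\|F\|_{\widetilde H^1(X)}$ for all $F\in H^1\hat\otimes X$. The smallest such $c$ is denoted $\eta(X)$. For a bounded operator $T:X\to Y$, $\widetilde T:\widetilde H^1(X)\to\widetilde H^1(Y)$ denotes the bounded operator, of the same norm as $T$,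 determined by $\widetilde T(\sum_{k=0}^n z^k a_k)=\sum_{k=0}^n z^kT(a_k)$. A norm-one operator $u:X\to Y$ is $\lambda$-surjective (a $\lambda$-surjection) if for every $y\in Y$ with $\|y\|<1$ there is $x\in X$ with $\|x\|<\lambda$ and $u(x)=y$. A norm-one operator is a metric surjection if it is $(1+\varepsilon)$-surjective for every $\varepsilon>0$. $\ell^1(I)$ is the $L^1$-space of the counting measure on $I$. *)

theory Defs
  imports
    "HOL-Analysis.Analysis"
    "HOL-Algebra.Module"
    "HOL-Algebra.AbelCoset"
    "HOL-Library.Poly_Mapping"
begin

section \<open>Complex normed spaces with explicit carriers\<close>

text \<open>
  The statement quantifies over Banach spaces, so these are records with a carrier, not types.
  A complex vector space is a HOL-Algebra module over the field of complex numbers. The \<open>mult\<close> and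
  \<open>one\<close> fields that the module record inherits from rings are used only for the scalars.
\<close>

record 'a cspace = "(complex, 'a) module" +
  nrm :: "'a \<Rightarrow> real"

text \<open>This serves both as the coefficient field and as the one-dimensional Banach space.\<close>

definition scalars :: "complex cspace" where
  "scalars =
     \<lparr>carrier = UNIV, mult = (*), one = 1, zero = 0, add = (+), smult = (*), nrm = cmod\<rparr>"

definition complex_vector_space :: "'a cspace \<Rightarrow> bool" where
  "complex_vector_space V \<longleftrightarrow> Module.module scalars V"

definition complex_normed_space :: "'a cspace \<Rightarrow> bool" where
  "complex_normed_space V \<longleftrightarrow> complex_vector_space V \<and>
     (\<forall>x\<in>carrier V. 0 \<le> nrm V x \<and> (nrm V x = 0 \<longleftrightarrow> x = \<zero>\<^bsub>V\<^esub>)) \<and>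
     (\<forall>c. \<forall>x\<in>carrier V. nrm V (c \<odot>\<^bsub>V\<^esub> x) = cmod c * nrm V x) \<and>
     (\<forall>x\<in>carrier V. \<forall>y\<in>carrier V. nrm V (x \<oplus>\<^bsub>V\<^esub> y) \<le> nrm V x + nrm V y)"

definition cauchy_in :: "'a cspace \<Rightarrow> (nat \<Rightarrow> 'a) \<Rightarrow> bool" where
  "cauchy_in V s \<longleftrightarrow> (\<forall>n. s n \<in> carrier V) \<and>
     (\<forall>\<epsilon>>0. \<exists>N. \<forall>m\<ge>N. \<forall>n\<ge>N. nrm V (s m \<ominus>\<^bsub>V\<^esub> s n) < \<epsilon>)"

definition complex_banach_space :: "'a cspace \<Rightarrow> bool" where
  "complex_banach_space V \<longleftrightarrow> complex_normed_space V \<and>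
     (\<forall>s. cauchy_in V s \<longrightarrow> (\<exists>x\<in>carrier V. (\<lambda>n. nrm V (s n \<ominus>\<^bsub>V\<^esub> x)) \<longlonglongrightarrow> 0))"

text \<open>
  The quotient by a linear subspace, with the quotient seminorm. It is used three times: for functions
  modulo null functions, for tensor products, and for completions.
\<close>

definition quotient_space :: "'a cspace \<Rightarrow> 'a set \<Rightarrow> 'a set cspace" where
  "quotient_space V N =
     \<lparr>carrier = a_rcosets\<^bsub>V\<^esub> N, mult = undefined, one = undefined,
      zero = N, add = (\<lambda>A B. A <+>\<^bsub>V\<^esub> B),
      smult = (\<lambda>c A. \<Union>a\<in>A. N +>\<^bsub>V\<^esub> (c \<odot>\<^bsub>V\<^esub> a)),
      nrm = (\<lambda>A. Inf (nrm V ` A))\<rparr>"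

definition cauchy_space :: "'a cspace \<Rightarrow> (nat \<Rightarrow> 'a) cspace" where
  "cauchy_space V =
     \<lparr>carrier = {s. cauchy_in V s}, mult = undefined, one = undefined,
      zero = (\<lambda>n. \<zero>\<^bsub>V\<^esub>), add = (\<lambda>s t n. s n \<oplus>\<^bsub>V\<^esub> t n),
      smult = (\<lambda>c s n. c \<odot>\<^bsub>V\<^esub> s n),
      nrm = (\<lambda>s. lim (\<lambda>n. nrm V (s n)))\<rparr>"

definition null_sequences :: "'a cspace \<Rightarrow> (nat \<Rightarrow> 'a) set" where
  "null_sequences V = {s. (\<forall>n. s n \<in> carrier V) \<and> (\<lambda>n. nrm V (s n)) \<longlonglongrightarrow> 0}"

definition completion_space :: "'a cspace \<Rightarrow> (nat \<Rightarrow> 'a) set cspace" where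
  "completion_space V = quotient_space (cauchy_space V) (null_sequences V)"

definition completion_embed :: "'a cspace \<Rightarrow> 'a \<Rightarrow> (nat \<Rightarrow> 'a) set" where
  "completion_embed V x = null_sequences V +>\<^bsub>cauchy_space V\<^esub> (\<lambda>n. x)"

definition ell1 :: "'i set \<Rightarrow> ('i \<Rightarrow> complex) cspace" where
  "ell1 I =
     \<lparr>carrier = {f \<in> extensional I. integrable (count_space I) f},
      mult = undefined, one = undefined,
      zero = (\<lambda>i\<in>I. 0), add = (\<lambda>f g. \<lambda>i\<in>I. f i + g i), smult = (\<lambda>c f. \<lambda>i\<in>I. c * f i),
      nrm = (\<lambda>f. LINT i|count_space I. cmod (f i))\<rparr>"


section \<open>Bounded operators and surjections\<close>

definition bounded_operator :: "'a cspace \<Rightarrow> 'b cspace \<Rightarrow> ('a \<Rightarrow> 'b) \<Rightarrow> bool" where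
  "bounded_operator V W T \<longleftrightarrow>
     T \<in> carrier V \<rightarrow> carrier W \<and>
     (\<forall>x\<in>carrier V. \<forall>y\<in>carrier V. T (x \<oplus>\<^bsub>V\<^esub> y) = T x \<oplus>\<^bsub>W\<^esub> T y) \<and>
     (\<forall>c. \<forall>x\<in>carrier V. T (c \<odot>\<^bsub>V\<^esub> x) = c \<odot>\<^bsub>W\<^esub> T x) \<and>
     (\<exists>K. \<forall>x\<in>carrier V. nrm W (T x) \<le> K * nrm V x)"

definition op_norm :: "'a cspace \<Rightarrow> 'b cspace \<Rightarrow> ('a \<Rightarrow> 'b) \<Rightarrow> real" where
  "op_norm V W T = Sup {nrm W (T x) | x. x \<in> carrier V \<and> nrm V x \<le> 1}"

definition surjective_operator :: "'a cspace \<Rightarrow> 'b cspace \<Rightarrow> ('a \<Rightarrow> 'b) \<Rightarrow> bool" where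
  "surjective_operator V W T \<longleftrightarrow> bounded_operator V W T \<and> T ` carrier V = carrier W"

definition lambda_surjection :: "real \<Rightarrow> 'a cspace \<Rightarrow> 'b cspace \<Rightarrow> ('a \<Rightarrow> 'b) \<Rightarrow> bool" where
  "lambda_surjection r V W u \<longleftrightarrow>
     bounded_operator V W u \<and> op_norm V W u = 1 \<and>
     (\<forall>y\<in>carrier W. nrm W y < 1 \<longrightarrow> (\<exists>x\<in>carrier V. nrm V x < r \<and> u x = y))"

definition metric_surjection :: "'a cspace \<Rightarrow> 'b cspace \<Rightarrow> ('a \<Rightarrow> 'b) \<Rightarrow> bool" where
  "metric_surjection V W u \<longleftrightarrow> (\<forall>\<epsilon>>0. lambda_surjection (1 + \<epsilon>) V W u)"


section \<open>The Bochner space \<open>L\<^sup>1\<close> of the circle and the Hardy space\<close>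

abbreviation circle :: "complex set" where
  "circle \<equiv> sphere 0 1"

text \<open>Normalized Haar measure, as the image of Lebesgue measure on the unit interval.\<close>

definition haar_circle :: "complex measure" where
  "haar_circle =
     distr (restrict_space lborel {0..1}) (restrict_space borel circle) (\<lambda>t. cis (2 * pi * t))"

definition strongly_measurable :: "'a cspace \<Rightarrow> (complex \<Rightarrow> 'a) \<Rightarrow> bool" where
  "strongly_measurable X f \<longleftrightarrow>
     (\<exists>s. (\<forall>n. simple_function haar_circle (s n) \<and> s n \<in> circle \<rightarrow> carrier X) \<and>
          (AE z in haar_circle. (\<lambda>n. nrm X (s n z \<ominus>\<^bsub>X\<^esub> f z)) \<longlonglongrightarrow> 0))"

definition bochner_functions :: "'a cspace \<Rightarrow> (complex \<Rightarrow> 'a) cspace" where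
  "bochner_functions X =
     \<lparr>carrier = {f \<in> circle \<rightarrow>\<^sub>E carrier X. strongly_measurable X f \<and>
                    (\<integral>\<^sup>+z. ennreal (nrm X (f z)) \<partial>haar_circle) < \<infinity>},
      mult = undefined, one = undefined,
      zero = (\<lambda>z\<in>circle. \<zero>\<^bsub>X\<^esub>), add = (\<lambda>f g. \<lambda>z\<in>circle. f z \<oplus>\<^bsub>X\<^esub> g z),
      smult = (\<lambda>c f. \<lambda>z\<in>circle. c \<odot>\<^bsub>X\<^esub> f z),
      nrm = (\<lambda>f. enn2real (\<integral>\<^sup>+z. ennreal (nrm X (f z)) \<partial>haar_circle))\<rparr>"

definition null_functions :: "'a cspace \<Rightarrow> (complex \<Rightarrow> 'a) set" where
  "null_functions X =
     {f \<in> carrier (bochner_functions X). AE z in haar_circle. f z = \<zero>\<^bsub>X\<^esub>}"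

definition bochner_L1 :: "'a cspace \<Rightarrow> (complex \<Rightarrow> 'a) set cspace" where
  "bochner_L1 X = quotient_space (bochner_functions X) (null_functions X)"

definition L1_class :: "'a cspace \<Rightarrow> (complex \<Rightarrow> 'a) \<Rightarrow> (complex \<Rightarrow> 'a) set" where
  "L1_class X f = null_functions X +>\<^bsub>bochner_functions X\<^esub> restrict f circle"

definition analytic_poly :: "'a cspace \<Rightarrow> nat \<Rightarrow> (nat \<Rightarrow> 'a) \<Rightarrow> (complex \<Rightarrow> 'a) set" where
  "analytic_poly X n x = L1_class X (\<lambda>z. \<Oplus>\<^bsub>X\<^esub>k\<in>{..n}. (z ^ k) \<odot>\<^bsub>X\<^esub> x k)"

definition hardy1 :: "'a cspace \<Rightarrow> (complex \<Rightarrow> 'a) set cspace" where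
  "hardy1 X = (bochner_L1 X)
     \<lparr>carrier := {F \<in> carrier (bochner_L1 X).
        \<forall>\<epsilon>>0. \<exists>n x. x \<in> {..n} \<rightarrow> carrier X \<and>
          nrm (bochner_L1 X) (F \<ominus>\<^bsub>bochner_L1 X\<^esub> analytic_poly X n x) < \<epsilon>}\<rparr>"

definition hardy_ext ::
    "'a cspace \<Rightarrow> 'b cspace \<Rightarrow> ('a \<Rightarrow> 'b) \<Rightarrow> (complex \<Rightarrow> 'a) set \<Rightarrow> (complex \<Rightarrow> 'b) set" where
  "hardy_ext X Y T =
     (THE S. S \<in> extensional (carrier (hardy1 X)) \<and>
        bounded_operator (hardy1 X) (hardy1 Y) S \<and>
        (\<forall>n. \<forall>a\<in>{..n} \<rightarrow> carrier X. S (analytic_poly X n a) = analytic_poly Y n (T \<circ> a)))"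


section \<open>The projective tensor product\<close>

text \<open>
  The seminorm of \<open>\<Sum> c\<^sub>i (x\<^sub>i, y\<^sub>i)\<close> in the free vector space is \<open>\<Sum> \<bar>c\<^sub>i\<bar> \<parallel>x\<^sub>i\<parallel> \<parallel>y\<^sub>i\<parallel>\<close>. The quotient seminorm
  on \<open>alg_tensor\<close> is then the infimum of these numbers over all representations of a tensor, which is
  the projective norm.
\<close>

definition free_space :: "'a cspace \<Rightarrow> 'b cspace \<Rightarrow> ('a \<times> 'b \<Rightarrow>\<^sub>0 complex) cspace" where
  "free_space E F =
     \<lparr>carrier = {u. Poly_Mapping.keys u \<subseteq> carrier E \<times> carrier F},
      mult = undefined, one = undefined,
      zero = 0, add = (+), smult = (\<lambda>c. Poly_Mapping.map ((*) c)),
      nrm = (\<lambda>u. \<Sum>p\<in>Poly_Mapping.keys u.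
               cmod (Poly_Mapping.lookup u p) * nrm E (fst p) * nrm F (snd p))\<rparr>"

definition bilinear_relators :: "'a cspace \<Rightarrow> 'b cspace \<Rightarrow> ('a \<times> 'b \<Rightarrow>\<^sub>0 complex) set" where
  "bilinear_relators E F =
     (let \<delta> = (\<lambda>x y. Poly_Mapping.single (x, y) (1::complex)) in
       {\<delta> (x \<oplus>\<^bsub>E\<^esub> x') y - \<delta> x y - \<delta> x' y | x x' y.
          x \<in> carrier E \<and> x' \<in> carrier E \<and> y \<in> carrier F} \<union>
       {\<delta> x (y \<oplus>\<^bsub>F\<^esub> y') - \<delta> x y - \<delta> x y' | x y y'.
          x \<in> carrier E \<and> y \<in> carrier F \<and> y' \<in> carrier F} \<union>
       {\<delta> (c \<odot>\<^bsub>E\<^esub> x) y - Poly_Mapping.single (x, y) c | c x y.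
          x \<in> carrier E \<and> y \<in> carrier F} \<union>
       {\<delta> x (c \<odot>\<^bsub>F\<^esub> y) - Poly_Mapping.single (x, y) c | c x y.
          x \<in> carrier E \<and> y \<in> carrier F})"

definition tensor_relations :: "'a cspace \<Rightarrow> 'b cspace \<Rightarrow> ('a \<times> 'b \<Rightarrow>\<^sub>0 complex) set" where
  "tensor_relations E F =
     \<Inter>{N. submodule N scalars (free_space E F) \<and>
          bilinear_relators E F \<subseteq> N}"

definition alg_tensor :: "'a cspace \<Rightarrow> 'b cspace \<Rightarrow> ('a \<times> 'b \<Rightarrow>\<^sub>0 complex) set cspace" where
  "alg_tensor E F = quotient_space (free_space E F) (tensor_relations E F)"

definition proj_tensor ::
    "'a cspace \<Rightarrow> 'b cspace \<Rightarrow> (nat \<Rightarrow> ('a \<times> 'b \<Rightarrow>\<^sub>0 complex) set) set cspace" where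
  "proj_tensor E F = completion_space (alg_tensor E F)"

definition elem_tensor ::
    "'a cspace \<Rightarrow> 'b cspace \<Rightarrow> 'a \<Rightarrow> 'b \<Rightarrow> (nat \<Rightarrow> ('a \<times> 'b \<Rightarrow>\<^sub>0 complex) set) set" where
  "elem_tensor E F x y = completion_embed (alg_tensor E F)
     (tensor_relations E F +>\<^bsub>free_space E F\<^esub> Poly_Mapping.single (x, y) 1)"


section \<open>\<open>H\<^sup>1\<close>-projectivity\<close>

text \<open>
  The element \<open>f\<close> of \<open>hardy1 scalars\<close> is an almost-everywhere class, and \<open>h\<close> is any function in it.
\<close>

definition canonical_map ::
    "'x cspace \<Rightarrow> (nat \<Rightarrow> ((complex \<Rightarrow> complex) set \<times> 'x \<Rightarrow>\<^sub>0 complex) set) set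
       \<Rightarrow> (complex \<Rightarrow> 'x) set" where
  "canonical_map X =
     (THE J. J \<in> extensional (carrier (proj_tensor (hardy1 scalars) X)) \<and>
        bounded_operator (proj_tensor (hardy1 scalars) X) (hardy1 X) J \<and>
        (\<forall>f\<in>carrier (hardy1 scalars). \<forall>h\<in>f. \<forall>x\<in>carrier X.
           J (elem_tensor (hardy1 scalars) X f x) = L1_class X (\<lambda>z. h z \<odot>\<^bsub>X\<^esub> x)))"

definition H1_projective :: "'x cspace \<Rightarrow> bool" where
  "H1_projective X \<longleftrightarrow>
     canonical_map X ` carrier (proj_tensor (hardy1 scalars) X) = carrier (hardy1 X)"

definition eta :: "'x cspace \<Rightarrow> real" where
  "eta X = (LEAST c. \<forall>u\<in>carrier (proj_tensor (hardy1 scalars) X).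
     nrm (proj_tensor (hardy1 scalars) X) u \<le> c * nrm (hardy1 X) (canonical_map X u))"


section \<open>The conditions of the theorem\<close>

text \<open>
  HOL cannot quantify over all types inside a formula, so the set \<open>I\<close> and the space \<open>Y\<close> below live in
  a universe type. It is the sum of an arbitrary type \<open>'u\<close>, by which it contains any given set or
  space, and \<open>'x \<Rightarrow> complex\<close>, by which it contains a copy of \<open>ell1\<close> of the unit ball of \<open>X\<close>. The latter
  cannot be dropped: over too small a type the condition on all \<open>Y\<close> is vacuous.
\<close>

type_synonym ('u, 'x) universe = "'u + ('x \<Rightarrow> complex)"

definition lifts_from_ell1 ::
    "('u, 'x) universe itself \<Rightarrow> 'x cspace \<Rightarrow> real \<Rightarrow> bool" where
  "lifts_from_ell1 _ X r \<longleftrightarrow>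
     (\<exists>(I :: ('u, 'x) universe set) \<sigma>.
        metric_surjection (ell1 I) X \<sigma> \<and>
        lambda_surjection r (hardy1 (ell1 I)) (hardy1 X) (hardy_ext (ell1 I) X \<sigma>))"

definition lifts_all_surjections ::
    "('u, 'x) universe itself \<Rightarrow> 'x cspace \<Rightarrow> bool" where
  "lifts_all_surjections _ X \<longleftrightarrow>
     (\<forall>(Y :: ('u, 'x) universe cspace) \<rho>.
        complex_banach_space Y \<and> surjective_operator Y X \<rho> \<longrightarrow>
        surjective_operator (hardy1 Y) (hardy1 X) (hardy_ext Y X \<rho>))"

end

theory Submission
  imports Defs
begin

text \<open>
  Let \<open>J\<close> be the canonical map from the projective tensor product \<open>H\<^sup>1 \<otimes> X\<close> to the Hardy space \<open>H\<^sup>1(X)\<close>.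
  Three facts carry the proof.

  First, \<open>J\<close> is injective (\<open>canonical_map_inj\<close>). Fejer means are contractions of finite rank on \<open>H\<^sup>1\<close> that
  converge strongly to the identity. Applied to the first factor, they converge strongly to the
  identity of \<open>H\<^sup>1 \<otimes> X\<close>, and the mean of order \<open>n\<close> of a tensor \<open>u\<close> is \<open>\<Sum> (1 - k/n) z\<^sup>k \<otimes> c\<^sub>k\<close>, where \<open>c\<^sub>k\<close> is the
  \<open>k\<close>-th Taylor coefficient of \<open>J u\<close>. So \<open>J u\<close> determines \<open>u\<close>. If \<open>X\<close> is \<open>H\<^sup>1\<close>-projective, then \<open>J\<close> is an
  isomorphism by the open mapping theorem, and \<open>eta X\<close> is the norm of its inverse (\<open>eta_props\<close>).

  Second, tensors lift term by term (\<open>lift_canonical\<close>). If every \<open>x\<close> in \<open>X\<close> has a preimage \<open>y\<close> under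
  \<open>\<rho> : Y \<rightarrow> X\<close> with \<open>\<parallel>y\<parallel> \<le> C \<parallel>x\<parallel>\<close>, then replacing the \<open>x\<^sub>i\<close> in \<open>\<Sum> h\<^sub>i \<otimes> x\<^sub>i\<close> shows that \<open>J u\<close> is the image
  under the extension of \<open>\<rho>\<close> of a function of norm at most \<open>C \<parallel>u\<parallel> + \<epsilon>\<close>. For an arbitrary surjection the
  open mapping theorem provides \<open>C\<close>. The canonical map of \<open>ell1\<close> of the unit sphere onto \<open>X\<close> has \<open>C = 1\<close>,
  so for it the extension is an \<open>eta X\<close>-surjection.

  Third, \<open>H\<^sup>1\<close> of \<open>ell1 I\<close> is \<open>H\<^sup>1 \<otimes> ell1 I\<close> isometrically, because the norm of a polynomial with finitely
  supported coefficients is the sum of the norms of its coordinates. So an operator \<open>\<sigma>\<close> from \<open>ell1 I\<close> to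
  \<open>X\<close> with \<open>\<parallel>\<sigma> e\<^sub>i\<parallel> \<le> 1\<close> takes every \<open>G\<close> in \<open>H\<^sup>1(ell1 I)\<close> to the image under \<open>J\<close> of a tensor of norm at most
  \<open>\<parallel>G\<parallel> + \<epsilon>\<close> (\<open>lift_ell1\<close>). If \<open>\<sigma>\<close> extends to a surjection of Hardy spaces, then \<open>X\<close> is
  \<open>H\<^sup>1\<close>-projective, and if it extends to a \<open>\<lambda>\<close>-surjection, then \<open>eta X \<le> \<lambda>\<close>.

  Operators on completions are defined by their values on a dense set (\<open>extension_exists\<close>), and
  equations are solved there first (\<open>lift_from_dense\<close>). On polynomials, Taylor coefficients and Fejer
  means are finite averages of rotations, so their bounds in \<open>L\<^sup>1\<close> follow from the rotation invariance of
  Haar measure (\<open>multiplier_bound\<close>).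
\<close>

section \<open>Seminormed spaces and bounded operators\<close>

lemma scalars_simps [simp]:
  "carrier scalars = UNIV" "a \<oplus>\<^bsub>scalars\<^esub> b = a + b" "a \<otimes>\<^bsub>scalars\<^esub> b = a * b"
  "\<one>\<^bsub>scalars\<^esub> = 1" "\<zero>\<^bsub>scalars\<^esub> = 0" "a \<odot>\<^bsub>scalars\<^esub> b = a * b" "nrm scalars a = cmod a"
  by (simp_all add: scalars_def)

lemma cring_scalars: "cring scalars"
proof (rule cringI)
  show "abelian_group scalars"
    by (rule abelian_groupI) (auto intro: exI[of _ "- x" for x])
  show "comm_monoid scalars"
    by (rule comm_monoidI) auto
qed (auto simp: distrib_right)

lemma scalars_uminus [simp]: "\<ominus>\<^bsub>scalars\<^esub> a = - a"
proof -
  interpret cring scalars by (rule cring_scalars)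
  have "a \<oplus>\<^bsub>scalars\<^esub> (\<ominus>\<^bsub>scalars\<^esub> a) = \<zero>\<^bsub>scalars\<^esub>" by (rule r_neg) simp
  then show ?thesis by (simp add: eq_neg_iff_add_eq_0 add.commute)
qed

lemma scalars_minus [simp]: "a \<ominus>\<^bsub>scalars\<^esub> b = a - b"
  by (simp add: a_minus_def)

text \<open>
  A complex vector space with a seminorm. The scalars are the ring \<open>scalars\<close>, so that the vector space
  is a module over it and the facts on modules and abelian groups apply. Differences \<open>x \<ominus> y\<close> measure
  distances; the lemmas of this locale reduce later estimates to the triangle inequality.
\<close>

locale seminormed = Module.module scalars V for V :: "'a cspace" (structure) +
  assumes nrm_ge_0 [simp]: "x \<in> carrier V \<Longrightarrow> 0 \<le> nrm V x"
    and nrm_smult: "x \<in> carrier V \<Longrightarrow> nrm V (c \<odot> x) = cmod c * nrm V x"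
    and nrm_triangle: "x \<in> carrier V \<Longrightarrow> y \<in> carrier V \<Longrightarrow> nrm V (x \<oplus> y) \<le> nrm V x + nrm V y"
begin

lemma smult_in [simp, intro]: "x \<in> carrier V \<Longrightarrow> c \<odot> x \<in> carrier V"
  using smult_closed[of c x] by simp

lemma smult_add_left: "x \<in> carrier V \<Longrightarrow> (a + b) \<odot> x = a \<odot> x \<oplus> b \<odot> x"
  using smult_l_distr[of a b x] by simp

lemma smult_add_right: "x \<in> carrier V \<Longrightarrow> y \<in> carrier V \<Longrightarrow> a \<odot> (x \<oplus> y) = a \<odot> x \<oplus> a \<odot> y"
  using smult_r_distr[of a x y] by simp

lemma smult_smult: "x \<in> carrier V \<Longrightarrow> a \<odot> (b \<odot> x) = (a * b) \<odot> x"
  using smult_assoc1[of a b x] by simp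

lemma one_smult [simp]: "x \<in> carrier V \<Longrightarrow> 1 \<odot> x = x"
  using smult_one[of x] by simp

lemma zero_smult [simp]: "x \<in> carrier V \<Longrightarrow> 0 \<odot> x = \<zero>"
  using smult_l_null[of x] by simp

lemma smult_zero [simp]: "c \<odot> \<zero> = \<zero>"
  using smult_r_null[of c] by simp

lemma uminus_smult: "x \<in> carrier V \<Longrightarrow> \<ominus> x = (- 1) \<odot> x"
  using smult_l_minus[of 1 x] by simp

lemma minus_smult: "x \<in> carrier V \<Longrightarrow> y \<in> carrier V \<Longrightarrow> x \<ominus> y = x \<oplus> (- 1) \<odot> y"
  by (simp add: a_minus_def uminus_smult)

lemma minus_in [simp, intro]: "x \<in> carrier V \<Longrightarrow> y \<in> carrier V \<Longrightarrow> x \<ominus> y \<in> carrier V"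
  by (simp add: a_minus_def)

lemma smult_minus_right:
  "x \<in> carrier V \<Longrightarrow> y \<in> carrier V \<Longrightarrow> a \<odot> (x \<ominus> y) = a \<odot> x \<ominus> a \<odot> y"
  by (simp add: minus_smult smult_add_right smult_smult)

lemma smult_minus_left: "x \<in> carrier V \<Longrightarrow> (a - b) \<odot> x = a \<odot> x \<ominus> b \<odot> x"
  by (simp add: minus_smult smult_smult smult_add_left[symmetric])

lemma nrm_zero [simp]: "nrm V \<zero> = 0"
  using nrm_smult[of \<zero> 0] by simp

lemma nrm_uminus [simp]: "x \<in> carrier V \<Longrightarrow> nrm V (\<ominus> x) = nrm V x"
  by (simp add: uminus_smult nrm_smult)

lemma minus_self [simp]: "x \<in> carrier V \<Longrightarrow> x \<ominus> x = \<zero>"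
  by (simp add: a_minus_def M.r_neg)

lemma minus_zero_right [simp]: "x \<in> carrier V \<Longrightarrow> x \<ominus> \<zero> = x"
  by (simp add: a_minus_def)

lemma minus_eq_zero_iff: "x \<in> carrier V \<Longrightarrow> y \<in> carrier V \<Longrightarrow> x \<ominus> y = \<zero> \<longleftrightarrow> x = y"
  by (simp add: a_minus_def)
     (metis M.add.inv_closed M.minus_equality M.minus_minus M.r_neg M.a_comm)

lemma minus_add_cancel [simp]: "x \<in> carrier V \<Longrightarrow> y \<in> carrier V \<Longrightarrow> (x \<ominus> y) \<oplus> y = x"
  by (simp add: a_minus_def M.a_assoc M.l_neg)

lemma add_minus_cancel [simp]: "x \<in> carrier V \<Longrightarrow> y \<in> carrier V \<Longrightarrow> (x \<oplus> y) \<ominus> y = x"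
  by (simp add: a_minus_def M.a_assoc M.r_neg)

lemma add_minus_add:
  assumes "x \<in> carrier V" "y \<in> carrier V" "x' \<in> carrier V" "y' \<in> carrier V"
  shows "(x \<oplus> y) \<ominus> (x' \<oplus> y') = (x \<ominus> x') \<oplus> (y \<ominus> y')"
  using assms by (simp add: a_minus_def M.minus_add M.a_ac)

lemma minus_add_minus:
  assumes "x \<in> carrier V" "y \<in> carrier V" "z \<in> carrier V"
  shows "(x \<ominus> y) \<oplus> (y \<ominus> z) = x \<ominus> z"
  using assms by (simp add: a_minus_def M.a_assoc M.r_neg1)

lemma minus_minus_minus:
  assumes "x \<in> carrier V" "y \<in> carrier V" "x' \<in> carrier V" "y' \<in> carrier V"
  shows "(x \<ominus> y) \<ominus> (x' \<ominus> y') = (x \<ominus> x') \<ominus> (y \<ominus> y')"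
  using assms by (simp add: a_minus_def M.minus_add M.a_ac)

lemma minus_swap: "x \<in> carrier V \<Longrightarrow> y \<in> carrier V \<Longrightarrow> \<ominus> (x \<ominus> y) = y \<ominus> x"
  by (simp add: a_minus_def M.minus_add M.a_ac)

lemma nrm_minus_commute: "x \<in> carrier V \<Longrightarrow> y \<in> carrier V \<Longrightarrow> nrm V (x \<ominus> y) = nrm V (y \<ominus> x)"
  by (metis minus_swap nrm_uminus minus_in)

lemma nrm_triangle_minus: "x \<in> carrier V \<Longrightarrow> y \<in> carrier V \<Longrightarrow> nrm V (x \<ominus> y) \<le> nrm V x + nrm V y"
  using nrm_triangle[of x "\<ominus> y"] by (simp add: a_minus_def)

lemma dist_triangle:
  assumes "x \<in> carrier V" "y \<in> carrier V" "z \<in> carrier V"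
  shows "nrm V (x \<ominus> z) \<le> nrm V (x \<ominus> y) + nrm V (y \<ominus> z)"
  using nrm_triangle[of "x \<ominus> y" "y \<ominus> z"] assms by (simp add: minus_add_minus)

lemma nrm_le_add: "x \<in> carrier V \<Longrightarrow> y \<in> carrier V \<Longrightarrow> nrm V x \<le> nrm V y + nrm V (x \<ominus> y)"
  using nrm_triangle[of "x \<ominus> y" y] by simp

lemma nrm_diff_le: "x \<in> carrier V \<Longrightarrow> y \<in> carrier V \<Longrightarrow> \<bar>nrm V x - nrm V y\<bar> \<le> nrm V (x \<ominus> y)"
  using nrm_le_add[of x y] nrm_le_add[of y x] nrm_minus_commute[of x y] by linarith

lemma dist_add:
  assumes "x \<in> carrier V" "y \<in> carrier V" "x' \<in> carrier V" "y' \<in> carrier V"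
  shows "nrm V ((x \<oplus> y) \<ominus> (x' \<oplus> y')) \<le> nrm V (x \<ominus> x') + nrm V (y \<ominus> y')"
  using assms nrm_triangle[of "x \<ominus> x'" "y \<ominus> y'"] by (simp add: add_minus_add)

lemma dist_minus:
  assumes "x \<in> carrier V" "y \<in> carrier V" "x' \<in> carrier V" "y' \<in> carrier V"
  shows "nrm V ((x \<ominus> y) \<ominus> (x' \<ominus> y')) \<le> nrm V (x \<ominus> x') + nrm V (y \<ominus> y')"
  using assms nrm_triangle_minus[of "x \<ominus> x'" "y \<ominus> y'"] by (simp add: minus_minus_minus)

lemma dist_smult:
  "x \<in> carrier V \<Longrightarrow> y \<in> carrier V \<Longrightarrow> nrm V (c \<odot> x \<ominus> c \<odot> y) = cmod c * nrm V (x \<ominus> y)"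
  by (simp add: smult_minus_right[symmetric] nrm_smult)

lemma nrm_finsum:
  assumes "finite A" "f \<in> A \<rightarrow> carrier V"
  shows "nrm V (finsum V f A) \<le> (\<Sum>i\<in>A. nrm V (f i))"
  using assms
proof (induction A rule: finite_induct)
  case (insert a A)
  then have "nrm V (finsum V f (insert a A)) = nrm V (f a \<oplus> finsum V f A)"
    by (subst M.finsum_insert) auto
  also have "\<dots> \<le> nrm V (f a) + nrm V (finsum V f A)"
    using insert by (intro nrm_triangle M.finsum_closed) auto
  finally show ?case using insert by fastforce
qed simp

lemma smult_finsum:
  "finite A \<Longrightarrow> f \<in> A \<rightarrow> carrier V \<Longrightarrow> c \<odot> finsum V f A = (\<Oplus>i\<in>A. c \<odot> f i)"
  using finsum_smult_ldistr[of A c f] by simp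

lemma finsum_smult_left:
  "finite A \<Longrightarrow> x \<in> carrier V \<Longrightarrow> (\<Sum>i\<in>A. c i) \<odot> x = (\<Oplus>i\<in>A. c i \<odot> x)"
  by (induction A rule: finite_induct) (auto simp: smult_add_left)

lemma limit_add:
  assumes "\<And>n. s n \<in> carrier V" "\<And>n. t n \<in> carrier V" "x \<in> carrier V" "y \<in> carrier V"
    "(\<lambda>n. nrm V (s n \<ominus> x)) \<longlonglongrightarrow> 0" "(\<lambda>n. nrm V (t n \<ominus> y)) \<longlonglongrightarrow> 0"
  shows "(\<lambda>n. nrm V ((s n \<oplus> t n) \<ominus> (x \<oplus> y))) \<longlonglongrightarrow> 0"
proof (rule tendsto_sandwich[of "\<lambda>n. 0" _ _ "\<lambda>n. nrm V (s n \<ominus> x) + nrm V (t n \<ominus> y)"])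
  show "(\<lambda>n. nrm V (s n \<ominus> x) + nrm V (t n \<ominus> y)) \<longlonglongrightarrow> 0"
    using tendsto_add[OF assms(5,6)] by simp
qed (use assms dist_add in auto)

lemma limit_smult:
  assumes "\<And>n. s n \<in> carrier V" "x \<in> carrier V" "(\<lambda>n. nrm V (s n \<ominus> x)) \<longlonglongrightarrow> 0"
  shows "(\<lambda>n. nrm V (c \<odot> s n \<ominus> c \<odot> x)) \<longlonglongrightarrow> 0"
  using tendsto_mult_right_zero[OF assms(3), of "cmod c"] assms by (simp add: dist_smult)

lemma limit_nrm:
  assumes "\<And>n. s n \<in> carrier V" "x \<in> carrier V" "(\<lambda>n. nrm V (s n \<ominus> x)) \<longlonglongrightarrow> 0"
  shows "(\<lambda>n. nrm V (s n)) \<longlonglongrightarrow> nrm V x"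
proof -
  have "(\<lambda>n. nrm V (s n) - nrm V x) \<longlonglongrightarrow> 0"
    by (rule Lim_null_comparison[OF _ assms(3)]) (use assms nrm_diff_le in auto)
  then show ?thesis by (rule LIM_zero_cancel)
qed

lemma cauchy_if_tendsto:
  assumes "\<And>n. s n \<in> carrier V" "x \<in> carrier V" "(\<lambda>n. nrm V (s n \<ominus> x)) \<longlonglongrightarrow> 0"
  shows "cauchy_in V s"
  unfolding cauchy_in_def
proof (intro conjI allI impI)
  fix e :: real assume "e > 0"
  then obtain N where N: "\<And>n. n \<ge> N \<Longrightarrow> nrm V (s n \<ominus> x) < e / 2"
    using order_tendstoD(2)[OF assms(3), of "e/2"] by (auto simp: eventually_sequentially)
  have "nrm V (s m \<ominus> s n) < e" if "m \<ge> N" "n \<ge> N" for m n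
    using dist_triangle[of "s m" x "s n"] nrm_minus_commute[of x "s n"] N[OF that(1)] N[OF that(2)] assms
    by auto
  then show "\<exists>N. \<forall>m\<ge>N. \<forall>n\<ge>N. nrm V (s m \<ominus> s n) < e" by blast
qed (use assms in auto)

end

text \<open>A seminorm that separates points.\<close>

locale normed = seminormed +
  assumes nrm_eq_0: "x \<in> carrier V \<Longrightarrow> nrm V x = 0 \<Longrightarrow> x = \<zero>"
begin

lemma nrm_eq_0_iff: "x \<in> carrier V \<Longrightarrow> nrm V x = 0 \<longleftrightarrow> x = \<zero>"
  using nrm_eq_0 by auto

lemma eq_if_dist_small:
  assumes "x \<in> carrier V" "y \<in> carrier V" "\<And>e. e > 0 \<Longrightarrow> nrm V (x \<ominus> y) < e"
  shows "x = y"
proof -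
  have "nrm V (x \<ominus> y) = 0"
    using assms nrm_ge_0[of "x \<ominus> y"] by (metis linorder_neqE_linordered_idom minus_in not_less_iff_gr_or_eq not_le)
  then show ?thesis using nrm_eq_0[of "x \<ominus> y"] assms minus_eq_zero_iff by auto
qed

lemma limit_unique:
  assumes "\<And>n. s n \<in> carrier V" "x \<in> carrier V" "y \<in> carrier V"
    "(\<lambda>n. nrm V (s n \<ominus> x)) \<longlonglongrightarrow> 0" "(\<lambda>n. nrm V (s n \<ominus> y)) \<longlonglongrightarrow> 0"
  shows "x = y"
proof (rule eq_if_dist_small[OF assms(2,3)])
  fix e :: real assume "e > 0"
  then have "eventually (\<lambda>n. nrm V (s n \<ominus> x) < e/2) sequentially"
            "eventually (\<lambda>n. nrm V (s n \<ominus> y) < e/2) sequentially"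
    using order_tendstoD(2)[OF assms(4), of "e/2"] order_tendstoD(2)[OF assms(5), of "e/2"] by auto
  then have "eventually (\<lambda>n. nrm V (s n \<ominus> x) < e/2 \<and> nrm V (s n \<ominus> y) < e/2) sequentially"
    by (rule eventually_conj)
  then obtain n where "nrm V (s n \<ominus> x) < e/2" "nrm V (s n \<ominus> y) < e/2"
    by (auto simp: eventually_sequentially)
  then show "nrm V (x \<ominus> y) < e"
    using dist_triangle[of x "s n" y] nrm_minus_commute[of x "s n"] assms by auto
qed

end

text \<open>A complete normed space.\<close>

locale banach = normed +
  assumes complete: "cauchy_in V s \<Longrightarrow> \<exists>x\<in>carrier V. (\<lambda>n. nrm V (s n \<ominus> x)) \<longlonglongrightarrow> 0"

lemma complex_normed_space_iff: "complex_normed_space V \<longleftrightarrow> normed V"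
proof
  assume V: "complex_normed_space V"
  then interpret Module.module scalars V
    by (simp add: complex_normed_space_def complex_vector_space_def)
  show "normed V"
    by unfold_locales (use V in \<open>auto simp: complex_normed_space_def\<close>)
next
  assume "normed V"
  then interpret normed V .
  show "complex_normed_space V"
    unfolding complex_normed_space_def complex_vector_space_def
    using nrm_eq_0 nrm_triangle nrm_smult module_axioms by auto
qed

lemma complex_banach_space_iff: "complex_banach_space V \<longleftrightarrow> banach V"
  unfolding complex_banach_space_def complex_normed_space_iff banach_def banach_axioms_def by blast

lemma banach_scalars: "banach scalars"
proof -
  have "Module.module scalars scalars"
    by (rule moduleI) (auto simp: algebra_simps
        intro: cring_scalars ring.is_abelian_group cring.axioms)
  then interpret Module.module scalars scalars .
  interpret normed scalars
    by unfold_locales (auto simp: norm_mult norm_triangle_ineq)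
  show ?thesis
  proof unfold_locales
    fix s assume "cauchy_in scalars s"
    then have "Cauchy s"
      by (intro CauchyI) (simp add: cauchy_in_def)
    then obtain x where "s \<longlonglongrightarrow> x" using Cauchy_convergent_iff convergent_def by blast
    then show "\<exists>x\<in>carrier scalars. (\<lambda>n. nrm scalars (s n \<ominus>\<^bsub>scalars\<^esub> x)) \<longlonglongrightarrow> 0"
      by (auto simp: LIM_zero_iff tendsto_norm_zero_iff intro!: exI[of _ x])
  qed
qed

text \<open>
  A bounded linear operator together with the two seminormed spaces that it connects. The operator is
  only specified on the carrier of \<open>V\<close>.
\<close>

locale bounded_op = V: seminormed V + W: seminormed W for V :: "'a cspace" and W :: "'b cspace" +
  fixes T :: "'a \<Rightarrow> 'b"
  assumes bounded: "bounded_operator V W T"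
begin

lemma closed [simp, intro]: "x \<in> carrier V \<Longrightarrow> T x \<in> carrier W"
  using bounded by (auto simp: bounded_operator_def)

lemma add: "x \<in> carrier V \<Longrightarrow> y \<in> carrier V \<Longrightarrow> T (x \<oplus>\<^bsub>V\<^esub> y) = T x \<oplus>\<^bsub>W\<^esub> T y"
  using bounded by (auto simp: bounded_operator_def)

lemma smult: "x \<in> carrier V \<Longrightarrow> T (c \<odot>\<^bsub>V\<^esub> x) = c \<odot>\<^bsub>W\<^esub> T x"
  using bounded by (auto simp: bounded_operator_def)

lemma zero [simp]: "T \<zero>\<^bsub>V\<^esub> = \<zero>\<^bsub>W\<^esub>"
  using smult[of "\<zero>\<^bsub>V\<^esub>" 0] by simp

lemma minus: "x \<in> carrier V \<Longrightarrow> y \<in> carrier V \<Longrightarrow> T (x \<ominus>\<^bsub>V\<^esub> y) = T x \<ominus>\<^bsub>W\<^esub> T y"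
  by (simp add: V.minus_smult W.minus_smult add smult)

lemma finsum: "finite A \<Longrightarrow> f \<in> A \<rightarrow> carrier V \<Longrightarrow> T (finsum V f A) = (\<Oplus>\<^bsub>W\<^esub>i\<in>A. T (f i))"
proof (induction A rule: finite_induct)
  case (insert a A)
  have "T (f a \<oplus>\<^bsub>V\<^esub> finsum V f A) = T (f a) \<oplus>\<^bsub>W\<^esub> T (finsum V f A)"
    using insert.prems by (intro add V.finsum_closed) auto
  also have "\<dots> = T (f a) \<oplus>\<^bsub>W\<^esub> (\<Oplus>\<^bsub>W\<^esub>i\<in>A. T (f i))"
    using insert by auto
  also have "\<dots> = (\<Oplus>\<^bsub>W\<^esub>i\<in>insert a A. T (f i))"
    using insert by (subst W.finsum_insert) auto
  finally show ?case using insert by (subst V.finsum_insert) auto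
qed simp

lemma bound_pos: obtains K where "K > 0" "\<And>x. x \<in> carrier V \<Longrightarrow> nrm W (T x) \<le> K * nrm V x"
proof -
  obtain K where K: "\<And>x. x \<in> carrier V \<Longrightarrow> nrm W (T x) \<le> K * nrm V x"
    using bounded unfolding bounded_operator_def by blast
  have "nrm W (T x) \<le> (\<bar>K\<bar> + 1) * nrm V x" if "x \<in> carrier V" for x
    by (rule order_trans[OF K[OF that]], rule mult_right_mono) (use that in auto)
  then show ?thesis by (intro that[of "\<bar>K\<bar> + 1"]) auto
qed

lemma tendsto:
  assumes "\<And>n. s n \<in> carrier V" "x \<in> carrier V" "(\<lambda>n. nrm V (s n \<ominus>\<^bsub>V\<^esub> x)) \<longlonglongrightarrow> 0"
  shows "(\<lambda>n. nrm W (T (s n) \<ominus>\<^bsub>W\<^esub> T x)) \<longlonglongrightarrow> 0"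
proof -
  obtain K where K: "K > 0" "\<And>x. x \<in> carrier V \<Longrightarrow> nrm W (T x) \<le> K * nrm V x"
    by (rule bound_pos) blast
  show ?thesis
  proof (rule tendsto_sandwich[of "\<lambda>n. 0" _ _ "\<lambda>n. K * nrm V (s n \<ominus>\<^bsub>V\<^esub> x)"])
    show "(\<lambda>n. K * nrm V (s n \<ominus>\<^bsub>V\<^esub> x)) \<longlonglongrightarrow> 0"
      using tendsto_mult_right_zero[OF assms(3)] .
    show "\<forall>\<^sub>F n in sequentially. nrm W (T (s n) \<ominus>\<^bsub>W\<^esub> T x) \<le> K * nrm V (s n \<ominus>\<^bsub>V\<^esub> x)"
      using assms K(2) by (auto simp: minus[symmetric])
  qed (use assms in auto)
qed

end

lemma bounded_operatorI:
  assumes "\<And>x. x \<in> carrier V \<Longrightarrow> T x \<in> carrier W"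
    "\<And>x y. x \<in> carrier V \<Longrightarrow> y \<in> carrier V \<Longrightarrow> T (x \<oplus>\<^bsub>V\<^esub> y) = T x \<oplus>\<^bsub>W\<^esub> T y"
    "\<And>c x. x \<in> carrier V \<Longrightarrow> T (c \<odot>\<^bsub>V\<^esub> x) = c \<odot>\<^bsub>W\<^esub> T x"
    "\<And>x. x \<in> carrier V \<Longrightarrow> nrm W (T x) \<le> K * nrm V x"
  shows "bounded_operator V W T"
  using assms unfolding bounded_operator_def by blast

lemma bounded_op_compose:
  assumes "bounded_op V W T" "bounded_op W U S"
  shows "bounded_op V U (\<lambda>x. S (T x))"
proof -
  interpret T: bounded_op V W T by fact
  interpret S: bounded_op W U S by fact
  obtain K where K: "K > 0" "\<And>x. x \<in> carrier V \<Longrightarrow> nrm W (T x) \<le> K * nrm V x"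
    by (rule T.bound_pos) blast
  obtain L where L: "L > 0" "\<And>x. x \<in> carrier W \<Longrightarrow> nrm U (S x) \<le> L * nrm W x"
    by (rule S.bound_pos) blast
  have "bounded_operator V U (\<lambda>x. S (T x))"
  proof (rule bounded_operatorI[where K = "L * K"])
    fix x assume x: "x \<in> carrier V"
    have "nrm U (S (T x)) \<le> L * nrm W (T x)" using x L by auto
    also have "\<dots> \<le> L * (K * nrm V x)" using x K L by auto
    finally show "nrm U (S (T x)) \<le> L * K * nrm V x" by simp
  qed (auto simp: T.add T.smult S.add S.smult)
  then show ?thesis by (intro bounded_op.intro bounded_op_axioms.intro T.V.seminormed_axioms S.W.seminormed_axioms)
qed


section \<open>Density, extension and lifting\<close>

text \<open>Density with respect to the seminorm of \<open>V\<close>.\<close>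

definition dense_in :: "'a cspace \<Rightarrow> 'a set \<Rightarrow> bool" where
  "dense_in V D \<longleftrightarrow> D \<subseteq> carrier V \<and> (\<forall>x\<in>carrier V. \<forall>e>0. \<exists>d\<in>D. nrm V (x \<ominus>\<^bsub>V\<^esub> d) < e)"

lemma dense_inE:
  assumes "dense_in V D" "x \<in> carrier V" "e > 0"
  obtains d where "d \<in> D" "d \<in> carrier V" "nrm V (x \<ominus>\<^bsub>V\<^esub> d) < e"
  using assms unfolding dense_in_def by blast

lemma dense_in_sequence:
  assumes "dense_in V D" "x \<in> carrier V" "seminormed V"
  obtains s where "\<And>n. s n \<in> D" "(\<lambda>n. nrm V (s n \<ominus>\<^bsub>V\<^esub> x)) \<longlonglongrightarrow> 0"
proof -
  interpret seminormed V by fact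
  have "\<exists>d\<in>D. nrm V (x \<ominus>\<^bsub>V\<^esub> d) < inverse (real (Suc n))" for n
    using assms unfolding dense_in_def by simp
  then obtain s where s: "\<And>n. s n \<in> D" "\<And>n. nrm V (x \<ominus>\<^bsub>V\<^esub> s n) < inverse (real (Suc n))"
    by metis
  have c: "s n \<in> carrier V" for n using s(1) assms(1) by (auto simp: dense_in_def)
  have "(\<lambda>n. nrm V (s n \<ominus>\<^bsub>V\<^esub> x)) \<longlonglongrightarrow> 0"
    by (rule tendsto_sandwich[OF _ _ tendsto_const LIMSEQ_inverse_real_of_nat])
       (use s c assms(2) nrm_minus_commute in \<open>auto intro!: always_eventually less_imp_le\<close>)
  then show ?thesis using s(1) that by blast
qed

lemma agree_on_dense:
  assumes "bounded_op V W T" "bounded_op V W S" "normed W" "dense_in V D"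
    and "\<And>d. d \<in> D \<Longrightarrow> T d = S d" "x \<in> carrier V"
  shows "T x = S x"
proof -
  interpret T: bounded_op V W T by fact
  interpret S: bounded_op V W S by fact
  interpret W: normed W by fact
  obtain s where s: "\<And>n. s n \<in> D" "(\<lambda>n. nrm V (s n \<ominus>\<^bsub>V\<^esub> x)) \<longlonglongrightarrow> 0"
    using dense_in_sequence[OF assms(4,6) T.V.seminormed_axioms] by blast
  have c: "s n \<in> carrier V" for n using s(1) assms(4) by (auto simp: dense_in_def)
  have "(\<lambda>n. nrm W (T (s n) \<ominus>\<^bsub>W\<^esub> T x)) \<longlonglongrightarrow> 0" using T.tendsto[OF c assms(6) s(2)] .
  moreover have "(\<lambda>n. nrm W (T (s n) \<ominus>\<^bsub>W\<^esub> S x)) \<longlonglongrightarrow> 0"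
    using S.tendsto[OF c assms(6) s(2)] assms(5)[OF s(1)] by simp
  ultimately show ?thesis
    by (intro W.limit_unique[of "\<lambda>n. T (s n)"]) (use c assms in auto)
qed

lemma bound_on_dense:
  assumes "bounded_op V W T" "dense_in V D" "\<And>d. d \<in> D \<Longrightarrow> nrm W (T d) \<le> K * nrm V d"
    and "x \<in> carrier V"
  shows "nrm W (T x) \<le> K * nrm V x"
proof -
  interpret T: bounded_op V W T by fact
  obtain s where s: "\<And>n. s n \<in> D" "(\<lambda>n. nrm V (s n \<ominus>\<^bsub>V\<^esub> x)) \<longlonglongrightarrow> 0"
    using dense_in_sequence[OF assms(2,4) T.V.seminormed_axioms] by blast
  have c: "s n \<in> carrier V" for n using s(1) assms(2) by (auto simp: dense_in_def)
  have "(\<lambda>n. nrm W (T (s n))) \<longlonglongrightarrow> nrm W (T x)"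
    by (rule T.W.limit_nrm) (use c T.tendsto[OF c assms(4) s(2)] assms(4) in auto)
  moreover have "(\<lambda>n. K * nrm V (s n)) \<longlonglongrightarrow> K * nrm V x"
    by (intro tendsto_mult_left T.V.limit_nrm) (use c s assms in auto)
  ultimately show ?thesis
    by (rule LIMSEQ_le) (use assms(3) s(1) in auto)
qed

context seminormed
begin

lemma finsum_dist_le:
  fixes w :: "nat \<Rightarrow> 'a"
  assumes "\<And>n. w n \<in> carrier V" "m \<le> n"
  shows "nrm V (finsum V w {..<n} \<ominus> finsum V w {..<m}) \<le> (\<Sum>k=m..<n. nrm V (w k))"
  using assms(2)
proof (induction n rule: dec_induct)
  case base
  have "finsum V w {..<m} \<in> carrier V" using assms by (intro M.finsum_closed) auto
  then show ?case by simp
next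
  case (step n)
  have c: "finsum V w {..<n} \<in> carrier V" for n using assms by (intro M.finsum_closed) auto
  have "finsum V w {..<Suc n} \<ominus> finsum V w {..<m} = (w n \<oplus> finsum V w {..<n}) \<ominus> finsum V w {..<m}"
    using assms by (simp add: lessThan_Suc Pi_def)
  also have "\<dots> = w n \<oplus> (finsum V w {..<n} \<ominus> finsum V w {..<m})"
    using c assms by (simp add: a_minus_def M.a_assoc)
  finally show ?case
    using nrm_triangle[of "w n" "finsum V w {..<n} \<ominus> finsum V w {..<m}"] step c assms by simp
qed

end

lemma (in banach) series_converges:
  fixes w :: "nat \<Rightarrow> 'a"
  assumes "\<And>n. w n \<in> carrier V" "summable (\<lambda>n. nrm V (w n))"
  obtains x where "x \<in> carrier V" "(\<lambda>n. nrm V (finsum V w {..<n} \<ominus> x)) \<longlonglongrightarrow> 0"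
    "nrm V x \<le> suminf (\<lambda>n. nrm V (w n))"
proof -
  have c: "finsum V w {..<n} \<in> carrier V" for n using assms by (intro M.finsum_closed) auto
  have "cauchy_in V (\<lambda>n. finsum V w {..<n})"
    unfolding cauchy_in_def
  proof (intro conjI allI impI)
    fix e :: real assume "e > 0"
    then obtain N where N: "\<And>m n. m \<ge> N \<Longrightarrow> norm (\<Sum>k=m..<n. nrm V (w k)) < e"
      using assms(2) unfolding summable_Cauchy by blast
    have "nrm V (finsum V w {..<n} \<ominus> finsum V w {..<m}) < e" if "m \<ge> N" "m \<le> n" for m n
      using finsum_dist_le[of w m n] assms(1) that(2) N[OF that(1), of n] by auto
    then show "\<exists>N. \<forall>m\<ge>N. \<forall>n\<ge>N. nrm V (finsum V w {..<m} \<ominus> finsum V w {..<n}) < e"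
      by (metis nrm_minus_commute c nle_le)
  qed (rule c)
  then obtain x where x: "x \<in> carrier V" "(\<lambda>n. nrm V (finsum V w {..<n} \<ominus> x)) \<longlonglongrightarrow> 0"
    using complete by blast
  have "nrm V x \<le> suminf (\<lambda>n. nrm V (w n))"
  proof (rule LIMSEQ_le_const2)
    show "(\<lambda>n. nrm V (finsum V w {..<n})) \<longlonglongrightarrow> nrm V x"
      by (rule limit_nrm[OF c x])
    have "nrm V (finsum V w {..<n}) \<le> suminf (\<lambda>n. nrm V (w n))" for n
      using nrm_finsum[of "{..<n}" w] sum_le_suminf[OF assms(2), of "{..<n}"] assms(1)
      by fastforce
    then show "\<exists>N. \<forall>n\<ge>N. nrm V (finsum V w {..<n}) \<le> suminf (\<lambda>n. nrm V (w n))" by blast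
  qed
  with x that show thesis by blast
qed

text \<open>The form in which absolutely convergent series are used: to solve \<open>J u = w\<close>.\<close>

lemma solve_by_series:
  assumes "bounded_op P W J" "normed W" "banach P"
    and u: "\<And>n. u n \<in> carrier P" "\<And>n. nrm P (u n) \<le> b n" "b sums B"
    and "w \<in> carrier W" "(\<lambda>n. nrm W (J (finsum P u {..<n}) \<ominus>\<^bsub>W\<^esub> w)) \<longlonglongrightarrow> 0"
  obtains v where "v \<in> carrier P" "J v = w" "nrm P v \<le> B"
proof -
  interpret P: banach P by fact
  interpret W: normed W by fact
  interpret J: bounded_op P W J by fact
  have c: "finsum P u {..<n} \<in> carrier P" for n using u by (intro P.finsum_closed) auto
  have s: "summable (\<lambda>n. nrm P (u n))"
    by (rule summable_comparison_test[of _ b]) (use u in \<open>auto simp: sums_iff\<close>)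
  obtain v where v: "v \<in> carrier P" "(\<lambda>n. nrm P (finsum P u {..<n} \<ominus>\<^bsub>P\<^esub> v)) \<longlonglongrightarrow> 0"
    "nrm P v \<le> suminf (\<lambda>n. nrm P (u n))"
    using P.series_converges[OF u(1) s] by blast
  have "suminf (\<lambda>n. nrm P (u n)) \<le> B"
    using suminf_le[of "\<lambda>n. nrm P (u n)" b] u s by (auto simp: sums_iff)
  moreover have "J v = w"
    by (rule W.limit_unique[of "\<lambda>n. J (finsum P u {..<n})"])
       (use c v assms(7,8) J.tendsto[OF c v(1,2)] in auto)
  ultimately show thesis using v that by force
qed

text \<open>
  Approximate lifting. An equation \<open>J u = S v\<close> that has a solution with a norm bound for every \<open>v\<close> of a
  dense set has one, with the same bound up to an arbitrarily small error, for every \<open>v\<close>. The vector \<open>v\<close>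
  is the sum of a series of elements of \<open>D\<close> whose terms after the first are small, and the solutions
  for the terms are added up.
\<close>

lemma lift_from_dense:
  assumes "bounded_op V W S" "bounded_op P W J" "normed W" "banach P" "dense_in V D" "C \<ge> 0"
    and lift: "\<And>d \<delta>. d \<in> D \<Longrightarrow> \<delta> > 0 \<Longrightarrow> \<exists>u\<in>carrier P. J u = S d \<and> nrm P u \<le> C * nrm V d + \<delta>"
    and v: "v \<in> carrier V" and e: "e > 0"
  obtains u where "u \<in> carrier P" "J u = S v" "nrm P u \<le> C * nrm V v + e"
proof -
  interpret P: banach P by fact
  interpret W: normed W by fact
  interpret S: bounded_op V W S by fact
  interpret J: bounded_op P W J by fact
  \<comment> \<open>Every term \<open>d n\<close> has norm at most \<open>3 * h n\<close> besides the contribution of \<open>v\<close>, and its lifting costs \<open>h n\<close> more. The \<open>h n\<close> add up to \<open>\<delta>\<close>, so this choice makes the total error \<open>e\<close>.\<close>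
  define \<delta> where "\<delta> = e / (3 * C + 1)"
  have \<delta>: "\<delta> > 0" using e \<open>C \<ge> 0\<close> by (simp add: \<delta>_def)
  define h where "h n = \<delta> * (1/2) ^ Suc n" for n :: nat
  have h: "h n > 0" for n using \<delta> by (simp add: h_def)
  define p where "p n x = (SOME d. d \<in> D \<and> nrm V (x \<ominus>\<^bsub>V\<^esub> d) < h n)" for n x
  have p: "p n x \<in> D" "nrm V (x \<ominus>\<^bsub>V\<^esub> p n x) < h n" if x: "x \<in> carrier V" for x n
  proof -
    have "\<exists>d. d \<in> D \<and> nrm V (x \<ominus>\<^bsub>V\<^esub> d) < h n"
      using dense_inE[OF assms(5) x h] by metis
    from someI_ex[OF this] show "p n x \<in> D" "nrm V (x \<ominus>\<^bsub>V\<^esub> p n x) < h n"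
      unfolding p_def by simp_all
  qed
  have D: "D \<subseteq> carrier V" using assms(5) by (auto simp: dense_in_def)
  \<comment> \<open>the remainders of the expansion of \<open>v\<close>\<close>
  define r where "r = rec_nat v (\<lambda>n x. x \<ominus>\<^bsub>V\<^esub> p n x)"
  have r0: "r 0 = v" and rS: "r (Suc n) = r n \<ominus>\<^bsub>V\<^esub> p n (r n)" for n by (simp_all add: r_def)
  have rc: "r n \<in> carrier V" for n
    by (induction n) (auto simp: r0 rS v subsetD[OF D p(1)])
  define d where "d n = p n (r n)" for n
  have dD: "d n \<in> D" for n by (simp add: d_def p(1) rc)
  have dc: "d n \<in> carrier V" for n using dD D by auto
  have rb: "nrm V (r (Suc n)) < h n" for n using p(2)[OF rc, of n n] by (simp add: rS)
  have rb': "nrm V (r n) \<le> (if n = 0 then nrm V v else 0) + 2 * h n" for n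
  proof (cases n)
    case (Suc m)
    have "h m = 2 * h n" by (simp add: h_def Suc)
    then show ?thesis using rb[of m] Suc by simp
  qed (use h[of 0] r0 in simp)
  have db: "nrm V (d n) \<le> (if n = 0 then nrm V v else 0) + 3 * h n" for n
  proof -
    have "nrm V (d n) \<le> nrm V (r n) + nrm V (r (Suc n))"
      using S.V.nrm_le_add[of "d n" "r n"] S.V.nrm_minus_commute[of "d n" "r n"] dc rc
      by (simp add: rS d_def)
    then show ?thesis using rb[of n] rb'[of n] by simp
  qed
  have "\<forall>n. \<exists>u. u \<in> carrier P \<and> J u = S (d n) \<and> nrm P u \<le> C * nrm V (d n) + h n"
    using lift[OF dD h] by blast
  from choice[OF this] obtain u where u: "\<And>n. u n \<in> carrier P" "\<And>n. J (u n) = S (d n)"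
      "\<And>n. nrm P (u n) \<le> C * nrm V (d n) + h n"
    by blast
  have ds: "finsum V d {..<n} = v \<ominus>\<^bsub>V\<^esub> r n" for n
  proof (induction n)
    case 0
    then show ?case using r0 v by simp
  next
    case (Suc n)
    have "finsum V d {..<Suc n} = d n \<oplus>\<^bsub>V\<^esub> (v \<ominus>\<^bsub>V\<^esub> r n)"
      using dc Suc by (simp add: lessThan_Suc Pi_def)
    also have "\<dots> = v \<ominus>\<^bsub>V\<^esub> (r n \<ominus>\<^bsub>V\<^esub> d n)"
      using dc rc v by (simp add: a_minus_def S.V.minus_add S.V.a_ac)
    also have "r n \<ominus>\<^bsub>V\<^esub> d n = r (Suc n)" by (simp add: rS d_def)
    finally show ?case .
  qed
  have Ju: "J (finsum P u {..<n}) = S (finsum V d {..<n})" for n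
    using u dc by (simp add: J.finsum S.finsum Pi_def)
  have h0: "h \<longlonglongrightarrow> 0"
    unfolding h_def using LIMSEQ_Suc[OF LIMSEQ_realpow_zero[of "1/2::real"]]
    by (intro tendsto_mult_right_zero) auto
  have "(\<lambda>n. nrm V (r (Suc n))) \<longlonglongrightarrow> 0"
    by (rule tendsto_sandwich[OF _ _ tendsto_const h0])
       (use rb rc in \<open>auto intro!: always_eventually less_imp_le\<close>)
  then have r_lim: "(\<lambda>n. nrm V (r n)) \<longlonglongrightarrow> 0" by (rule LIMSEQ_imp_Suc)
  have "(\<lambda>n. nrm V ((v \<ominus>\<^bsub>V\<^esub> r n) \<ominus>\<^bsub>V\<^esub> v)) = (\<lambda>n. nrm V (r n))"
  proof
    fix n
    have "(v \<ominus>\<^bsub>V\<^esub> r n) \<ominus>\<^bsub>V\<^esub> v = \<ominus>\<^bsub>V\<^esub> r n"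
      using v rc[of n] by (metis S.V.add_minus_cancel S.V.a_comm S.V.minus_eq S.V.a_inv_closed)
    then show "nrm V ((v \<ominus>\<^bsub>V\<^esub> r n) \<ominus>\<^bsub>V\<^esub> v) = nrm V (r n)" using rc by simp
  qed
  then have "(\<lambda>n. nrm W (S (v \<ominus>\<^bsub>V\<^esub> r n) \<ominus>\<^bsub>W\<^esub> S v)) \<longlonglongrightarrow> 0"
    using S.tendsto[of "\<lambda>n. v \<ominus>\<^bsub>V\<^esub> r n" v] r_lim v rc by simp
  then have lim: "(\<lambda>n. nrm W (J (finsum P u {..<n}) \<ominus>\<^bsub>W\<^esub> S v)) \<longlonglongrightarrow> 0"
    by (simp add: Ju ds)
  define b where "b n = (if n = 0 then C * nrm V v else 0) + (3 * C + 1) * h n" for n :: nat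
  have ub: "nrm P (u n) \<le> b n" for n
  proof -
    have "C * nrm V (d n) \<le> C * ((if n = 0 then nrm V v else 0) + 3 * h n)"
      using db[of n] \<open>C \<ge> 0\<close> by (rule mult_left_mono)
    then show ?thesis using u(3)[of n] by (auto simp: b_def algebra_simps)
  qed
  have "h sums \<delta>"
    unfolding h_def using sums_mult[OF power_half_series, of \<delta>] by simp
  then have "(\<lambda>n. (3 * C + 1) * h n) sums e"
    using sums_mult[of h \<delta> "3 * C + 1"] \<open>C \<ge> 0\<close> by (simp add: \<delta>_def)
  then have bs: "b sums (C * nrm V v + e)"
    unfolding b_def by (intro sums_add sums_If_finite_set'[of _ 0 "{0}"])
      (use sums_single[of 0 "\<lambda>_. C * nrm V v"] in \<open>auto simp: eq_commute\<close>)
  obtain w where "w \<in> carrier P" "J w = S v" "nrm P w \<le> C * nrm V v + e"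
    by (rule solve_by_series[OF assms(2-4) u(1) ub bs _ lim]) (use v in auto)
  then show thesis using that by blast
qed

text \<open>
  The extension principle by which all operators below are constructed. A linear relation that is
  bounded and has a dense domain extends to the graph of a bounded operator. A
  relation is used instead of an operator on the dense set because the elements of that set (such as
  classes of polynomials) have no canonical representatives: single-valuedness follows from the bound.
\<close>

lemma extension_exists:
  assumes "seminormed V" "banach W"
    and R: "R \<subseteq> carrier V \<times> carrier W"
    and R_add: "\<And>v w v' w'. (v, w) \<in> R \<Longrightarrow> (v', w') \<in> R \<Longrightarrow> (v \<oplus>\<^bsub>V\<^esub> v', w \<oplus>\<^bsub>W\<^esub> w') \<in> R"
    and R_smult: "\<And>c v w. (v, w) \<in> R \<Longrightarrow> (c \<odot>\<^bsub>V\<^esub> v, c \<odot>\<^bsub>W\<^esub> w) \<in> R"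
    and R_bound: "\<And>v w. (v, w) \<in> R \<Longrightarrow> nrm W w \<le> K * nrm V v"
    and "K \<ge> 0" and dense: "dense_in V (Domain R)"
  obtains T where "T \<in> extensional (carrier V)" "bounded_op V W T" "\<And>v w. (v, w) \<in> R \<Longrightarrow> T v = w"
    "\<And>x. x \<in> carrier V \<Longrightarrow> nrm W (T x) \<le> K * nrm V x"
proof -
  interpret V: seminormed V by fact
  interpret W: banach W by fact
  have R_minus: "(v \<ominus>\<^bsub>V\<^esub> v', w \<ominus>\<^bsub>W\<^esub> w') \<in> R" if "(v, w) \<in> R" "(v', w') \<in> R" for v w v' w'
  proof -
    have "v \<in> carrier V" "v' \<in> carrier V" "w \<in> carrier W" "w' \<in> carrier W" using that R by auto
    then show ?thesis
      using R_add[OF that(1) R_smult[OF that(2), of "-1"]] by (simp add: V.minus_smult W.minus_smult)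
  qed
  \<comment> \<open>the closure of the graph \<open>R\<close> is again a graph\<close>
  define Q where "Q x y \<longleftrightarrow> x \<in> carrier V \<and> y \<in> carrier W \<and>
    (\<forall>e>0. \<exists>(v, w)\<in>R. nrm V (x \<ominus>\<^bsub>V\<^esub> v) < e \<and> nrm W (y \<ominus>\<^bsub>W\<^esub> w) < e)" for x y
  have Qc: "x \<in> carrier V" "y \<in> carrier W" if "Q x y" for x y using that by (auto simp: Q_def)
  have QE: "\<exists>v w. (v, w) \<in> R \<and> v \<in> carrier V \<and> w \<in> carrier W \<and>
      nrm V (x \<ominus>\<^bsub>V\<^esub> v) < e \<and> nrm W (y \<ominus>\<^bsub>W\<^esub> w) < e" if "Q x y" "e > 0" for x y e
    using that R unfolding Q_def by blast
  have Q_ex: "\<exists>y. Q x y" if x: "x \<in> carrier V" for x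
  proof -
    obtain s where s: "\<And>n. s n \<in> Domain R" "(\<lambda>n. nrm V (s n \<ominus>\<^bsub>V\<^esub> x)) \<longlonglongrightarrow> 0"
      using dense_in_sequence[OF dense x V.seminormed_axioms] by blast
    have "\<forall>n. \<exists>t. (s n, t) \<in> R" using s(1) by (simp add: Domain_iff)
    from choice[OF this] obtain t where t: "\<And>n. (s n, t n) \<in> R" by blast
    have c: "s n \<in> carrier V" "t n \<in> carrier W" for n using subsetD[OF R t[of n]] by auto
    have "cauchy_in W t"
      unfolding cauchy_in_def
    proof (intro conjI allI impI)
      fix e :: real assume e: "e > 0"
      then have "e / (K + 1) > 0" using \<open>K \<ge> 0\<close> by simp
      then obtain N where N: "\<And>m n. m \<ge> N \<Longrightarrow> n \<ge> N \<Longrightarrow> nrm V (s m \<ominus>\<^bsub>V\<^esub> s n) < e / (K + 1)"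
        using V.cauchy_if_tendsto[OF c(1) x s(2)] unfolding cauchy_in_def by blast
      have "nrm W (t m \<ominus>\<^bsub>W\<^esub> t n) < e" if "m \<ge> N" "n \<ge> N" for m n
      proof -
        have "nrm W (t m \<ominus>\<^bsub>W\<^esub> t n) \<le> K * nrm V (s m \<ominus>\<^bsub>V\<^esub> s n)"
          by (rule R_bound[OF R_minus[OF t t]])
        also have "\<dots> \<le> K * (e / (K + 1))"
          using N[OF that] \<open>K \<ge> 0\<close> by (intro mult_left_mono) auto
        also have "\<dots> < e" using e \<open>K \<ge> 0\<close> by (simp add: field_simps)
        finally show ?thesis .
      qed
      then show "\<exists>N. \<forall>m\<ge>N. \<forall>n\<ge>N. nrm W (t m \<ominus>\<^bsub>W\<^esub> t n) < e" by blast
    qed (rule c)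
    then obtain y where y: "y \<in> carrier W" "(\<lambda>n. nrm W (t n \<ominus>\<^bsub>W\<^esub> y)) \<longlonglongrightarrow> 0"
      using W.complete by blast
    have "\<exists>(v, w)\<in>R. nrm V (x \<ominus>\<^bsub>V\<^esub> v) < e \<and> nrm W (y \<ominus>\<^bsub>W\<^esub> w) < e" if "e > 0" for e
    proof -
      have "eventually (\<lambda>n. nrm V (s n \<ominus>\<^bsub>V\<^esub> x) < e \<and> nrm W (t n \<ominus>\<^bsub>W\<^esub> y) < e) sequentially"
        using order_tendstoD(2)[OF s(2) that] order_tendstoD(2)[OF y(2) that] by (rule eventually_conj)
      then obtain n where "nrm V (s n \<ominus>\<^bsub>V\<^esub> x) < e" "nrm W (t n \<ominus>\<^bsub>W\<^esub> y) < e"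
        by (auto simp: eventually_sequentially)
      then show ?thesis using t[of n] V.nrm_minus_commute[of x "s n"] W.nrm_minus_commute[of y "t n"] c x y
        by (intro bexI[of _ "(s n, t n)"]) auto
    qed
    then show ?thesis using x y by (auto simp: Q_def)
  qed
  have Q_minus: "nrm W (y \<ominus>\<^bsub>W\<^esub> y') \<le> K * nrm V (x \<ominus>\<^bsub>V\<^esub> x')" if Q: "Q x y" "Q x' y'" for x y x' y'
  proof (rule field_le_epsilon)
    fix e :: real assume e: "e > 0"
    define d where "d = e / (2 * K + 2)"
    have d: "d > 0" using e \<open>K \<ge> 0\<close> by (simp add: d_def)
    obtain v w where vw: "(v, w) \<in> R" "v \<in> carrier V" "w \<in> carrier W"
      "nrm V (x \<ominus>\<^bsub>V\<^esub> v) < d" "nrm W (y \<ominus>\<^bsub>W\<^esub> w) < d" using QE[OF Q(1) d] by blast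
    obtain v' w' where vw': "(v', w') \<in> R" "v' \<in> carrier V" "w' \<in> carrier W"
      "nrm V (x' \<ominus>\<^bsub>V\<^esub> v') < d" "nrm W (y' \<ominus>\<^bsub>W\<^esub> w') < d" using QE[OF Q(2) d] by blast
    note c = Qc[OF Q(1)] Qc[OF Q(2)]
    have 1: "nrm W (w \<ominus>\<^bsub>W\<^esub> w') \<le> K * nrm V (v \<ominus>\<^bsub>V\<^esub> v')"
      by (rule R_bound[OF R_minus]) fact+
    have "nrm V (v \<ominus>\<^bsub>V\<^esub> v') \<le> nrm V (x \<ominus>\<^bsub>V\<^esub> x') + nrm V ((v \<ominus>\<^bsub>V\<^esub> v') \<ominus>\<^bsub>V\<^esub> (x \<ominus>\<^bsub>V\<^esub> x'))"
      using c vw vw' by (intro V.nrm_le_add) auto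
    also have "\<dots> \<le> nrm V (x \<ominus>\<^bsub>V\<^esub> x') + 2 * d"
      using V.dist_minus[of v v' x x'] V.nrm_minus_commute[of v x] V.nrm_minus_commute[of v' x'] c vw vw' by auto
    finally have 2: "K * nrm V (v \<ominus>\<^bsub>V\<^esub> v') \<le> K * (nrm V (x \<ominus>\<^bsub>V\<^esub> x') + 2 * d)"
      using \<open>K \<ge> 0\<close> by (rule mult_left_mono)
    have "nrm W (y \<ominus>\<^bsub>W\<^esub> y') \<le> nrm W (w \<ominus>\<^bsub>W\<^esub> w') + nrm W ((y \<ominus>\<^bsub>W\<^esub> y') \<ominus>\<^bsub>W\<^esub> (w \<ominus>\<^bsub>W\<^esub> w'))"
      using c vw vw' by (intro W.nrm_le_add) auto
    also have "\<dots> \<le> nrm W (w \<ominus>\<^bsub>W\<^esub> w') + 2 * d"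
      using W.dist_minus[of y y' w w'] c vw vw' by auto
    also have "\<dots> \<le> K * (nrm V (x \<ominus>\<^bsub>V\<^esub> x') + 2 * d) + 2 * d" using 1 2 by simp
    also have "\<dots> = K * nrm V (x \<ominus>\<^bsub>V\<^esub> x') + d * (2 * K + 2)" by (simp add: algebra_simps)
    also have "d * (2 * K + 2) = e" using \<open>K \<ge> 0\<close> by (simp add: d_def)
    finally show "nrm W (y \<ominus>\<^bsub>W\<^esub> y') \<le> K * nrm V (x \<ominus>\<^bsub>V\<^esub> x') + e" .
  qed
  have Q_unique: "y = y'" if "Q x y" "Q x y'" for x y y'
  proof -
    have c: "x \<in> carrier V" "y \<in> carrier W" "y' \<in> carrier W" using that Qc by auto
    have "nrm W (y \<ominus>\<^bsub>W\<^esub> y') \<le> 0" using Q_minus[OF that] c by simp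
    then have "y \<ominus>\<^bsub>W\<^esub> y' = \<zero>\<^bsub>W\<^esub>"
      using W.nrm_eq_0[of "y \<ominus>\<^bsub>W\<^esub> y'"] W.nrm_ge_0[of "y \<ominus>\<^bsub>W\<^esub> y'"] c by fastforce
    then show ?thesis using c by (simp add: W.minus_eq_zero_iff)
  qed
  have Q_R: "Q v w" if "(v, w) \<in> R" for v w
    using that R unfolding Q_def by (auto intro!: bexI[of _ "(v, w)"])
  have Q_add: "Q (x \<oplus>\<^bsub>V\<^esub> x') (y \<oplus>\<^bsub>W\<^esub> y')" if Q: "Q x y" "Q x' y'" for x y x' y'
    unfolding Q_def
  proof (intro conjI allI impI)
    fix e :: real assume "e > 0"
    then have e: "e / 2 > 0" by simp
    obtain v w where vw: "(v, w) \<in> R" "v \<in> carrier V" "w \<in> carrier W"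
      "nrm V (x \<ominus>\<^bsub>V\<^esub> v) < e/2" "nrm W (y \<ominus>\<^bsub>W\<^esub> w) < e/2" using QE[OF Q(1) e] by blast
    obtain v' w' where vw': "(v', w') \<in> R" "v' \<in> carrier V" "w' \<in> carrier W"
      "nrm V (x' \<ominus>\<^bsub>V\<^esub> v') < e/2" "nrm W (y' \<ominus>\<^bsub>W\<^esub> w') < e/2" using QE[OF Q(2) e] by blast
    show "\<exists>(v, w)\<in>R. nrm V (x \<oplus>\<^bsub>V\<^esub> x' \<ominus>\<^bsub>V\<^esub> v) < e \<and> nrm W (y \<oplus>\<^bsub>W\<^esub> y' \<ominus>\<^bsub>W\<^esub> w) < e"
      using R_add[OF vw(1) vw'(1)] V.dist_add[of x x' v v'] W.dist_add[of y y' w w']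
        vw vw' Qc[OF Q(1)] Qc[OF Q(2)]
      by (intro bexI[of _ "(v \<oplus>\<^bsub>V\<^esub> v', w \<oplus>\<^bsub>W\<^esub> w')"]) auto
  qed (use Qc[OF Q(1)] Qc[OF Q(2)] in auto)
  have Q_smult: "Q (c \<odot>\<^bsub>V\<^esub> x) (c \<odot>\<^bsub>W\<^esub> y)" if Q: "Q x y" for c x y
    unfolding Q_def
  proof (intro conjI allI impI)
    fix e :: real assume e: "e > 0"
    then have e': "e / (cmod c + 1) > 0" by (simp add: add_nonneg_pos)
    obtain v w where vw: "(v, w) \<in> R" "v \<in> carrier V" "w \<in> carrier W"
      "nrm V (x \<ominus>\<^bsub>V\<^esub> v) < e / (cmod c + 1)" "nrm W (y \<ominus>\<^bsub>W\<^esub> w) < e / (cmod c + 1)"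
      using QE[OF Q e'] by blast
    have "cmod c * t < e" if "t < e / (cmod c + 1)" "t \<ge> 0" for t
    proof -
      have "cmod c * t \<le> (cmod c + 1) * t" using that by (simp add: algebra_simps)
      also have "\<dots> < e" using that
        by (metis add_nonneg_pos less_numeral_extra(1) mult.commute norm_ge_zero pos_less_divide_eq)
      finally show ?thesis .
    qed
    then show "\<exists>(v, w)\<in>R. nrm V (c \<odot>\<^bsub>V\<^esub> x \<ominus>\<^bsub>V\<^esub> v) < e \<and> nrm W (c \<odot>\<^bsub>W\<^esub> y \<ominus>\<^bsub>W\<^esub> w) < e"
      using R_smult[OF vw(1), of c] vw Qc[OF Q]
      by (intro bexI[of _ "(c \<odot>\<^bsub>V\<^esub> v, c \<odot>\<^bsub>W\<^esub> w)"]) (auto simp: V.dist_smult W.dist_smult)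
  qed (use Qc[OF Q] in auto)
  define T where "T = restrict (\<lambda>x. THE y. Q x y) (carrier V)"
  have TQ: "T x = y" if "Q x y" for x y
    using that Q_unique Qc[OF that] by (auto simp: T_def intro!: the_equality)
  have QT: "Q x (T x)" if "x \<in> carrier V" for x
    using Q_ex[OF that] TQ by metis
  have T_bound: "nrm W (T x) \<le> K * nrm V x" if x: "x \<in> carrier V" for x
  proof -
    have "Q \<zero>\<^bsub>V\<^esub> \<zero>\<^bsub>W\<^esub>" using Q_smult[OF QT[OF x], of 0] x Qc[OF QT[OF x]] by simp
    from Q_minus[OF QT[OF x] this] show ?thesis using x Qc[OF QT[OF x]] by simp
  qed
  have "bounded_operator V W T"
    by (rule bounded_operatorI[where K = K])
       (use Qc(2)[OF QT] QT T_bound in \<open>auto intro!: TQ Q_add Q_smult\<close>)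
  then have "bounded_op V W T" by unfold_locales
  then show thesis
    using that[of T] T_bound TQ Q_R by (simp add: T_def)
qed

text \<open>
  It is enough to find limits of rapidly converging sequences in a dense subset.
\<close>

lemma banach_if_dense:
  assumes "normed V" "dense_in V D"
    and lim: "\<And>s. (\<And>n. s n \<in> D) \<Longrightarrow> (\<And>n. nrm V (s n \<ominus>\<^bsub>V\<^esub> s (Suc n)) \<le> (1/2) ^ n) \<Longrightarrow>
           \<exists>x\<in>carrier V. (\<lambda>n. nrm V (s n \<ominus>\<^bsub>V\<^esub> x)) \<longlonglongrightarrow> 0"
  shows "banach V"
proof -
  interpret V: normed V by fact
  show ?thesis
  proof unfold_locales
    fix x assume x: "cauchy_in V x"
    then have xc: "x n \<in> carrier V" for n by (simp add: cauchy_in_def)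
    define h where "h k = (1/2) ^ k / (4::real)" for k :: nat
    have h: "h k > 0" for k by (simp add: h_def)
    have "\<forall>k. \<exists>N. \<forall>m\<ge>N. \<forall>n\<ge>N. nrm V (x m \<ominus>\<^bsub>V\<^esub> x n) < h k"
      using x h unfolding cauchy_in_def by blast
    from choice[OF this] obtain N
      where N: "\<And>k m n. m \<ge> N k \<Longrightarrow> n \<ge> N k \<Longrightarrow> nrm V (x m \<ominus>\<^bsub>V\<^esub> x n) < h k"
      by blast
    \<comment> \<open>a monotone majorant of \<open>N\<close>\<close>
    define M where "M k = (\<Sum>j\<le>k. N j)" for k
    have MN: "M k \<ge> N j" if "j \<le> k" for j k
      unfolding M_def using that by (intro member_le_sum) auto
    have "\<forall>k. \<exists>d. d \<in> D \<and> nrm V (x (M k) \<ominus>\<^bsub>V\<^esub> d) < h k"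
      using dense_inE[OF assms(2) xc h] by metis
    from choice[OF this] obtain d
      where d: "\<And>k. d k \<in> D" "\<And>k. nrm V (x (M k) \<ominus>\<^bsub>V\<^esub> d k) < h k"
      by blast
    have dc: "d k \<in> carrier V" for k using d(1) assms(2) by (auto simp: dense_in_def)
    have "nrm V (d k \<ominus>\<^bsub>V\<^esub> d (Suc k)) \<le> (1/2) ^ k" for k
    proof -
      have "nrm V (d k \<ominus>\<^bsub>V\<^esub> d (Suc k)) \<le> nrm V (d k \<ominus>\<^bsub>V\<^esub> x (M k)) + nrm V (x (M k) \<ominus>\<^bsub>V\<^esub> d (Suc k))"
        using dc xc by (intro V.dist_triangle)
      moreover have "nrm V (x (M k) \<ominus>\<^bsub>V\<^esub> d (Suc k)) \<le>
          nrm V (x (M k) \<ominus>\<^bsub>V\<^esub> x (M (Suc k))) + nrm V (x (M (Suc k)) \<ominus>\<^bsub>V\<^esub> d (Suc k))"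
        using dc xc by (intro V.dist_triangle)
      moreover have "nrm V (x (M k) \<ominus>\<^bsub>V\<^esub> x (M (Suc k))) < h k" by (intro N MN) auto
      moreover have "nrm V (d k \<ominus>\<^bsub>V\<^esub> x (M k)) < h k"
        using d(2)[of k] V.nrm_minus_commute[OF dc[of k] xc[of "M k"]] by simp
      ultimately have "nrm V (d k \<ominus>\<^bsub>V\<^esub> d (Suc k)) \<le> 2 * h k + h (Suc k)" using d(2)[of "Suc k"] by linarith
      also have "\<dots> \<le> (1/2) ^ k" by (simp add: h_def)
      finally show ?thesis .
    qed
    then obtain y where y: "y \<in> carrier V" "(\<lambda>k. nrm V (d k \<ominus>\<^bsub>V\<^esub> y)) \<longlonglongrightarrow> 0"
      using lim[of d] d(1) by blast
    have h0: "h \<longlonglongrightarrow> 0"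
      unfolding h_def using LIMSEQ_realpow_zero[of "1/2::real"] by (intro tendsto_divide_zero) auto
    have "(\<lambda>n. nrm V (x n \<ominus>\<^bsub>V\<^esub> y)) \<longlonglongrightarrow> 0"
    proof (rule LIMSEQ_I)
      fix e :: real assume e: "e > 0"
      then have "eventually (\<lambda>k. h k < e/4 \<and> nrm V (d k \<ominus>\<^bsub>V\<^esub> y) < e/4) sequentially"
        using order_tendstoD(2)[OF h0, of "e/4"] order_tendstoD(2)[OF y(2), of "e/4"]
        by (intro eventually_conj) auto
      then obtain k where k: "h k < e/4" "nrm V (d k \<ominus>\<^bsub>V\<^esub> y) < e/4"
        by (auto simp: eventually_sequentially)
      have "nrm V (x n \<ominus>\<^bsub>V\<^esub> y) < e" if "n \<ge> M k" for n
      proof -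
        have "nrm V (x n \<ominus>\<^bsub>V\<^esub> x (M k)) < h k"
          using that MN[of k k] by (intro N) auto
        moreover have "nrm V (x n \<ominus>\<^bsub>V\<^esub> y) \<le> nrm V (x n \<ominus>\<^bsub>V\<^esub> x (M k)) + nrm V (x (M k) \<ominus>\<^bsub>V\<^esub> y)"
          "nrm V (x (M k) \<ominus>\<^bsub>V\<^esub> y) \<le> nrm V (x (M k) \<ominus>\<^bsub>V\<^esub> d k) + nrm V (d k \<ominus>\<^bsub>V\<^esub> y)"
          using dc xc y by (auto intro!: V.dist_triangle)
        ultimately show ?thesis using d(2)[of k] k e by linarith
      qed
      then show "\<exists>no. \<forall>n\<ge>no. norm (nrm V (x n \<ominus>\<^bsub>V\<^esub> y) - 0) < e"
        using xc y by (intro exI[of _ "M k"]) auto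
    qed
    then show "\<exists>y\<in>carrier V. (\<lambda>n. nrm V (x n \<ominus>\<^bsub>V\<^esub> y)) \<longlonglongrightarrow> 0" using y by blast
  qed
qed

section \<open>The open mapping theorem\<close>

text \<open>
  By the Baire category theorem, the closure of the image of some ball contains a ball. The centre of
  the latter is removed by taking differences, and scaling gives approximate preimages.
\<close>

lemma open_mapping_approx:
  assumes "seminormed V" "banach W" "bounded_op V W T" "T ` carrier V = carrier W"
  obtains C where "C > 0"
    "\<And>w. w \<in> carrier W \<Longrightarrow> \<exists>v\<in>carrier V. nrm V v \<le> C * nrm W w \<and> nrm W (w \<ominus>\<^bsub>W\<^esub> T v) \<le> nrm W w / 2"
proof -
  interpret V: seminormed V by fact
  interpret W: banach W by fact
  interpret T: bounded_op V W T by fact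
  define d where "d x y = (if x \<in> carrier W \<and> y \<in> carrier W then nrm W (x \<ominus>\<^bsub>W\<^esub> y) else 0)" for x y
  interpret M: Metric_space "carrier W" d
  proof
    fix x y z
    show "0 \<le> d x y" "d x y = d y x" by (auto simp: d_def W.nrm_minus_commute)
    show "(d x y = 0) = (x = y)" if "x \<in> carrier W" "y \<in> carrier W"
      using that by (auto simp: d_def W.nrm_eq_0_iff W.minus_eq_zero_iff)
    show "d x z \<le> d x y + d y z" if "x \<in> carrier W" "y \<in> carrier W" "z \<in> carrier W"
      using that by (auto simp: d_def W.dist_triangle)
  qed
  have "M.mcomplete"
    unfolding M.mcomplete_def
  proof (intro allI impI)
    fix s assume s: "M.MCauchy s"
    then have sc: "s n \<in> carrier W" for n by (auto simp: M.MCauchy_def)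
    then have "cauchy_in W s" using s unfolding M.MCauchy_def cauchy_in_def by (simp add: d_def)
    then obtain x where x: "x \<in> carrier W" "(\<lambda>n. nrm W (s n \<ominus>\<^bsub>W\<^esub> x)) \<longlonglongrightarrow> 0"
      using W.complete by blast
    have "limitin M.mtopology s x sequentially"
      unfolding M.limit_metric_sequentially
    proof (intro conjI allI impI)
      fix e :: real assume "e > 0"
      from order_tendstoD(2)[OF x(2) this]
      show "\<exists>N. \<forall>n\<ge>N. s n \<in> carrier W \<and> d (s n) x < e"
        using sc x(1) by (simp add: eventually_sequentially d_def)
    qed (rule x(1))
    then show "\<exists>x. limitin M.mtopology s x sequentially" by blast
  qed
  define B where "B n = M.mtopology closure_of (T ` {v \<in> carrier V. nrm V v \<le> real n})" for n :: nat
  have "\<exists>n. M.mtopology interior_of B n \<noteq> {}"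
  proof (rule ccontr)
    assume "\<not> ?thesis"
    then have "M.mtopology interior_of (\<Union>(range B)) = {}"
      by (intro M.metric_Baire_category_alt[OF \<open>M.mcomplete\<close>]) (auto simp: B_def)
    moreover have "\<Union>(range B) = carrier W"
    proof
      show "\<Union>(range B) \<subseteq> carrier W" using closure_of_subset_topspace[of M.mtopology] by (auto simp: B_def)
      show "carrier W \<subseteq> \<Union>(range B)"
      proof
        fix w assume "w \<in> carrier W"
        then obtain v where v: "v \<in> carrier V" "w = T v" using assms(4) by blast
        obtain n where "nrm V v \<le> real n" using real_arch_simple by blast
        then have "w \<in> T ` {v \<in> carrier V. nrm V v \<le> real n}" using v by blast
        also have "\<dots> \<subseteq> B n" unfolding B_def by (rule closure_of_subset) auto
        finally show "w \<in> \<Union>(range B)" by blast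
      qed
    qed
    ultimately have "carrier W = {}" using interior_of_topspace[of M.mtopology] by simp
    then show False using W.zero_closed by blast
  qed
  then obtain n w0 where "w0 \<in> M.mtopology interior_of B n" by blast
  then obtain U where U: "openin M.mtopology U" "w0 \<in> U" "U \<subseteq> B n"
    by (auto simp: interior_of_def)
  then obtain r where r: "r > 0" "M.mball w0 r \<subseteq> U"
    using M.openin_mtopology by blast
  have w0: "w0 \<in> carrier W" using U(1,2) openin_subset by fastforce
  have approx: "\<exists>v\<in>carrier V. nrm V v \<le> real n \<and> nrm W (y \<ominus>\<^bsub>W\<^esub> T v) < \<delta>"
    if "y \<in> B n" "\<delta> > 0" for y \<delta>
  proof -
    have "y \<in> carrier W" using that(1) by (auto simp: B_def M.metric_closure_of)
    then show ?thesis using that unfolding B_def M.metric_closure_of by (force simp: d_def)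
  qed
  define C where "C = 4 * real n / r + 1"
  show thesis
  proof (rule that)
    show "C > 0" using r by (simp add: C_def add_nonneg_pos)
    fix w assume w: "w \<in> carrier W"
    show "\<exists>v\<in>carrier V. nrm V v \<le> C * nrm W w \<and> nrm W (w \<ominus>\<^bsub>W\<^esub> T v) \<le> nrm W w / 2"
    proof (cases "nrm W w = 0")
      case True
      then show ?thesis using w by (intro bexI[of _ "\<zero>\<^bsub>V\<^esub>"]) auto
    next
      case False
      then have wp: "nrm W w > 0" using w W.nrm_ge_0[of w] by linarith
      \<comment> \<open>The vector \<open>w\<close> is scaled to norm \<open>r / 2\<close>. Both \<open>w0\<close> and \<open>w0 \<oplus> w'\<close> are approximated by images up to \<open>r / 8\<close>, so \<open>w'\<close> is up to \<open>r / 4\<close>, which is half of its norm.\<close>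
      define t where "t = 2 * nrm W w / r"
      have t: "t > 0" using wp r by (simp add: t_def)
      define w' where "w' = complex_of_real (1 / t) \<odot>\<^bsub>W\<^esub> w"
      have w': "w' \<in> carrier W" using w by (simp add: w'_def)
      have "nrm W w' = r / 2" using w t wp using r by (simp add: w'_def W.nrm_smult norm_divide t_def)
      then have "d w0 (w0 \<oplus>\<^bsub>W\<^esub> w') < r"
        using r w0 w' by (simp add: d_def a_minus_def W.minus_add W.r_neg1 flip: W.a_assoc)
          (simp add: W.r_neg)
      then have "w0 \<oplus>\<^bsub>W\<^esub> w' \<in> M.mball w0 r" using w0 w' by (simp add: M.in_mball)
      then have "w0 \<oplus>\<^bsub>W\<^esub> w' \<in> B n" using r(2) U(3) by blast
      moreover have "w0 \<in> B n" using U by blast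
      moreover have "r / 8 > 0" using r by simp
      ultimately obtain v1 v2 where v: "v1 \<in> carrier V" "nrm V v1 \<le> real n"
          "nrm W ((w0 \<oplus>\<^bsub>W\<^esub> w') \<ominus>\<^bsub>W\<^esub> T v1) < r / 8"
          "v2 \<in> carrier V" "nrm V v2 \<le> real n" "nrm W (w0 \<ominus>\<^bsub>W\<^esub> T v2) < r / 8"
        using approx by metis
      have "w' = (w0 \<oplus>\<^bsub>W\<^esub> w') \<ominus>\<^bsub>W\<^esub> w0" using w0 w' by (metis W.add_minus_cancel W.a_comm)
      then have "nrm W (w' \<ominus>\<^bsub>W\<^esub> T (v1 \<ominus>\<^bsub>V\<^esub> v2)) \<le> r / 4"
        using W.dist_minus[of "w0 \<oplus>\<^bsub>W\<^esub> w'" w0 "T v1" "T v2"] v w0 w' by (simp add: T.minus)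
      define v' where "v' = complex_of_real t \<odot>\<^bsub>V\<^esub> (v1 \<ominus>\<^bsub>V\<^esub> v2)"
      have v': "v' \<in> carrier V" using v by (simp add: v'_def)
      have "w = complex_of_real t \<odot>\<^bsub>W\<^esub> w'"
        using t w by (simp add: w'_def W.smult_smult flip: of_real_mult)
      then have "nrm W (w \<ominus>\<^bsub>W\<^esub> T v') = t * nrm W (w' \<ominus>\<^bsub>W\<^esub> T (v1 \<ominus>\<^bsub>V\<^esub> v2))"
        using v w' t by (simp add: v'_def T.smult W.dist_smult)
      also have "\<dots> \<le> t * (r / 4)"
        using t \<open>nrm W (w' \<ominus>\<^bsub>W\<^esub> T (v1 \<ominus>\<^bsub>V\<^esub> v2)) \<le> r / 4\<close> by simp
      also have "\<dots> = nrm W w / 2" using r by (simp add: t_def)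
      finally have 1: "nrm W (w \<ominus>\<^bsub>W\<^esub> T v') \<le> nrm W w / 2" .
      have "nrm V v' \<le> t * (2 * real n)"
        using V.nrm_triangle_minus[of v1 v2] v t by (simp add: v'_def V.nrm_smult)
      also have "\<dots> \<le> C * nrm W w" using wp r by (simp add: t_def C_def field_simps)
      finally show ?thesis using 1 v' by blast
    qed
  qed
qed

theorem open_mapping:
  assumes "banach V" "banach W" "bounded_op V W T" "T ` carrier V = carrier W"
  obtains C where "C > 0" "\<And>w. w \<in> carrier W \<Longrightarrow> \<exists>v\<in>carrier V. T v = w \<and> nrm V v \<le> C * nrm W w"
proof -
  interpret V: banach V by fact
  interpret W: banach W by fact
  interpret T: bounded_op V W T by fact
  obtain C where C: "C > 0"
    "\<And>w. w \<in> carrier W \<Longrightarrow> \<exists>v\<in>carrier V. nrm V v \<le> C * nrm W w \<and> nrm W (w \<ominus>\<^bsub>W\<^esub> T v) \<le> nrm W w / 2"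
    using open_mapping_approx[OF V.seminormed_axioms W.banach_axioms T.bounded_op_axioms assms(4)] by metis
  then have "\<forall>w\<in>carrier W. \<exists>v. v \<in> carrier V \<and> nrm V v \<le> C * nrm W w \<and> nrm W (w \<ominus>\<^bsub>W\<^esub> T v) \<le> nrm W w / 2"
    by blast
  from bchoice[OF this] obtain g where g: "\<And>w. w \<in> carrier W \<Longrightarrow> g w \<in> carrier V"
      "\<And>w. w \<in> carrier W \<Longrightarrow> nrm V (g w) \<le> C * nrm W w"
      "\<And>w. w \<in> carrier W \<Longrightarrow> nrm W (w \<ominus>\<^bsub>W\<^esub> T (g w)) \<le> nrm W w / 2"
    by blast
  have "\<exists>v\<in>carrier V. T v = w \<and> nrm V v \<le> 2 * C * nrm W w" if w: "w \<in> carrier W" for w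
  proof -
    define x where "x = rec_nat w (\<lambda>_ w. w \<ominus>\<^bsub>W\<^esub> T (g w))"
    have x0: "x 0 = w" and xS: "x (Suc n) = x n \<ominus>\<^bsub>W\<^esub> T (g (x n))" for n by (simp_all add: x_def)
    have xc: "x n \<in> carrier W" for n by (induction n) (auto simp: x0 xS w g)
    have xb: "nrm W (x n) \<le> nrm W w * (1/2) ^ n" for n
    proof (induction n)
      case (Suc n)
      then show ?case using g(3)[OF xc[of n]] by (simp add: xS)
    qed (simp add: x0)
    have part: "T (finsum V (\<lambda>n. g (x n)) {..<n}) = w \<ominus>\<^bsub>W\<^esub> x n" for n
    proof (induction n)
      case 0
      then show ?case by (simp add: x0 w)
    next
      case (Suc n)
      have "T (finsum V (\<lambda>n. g (x n)) {..<Suc n}) = T (g (x n)) \<oplus>\<^bsub>W\<^esub> (w \<ominus>\<^bsub>W\<^esub> x n)"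
        using g xc by (simp add: lessThan_Suc Pi_def T.add Suc)
      also have "\<dots> = w \<ominus>\<^bsub>W\<^esub> (x n \<ominus>\<^bsub>W\<^esub> T (g (x n)))"
        using g xc w by (simp add: a_minus_def W.minus_add W.a_ac)
      finally show ?case by (simp add: xS)
    qed
    have x_lim: "(\<lambda>n. nrm W (x n)) \<longlonglongrightarrow> 0"
    proof (rule tendsto_sandwich[OF _ _ tendsto_const])
      show "(\<lambda>n. nrm W w * (1/2) ^ n) \<longlonglongrightarrow> 0"
        by (intro tendsto_mult_right_zero LIMSEQ_realpow_zero) auto
    qed (use xb xc in auto)
    have "nrm W ((w \<ominus>\<^bsub>W\<^esub> x n) \<ominus>\<^bsub>W\<^esub> w) = nrm W (x n)" for n
    proof -
      have "(w \<ominus>\<^bsub>W\<^esub> x n) \<ominus>\<^bsub>W\<^esub> w = \<ominus>\<^bsub>W\<^esub> x n"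
        using w xc[of n] by (metis W.add_minus_cancel W.a_comm W.minus_eq W.a_inv_closed)
      then show ?thesis using xc by simp
    qed
    then have lim: "(\<lambda>n. nrm W (T (finsum V (\<lambda>n. g (x n)) {..<n}) \<ominus>\<^bsub>W\<^esub> w)) \<longlonglongrightarrow> 0"
      using x_lim by (simp add: part)
    have gb: "nrm V (g (x n)) \<le> C * nrm W w * (1/2) ^ n" for n
      using order_trans[OF g(2)[OF xc[of n]] mult_left_mono[OF xb[of n], of C]] C(1)
      by (simp add: mult.assoc)
    have "(\<lambda>n. C * nrm W w * (1/2) ^ n) sums (C * nrm W w * 2)"
      using geometric_sums[of "1/2::real"] by (intro sums_mult) simp
    then obtain v where "v \<in> carrier V" "T v = w" "nrm V v \<le> C * nrm W w * 2"
      using solve_by_series[OF T.bounded_op_axioms W.normed_axioms V.banach_axioms _ gb _ w lim] g xc by metis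
    then show ?thesis by (auto simp: mult.commute mult.left_commute)
  qed
  then show thesis using that[of "2 * C"] C(1) by simp
qed


section \<open>Subspaces, quotients and completions\<close>

context seminormed
begin

text \<open>
  A linear subspace with the restricted operations. Differences are computed as in the whole space,
  although they are defined through the carrier.
\<close>

lemma sub_seminormed:
  assumes "submodule H scalars V"
  shows "seminormed (V\<lparr>carrier := H\<rparr>)"
proof -
  have H: "H \<subseteq> carrier V" using submoduleE[OF assms] by blast
  interpret S: Module.module scalars "V\<lparr>carrier := H\<rparr>"
    by (rule submodule.submodule_is_module[OF assms module_axioms])
  show ?thesis
    by unfold_locales (simp_all add: subsetD[OF H] nrm_triangle nrm_smult)
qed

lemma sub_minus:
  assumes "submodule H scalars V" "x \<in> H" "y \<in> H"
  shows "x \<ominus>\<^bsub>V\<lparr>carrier := H\<rparr>\<^esub> y = x \<ominus> y"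
proof -
  have H: "H \<subseteq> carrier V" using submoduleE[OF assms(1)] by blast
  interpret S: seminormed "V\<lparr>carrier := H\<rparr>"
    by (rule sub_seminormed) fact
  show ?thesis
    using S.minus_smult[of x y] minus_smult[OF subsetD[OF H assms(2)] subsetD[OF H assms(3)]] assms
    by simp
qed

lemma submoduleI':
  assumes "H \<subseteq> carrier V" "\<zero> \<in> H" "\<And>x y. x \<in> H \<Longrightarrow> y \<in> H \<Longrightarrow> x \<oplus> y \<in> H"
    "\<And>c x. x \<in> H \<Longrightarrow> c \<odot> x \<in> H"
  shows "submodule H scalars V"
proof (rule submoduleI)
  show "\<ominus> a \<in> H" if "a \<in> H" for a
    using assms(4)[OF that, of "-1"] that assms(1) by (auto simp: uminus_smult)
qed (use assms in auto)

end

text \<open>The quotient of a seminormed space by a linear subspace \<open>N\<close>, with \<open>coset x\<close> the class of \<open>x\<close>.\<close>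

locale quot = seminormed +
  fixes N :: "'a set"
  assumes sub: "submodule N scalars V"
begin

lemma N_subset: "N \<subseteq> carrier V"
  using submoduleE[OF sub] by blast

sublocale asub: abelian_subgroup N V
proof (rule abelian_subgroupI3)
  show "additive_subgroup N V"
    using sub by (intro additive_subgroup.intro) (simp add: submodule_def)
qed (rule M.abelian_group_axioms)

abbreviation Q where "Q \<equiv> quotient_space V N"
abbreviation coset where "coset x \<equiv> N +> x"

lemma cosetI: "n \<in> N \<Longrightarrow> n \<oplus> x \<in> coset x"
  by (auto simp: a_r_coset_def')

lemma cosetE: "y \<in> coset x \<Longrightarrow> x \<in> carrier V \<Longrightarrow> y \<in> carrier V \<and> coset y = coset x \<and> (\<exists>n\<in>N. y = n \<oplus> x)"
  using asub.a_repr_independence'[of y x] subsetD[OF N_subset] by (fastforce simp: a_r_coset_def')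

lemma coset_carrier: "y \<in> coset x \<Longrightarrow> x \<in> carrier V \<Longrightarrow> y \<in> carrier V"
  using cosetE by blast

lemma coset_self: "x \<in> carrier V \<Longrightarrow> x \<in> coset x"
  by (rule asub.a_rcos_self)

lemma Q_carrier: "carrier Q = coset ` carrier V"
  by (auto simp: quotient_space_def A_RCOSETS_def')

lemma Q_coset [simp, intro]: "x \<in> carrier V \<Longrightarrow> coset x \<in> carrier Q"
  by (simp add: Q_carrier)

lemma Q_zero: "\<zero>\<^bsub>Q\<^esub> = coset \<zero>"
  by (simp add: quotient_space_def M.a_coset_add_zero[OF N_subset])

lemma Q_add: "x \<in> carrier V \<Longrightarrow> y \<in> carrier V \<Longrightarrow> coset x \<oplus>\<^bsub>Q\<^esub> coset y = coset (x \<oplus> y)"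
  by (simp add: quotient_space_def asub.a_rcos_sum)

lemma Q_smult: assumes x: "x \<in> carrier V" shows "c \<odot>\<^bsub>Q\<^esub> coset x = coset (c \<odot> x)"
proof -
  have "coset (c \<odot> y) = coset (c \<odot> x)" if y: "y \<in> coset x" for y
  proof -
    obtain n where n: "n \<in> N" "y = n \<oplus> x" using cosetE[OF y x] by blast
    have nc: "n \<in> carrier V" using n N_subset by blast
    have "c \<odot> n \<in> N" using submoduleE(4)[OF sub, of c n] n by simp
    then have "c \<odot> y \<in> coset (c \<odot> x)" using cosetI[of "c \<odot> n" "c \<odot> x"] n nc x by (simp add: smult_add_right)
    then show ?thesis using cosetE x by blast
  qed
  then have "(\<Union>y\<in>coset x. coset (c \<odot> y)) = (\<Union>y\<in>coset x. coset (c \<odot> x))"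
    by (intro SUP_cong refl)
  also have "\<dots> = coset (c \<odot> x)" using coset_self[OF x] by blast
  finally show ?thesis by (simp add: quotient_space_def)
qed

lemma Q_module: "Module.module scalars Q"
proof (rule moduleI)
  show "abelian_group Q"
  proof (rule abelian_groupI)
    show "\<exists>y\<in>carrier Q. y \<oplus>\<^bsub>Q\<^esub> x = \<zero>\<^bsub>Q\<^esub>" if x: "x \<in> carrier Q" for x
    proof -
      obtain a where a: "a \<in> carrier V" "x = coset a" using x by (auto simp: Q_carrier)
      then have "coset (\<ominus> a) \<oplus>\<^bsub>Q\<^esub> x = \<zero>\<^bsub>Q\<^esub>"
        by (simp add: Q_add Q_zero M.l_neg)
      then show ?thesis using a by blast
    qed
  qed (auto simp: Q_carrier Q_add Q_zero M.a_ac)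
qed (auto simp: cring_scalars Q_carrier Q_add Q_smult smult_add_left smult_add_right smult_smult)

lemma nrm_Q_bdd: "x \<in> carrier V \<Longrightarrow> bdd_below (nrm V ` coset x)"
  by (rule bdd_belowI[of _ 0]) (auto dest: coset_carrier)

lemma nrm_Q_le: assumes "x \<in> carrier V" shows "nrm Q (coset x) \<le> nrm V x"
  using nrm_Q_bdd[OF assms] coset_self[OF assms] by (auto simp: quotient_space_def intro!: cInf_lower)

lemma nrm_Q_ge_0: assumes "x \<in> carrier V" shows "0 \<le> nrm Q (coset x)"
  using coset_self[OF assms] coset_carrier[OF _ assms]
  by (auto simp: quotient_space_def intro!: cInf_greatest)

lemma nrm_Q_less:
  assumes "x \<in> carrier V" "nrm Q (coset x) < r"
  obtains y where "y \<in> carrier V" "coset y = coset x" "nrm V y < r"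
proof -
  have "nrm V ` coset x \<noteq> {}" using coset_self[OF assms(1)] by blast
  moreover have "Inf (nrm V ` coset x) < r" using assms(2) by (simp add: quotient_space_def)
  ultimately have "\<exists>t\<in>nrm V ` coset x. t < r" by (rule cInf_lessD)
  then obtain y where "y \<in> coset x" "nrm V y < r" by blast
  with cosetE[OF this(1) assms(1)] that show thesis by blast
qed

sublocale quo: seminormed Q
proof (rule seminormed.intro[OF Q_module], unfold_locales)
  fix x assume "x \<in> carrier Q"
  then obtain a where a: "a \<in> carrier V" "x = coset a" by (auto simp: Q_carrier)
  show "0 \<le> nrm Q x" using a nrm_Q_ge_0 by simp
  have le: "nrm Q (coset (c \<odot> a)) \<le> cmod c * nrm Q (coset a)" if a: "a \<in> carrier V" for c a
  proof (rule field_le_epsilon)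
    fix e :: real assume e: "e > 0"
    have "nrm Q (coset a) < nrm Q (coset a) + e / (cmod c + 1)" using e by (simp add: add_nonneg_pos)
    then obtain b where b: "b \<in> carrier V" "coset b = coset a" "nrm V b < nrm Q (coset a) + e / (cmod c + 1)"
      using nrm_Q_less[OF a] by blast
    have "nrm Q (coset (c \<odot> a)) = nrm Q (coset (c \<odot> b))" using a b by (metis Q_smult)
    also have "\<dots> \<le> cmod c * nrm V b" using b nrm_Q_le[of "c \<odot> b"] by (simp add: nrm_smult)
    also have "\<dots> \<le> cmod c * (nrm Q (coset a) + e / (cmod c + 1))"
      using b by (intro mult_left_mono) auto
    also have "\<dots> \<le> cmod c * nrm Q (coset a) + e"
    proof -
      have "cmod c * (e / (cmod c + 1)) \<le> (cmod c + 1) * (e / (cmod c + 1))"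
        using e by (intro mult_right_mono) auto
      also have "\<dots> = e" by (simp add: add_nonneg_eq_0_iff)
      finally show ?thesis by (simp add: distrib_left)
    qed
    finally show "nrm Q (coset (c \<odot> a)) \<le> cmod c * nrm Q (coset a) + e" .
  qed
  show "nrm Q (c \<odot>\<^bsub>Q\<^esub> x) = cmod c * nrm Q x" for c
  proof (cases "c = 0")
    case True
    have "nrm Q (coset \<zero>) = 0" using nrm_Q_le[of \<zero>] nrm_Q_ge_0[of \<zero>] by simp
    then show ?thesis using True a by (simp add: Q_smult)
  next
    case False
    have "nrm Q (coset a) \<le> cmod (1/c) * nrm Q (coset (c \<odot> a))"
      using le[of "c \<odot> a" "1/c"] a False by (simp add: smult_smult)
    then have "cmod c * nrm Q (coset a) \<le> nrm Q (coset (c \<odot> a))"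
      using False by (simp add: norm_divide field_simps)
    then show ?thesis using le[OF a(1), of c] a by (simp add: Q_smult)
  qed
  fix y assume "y \<in> carrier Q"
  then obtain b where b: "b \<in> carrier V" "y = coset b" by (auto simp: Q_carrier)
  show "nrm Q (x \<oplus>\<^bsub>Q\<^esub> y) \<le> nrm Q x + nrm Q y"
  proof (rule field_le_epsilon)
    fix e :: real assume e: "e > 0"
    obtain a' where a': "a' \<in> carrier V" "coset a' = coset a" "nrm V a' < nrm Q (coset a) + e / 2"
      using nrm_Q_less[OF a(1), of "nrm Q (coset a) + e / 2"] e by auto
    obtain b' where b': "b' \<in> carrier V" "coset b' = coset b" "nrm V b' < nrm Q (coset b) + e / 2"
      using nrm_Q_less[OF b(1), of "nrm Q (coset b) + e / 2"] e by auto
    have "nrm Q (x \<oplus>\<^bsub>Q\<^esub> y) = nrm Q (coset (a' \<oplus> b'))" using a b a' b' by (metis Q_add)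
    also have "\<dots> \<le> nrm V a' + nrm V b'" using nrm_Q_le[of "a' \<oplus> b'"] nrm_triangle[of a' b'] a' b' by simp
    finally show "nrm Q (x \<oplus>\<^bsub>Q\<^esub> y) \<le> nrm Q x + nrm Q y + e" using a b a' b' by simp
  qed
qed

lemma bounded_op_coset: "bounded_op V Q coset"
proof unfold_locales
  show "bounded_operator V Q coset"
    by (rule bounded_operatorI[where K = 1]) (auto simp: Q_add Q_smult nrm_Q_le)
qed

lemma Q_minus: "x \<in> carrier V \<Longrightarrow> y \<in> carrier V \<Longrightarrow> coset x \<ominus>\<^bsub>Q\<^esub> coset y = coset (x \<ominus> y)"
  by (simp add: bounded_op.minus[OF bounded_op_coset])

lemma coset_eq_iff: assumes "x \<in> carrier V" "y \<in> carrier V" shows "coset x = coset y \<longleftrightarrow> x \<ominus> y \<in> N"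
proof -
  have "coset x = coset y \<longleftrightarrow> x \<in> coset y"
    using coset_self[OF assms(1)] cosetE[OF _ assms(2), of x] by auto
  also have "\<dots> \<longleftrightarrow> x \<ominus> y \<in> N"
    using asub.a_rcos_module[of y x] assms by (simp add: a_minus_def)
  finally show ?thesis .
qed

text \<open>If the seminorm vanishes on \<open>N\<close>, then it is constant on cosets and the quotient seminorm equals it.\<close>

lemma nrm_Q_eq:
  assumes "\<And>n. n \<in> N \<Longrightarrow> nrm V n = 0" "x \<in> carrier V"
  shows "nrm Q (coset x) = nrm V x"
proof -
  have "nrm V y = nrm V x" if "y \<in> coset x" for y
  proof -
    have "x \<ominus> y \<in> N" using cosetE[OF that assms(2)] assms(2) by (simp flip: coset_eq_iff)
    then show ?thesis using assms nrm_diff_le[of x y] cosetE[OF that assms(2)] by fastforce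
  qed
  then have "nrm V ` coset x = (\<lambda>_. nrm V x) ` coset x" by (intro image_cong refl)
  also have "\<dots> = {nrm V x}" using coset_self[OF assms(2)] by blast
  finally have "nrm V ` coset x = {nrm V x}" .
  then show ?thesis by (simp add: quotient_space_def)
qed

lemma Q_normed:
  assumes "\<And>x. x \<in> carrier V \<Longrightarrow> nrm V x = 0 \<longleftrightarrow> x \<in> N"
  shows "normed Q"
proof unfold_locales
  fix x assume "x \<in> carrier Q" "nrm Q x = 0"
  then obtain a where a: "a \<in> carrier V" "x = coset a" by (auto simp: Q_carrier)
  have "nrm Q (coset a) = nrm V a" using assms N_subset a by (intro nrm_Q_eq) auto
  then have "a \<in> N" using a assms \<open>nrm Q x = 0\<close> by simp
  then show "x = \<zero>\<^bsub>Q\<^esub>" using a coset_eq_iff[of a \<zero>] by (simp add: Q_zero)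
qed

end

lemma (in seminormed) null_submodule:
  assumes "\<And>x. x \<in> N \<longleftrightarrow> x \<in> carrier V \<and> nrm V x = 0"
  shows "submodule N scalars V"
proof (rule submoduleI')
  fix x y assume "x \<in> N" "y \<in> N"
  then have "x \<in> carrier V" "nrm V x = 0" "y \<in> carrier V" "nrm V y = 0"
    unfolding assms by simp_all
  then show "x \<oplus> y \<in> N"
    unfolding assms using nrm_triangle[of x y] nrm_ge_0[of "x \<oplus> y"] by (simp add: antisym)
qed (auto simp: nrm_smult assms)

lemma (in seminormed) fast_dist:
  assumes "\<And>n. s n \<in> carrier V" "\<And>n. nrm V (s n \<ominus> s (Suc n)) \<le> (1/2) ^ n" "m \<le> n"
  shows "nrm V (s m \<ominus> s n) \<le> 2 * (1/2) ^ m - 2 * (1/2) ^ n"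
  using assms(3)
proof (induction n rule: dec_induct)
  case (step n)
  have "nrm V (s m \<ominus> s (Suc n)) \<le> nrm V (s m \<ominus> s n) + nrm V (s n \<ominus> s (Suc n))"
    using assms(1) by (intro dist_triangle)
  then show ?case using step assms(2)[of n] by simp
qed (use assms in simp)

lemma (in seminormed) fast_cauchy:
  assumes "\<And>n. s n \<in> carrier V" "\<And>n. nrm V (s n \<ominus> s (Suc n)) \<le> (1/2) ^ n"
  shows "cauchy_in V s"
  unfolding cauchy_in_def
proof (intro conjI allI impI)
  fix e :: real assume "e > 0"
  then obtain N where N: "(1/2) ^ N < e / (2::real)"
    using real_arch_pow_inv[of "e/2" "1/2"] by auto
  have *: "nrm V (s m \<ominus> s n) < e" if "m \<ge> N" "m \<le> n" for m n
  proof -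
    have "nrm V (s m \<ominus> s n) \<le> 2 * (1/2) ^ m - 2 * (1/2) ^ n"
      using fast_dist[of s m n] assms that by blast
    also have "\<dots> \<le> 2 * (1/2) ^ m" by simp
    also have "\<dots> \<le> 2 * (1/2) ^ N"
      using that(1) by (intro mult_left_mono power_decreasing) auto
    finally show ?thesis using N by linarith
  qed
  then show "\<exists>N. \<forall>m\<ge>N. \<forall>n\<ge>N. nrm V (s m \<ominus> s n) < e"
    using assms(1) nrm_minus_commute by (metis nle_le)
qed (rule assms)

context seminormed
begin

text \<open>The limit in the definition of the seminorm of \<open>cauchy_space\<close> exists.\<close>

lemma cauchy_nrm_convergent:
  assumes "cauchy_in V s" shows "(\<lambda>n. nrm V (s n)) \<longlonglongrightarrow> nrm (cauchy_space V) s"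
proof -
  have "Cauchy (\<lambda>n. nrm V (s n))"
  proof (rule CauchyI)
    fix e :: real assume "e > 0"
    then obtain N where "\<And>m n. m \<ge> N \<Longrightarrow> n \<ge> N \<Longrightarrow> nrm V (s m \<ominus> s n) < e"
      using assms unfolding cauchy_in_def by blast
    then show "\<exists>M. \<forall>m\<ge>M. \<forall>n\<ge>M. norm (nrm V (s m) - nrm V (s n)) < e"
      using assms nrm_diff_le unfolding cauchy_in_def real_norm_def by (meson le_less_trans)
  qed
  then show ?thesis
    by (simp add: cauchy_space_def Cauchy_convergent_iff convergent_LIMSEQ_iff)
qed

lemma cauchy_in_carrier: "cauchy_in V s \<Longrightarrow> s n \<in> carrier V"
  by (simp add: cauchy_in_def)

lemma cauchy_add:
  assumes "cauchy_in V s" "cauchy_in V t" shows "cauchy_in V (\<lambda>n. s n \<oplus> t n)"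
  unfolding cauchy_in_def
proof (intro conjI allI impI)
  note c = cauchy_in_carrier[OF assms(1)] cauchy_in_carrier[OF assms(2)]
  show "s n \<oplus> t n \<in> carrier V" for n using c by simp
  fix e :: real assume "e > 0"
  then have e: "e / 2 > 0" by simp
  obtain N where N: "\<And>m n. m \<ge> N \<Longrightarrow> n \<ge> N \<Longrightarrow> nrm V (s m \<ominus> s n) < e/2"
    using assms(1) e unfolding cauchy_in_def by blast
  obtain M where M: "\<And>m n. m \<ge> M \<Longrightarrow> n \<ge> M \<Longrightarrow> nrm V (t m \<ominus> t n) < e/2"
    using assms(2) e unfolding cauchy_in_def by blast
  have "nrm V ((s m \<oplus> t m) \<ominus> (s n \<oplus> t n)) < e" if "m \<ge> max M N" "n \<ge> max M N" for m n
    using dist_add[of "s m" "t m" "s n" "t n"] N[of m n] M[of m n] that c by force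
  then show "\<exists>N. \<forall>m\<ge>N. \<forall>n\<ge>N. nrm V ((s m \<oplus> t m) \<ominus> (s n \<oplus> t n)) < e" by blast
qed

lemma cauchy_smult:
  assumes "cauchy_in V s" shows "cauchy_in V (\<lambda>n. c \<odot> s n)"
  unfolding cauchy_in_def
proof (intro conjI allI impI)
  note sc = cauchy_in_carrier[OF assms(1)]
  show "c \<odot> s n \<in> carrier V" for n using sc by simp
  fix e :: real assume "e > 0"
  then have "e / (cmod c + 1) > 0" by (simp add: add_nonneg_pos)
  then obtain N where N: "\<And>m n. m \<ge> N \<Longrightarrow> n \<ge> N \<Longrightarrow> nrm V (s m \<ominus> s n) < e / (cmod c + 1)"
    using assms(1) unfolding cauchy_in_def by blast
  have "nrm V (c \<odot> s m \<ominus> c \<odot> s n) < e" if "m \<ge> N" "n \<ge> N" for m n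
  proof -
    have "nrm V (c \<odot> s m \<ominus> c \<odot> s n) = cmod c * nrm V (s m \<ominus> s n)"
      using sc by (simp add: dist_smult)
    also have "\<dots> \<le> (cmod c + 1) * nrm V (s m \<ominus> s n)" using sc by (simp add: mult_right_mono)
    also have "\<dots> < e" using N[OF that]
      by (metis add_nonneg_pos less_numeral_extra(1) mult.commute norm_ge_zero pos_less_divide_eq)
    finally show ?thesis .
  qed
  then show "\<exists>N. \<forall>m\<ge>N. \<forall>n\<ge>N. nrm V (c \<odot> s m \<ominus> c \<odot> s n) < e" by blast
qed

lemma cauchy_const: "x \<in> carrier V \<Longrightarrow> cauchy_in V (\<lambda>n. x)"
  by (simp add: cauchy_in_def)

lemma cauchy_module: "Module.module scalars (cauchy_space V)"
proof (rule moduleI)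
  show "abelian_group (cauchy_space V)"
  proof (rule abelian_groupI)
    fix s assume "s \<in> carrier (cauchy_space V)"
    then have s: "cauchy_in V s" by (simp add: cauchy_space_def)
    have "(\<lambda>n. (- 1) \<odot> s n \<oplus> s n) = (\<lambda>n. \<zero>)"
      using cauchy_in_carrier[OF s] by (simp add: M.l_neg flip: uminus_smult)
    then show "\<exists>y\<in>carrier (cauchy_space V). y \<oplus>\<^bsub>cauchy_space V\<^esub> s = \<zero>\<^bsub>cauchy_space V\<^esub>"
      using cauchy_smult[OF s, of "-1"] by (auto simp: cauchy_space_def)
  qed (auto simp: cauchy_space_def cauchy_add cauchy_const cauchy_in_carrier M.a_ac)
qed (auto simp: cauchy_space_def cring_scalars cauchy_smult cauchy_in_carrier smult_add_left
    smult_add_right smult_smult)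

lemma cauchy_seminormed: "seminormed (cauchy_space V)"
proof (rule seminormed.intro[OF cauchy_module], unfold_locales)
  fix s assume "s \<in> carrier (cauchy_space V)"
  then have s: "cauchy_in V s" by (simp add: cauchy_space_def)
  show "0 \<le> nrm (cauchy_space V) s"
    by (rule LIMSEQ_le_const[OF cauchy_nrm_convergent[OF s]]) (use cauchy_in_carrier[OF s] in auto)
  show "nrm (cauchy_space V) (c \<odot>\<^bsub>cauchy_space V\<^esub> s) = cmod c * nrm (cauchy_space V) s" for c
  proof (rule LIMSEQ_unique)
    show "(\<lambda>n. nrm V (c \<odot> s n)) \<longlonglongrightarrow> nrm (cauchy_space V) (c \<odot>\<^bsub>cauchy_space V\<^esub> s)"
      using cauchy_nrm_convergent[OF cauchy_smult[OF s, of c]] by (simp add: cauchy_space_def)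
    show "(\<lambda>n. nrm V (c \<odot> s n)) \<longlonglongrightarrow> cmod c * nrm (cauchy_space V) s"
      using tendsto_mult_left[OF cauchy_nrm_convergent[OF s], of "cmod c"] cauchy_in_carrier[OF s]
      by (simp add: nrm_smult)
  qed
  fix t assume "t \<in> carrier (cauchy_space V)"
  then have t: "cauchy_in V t" by (simp add: cauchy_space_def)
  have "(\<lambda>n. nrm V (s n \<oplus> t n)) \<longlonglongrightarrow> nrm (cauchy_space V) (s \<oplus>\<^bsub>cauchy_space V\<^esub> t)"
    using cauchy_nrm_convergent[OF cauchy_add[OF s t]] by (simp add: cauchy_space_def)
  from this tendsto_add[OF cauchy_nrm_convergent[OF s] cauchy_nrm_convergent[OF t]]
  show "nrm (cauchy_space V) (s \<oplus>\<^bsub>cauchy_space V\<^esub> t) \<le> nrm (cauchy_space V) s + nrm (cauchy_space V) t"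
    by (rule LIMSEQ_le) (use cauchy_in_carrier[OF s] cauchy_in_carrier[OF t] nrm_triangle in auto)
qed

lemma null_sequences_iff:
  "s \<in> null_sequences V \<longleftrightarrow> s \<in> carrier (cauchy_space V) \<and> nrm (cauchy_space V) s = 0"
proof
  assume "s \<in> null_sequences V"
  then have s: "\<And>n. s n \<in> carrier V" "(\<lambda>n. nrm V (s n)) \<longlonglongrightarrow> 0" by (auto simp: null_sequences_def)
  then have c: "cauchy_in V s" using cauchy_if_tendsto[of s \<zero>] by simp
  then show "s \<in> carrier (cauchy_space V) \<and> nrm (cauchy_space V) s = 0"
    using LIMSEQ_unique[OF cauchy_nrm_convergent[OF c] s(2)] by (simp add: cauchy_space_def)
next
  assume s: "s \<in> carrier (cauchy_space V) \<and> nrm (cauchy_space V) s = 0"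
  then have c: "cauchy_in V s" by (simp add: cauchy_space_def)
  then show "s \<in> null_sequences V"
    using cauchy_nrm_convergent[OF c] cauchy_in_carrier[OF c] s by (simp add: null_sequences_def)
qed

text \<open>The completion is the quotient of the space of Cauchy sequences by the sequences of seminorm zero.\<close>

interpretation comp: quot "cauchy_space V" "null_sequences V"
  rewrites "quotient_space (cauchy_space V) (null_sequences V) \<equiv> completion_space V"
proof -
  interpret C: seminormed "cauchy_space V" by (rule cauchy_seminormed)
  show "quot (cauchy_space V) (null_sequences V)"
    by (intro quot.intro quot_axioms.intro C.seminormed_axioms C.null_submodule null_sequences_iff)
qed (simp add: completion_space_def)

lemma cauchy_space_minus:
  assumes "cauchy_in V s" "cauchy_in V t"
  shows "s \<ominus>\<^bsub>cauchy_space V\<^esub> t = (\<lambda>n. s n \<ominus> t n)"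
  using assms comp.minus_smult[of s t] cauchy_in_carrier[OF assms(1)] cauchy_in_carrier[OF assms(2)]
  by (simp add: minus_smult cauchy_space_def)

lemma completion_normed: "normed (completion_space V)"
  by (rule comp.Q_normed) (simp add: null_sequences_iff)

lemma nrm_comp: "s \<in> carrier (cauchy_space V) \<Longrightarrow> nrm (completion_space V) (comp.coset s) = nrm (cauchy_space V) s"
  by (rule comp.nrm_Q_eq) (simp_all add: null_sequences_iff)

lemma const_in_cauchy_space: "x \<in> carrier V \<Longrightarrow> (\<lambda>n. x) \<in> carrier (cauchy_space V)"
  by (simp add: cauchy_space_def cauchy_const)

lemma nrm_embed: "x \<in> carrier V \<Longrightarrow> nrm (completion_space V) (completion_embed V x) = nrm V x"
  using cauchy_nrm_convergent[OF cauchy_const]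
  by (simp add: completion_embed_def nrm_comp const_in_cauchy_space LIMSEQ_const_iff)

lemma bounded_op_embed: "bounded_op V (completion_space V) (completion_embed V)"
proof (intro bounded_op.intro bounded_op_axioms.intro bounded_operatorI[where K = 1])
  show "seminormed V" "seminormed (completion_space V)"
    by (fact seminormed_axioms comp.quo.seminormed_axioms)+
  fix x y and c :: complex
  assume x: "x \<in> carrier V"
  show "completion_embed V x \<in> carrier (completion_space V)"
    using x by (simp add: completion_embed_def const_in_cauchy_space)
  show "nrm (completion_space V) (completion_embed V x) \<le> 1 * nrm V x"
    using x by (simp add: nrm_embed)
  show "completion_embed V (c \<odot> x) = c \<odot>\<^bsub>completion_space V\<^esub> completion_embed V x"
    using x comp.Q_smult[OF const_in_cauchy_space, of x c]
    by (simp add: completion_embed_def) (simp add: cauchy_space_def)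
  assume y: "y \<in> carrier V"
  show "completion_embed V (x \<oplus> y) = completion_embed V x \<oplus>\<^bsub>completion_space V\<^esub> completion_embed V y"
    using x y comp.Q_add[OF const_in_cauchy_space const_in_cauchy_space, of x y]
    by (simp add: completion_embed_def) (simp add: cauchy_space_def)
qed

lemma embed_dense: "dense_in (completion_space V) (completion_embed V ` carrier V)"
  unfolding dense_in_def
proof (intro conjI ballI allI impI)
  interpret E: bounded_op V "completion_space V" "completion_embed V" by (rule bounded_op_embed)
  show "completion_embed V ` carrier V \<subseteq> carrier (completion_space V)" by blast
  fix x e assume "x \<in> carrier (completion_space V)" and e: "(e::real) > 0"
  then obtain s where s: "cauchy_in V s" "x = comp.coset s"
    by (auto simp: comp.Q_carrier cauchy_space_def)
  note sc = cauchy_in_carrier[OF s(1)]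
  obtain N where N: "\<And>m n. m \<ge> N \<Longrightarrow> n \<ge> N \<Longrightarrow> nrm V (s m \<ominus> s n) < e/2"
    using s(1) e unfolding cauchy_in_def by (metis half_gt_zero)
  have c: "s \<in> carrier (cauchy_space V)" "(\<lambda>n. s N) \<in> carrier (cauchy_space V)"
    using s(1) cauchy_const[OF sc] by (auto simp: cauchy_space_def)
  have m: "s \<ominus>\<^bsub>cauchy_space V\<^esub> (\<lambda>n. s N) = (\<lambda>n. s n \<ominus> s N)"
    using cauchy_space_minus[OF s(1) cauchy_const[OF sc]] .
  have "nrm (completion_space V) (x \<ominus>\<^bsub>completion_space V\<^esub> completion_embed V (s N)) =
      nrm (cauchy_space V) (\<lambda>n. s n \<ominus> s N)"
    using comp.Q_minus[OF c] nrm_comp[OF comp.minus_in[OF c]]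
    by (simp add: completion_embed_def s(2) m)
  also have "\<dots> \<le> e / 2"
  proof (rule LIMSEQ_le_const2)
    show "(\<lambda>n. nrm V (s n \<ominus> s N)) \<longlonglongrightarrow> nrm (cauchy_space V) (\<lambda>n. s n \<ominus> s N)"
      using c comp.minus_in[OF c] by (intro cauchy_nrm_convergent) (simp add: m, simp add: cauchy_space_def)
    show "\<exists>M. \<forall>n\<ge>M. nrm V (s n \<ominus> s N) \<le> e / 2" using N by (intro exI[of _ N]) (auto intro: less_imp_le)
  qed
  finally show "\<exists>d\<in>completion_embed V ` carrier V.
      nrm (completion_space V) (x \<ominus>\<^bsub>completion_space V\<^esub> d) < e"
    using e sc by (intro bexI[of _ "completion_embed V (s N)"]) auto
qed

lemma completion_banach: "banach (completion_space V)"
proof (rule banach_if_dense[OF completion_normed embed_dense])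
  interpret C: normed "completion_space V" by (rule completion_normed)
  interpret E: bounded_op V "completion_space V" "completion_embed V" by (rule bounded_op_embed)
  fix s assume "\<And>n. s n \<in> completion_embed V ` carrier V"
    and fast: "\<And>n. nrm (completion_space V) (s n \<ominus>\<^bsub>completion_space V\<^esub> s (Suc n)) \<le> (1/2) ^ n"
  then have "\<forall>n. \<exists>t. t \<in> carrier V \<and> s n = completion_embed V t" by blast
  from choice[OF this] obtain t where t: "\<And>n. t n \<in> carrier V" "\<And>n. s n = completion_embed V (t n)"
    by blast
  have fast': "nrm V (t n \<ominus> t (Suc n)) \<le> (1/2) ^ n" for n
    using fast[of n] t nrm_embed[of "t n \<ominus> t (Suc n)"] by (simp add: E.minus)
  have tC: "cauchy_in V t" by (rule fast_cauchy[OF t(1) fast'])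
  have c: "t \<in> carrier (cauchy_space V)" "(\<lambda>m. t n) \<in> carrier (cauchy_space V)" for n
    using tC cauchy_const[OF t(1)] by (auto simp: cauchy_space_def)
  have m: "(\<lambda>m. t n) \<ominus>\<^bsub>cauchy_space V\<^esub> t = (\<lambda>m. t n \<ominus> t m)" for n
    using cauchy_space_minus[OF cauchy_const[OF t(1)] tC] .
  have le: "nrm (completion_space V) (s n \<ominus>\<^bsub>completion_space V\<^esub> comp.coset t) \<le> 2 * (1/2) ^ n" for n
  proof -
    have "nrm (completion_space V) (s n \<ominus>\<^bsub>completion_space V\<^esub> comp.coset t) =
        nrm (cauchy_space V) (\<lambda>m. t n \<ominus> t m)"
      using comp.Q_minus[OF c(2)[of n] c(1)] nrm_comp[OF comp.minus_in[OF c(2)[of n] c(1)]]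
      by (simp add: completion_embed_def t(2) m)
    also have "\<dots> \<le> 2 * (1/2) ^ n"
    proof (rule LIMSEQ_le_const2)
      show "(\<lambda>m. nrm V (t n \<ominus> t m)) \<longlonglongrightarrow> nrm (cauchy_space V) (\<lambda>m. t n \<ominus> t m)"
        using comp.minus_in[OF c(2)[of n] c(1)]
        by (intro cauchy_nrm_convergent) (simp add: m, simp add: cauchy_space_def)
      have "nrm V (t n \<ominus> t m) \<le> 2 * (1/2) ^ n" if "m \<ge> n" for m
        using fast_dist[OF t(1) fast' that] zero_le_power[of "1/2::real" m] by linarith
      then show "\<exists>M. \<forall>m\<ge>M. nrm V (t n \<ominus> t m) \<le> 2 * (1/2) ^ n" by blast
    qed
    finally show ?thesis .
  qed
  have tc: "comp.coset t \<in> carrier (completion_space V)" using c(1) by (rule comp.Q_coset)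
  have sc: "s n \<in> carrier (completion_space V)" for n using t by simp
  have "(\<lambda>n. nrm (completion_space V) (s n \<ominus>\<^bsub>completion_space V\<^esub> comp.coset t)) \<longlonglongrightarrow> 0"
  proof (rule tendsto_sandwich[OF _ _ tendsto_const])
    show "(\<lambda>n. 2 * (1/2) ^ n :: real) \<longlonglongrightarrow> 0"
      by (intro tendsto_mult_right_zero LIMSEQ_realpow_zero) auto
  qed (use le tc sc in auto)
  then show "\<exists>x\<in>carrier (completion_space V).
      (\<lambda>n. nrm (completion_space V) (s n \<ominus>\<^bsub>completion_space V\<^esub> x)) \<longlonglongrightarrow> 0"
    using tc by blast
qed

end

section \<open>Haar measure on the circle\<close>

lemma measurable_cis_circle: "(\<lambda>t. cis (2 * pi * t)) \<in> borel \<rightarrow>\<^sub>M restrict_space borel circle"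
  by (rule measurable_restrict_space2) (auto intro!: borel_measurable_continuous_onI continuous_intros)

lemma measurable_cis_unit:
  "(\<lambda>t. cis (2 * pi * t)) \<in> restrict_space lborel {0..1} \<rightarrow>\<^sub>M restrict_space borel circle"
  using measurable_cis_circle by (intro measurable_restrict_space1) simp

lemma space_haar [simp]: "space haar_circle = circle"
  by (simp add: haar_circle_def)

lemma sets_haar [measurable_cong]: "sets haar_circle = sets (restrict_space borel circle)"
  by (simp add: haar_circle_def)

lemma nn_integral_haar:
  fixes f :: "complex \<Rightarrow> ennreal"
  assumes "f \<in> borel_measurable haar_circle"
  shows "(\<integral>\<^sup>+z. f z \<partial>haar_circle) = (\<integral>\<^sup>+t. f (cis (2 * pi * t)) * indicator {0..<1} t \<partial>lborel)"
proof -
  have "(\<integral>\<^sup>+z. f z \<partial>haar_circle) = (\<integral>\<^sup>+t. f (cis (2 * pi * t)) \<partial>restrict_space lborel {0..1})"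
    unfolding haar_circle_def by (rule nn_integral_distr[OF measurable_cis_unit assms[unfolded haar_circle_def]])
  also have "\<dots> = (\<integral>\<^sup>+t. f (cis (2 * pi * t)) * indicator {0..1} t \<partial>lborel)"
    by (rule nn_integral_restrict_space) simp
  also have "\<dots> = (\<integral>\<^sup>+t. f (cis (2 * pi * t)) * indicator {0..<1} t \<partial>lborel)"
  proof (rule nn_integral_cong_AE)
    have "AE t in lborel. t \<noteq> (1::real)" by (rule AE_lborel_singleton)
    then show "AE t in lborel. f (cis (2 * pi * t)) * indicator {0..1} t = f (cis (2 * pi * t)) * indicator {0..<1} t"
      by eventually_elim (auto split: split_indicator)
  qed
  finally show ?thesis .
qed

lemma emeasure_haar_circle: "emeasure haar_circle circle = 1"
proof -
  have "emeasure haar_circle circle = (\<integral>\<^sup>+z. 1 \<partial>haar_circle)"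
    by (simp flip: space_haar)
  also have "\<dots> = 1" by (subst nn_integral_haar) auto
  finally show ?thesis .
qed

lemma measurable_rotate:
  assumes "cmod w = 1"
  shows "(\<lambda>z. w * z) \<in> haar_circle \<rightarrow>\<^sub>M haar_circle"
proof -
  have "(\<lambda>z. w * z) \<in> restrict_space borel circle \<rightarrow>\<^sub>M restrict_space borel circle"
    by (rule measurable_restrict_space3) (use assms in \<open>auto simp: norm_mult\<close>)
  then show ?thesis by (simp cong: measurable_cong_sets add: sets_haar)
qed

lemma nn_integral_translate:
  fixes g :: "real \<Rightarrow> ennreal"
  assumes "g \<in> borel_measurable borel"
  shows "(\<integral>\<^sup>+t. g (t + s) \<partial>lborel) = (\<integral>\<^sup>+t. g t \<partial>lborel)"
  using nn_integral_real_affine[of g 1 s] assms by (simp add: add.commute)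

text \<open>Rotation invariance: a rotation of the circle is a translation of a function of period one on the line.\<close>

lemma nn_integral_rotate:
  fixes f :: "complex \<Rightarrow> ennreal"
  assumes f: "f \<in> borel_measurable haar_circle" and w: "cmod w = 1"
  shows "(\<integral>\<^sup>+z. f (w * z) \<partial>haar_circle) = (\<integral>\<^sup>+z. f z \<partial>haar_circle)"
proof -
  define s where "s = frac (Arg w / (2 * pi))"
  have s: "0 \<le> s" "s < 1" by (auto simp: s_def frac_lt_1)
  have "w = cis (Arg w)" using w cis_Arg[of w] by (cases "w = 0") (auto simp: sgn_div_norm)
  also have "Arg w = 2 * pi * s + 2 * pi * of_int \<lfloor>Arg w / (2 * pi)\<rfloor>"
    by (simp add: s_def frac_def field_simps)
  also have "cis \<dots> = cis (2 * pi * s)" by (simp flip: cis_mult)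
  finally have ws: "w = cis (2 * pi * s)" .
  define g where "g t = f (cis (2 * pi * t))" for t :: real
  have f': "f \<in> borel_measurable (restrict_space borel circle)"
    using f by (simp cong: measurable_cong_sets add: sets_haar)
  have [measurable]: "g \<in> borel_measurable borel"
    unfolding g_def using measurable_compose[OF measurable_cis_circle f'] .
  have per: "g (t + 1) = g t" for t by (simp add: g_def distrib_left flip: cis_mult)
  have "(\<integral>\<^sup>+z. f (w * z) \<partial>haar_circle) = (\<integral>\<^sup>+t. g (t + s) * indicator {0..<1} t \<partial>lborel)"
    using measurable_compose[OF measurable_rotate[OF w] f]
    by (subst nn_integral_haar) (auto simp: g_def ws cis_mult distrib_left add.commute)
  also have "\<dots> = (\<integral>\<^sup>+t. (\<lambda>u. g u * indicator {s..<1+s} u) (t + s) \<partial>lborel)"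
    by (intro nn_integral_cong) (auto split: split_indicator)
  also have "\<dots> = (\<integral>\<^sup>+u. g u * indicator {s..<1+s} u \<partial>lborel)"
    by (rule nn_integral_translate) measurable
  also have "\<dots> = (\<integral>\<^sup>+u. g u * indicator {s..<1} u + g u * indicator {1..<1+s} u \<partial>lborel)"
    using s by (intro nn_integral_cong) (auto split: split_indicator)
  also have "\<dots> = (\<integral>\<^sup>+u. g u * indicator {s..<1} u \<partial>lborel) + (\<integral>\<^sup>+u. g u * indicator {1..<1+s} u \<partial>lborel)"
    by (rule nn_integral_add) measurable
  also have "(\<integral>\<^sup>+u. g u * indicator {1..<1+s} u \<partial>lborel) = (\<integral>\<^sup>+t. (\<lambda>u. g u * indicator {1..<1+s} u) (t + 1) \<partial>lborel)"
    by (rule nn_integral_translate[symmetric]) measurable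
  also have "\<dots> = (\<integral>\<^sup>+u. g u * indicator {0..<s} u \<partial>lborel)"
    by (intro nn_integral_cong) (auto simp: per split: split_indicator)
  also have "(\<integral>\<^sup>+u. g u * indicator {s..<1} u \<partial>lborel) + \<dots> =
      (\<integral>\<^sup>+u. g u * indicator {s..<1} u + g u * indicator {0..<s} u \<partial>lborel)"
    by (rule nn_integral_add[symmetric]) measurable
  also have "\<dots> = (\<integral>\<^sup>+u. g u * indicator {0..<1} u \<partial>lborel)"
    using s by (intro nn_integral_cong) (auto split: split_indicator)
  also have "\<dots> = (\<integral>\<^sup>+z. f z \<partial>haar_circle)"
    using f by (subst nn_integral_haar) (auto simp: g_def)
  finally show ?thesis .
qed


section \<open>Bochner integrable functions\<close>

text \<open>
  The integral of the norm, as an extended nonnegative number. Strongly measurable functions have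
  almost everywhere measurable norms (\<open>strongly_measurable_norm\<close>), which makes this integral additive.
\<close>

definition bochner_norm :: "'a cspace \<Rightarrow> (complex \<Rightarrow> 'a) \<Rightarrow> ennreal" where
  "bochner_norm X f = (\<integral>\<^sup>+z. ennreal (nrm X (f z)) \<partial>haar_circle)"

text \<open>
  Representatives of elements of \<open>bochner_L1\<close>. Values off the circle are arbitrary; restriction to the
  circle gives an element of \<open>bochner_functions\<close>.
\<close>

definition bochner_integrable :: "'a cspace \<Rightarrow> (complex \<Rightarrow> 'a) \<Rightarrow> bool" where
  "bochner_integrable X f \<longleftrightarrow> f \<in> circle \<rightarrow> carrier X \<and> strongly_measurable X f \<and> bochner_norm X f < \<infinity>"

lemma strongly_measurableI:
  assumes "\<And>n. simple_function haar_circle (s n)" "\<And>n. s n \<in> circle \<rightarrow> carrier X"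
    "AE z in haar_circle. (\<lambda>n. nrm X (s n z \<ominus>\<^bsub>X\<^esub> f z)) \<longlonglongrightarrow> 0"
  shows "strongly_measurable X f"
  using assms unfolding strongly_measurable_def by blast

lemma strongly_measurable_cong:
  assumes "strongly_measurable X f" "\<And>z. z \<in> circle \<Longrightarrow> f z = g z"
  shows "strongly_measurable X g"
proof -
  obtain s where s: "\<And>n. simple_function haar_circle (s n)" "\<And>n. s n \<in> circle \<rightarrow> carrier X"
    "AE z in haar_circle. (\<lambda>n. nrm X (s n z \<ominus>\<^bsub>X\<^esub> f z)) \<longlonglongrightarrow> 0"
    using assms(1) unfolding strongly_measurable_def by blast
  show ?thesis
    by (rule strongly_measurableI[of s, OF s(1,2)], rule AE_mp[OF s(3)], rule AE_I2) (simp add: assms(2))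
qed

lemma bochner_norm_cong:
  "(\<And>z. z \<in> circle \<Longrightarrow> f z = g z) \<Longrightarrow> bochner_norm X f = bochner_norm X g"
  unfolding bochner_norm_def by (intro nn_integral_cong) simp

lemma bochner_integrable_cong:
  assumes "bochner_integrable X f" "\<And>z. z \<in> circle \<Longrightarrow> f z = g z"
  shows "bochner_integrable X g"
proof -
  have "g z \<in> carrier X" if "z \<in> circle" for z
    using assms(1) assms(2)[OF that, symmetric] that by (auto simp: bochner_integrable_def)
  then show ?thesis
    using assms strongly_measurable_cong[of X f g] bochner_norm_cong[of f g X]
    by (auto simp: bochner_integrable_def)
qed

context seminormed
begin

lemma strongly_measurable_norm:
  assumes "strongly_measurable V f" "f \<in> circle \<rightarrow> carrier V"
  obtains g where "g \<in> borel_measurable haar_circle"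
    "AE z in haar_circle. ennreal (nrm V (f z)) = g z"
proof -
  obtain s where s: "\<And>n. simple_function haar_circle (s n)" "\<And>n. s n \<in> circle \<rightarrow> carrier V"
    "AE z in haar_circle. (\<lambda>n. nrm V (s n z \<ominus> f z)) \<longlonglongrightarrow> 0"
    using assms(1) unfolding strongly_measurable_def by blast
  define g where "g z = liminf (\<lambda>n. ennreal (nrm V (s n z)))" for z
  have "simple_function haar_circle (\<lambda>z. ennreal (nrm V (s n z)))" for n
    using simple_function_compose1[OF s(1)[of n], of "\<lambda>x. ennreal (nrm V x)"] by (simp add: comp_def)
  then have "(\<lambda>z. ennreal (nrm V (s n z))) \<in> borel_measurable haar_circle" for n
    by (rule borel_measurable_simple_function)
  then have "g \<in> borel_measurable haar_circle"
    unfolding g_def by (rule borel_measurable_liminf)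
  moreover have "AE z in haar_circle. ennreal (nrm V (f z)) = g z"
    using s(3) AE_space[of haar_circle]
  proof eventually_elim
    case (elim z)
    then have "(\<lambda>n. nrm V (s n z)) \<longlonglongrightarrow> nrm V (f z)"
      using s(2) assms(2) by (intro limit_nrm) (auto simp: Pi_iff)
    then have "(\<lambda>n. ennreal (nrm V (s n z))) \<longlonglongrightarrow> ennreal (nrm V (f z))"
      by (rule tendsto_ennrealI)
    then show ?case unfolding g_def by (simp add: lim_imp_Liminf)
  qed
  ultimately show thesis by (rule that)
qed

lemma strongly_measurable_const: "x \<in> carrier V \<Longrightarrow> strongly_measurable V (\<lambda>z. x)"
  by (rule strongly_measurableI[of "\<lambda>n z. x"]) auto

lemma strongly_measurable_add:
  assumes "strongly_measurable V f" "strongly_measurable V g"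
    "f \<in> circle \<rightarrow> carrier V" "g \<in> circle \<rightarrow> carrier V"
  shows "strongly_measurable V (\<lambda>z. f z \<oplus> g z)"
proof -
  obtain s where s: "\<And>n. simple_function haar_circle (s n)" "\<And>n. s n \<in> circle \<rightarrow> carrier V"
    "AE z in haar_circle. (\<lambda>n. nrm V (s n z \<ominus> f z)) \<longlonglongrightarrow> 0"
    using assms(1) unfolding strongly_measurable_def by blast
  obtain t where t: "\<And>n. simple_function haar_circle (t n)" "\<And>n. t n \<in> circle \<rightarrow> carrier V"
    "AE z in haar_circle. (\<lambda>n. nrm V (t n z \<ominus> g z)) \<longlonglongrightarrow> 0"
    using assms(2) unfolding strongly_measurable_def by blast
  show ?thesis
  proof (rule strongly_measurableI[of "\<lambda>n z. s n z \<oplus> t n z"])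
    show "simple_function haar_circle (\<lambda>z. s n z \<oplus> t n z)" for n
      by (rule simple_function_compose2[OF s(1) t(1)])
    show "AE z in haar_circle. (\<lambda>n. nrm V ((s n z \<oplus> t n z) \<ominus> (f z \<oplus> g z))) \<longlonglongrightarrow> 0"
      using s(3) t(3) AE_space[of haar_circle]
    proof eventually_elim
      case (elim z)
      show ?case
        by (rule limit_add) (use elim s(2) t(2) assms(3,4) in \<open>auto simp: Pi_iff\<close>)
    qed
    show "(\<lambda>z. s n z \<oplus> t n z) \<in> circle \<rightarrow> carrier V" for n
      using s(2)[of n] t(2)[of n] by auto
  qed
qed

lemma strongly_measurable_smult:
  assumes "strongly_measurable V f" "f \<in> circle \<rightarrow> carrier V"
  shows "strongly_measurable V (\<lambda>z. c \<odot> f z)"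
proof -
  obtain s where s: "\<And>n. simple_function haar_circle (s n)" "\<And>n. s n \<in> circle \<rightarrow> carrier V"
    "AE z in haar_circle. (\<lambda>n. nrm V (s n z \<ominus> f z)) \<longlonglongrightarrow> 0"
    using assms(1) unfolding strongly_measurable_def by blast
  show ?thesis
  proof (rule strongly_measurableI[of "\<lambda>n z. c \<odot> s n z"])
    show "simple_function haar_circle (\<lambda>z. c \<odot> s n z)" for n
      using simple_function_compose1[OF s(1)[of n], of "\<lambda>x. c \<odot> x"] by (simp add: comp_def)
    show "AE z in haar_circle. (\<lambda>n. nrm V (c \<odot> s n z \<ominus> c \<odot> f z)) \<longlonglongrightarrow> 0"
      using s(3) AE_space[of haar_circle]
    proof eventually_elim
      case (elim z)
      show ?case
        by (rule limit_smult) (use elim s(2) assms(2) in \<open>auto simp: Pi_iff\<close>)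
    qed
    show "(\<lambda>z. c \<odot> s n z) \<in> circle \<rightarrow> carrier V" for n
      using s(2)[of n] by auto
  qed
qed

lemma strongly_measurable_scalar:
  assumes "strongly_measurable scalars h" "x \<in> carrier V"
  shows "strongly_measurable V (\<lambda>z. h z \<odot> x)"
proof -
  obtain s where s: "\<And>n. simple_function haar_circle (s n)"
    "AE z in haar_circle. (\<lambda>n. cmod (s n z - h z)) \<longlonglongrightarrow> 0"
    using assms(1) unfolding strongly_measurable_def by auto
  show ?thesis
  proof (rule strongly_measurableI[of "\<lambda>n z. s n z \<odot> x"])
    show "simple_function haar_circle (\<lambda>z. s n z \<odot> x)" for n
      using simple_function_compose1[OF s(1)[of n], of "\<lambda>c. c \<odot> x"] by (simp add: comp_def)
    show "AE z in haar_circle. (\<lambda>n. nrm V (s n z \<odot> x \<ominus> h z \<odot> x)) \<longlonglongrightarrow> 0"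
      using s(2)
    proof eventually_elim
      case (elim z)
      have "nrm V (s n z \<odot> x \<ominus> h z \<odot> x) = cmod (s n z - h z) * nrm V x" for n
        using assms(2) by (simp add: nrm_smult flip: smult_minus_left)
      then show ?case using tendsto_mult_left_zero[OF elim, of "nrm V x"] by simp
    qed
  qed (use assms in auto)
qed

lemma bochner_norm_add_le:
  assumes "strongly_measurable V f" "strongly_measurable V g"
    "f \<in> circle \<rightarrow> carrier V" "g \<in> circle \<rightarrow> carrier V"
  shows "bochner_norm V (\<lambda>z. f z \<oplus> g z) \<le> bochner_norm V f + bochner_norm V g"
proof -
  obtain f' where f': "f' \<in> borel_measurable haar_circle" "AE z in haar_circle. ennreal (nrm V (f z)) = f' z"
    using strongly_measurable_norm assms by blast
  obtain g' where g': "g' \<in> borel_measurable haar_circle" "AE z in haar_circle. ennreal (nrm V (g z)) = g' z"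
    using strongly_measurable_norm assms by blast
  have "bochner_norm V (\<lambda>z. f z \<oplus> g z) \<le> (\<integral>\<^sup>+z. f' z + g' z \<partial>haar_circle)"
    unfolding bochner_norm_def
  proof (rule nn_integral_mono_AE)
    show "AE z in haar_circle. ennreal (nrm V (f z \<oplus> g z)) \<le> f' z + g' z"
      using f'(2) g'(2) AE_space[of haar_circle]
    proof eventually_elim
      case (elim z)
      then have "ennreal (nrm V (f z \<oplus> g z)) \<le> ennreal (nrm V (f z) + nrm V (g z))"
        using assms by (intro ennreal_leI nrm_triangle) auto
      also have "\<dots> = ennreal (nrm V (f z)) + ennreal (nrm V (g z))"
        using assms elim by (intro ennreal_plus) (auto simp: Pi_iff)
      finally show ?case using elim by simp
    qed
  qed
  also have "\<dots> = (\<integral>\<^sup>+z. f' z \<partial>haar_circle) + (\<integral>\<^sup>+z. g' z \<partial>haar_circle)"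
    using f' g' by (intro nn_integral_add) auto
  also have "\<dots> = bochner_norm V f + bochner_norm V g"
    unfolding bochner_norm_def using f'(2) g'(2) by (intro arg_cong2[of _ _ _ _ "(+)"] nn_integral_cong_AE) auto
  finally show ?thesis .
qed

lemma bochner_norm_smult:
  assumes "strongly_measurable V f" "f \<in> circle \<rightarrow> carrier V"
  shows "bochner_norm V (\<lambda>z. c \<odot> f z) = ennreal (cmod c) * bochner_norm V f"
proof -
  obtain f' where f': "f' \<in> borel_measurable haar_circle" "AE z in haar_circle. ennreal (nrm V (f z)) = f' z"
    using strongly_measurable_norm assms by blast
  have "bochner_norm V (\<lambda>z. c \<odot> f z) = (\<integral>\<^sup>+z. ennreal (cmod c) * f' z \<partial>haar_circle)"
    unfolding bochner_norm_def
  proof (rule nn_integral_cong_AE)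
    show "AE z in haar_circle. ennreal (nrm V (c \<odot> f z)) = ennreal (cmod c) * f' z"
      using f'(2) AE_space[of haar_circle]
    proof eventually_elim
      case (elim z)
      then have "f z \<in> carrier V" using assms by auto
      then show ?case using elim by (simp add: nrm_smult ennreal_mult' flip: elim(1))
    qed
  qed
  also have "\<dots> = ennreal (cmod c) * bochner_norm V f"
    unfolding bochner_norm_def using f' nn_integral_cong_AE[OF f'(2)] by (simp add: nn_integral_cmult)
  finally show ?thesis .
qed

lemma bochner_integrable_add:
  assumes "bochner_integrable V f" "bochner_integrable V g"
  shows "bochner_integrable V (\<lambda>z. f z \<oplus> g z)"
proof -
  have "bochner_norm V (\<lambda>z. f z \<oplus> g z) \<le> bochner_norm V f + bochner_norm V g"
    using assms by (intro bochner_norm_add_le) (auto simp: bochner_integrable_def)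
  also have "\<dots> < \<infinity>" using assms by (auto simp: bochner_integrable_def)
  finally show ?thesis
    using assms strongly_measurable_add[of f g] unfolding bochner_integrable_def by auto
qed

lemma bochner_integrable_smult:
  assumes "bochner_integrable V f"
  shows "bochner_integrable V (\<lambda>z. c \<odot> f z)"
  using assms strongly_measurable_smult[of f c] bochner_norm_smult[of f c]
  unfolding bochner_integrable_def by (auto simp: ennreal_mult_less_top)

lemma bochner_integrable_const: "x \<in> carrier V \<Longrightarrow> bochner_integrable V (\<lambda>z. x)"
  by (simp add: bochner_integrable_def strongly_measurable_const bochner_norm_def emeasure_haar_circle)

lemma bochner_functions_carrier:
  "f \<in> carrier (bochner_functions V) \<longleftrightarrow> f \<in> extensional circle \<and> bochner_integrable V f"
  by (auto simp: bochner_functions_def bochner_integrable_def bochner_norm_def PiE_def)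

lemma restrict_bochner:
  "bochner_integrable V f \<Longrightarrow> restrict f circle \<in> carrier (bochner_functions V)"
  unfolding bochner_functions_carrier by (auto intro: bochner_integrable_cong)

lemma nrm_bochner_functions: "nrm (bochner_functions V) f = enn2real (bochner_norm V f)"
  by (simp add: bochner_functions_def bochner_norm_def)

lemma bochner_module: "Module.module scalars (bochner_functions V)"
proof (rule moduleI)
  have ops: "\<zero>\<^bsub>bochner_functions V\<^esub> = (\<lambda>z\<in>circle. \<zero>)"
    "\<And>f g. f \<oplus>\<^bsub>bochner_functions V\<^esub> g = (\<lambda>z\<in>circle. f z \<oplus> g z)"
    "\<And>c f. c \<odot>\<^bsub>bochner_functions V\<^esub> f = (\<lambda>z\<in>circle. c \<odot> f z)"
    by (simp_all add: bochner_functions_def)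
  have c: "f z \<in> carrier V" if "f \<in> carrier (bochner_functions V)" "z \<in> circle" for f z
    using that by (auto simp: bochner_functions_def)
  have e: "f \<in> extensional circle" if "f \<in> carrier (bochner_functions V)" for f
    using that by (auto simp: bochner_functions_carrier)
  have i: "bochner_integrable V f" if "f \<in> carrier (bochner_functions V)" for f
    using that by (auto simp: bochner_functions_carrier)
  show "abelian_group (bochner_functions V)"
  proof (rule abelian_groupI)
    fix f g h assume f: "f \<in> carrier (bochner_functions V)" and g: "g \<in> carrier (bochner_functions V)"
      and h: "h \<in> carrier (bochner_functions V)"
    show "f \<oplus>\<^bsub>bochner_functions V\<^esub> g \<in> carrier (bochner_functions V)"
      unfolding ops by (intro restrict_bochner bochner_integrable_add i f g)
    show "f \<oplus>\<^bsub>bochner_functions V\<^esub> g \<oplus>\<^bsub>bochner_functions V\<^esub> h =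
        f \<oplus>\<^bsub>bochner_functions V\<^esub> (g \<oplus>\<^bsub>bochner_functions V\<^esub> h)"
      unfolding ops by (rule restrict_ext) (use c f g h in \<open>simp add: M.a_assoc\<close>)
    show "f \<oplus>\<^bsub>bochner_functions V\<^esub> g = g \<oplus>\<^bsub>bochner_functions V\<^esub> f"
      unfolding ops by (rule restrict_ext) (use c f g in \<open>simp add: M.a_comm\<close>)
  next
    show "\<zero>\<^bsub>bochner_functions V\<^esub> \<in> carrier (bochner_functions V)"
      unfolding ops by (intro restrict_bochner bochner_integrable_const) simp
    fix f assume f: "f \<in> carrier (bochner_functions V)"
    show "\<zero>\<^bsub>bochner_functions V\<^esub> \<oplus>\<^bsub>bochner_functions V\<^esub> f = f"
      unfolding ops by (rule extensionalityI[OF _ e[OF f]]) (use c[OF f] in auto)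
    have "(\<lambda>z\<in>circle. (- 1) \<odot> f z) \<oplus>\<^bsub>bochner_functions V\<^esub> f = \<zero>\<^bsub>bochner_functions V\<^esub>"
      unfolding ops by (rule restrict_ext) (use c[OF f] in \<open>simp add: M.l_neg flip: uminus_smult\<close>)
    then show "\<exists>g\<in>carrier (bochner_functions V). g \<oplus>\<^bsub>bochner_functions V\<^esub> f = \<zero>\<^bsub>bochner_functions V\<^esub>"
      using restrict_bochner[OF bochner_integrable_smult[OF i[OF f]]] by blast
  qed
  fix a b f g assume f: "f \<in> carrier (bochner_functions V)" and g: "g \<in> carrier (bochner_functions V)"
  show "a \<odot>\<^bsub>bochner_functions V\<^esub> f \<in> carrier (bochner_functions V)"
    unfolding ops by (intro restrict_bochner bochner_integrable_smult i f)
  show "(a \<oplus>\<^bsub>scalars\<^esub> b) \<odot>\<^bsub>bochner_functions V\<^esub> f =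
      a \<odot>\<^bsub>bochner_functions V\<^esub> f \<oplus>\<^bsub>bochner_functions V\<^esub> b \<odot>\<^bsub>bochner_functions V\<^esub> f"
    unfolding ops by (rule restrict_ext) (use c[OF f] in \<open>simp add: smult_add_left\<close>)
  show "a \<odot>\<^bsub>bochner_functions V\<^esub> (f \<oplus>\<^bsub>bochner_functions V\<^esub> g) =
      a \<odot>\<^bsub>bochner_functions V\<^esub> f \<oplus>\<^bsub>bochner_functions V\<^esub> a \<odot>\<^bsub>bochner_functions V\<^esub> g"
    unfolding ops by (rule restrict_ext) (use c[OF f] c[OF g] in \<open>simp add: smult_add_right\<close>)
  show "(a \<otimes>\<^bsub>scalars\<^esub> b) \<odot>\<^bsub>bochner_functions V\<^esub> f =
      a \<odot>\<^bsub>bochner_functions V\<^esub> (b \<odot>\<^bsub>bochner_functions V\<^esub> f)"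
    unfolding ops by (rule restrict_ext) (use c[OF f] in \<open>simp add: smult_smult\<close>)
  show "\<one>\<^bsub>scalars\<^esub> \<odot>\<^bsub>bochner_functions V\<^esub> f = f"
    unfolding ops by (rule extensionalityI[OF _ e[OF f]]) (use c[OF f] in auto)
qed (rule cring_scalars)

lemma bochner_seminormed: "seminormed (bochner_functions V)"
proof (rule seminormed.intro[OF bochner_module], unfold_locales)
  have ops: "\<And>f g. f \<oplus>\<^bsub>bochner_functions V\<^esub> g = (\<lambda>z\<in>circle. f z \<oplus> g z)"
    "\<And>c f. c \<odot>\<^bsub>bochner_functions V\<^esub> f = (\<lambda>z\<in>circle. c \<odot> f z)"
    by (simp_all add: bochner_functions_def)
  fix f assume f: "f \<in> carrier (bochner_functions V)"
  show "0 \<le> nrm (bochner_functions V) f" by (simp add: nrm_bochner_functions)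
  have i: "bochner_integrable V f" using f by (simp add: bochner_functions_carrier)
  show "nrm (bochner_functions V) (c \<odot>\<^bsub>bochner_functions V\<^esub> f) = cmod c * nrm (bochner_functions V) f" for c
  proof -
    have "bochner_norm V (\<lambda>z\<in>circle. c \<odot> f z) = bochner_norm V (\<lambda>z. c \<odot> f z)"
      by (rule bochner_norm_cong) simp
    also have "\<dots> = ennreal (cmod c) * bochner_norm V f"
      using i by (intro bochner_norm_smult) (auto simp: bochner_integrable_def)
    finally show ?thesis by (simp add: nrm_bochner_functions ops enn2real_mult)
  qed
  fix g assume g: "g \<in> carrier (bochner_functions V)"
  have j: "bochner_integrable V g" using g by (simp add: bochner_functions_carrier)
  have "bochner_norm V (\<lambda>z\<in>circle. f z \<oplus> g z) = bochner_norm V (\<lambda>z. f z \<oplus> g z)"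
    by (rule bochner_norm_cong) simp
  also have "\<dots> \<le> bochner_norm V f + bochner_norm V g"
    using i j by (intro bochner_norm_add_le) (auto simp: bochner_integrable_def)
  finally have "enn2real (bochner_norm V (\<lambda>z\<in>circle. f z \<oplus> g z)) \<le> enn2real (bochner_norm V f + bochner_norm V g)"
    using i j by (intro enn2real_mono) (auto simp: bochner_integrable_def)
  also have "\<dots> = enn2real (bochner_norm V f) + enn2real (bochner_norm V g)"
    using i j by (intro enn2real_plus) (auto simp: bochner_integrable_def)
  finally show "nrm (bochner_functions V) (f \<oplus>\<^bsub>bochner_functions V\<^esub> g) \<le>
      nrm (bochner_functions V) f + nrm (bochner_functions V) g"
    by (simp add: nrm_bochner_functions ops)
qed

end

context normed
begin

lemma null_functions_iff:
  "f \<in> null_functions V \<longleftrightarrow> f \<in> carrier (bochner_functions V) \<and> nrm (bochner_functions V) f = 0"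
proof -
  have "(AE z in haar_circle. f z = \<zero>) \<longleftrightarrow> nrm (bochner_functions V) f = 0"
    if "f \<in> carrier (bochner_functions V)"
  proof -
    have i: "bochner_integrable V f" using that by (simp add: bochner_functions_carrier)
    then have fc: "f \<in> circle \<rightarrow> carrier V" by (simp add: bochner_integrable_def)
    obtain f' where f': "f' \<in> borel_measurable haar_circle" "AE z in haar_circle. ennreal (nrm V (f z)) = f' z"
      using strongly_measurable_norm i unfolding bochner_integrable_def by blast
    have "nrm (bochner_functions V) f = 0 \<longleftrightarrow> bochner_norm V f = 0"
      using i by (auto simp: nrm_bochner_functions bochner_integrable_def enn2real_eq_0_iff)
    also have "bochner_norm V f = (\<integral>\<^sup>+z. f' z \<partial>haar_circle)"
      unfolding bochner_norm_def by (rule nn_integral_cong_AE[OF f'(2)])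
    also have "\<dots> = 0 \<longleftrightarrow> (AE z in haar_circle. f' z = 0)"
      by (rule nn_integral_0_iff_AE[OF f'(1)])
    also have "\<dots> \<longleftrightarrow> (AE z in haar_circle. f z = \<zero>)"
    proof
      assume "AE z in haar_circle. f' z = 0"
      with f'(2) AE_space show "AE z in haar_circle. f z = \<zero>"
      proof eventually_elim
        case (elim z)
        have z: "f z \<in> carrier V" using fc elim by auto
        have "ennreal (nrm V (f z)) = 0" using elim by simp
        then have "nrm V (f z) = 0" using nrm_ge_0[OF z] by (simp add: ennreal_eq_0_iff)
        then show ?case using nrm_eq_0[OF z] by blast
      qed
    next
      assume "AE z in haar_circle. f z = \<zero>"
      with f'(2) show "AE z in haar_circle. f' z = 0" by eventually_elim (metis ennreal_0 nrm_zero)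
    qed
    finally show ?thesis by simp
  qed
  then show ?thesis by (auto simp: null_functions_def)
qed

lemma quot_bochner: "quot (bochner_functions V) (null_functions V)"
proof -
  interpret B: seminormed "bochner_functions V" by (rule bochner_seminormed)
  show ?thesis
    by (intro quot.intro quot_axioms.intro B.seminormed_axioms B.null_submodule null_functions_iff)
qed

interpretation boch: quot "bochner_functions V" "null_functions V"
  rewrites "quotient_space (bochner_functions V) (null_functions V) \<equiv> bochner_L1 V"
  by (simp_all add: quot_bochner bochner_L1_def)

lemma bochner_L1_normed: "normed (bochner_L1 V)"
  by (rule boch.Q_normed) (simp add: null_functions_iff)

lemma L1_class_closed [simp, intro]: "bochner_integrable V f \<Longrightarrow> L1_class V f \<in> carrier (bochner_L1 V)"
  unfolding L1_class_def by (intro boch.Q_coset restrict_bochner)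

lemma L1_classE:
  assumes "F \<in> carrier (bochner_L1 V)"
  obtains f where "bochner_integrable V f" "F = L1_class V f" "f \<in> F"
proof -
  obtain f where f: "f \<in> carrier (bochner_functions V)" "F = boch.coset f"
    using assms by (auto simp: boch.Q_carrier)
  then have "restrict f circle = f" by (simp add: bochner_functions_carrier extensional_restrict)
  then show thesis using f boch.coset_self[OF f(1)] that[of f]
    by (simp add: L1_class_def bochner_functions_carrier)
qed

text \<open>Elements of \<open>bochner_L1\<close> are sets of functions, and each of their members represents them.\<close>

lemma L1_class_member:
  assumes "F \<in> carrier (bochner_L1 V)" "h \<in> F"
  shows "bochner_integrable V h" "F = L1_class V h"
proof -
  obtain f where f: "f \<in> carrier (bochner_functions V)" "F = boch.coset f"
    using assms by (auto simp: boch.Q_carrier)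
  have h: "h \<in> carrier (bochner_functions V)" "boch.coset h = F"
    using boch.cosetE[of h f] f assms(2) by auto
  then show "bochner_integrable V h" by (simp add: bochner_functions_carrier)
  from h(1) have "restrict h circle = h" by (simp add: bochner_functions_carrier extensional_restrict)
  with h(2) show "F = L1_class V h" by (simp add: L1_class_def)
qed

lemma L1_class_cong: "(\<And>z. z \<in> circle \<Longrightarrow> f z = g z) \<Longrightarrow> L1_class V f = L1_class V g"
  unfolding L1_class_def by (metis restrict_ext)

lemma L1_class_add:
  assumes "bochner_integrable V f" "bochner_integrable V g"
  shows "L1_class V f \<oplus>\<^bsub>bochner_L1 V\<^esub> L1_class V g = L1_class V (\<lambda>z. f z \<oplus> g z)"
proof -
  have "restrict f circle \<oplus>\<^bsub>bochner_functions V\<^esub> restrict g circle = (\<lambda>z\<in>circle. f z \<oplus> g z)"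
    by (simp add: bochner_functions_def cong: restrict_cong)
  then show ?thesis
    using boch.Q_add[OF restrict_bochner restrict_bochner, of f g] assms by (simp add: L1_class_def)
qed

lemma L1_class_smult:
  assumes "bochner_integrable V f"
  shows "c \<odot>\<^bsub>bochner_L1 V\<^esub> L1_class V f = L1_class V (\<lambda>z. c \<odot> f z)"
proof -
  have "c \<odot>\<^bsub>bochner_functions V\<^esub> restrict f circle = (\<lambda>z\<in>circle. c \<odot> f z)"
    by (simp add: bochner_functions_def cong: restrict_cong)
  then show ?thesis
    using boch.Q_smult[OF restrict_bochner, of f c] assms by (simp add: L1_class_def)
qed

lemma L1_class_minus:
  assumes f: "bochner_integrable V f" and g: "bochner_integrable V g"
  shows "L1_class V f \<ominus>\<^bsub>bochner_L1 V\<^esub> L1_class V g = L1_class V (\<lambda>z. f z \<ominus> g z)"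
proof -
  have "L1_class V f \<ominus>\<^bsub>bochner_L1 V\<^esub> L1_class V g = L1_class V (\<lambda>z. f z \<oplus> (- 1) \<odot> g z)"
    using f g by (simp add: boch.quo.minus_smult L1_class_smult L1_class_add bochner_integrable_smult)
  also have "\<dots> = L1_class V (\<lambda>z. f z \<ominus> g z)"
    using f g by (intro L1_class_cong) (auto simp: minus_smult bochner_integrable_def Pi_iff)
  finally show ?thesis .
qed

lemma bochner_integrable_minus:
  assumes f: "bochner_integrable V f" and g: "bochner_integrable V g"
  shows "bochner_integrable V (\<lambda>z. f z \<ominus> g z)"
  by (rule bochner_integrable_cong[OF bochner_integrable_add[OF f bochner_integrable_smult[OF g, of "-1"]]])
     (use f g in \<open>auto simp: minus_smult bochner_integrable_def Pi_iff\<close>)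

lemma nrm_L1_class:
  assumes "bochner_integrable V f"
  shows "nrm (bochner_L1 V) (L1_class V f) = enn2real (bochner_norm V f)"
proof -
  have "nrm (bochner_L1 V) (L1_class V f) = nrm (bochner_functions V) (restrict f circle)"
    unfolding L1_class_def
    by (rule boch.nrm_Q_eq[OF _ restrict_bochner[OF assms]]) (simp add: null_functions_iff)
  also have "\<dots> = enn2real (bochner_norm V f)"
    unfolding nrm_bochner_functions by (intro arg_cong[of _ _ enn2real] bochner_norm_cong) simp
  finally show ?thesis .
qed

lemma ennreal_nrm_L1_class:
  "bochner_integrable V f \<Longrightarrow> ennreal (nrm (bochner_L1 V) (L1_class V f)) = bochner_norm V f"
  unfolding nrm_L1_class by (rule ennreal_enn2real) (simp add: bochner_integrable_def)

end

section \<open>Analytic polynomials\<close>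

text \<open>The analytic polynomial with coefficients \<open>x 0, ..., x n\<close> as a function.\<close>

definition poly_fun :: "'a cspace \<Rightarrow> nat \<Rightarrow> (nat \<Rightarrow> 'a) \<Rightarrow> complex \<Rightarrow> 'a" where
  "poly_fun X n x z = (\<Oplus>\<^bsub>X\<^esub>k\<in>{..n}. (z ^ k) \<odot>\<^bsub>X\<^esub> x k)"

lemma analytic_poly_eq: "analytic_poly X n x = L1_class X (poly_fun X n x)"
  by (simp add: analytic_poly_def poly_fun_def[abs_def])

text \<open>A rounding of the points of the unit circle to finitely many points of the closed unit disc.\<close>

definition grid :: "nat \<Rightarrow> complex \<Rightarrow> complex" where
  "grid N z = (let c = real (Suc N) in
     complex_of_real (c / (c + 2)) * Complex (of_int \<lfloor>c * Re z\<rfloor> / c) (of_int \<lfloor>c * Im z\<rfloor> / c))"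

lemma cmod_le_2: assumes "\<bar>Re w\<bar> \<le> t" "\<bar>Im w\<bar> \<le> t" shows "cmod w \<le> 2 * t"
  using cmod_le[of w] assms by linarith

lemma grid_dist:
  assumes "cmod z = 1"
  shows "cmod (grid N z) \<le> 1" "cmod (grid N z - z) \<le> 4 / real (Suc N)"
proof -
  define c where "c = real (Suc N)"
  have c: "c > 0" by (simp add: c_def)
  \<comment> \<open>the rounded point, which may leave the unit disc by \<open>2 / c\<close>; the factor \<open>c / (c + 2)\<close> brings it back\<close>
  define w where "w = Complex (of_int \<lfloor>c * Re z\<rfloor> / c) (of_int \<lfloor>c * Im z\<rfloor> / c)"
  have fl: "\<bar>of_int \<lfloor>c * r\<rfloor> / c - r\<bar> \<le> 1 / c" for r
  proof -
    have "\<bar>of_int \<lfloor>c * r\<rfloor> - c * r\<bar> \<le> 1" by linarith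
    then have "\<bar>(of_int \<lfloor>c * r\<rfloor> - c * r) / c\<bar> \<le> 1 / c"
      using c by (simp add: abs_divide divide_right_mono)
    then show ?thesis using c by (simp add: diff_divide_distrib)
  qed
  have wz: "cmod (w - z) \<le> 2 / c"
    using cmod_le_2[of "w - z" "1 / c"] fl by (simp add: w_def)
  have w1: "cmod w \<le> 1 + 2 / c"
    using norm_triangle_ineq[of z "w - z"] wz assms by simp
  have g: "grid N z = complex_of_real (c / (c + 2)) * w"
    by (simp add: grid_def w_def c_def Let_def)
  have "cmod (grid N z) = c / (c + 2) * cmod w" using c by (simp add: g norm_mult norm_divide)
  also have "\<dots> \<le> c / (c + 2) * (1 + 2 / c)" using w1 c by (intro mult_left_mono) auto
  also have "\<dots> = 1"
  proof -
    have "1 + 2 / c = (c + 2) / c" using c by (simp add: add_divide_distrib)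
    then show ?thesis using c by simp
  qed
  finally show "cmod (grid N z) \<le> 1" .
  have "grid N z - w = complex_of_real (- 2 / (c + 2)) * w"
    using c by (simp add: g field_simps flip: of_real_add)
      (simp add: algebra_simps)
  then have "cmod (grid N z - w) = 2 / (c + 2) * cmod w"
    using c by (simp add: norm_mult norm_divide)
  also have "\<dots> \<le> 2 / (c + 2) * (1 + 2 / c)" using w1 c by (intro mult_left_mono) auto
  also have "\<dots> = 2 / c"
  proof -
    have *: "1 + 2 / c = (c + 2) / c" using c by (simp add: add_divide_distrib)
    show ?thesis unfolding * using c by (simp add: frac_eq_eq del: distrib_left_numeral)
  qed
  finally have "cmod (grid N z - z) \<le> 2 / c + 2 / c"
    using norm_triangle_ineq[of "grid N z - w" "w - z"] wz by simp
  then show "cmod (grid N z - z) \<le> 4 / real (Suc N)" by (simp add: c_def)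
qed

lemma simple_function_floor:
  assumes "f \<in> borel_measurable M" "\<And>x. x \<in> space M \<Longrightarrow> \<bar>f x\<bar> \<le> (B::real)"
  shows "simple_function M (\<lambda>x. \<lfloor>f x\<rfloor>)"
  unfolding simple_function_def
proof (intro conjI ballI)
  have "(\<lambda>x. \<lfloor>f x\<rfloor>) ` space M \<subseteq> {\<lfloor>- B\<rfloor>..\<lfloor>B\<rfloor>}"
    using assms(2) by (auto intro!: floor_mono simp: abs_le_iff) (metis floor_mono minus_le_iff)
  then show "finite ((\<lambda>x. \<lfloor>f x\<rfloor>) ` space M)" by (rule finite_subset) simp
  fix k :: int
  have "(\<lambda>x. \<lfloor>f x\<rfloor>) -` {k} \<inter> space M = f -` {of_int k..<of_int k + 1} \<inter> space M"
    by (auto simp: floor_eq_iff)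
  also have "\<dots> \<in> sets M" using assms(1) by measurable
  finally show "(\<lambda>x. \<lfloor>f x\<rfloor>) -` {k} \<inter> space M \<in> sets M" .
qed

lemma simple_function_grid: "simple_function haar_circle (grid N)"
proof -
  have m: "(\<lambda>z. real (Suc N) * Re z) \<in> borel_measurable haar_circle"
    "(\<lambda>z. real (Suc N) * Im z) \<in> borel_measurable haar_circle"
    by (auto simp: sets_haar cong: measurable_cong_sets
        intro!: measurable_restrict_space1 borel_measurable_continuous_onI continuous_intros)
  have b: "\<bar>real (Suc N) * Re z\<bar> \<le> real (Suc N)" "\<bar>real (Suc N) * Im z\<bar> \<le> real (Suc N)"
    if "z \<in> space haar_circle" for z
    using that abs_Re_le_cmod[of z] abs_Im_le_cmod[of z] by (auto simp: abs_mult mult_left_le)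
  show ?thesis
    using simple_function_compose2[OF simple_function_floor[OF m(1) b(1)] simple_function_floor[OF m(2) b(2)],
        of "\<lambda>a b. complex_of_real (real (Suc N) / (real (Suc N) + 2)) *
               Complex (of_int a / real (Suc N)) (of_int b / real (Suc N))"]
    by (simp add: grid_def[abs_def] Let_def)
qed

context seminormed
begin

lemma poly_fun_closed [simp, intro]: "x \<in> {..n} \<rightarrow> carrier V \<Longrightarrow> poly_fun V n x z \<in> carrier V"
  unfolding poly_fun_def by (rule M.finsum_closed) auto

lemma poly_fun_dist:
  assumes x: "x \<in> {..n} \<rightarrow> carrier V" and "cmod z \<le> 1" "cmod w \<le> 1"
  shows "nrm V (poly_fun V n x z \<ominus> poly_fun V n x w) \<le> cmod (z - w) * (\<Sum>k\<le>n. real k * nrm V (x k))"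
proof -
  have "poly_fun V n x z = (\<Oplus>k\<in>{..n}. (z ^ k - w ^ k) \<odot> x k \<oplus> (w ^ k) \<odot> x k)"
    unfolding poly_fun_def using x by (intro M.finsum_cong') (auto simp: smult_minus_left Pi_iff)
  also have "\<dots> = (\<Oplus>k\<in>{..n}. (z ^ k - w ^ k) \<odot> x k) \<oplus> poly_fun V n x w"
    unfolding poly_fun_def using x by (intro M.finsum_addf) auto
  finally have "poly_fun V n x z \<ominus> poly_fun V n x w = (\<Oplus>k\<in>{..n}. (z ^ k - w ^ k) \<odot> x k)"
    using x by (simp add: Pi_iff M.finsum_closed)
  then have "nrm V (poly_fun V n x z \<ominus> poly_fun V n x w) \<le> (\<Sum>k\<le>n. nrm V ((z ^ k - w ^ k) \<odot> x k))"
    using nrm_finsum[of "{..n}" "\<lambda>k. (z ^ k - w ^ k) \<odot> x k"] x by (simp add: Pi_iff)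
  also have "\<dots> \<le> (\<Sum>k\<le>n. cmod (z - w) * (real k * nrm V (x k)))"
  proof (rule sum_mono)
    fix k assume "k \<in> {..n}"
    then have k: "x k \<in> carrier V" using x by auto
    have "cmod (z ^ k - w ^ k) * nrm V (x k) \<le> (real k * cmod (z - w)) * nrm V (x k)"
      using norm_power_diff[of z w k] assms(2,3) k by (intro mult_right_mono) auto
    then show "nrm V ((z ^ k - w ^ k) \<odot> x k) \<le> cmod (z - w) * (real k * nrm V (x k))"
      using k by (simp add: nrm_smult mult_ac)
  qed
  finally show ?thesis by (simp add: sum_distrib_left)
qed

text \<open>Polynomials are uniform limits of simple functions.\<close>

lemma poly_fun_simple_approx:
  assumes x: "x \<in> {..n} \<rightarrow> carrier V" and e: "e > 0"
  obtains s where "simple_function haar_circle s" "s \<in> circle \<rightarrow> carrier V"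
    "\<And>z. z \<in> circle \<Longrightarrow> nrm V (s z \<ominus> poly_fun V n x z) < e"
proof -
  define K where "K = (\<Sum>k\<le>n. real k * nrm V (x k))"
  have K: "K \<ge> 0" unfolding K_def using x by (intro sum_nonneg) (auto simp: Pi_iff)
  obtain N where N: "4 * K / e < real N" using reals_Archimedean2 by blast
  have KN: "4 / real (Suc N) * K < e"
  proof -
    have "4 * K < e * real N" using N e by (simp add: field_simps)
    also have "\<dots> \<le> e * real (Suc N)" using e by simp
    finally show ?thesis by (simp add: field_simps)
  qed
  show thesis
  proof (rule that[of "\<lambda>z. poly_fun V n x (grid N z)"])
    show "simple_function haar_circle (\<lambda>z. poly_fun V n x (grid N z))"
      by (rule simple_function_compose1[OF simple_function_grid])
    fix z :: complex assume "z \<in> circle"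
    then have z: "cmod z = 1" by simp
    have "nrm V (poly_fun V n x (grid N z) \<ominus> poly_fun V n x z) \<le> cmod (grid N z - z) * K"
      unfolding K_def using grid_dist(1)[OF z] z by (intro poly_fun_dist x) auto
    also have "\<dots> \<le> 4 / real (Suc N) * K" by (rule mult_right_mono[OF grid_dist(2)[OF z] K])
    also have "\<dots> < e" by (rule KN)
    finally show "nrm V (poly_fun V n x (grid N z) \<ominus> poly_fun V n x z) < e" .
  qed (use x in auto)
qed

lemma poly_fun_norm_measurable:
  assumes x: "x \<in> {..n} \<rightarrow> carrier V"
  shows "(\<lambda>z. nrm V (poly_fun V n x z)) \<in> borel_measurable haar_circle"
proof -
  define K where "K = (\<Sum>k\<le>n. real k * nrm V (x k))"
  have K: "K \<ge> 0" unfolding K_def using x by (intro sum_nonneg) (auto simp: Pi_iff)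
  have "continuous_on circle (\<lambda>z. nrm V (poly_fun V n x z))"
  proof (rule continuous_onI)
    fix z :: complex and e :: real assume z: "z \<in> circle" and "e > 0"
    show "\<exists>d>0. \<forall>w\<in>circle. dist w z < d \<longrightarrow> dist (nrm V (poly_fun V n x w)) (nrm V (poly_fun V n x z)) \<le> e"
    proof (intro exI[of _ "e / (K + 1)"] conjI ballI impI)
      show "e / (K + 1) > 0" using K \<open>e > 0\<close> by simp
      fix w :: complex assume w: "w \<in> circle" "dist w z < e / (K + 1)"
      have "dist (nrm V (poly_fun V n x w)) (nrm V (poly_fun V n x z)) \<le>
          nrm V (poly_fun V n x w \<ominus> poly_fun V n x z)"
        unfolding dist_real_def using x by (intro nrm_diff_le) auto
      also have "\<dots> \<le> cmod (w - z) * K"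
        unfolding K_def using w z by (intro poly_fun_dist x) auto
      also have "\<dots> \<le> e / (K + 1) * K"
        using w(2) K by (intro mult_right_mono) (auto simp: dist_norm)
      also have "\<dots> \<le> e" using K \<open>e > 0\<close> by (simp add: field_simps)
      finally show "dist (nrm V (poly_fun V n x w)) (nrm V (poly_fun V n x z)) \<le> e" .
    qed
  qed
  then have "(\<lambda>z. nrm V (poly_fun V n x z)) \<in> borel_measurable (restrict_space borel circle)"
    by (rule borel_measurable_continuous_on_restrict)
  then show ?thesis by (simp cong: measurable_cong_sets add: sets_haar)
qed

lemma bochner_integrable_bounded:
  assumes "strongly_measurable V f" "f \<in> circle \<rightarrow> carrier V" "\<And>z. z \<in> circle \<Longrightarrow> nrm V (f z) \<le> B"
  shows "bochner_integrable V f"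
proof -
  have "bochner_norm V f \<le> (\<integral>\<^sup>+z. ennreal B \<partial>haar_circle)"
    unfolding bochner_norm_def using assms(3) by (intro nn_integral_mono ennreal_leI) auto
  also have "\<dots> < \<infinity>" by (simp add: emeasure_haar_circle)
  finally show ?thesis using assms by (simp add: bochner_integrable_def)
qed

lemma poly_fun_norm_le:
  assumes x: "x \<in> {..n} \<rightarrow> carrier V" and "cmod z = 1"
  shows "nrm V (poly_fun V n x z) \<le> (\<Sum>k\<le>n. nrm V (x k))"
proof -
  have "nrm V (poly_fun V n x z) \<le> (\<Sum>k\<le>n. nrm V ((z ^ k) \<odot> x k))"
    unfolding poly_fun_def using x by (intro nrm_finsum) auto
  also have "\<dots> = (\<Sum>k\<le>n. nrm V (x k))"
    using x assms(2) by (intro sum.cong) (auto simp: nrm_smult norm_power Pi_iff)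
  finally show ?thesis .
qed

lemma poly_fun_integrable:
  assumes x: "x \<in> {..n} \<rightarrow> carrier V"
  shows "bochner_integrable V (poly_fun V n x)"
proof (rule bochner_integrable_bounded)
  have "\<forall>m. \<exists>s. simple_function haar_circle s \<and> s \<in> circle \<rightarrow> carrier V \<and>
      (\<forall>z\<in>circle. nrm V (s z \<ominus> poly_fun V n x z) < inverse (real (Suc m)))"
    using poly_fun_simple_approx[OF x] by (metis inverse_positive_iff_positive of_nat_0_less_iff zero_less_Suc)
  from choice[OF this] obtain s where s: "\<And>m. simple_function haar_circle (s m)"
    "\<And>m. s m \<in> circle \<rightarrow> carrier V"
    "\<And>m z. z \<in> circle \<Longrightarrow> nrm V (s m z \<ominus> poly_fun V n x z) < inverse (real (Suc m))"
    by blast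
  show "strongly_measurable V (poly_fun V n x)"
  proof (rule strongly_measurableI[of s, OF s(1,2)], rule AE_I2)
    fix z assume "z \<in> space haar_circle"
    then have z: "z \<in> circle" by simp
    show "(\<lambda>m. nrm V (s m z \<ominus> poly_fun V n x z)) \<longlonglongrightarrow> 0"
    proof (rule tendsto_sandwich[OF _ _ tendsto_const LIMSEQ_inverse_real_of_nat])
      have "s m z \<in> carrier V" for m using s(2)[of m] z by auto
      then show "\<forall>\<^sub>F m in sequentially. 0 \<le> nrm V (s m z \<ominus> poly_fun V n x z)" using x by simp
      show "\<forall>\<^sub>F m in sequentially. nrm V (s m z \<ominus> poly_fun V n x z) \<le> inverse (real (Suc m))"
        using s(3)[OF z] by (intro always_eventually allI less_imp_le)
    qed
  qed
  show "poly_fun V n x \<in> circle \<rightarrow> carrier V" using x by auto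
  show "nrm V (poly_fun V n x z) \<le> (\<Sum>k\<le>n. nrm V (x k))" if "z \<in> circle" for z
    using poly_fun_norm_le[OF x] that by simp
qed

lemma poly_fun_add:
  assumes "x \<in> {..n} \<rightarrow> carrier V" "y \<in> {..n} \<rightarrow> carrier V"
  shows "poly_fun V n x z \<oplus> poly_fun V n y z = poly_fun V n (\<lambda>k. x k \<oplus> y k) z"
proof -
  have "poly_fun V n (\<lambda>k. x k \<oplus> y k) z = (\<Oplus>k\<in>{..n}. (z ^ k) \<odot> x k \<oplus> (z ^ k) \<odot> y k)"
    unfolding poly_fun_def using assms by (intro M.finsum_cong') (auto simp: smult_add_right Pi_iff)
  also have "\<dots> = poly_fun V n x z \<oplus> poly_fun V n y z"
    unfolding poly_fun_def using assms by (intro M.finsum_addf) auto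
  finally show ?thesis by simp
qed

lemma poly_fun_smult:
  assumes "x \<in> {..n} \<rightarrow> carrier V"
  shows "c \<odot> poly_fun V n x z = poly_fun V n (\<lambda>k. c \<odot> x k) z"
proof -
  have "c \<odot> poly_fun V n x z = (\<Oplus>k\<in>{..n}. c \<odot> ((z ^ k) \<odot> x k))"
    unfolding poly_fun_def using assms by (intro smult_finsum) auto
  also have "\<dots> = poly_fun V n (\<lambda>k. c \<odot> x k) z"
    unfolding poly_fun_def using assms
    by (intro M.finsum_cong') (auto simp: smult_smult Pi_iff mult.commute)
  finally show ?thesis .
qed

text \<open>Polynomials of different degrees are brought to a common degree by zero coefficients.\<close>

lemma poly_fun_pad:
  assumes "x \<in> {..n} \<rightarrow> carrier V" "n \<le> N"
  shows "poly_fun V n x z = poly_fun V N (\<lambda>k. if k \<le> n then x k else \<zero>) z"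
proof -
  have "poly_fun V N (\<lambda>k. if k \<le> n then x k else \<zero>) z =
     (\<Oplus>k\<in>{..n}. (z ^ k) \<odot> (if k \<le> n then x k else \<zero>))"
    unfolding poly_fun_def
    by (rule M.add.finprod_mono_neutral_cong_left[symmetric]) (use assms in \<open>auto simp: Pi_iff\<close>)
  also have "\<dots> = poly_fun V n x z"
    unfolding poly_fun_def using assms by (intro M.finsum_cong') (auto simp: Pi_iff)
  finally show ?thesis by simp
qed

end

context normed
begin

lemma analytic_poly_closed: "x \<in> {..n} \<rightarrow> carrier V \<Longrightarrow> analytic_poly V n x \<in> carrier (bochner_L1 V)"
  unfolding analytic_poly_eq by (intro L1_class_closed poly_fun_integrable)

lemma analytic_poly_add:
  assumes "x \<in> {..n} \<rightarrow> carrier V" "y \<in> {..n} \<rightarrow> carrier V"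
  shows "analytic_poly V n x \<oplus>\<^bsub>bochner_L1 V\<^esub> analytic_poly V n y = analytic_poly V n (\<lambda>k. x k \<oplus> y k)"
  unfolding analytic_poly_eq using assms by (simp add: L1_class_add poly_fun_integrable poly_fun_add)

lemma analytic_poly_smult:
  assumes "x \<in> {..n} \<rightarrow> carrier V"
  shows "c \<odot>\<^bsub>bochner_L1 V\<^esub> analytic_poly V n x = analytic_poly V n (\<lambda>k. c \<odot> x k)"
  unfolding analytic_poly_eq using assms by (simp add: L1_class_smult poly_fun_integrable poly_fun_smult)

lemma analytic_poly_pad:
  assumes "x \<in> {..n} \<rightarrow> carrier V" "n \<le> N"
  shows "analytic_poly V n x = analytic_poly V N (\<lambda>k. if k \<le> n then x k else \<zero>)"
  unfolding analytic_poly_eq using poly_fun_pad[OF assms] by (intro arg_cong[of _ _ "L1_class V"] ext)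

lemma analytic_poly_cong:
  assumes "x \<in> {..n} \<rightarrow> carrier V" "\<And>k. k \<le> n \<Longrightarrow> x k = y k"
  shows "analytic_poly V n x = analytic_poly V n y"
proof -
  have "poly_fun V n x z = poly_fun V n y z" for z
    unfolding poly_fun_def using assms by (intro M.finsum_cong') (auto simp: Pi_iff)
  then show ?thesis unfolding analytic_poly_eq by presburger
qed

lemma analytic_poly_minus:
  assumes "x \<in> {..n} \<rightarrow> carrier V" "y \<in> {..n} \<rightarrow> carrier V"
  shows "analytic_poly V n x \<ominus>\<^bsub>bochner_L1 V\<^esub> analytic_poly V n y = analytic_poly V n (\<lambda>k. x k \<ominus> y k)"
proof -
  interpret L: normed "bochner_L1 V" by (rule bochner_L1_normed)
  have "analytic_poly V n x \<ominus>\<^bsub>bochner_L1 V\<^esub> analytic_poly V n y = analytic_poly V n (\<lambda>k. x k \<oplus> (- 1) \<odot> y k)"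
    using assms by (simp add: L.minus_smult analytic_poly_closed analytic_poly_smult analytic_poly_add Pi_iff)
  also have "\<dots> = analytic_poly V n (\<lambda>k. x k \<ominus> y k)"
    using assms by (intro analytic_poly_cong) (auto simp: minus_smult Pi_iff)
  finally show ?thesis .
qed

lemma nrm_analytic_poly_le:
  assumes "x \<in> {..n} \<rightarrow> carrier V"
  shows "nrm (bochner_L1 V) (analytic_poly V n x) \<le> (\<Sum>k\<le>n. nrm V (x k))"
proof -
  have "bochner_norm V (poly_fun V n x) \<le> (\<integral>\<^sup>+z. ennreal (\<Sum>k\<le>n. nrm V (x k)) \<partial>haar_circle)"
    unfolding bochner_norm_def using poly_fun_norm_le[OF assms] by (intro nn_integral_mono ennreal_leI) auto
  also have "\<dots> = ennreal (\<Sum>k\<le>n. nrm V (x k))" by (simp add: emeasure_haar_circle)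
  finally have "enn2real (bochner_norm V (poly_fun V n x)) \<le> enn2real (ennreal (\<Sum>k\<le>n. nrm V (x k)))"
    by (rule enn2real_mono) simp
  also have "\<dots> = (\<Sum>k\<le>n. nrm V (x k))" using assms by (intro enn2real_ennreal sum_nonneg) (auto simp: Pi_iff)
  finally show ?thesis
    unfolding analytic_poly_eq by (simp add: nrm_L1_class poly_fun_integrable[OF assms])
qed

end

section \<open>The Hardy space\<close>

lemma hardy1_ops [simp]:
  "add (hardy1 X) = add (bochner_L1 X)" "zero (hardy1 X) = zero (bochner_L1 X)"
  "smult (hardy1 X) = smult (bochner_L1 X)" "nrm (hardy1 X) = nrm (bochner_L1 X)"
  by (simp_all add: hardy1_def)

text \<open>The classes of analytic polynomials.\<close>

definition analytic_polys :: "'a cspace \<Rightarrow> (complex \<Rightarrow> 'a) set set" where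
  "analytic_polys X = {analytic_poly X n x | n x. x \<in> {..n} \<rightarrow> carrier X}"

context normed
begin

lemma hardy1_carrier:
  "F \<in> carrier (hardy1 V) \<longleftrightarrow> F \<in> carrier (bochner_L1 V) \<and>
     (\<forall>e>0. \<exists>p\<in>analytic_polys V. nrm (bochner_L1 V) (F \<ominus>\<^bsub>bochner_L1 V\<^esub> p) < e)"
proof -
  have "(\<exists>p\<in>analytic_polys V. P p) \<longleftrightarrow> (\<exists>n x. x \<in> {..n} \<rightarrow> carrier V \<and> P (analytic_poly V n x))" for P
    unfolding analytic_polys_def by blast
  then show ?thesis by (simp add: hardy1_def)
qed

lemma analytic_polys_add:
  assumes "p \<in> analytic_polys V" "q \<in> analytic_polys V"
  shows "p \<oplus>\<^bsub>bochner_L1 V\<^esub> q \<in> analytic_polys V"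
proof -
  obtain n x m y where x: "x \<in> {..n} \<rightarrow> carrier V" "p = analytic_poly V n x"
    and y: "y \<in> {..m} \<rightarrow> carrier V" "q = analytic_poly V m y"
    using assms by (auto simp: analytic_polys_def)
  define N where "N = max n m"
  have xN: "(\<lambda>k. if k \<le> n then x k else \<zero>) \<in> {..N} \<rightarrow> carrier V" using x by auto
  have yN: "(\<lambda>k. if k \<le> m then y k else \<zero>) \<in> {..N} \<rightarrow> carrier V" using y by auto
  have "p \<oplus>\<^bsub>bochner_L1 V\<^esub> q = analytic_poly V N (\<lambda>k. (if k \<le> n then x k else \<zero>) \<oplus> (if k \<le> m then y k else \<zero>))"
    using analytic_poly_add[OF xN yN] analytic_poly_pad[OF x(1), of N] analytic_poly_pad[OF y(1), of N]
    by (simp add: x(2) y(2) N_def)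
  then show ?thesis using xN yN unfolding analytic_polys_def by blast
qed

lemma analytic_polys_smult:
  assumes "p \<in> analytic_polys V"
  shows "c \<odot>\<^bsub>bochner_L1 V\<^esub> p \<in> analytic_polys V"
proof -
  obtain n x where x: "x \<in> {..n} \<rightarrow> carrier V" "p = analytic_poly V n x"
    using assms by (auto simp: analytic_polys_def)
  have "(\<lambda>k. c \<odot> x k) \<in> {..n} \<rightarrow> carrier V" using x by auto
  then show ?thesis using analytic_poly_smult[OF x(1), of c] x(2) unfolding analytic_polys_def by blast
qed

lemma analytic_polys_L1: "analytic_polys V \<subseteq> carrier (bochner_L1 V)"
  using analytic_poly_closed by (auto simp: analytic_polys_def)

lemma hardy1_submodule: "submodule (carrier (hardy1 V)) scalars (bochner_L1 V)"
proof -
  interpret L: normed "bochner_L1 V" by (rule bochner_L1_normed)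
  note pc = subsetD[OF analytic_polys_L1]
  show ?thesis
  proof (rule L.submoduleI')
    show "carrier (hardy1 V) \<subseteq> carrier (bochner_L1 V)" by (auto simp: hardy1_carrier)
    have "\<zero>\<^bsub>bochner_L1 V\<^esub> = analytic_poly V 0 (\<lambda>k. \<zero>)"
      using analytic_poly_smult[of "\<lambda>k. \<zero>" 0 0] analytic_poly_closed[of "\<lambda>k. \<zero>" 0] by simp
    then have "\<zero>\<^bsub>bochner_L1 V\<^esub> \<in> analytic_polys V" unfolding analytic_polys_def by blast
    then show "\<zero>\<^bsub>bochner_L1 V\<^esub> \<in> carrier (hardy1 V)"
      unfolding hardy1_carrier using pc by (auto intro!: bexI[of _ "\<zero>\<^bsub>bochner_L1 V\<^esub>"])
    fix F G assume F: "F \<in> carrier (hardy1 V)" and G: "G \<in> carrier (hardy1 V)"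
    show "F \<oplus>\<^bsub>bochner_L1 V\<^esub> G \<in> carrier (hardy1 V)"
      unfolding hardy1_carrier
    proof (intro conjI allI impI)
      show "F \<oplus>\<^bsub>bochner_L1 V\<^esub> G \<in> carrier (bochner_L1 V)" using F G by (simp add: hardy1_carrier)
      fix e :: real assume "e > 0"
      then have e: "e/2 > 0" by simp
      obtain p where p: "p \<in> analytic_polys V" "nrm (bochner_L1 V) (F \<ominus>\<^bsub>bochner_L1 V\<^esub> p) < e/2"
        using F e unfolding hardy1_carrier by blast
      obtain q where q: "q \<in> analytic_polys V" "nrm (bochner_L1 V) (G \<ominus>\<^bsub>bochner_L1 V\<^esub> q) < e/2"
        using G e unfolding hardy1_carrier by blast
      have "nrm (bochner_L1 V) ((F \<oplus>\<^bsub>bochner_L1 V\<^esub> G) \<ominus>\<^bsub>bochner_L1 V\<^esub> (p \<oplus>\<^bsub>bochner_L1 V\<^esub> q)) < e"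
        using L.dist_add[of F G p q] p q pc F G by (simp add: hardy1_carrier)
      then show "\<exists>r\<in>analytic_polys V. nrm (bochner_L1 V) ((F \<oplus>\<^bsub>bochner_L1 V\<^esub> G) \<ominus>\<^bsub>bochner_L1 V\<^esub> r) < e"
        using analytic_polys_add[OF p(1) q(1)] by blast
    qed
  next
    fix c F assume F: "F \<in> carrier (hardy1 V)"
    show "c \<odot>\<^bsub>bochner_L1 V\<^esub> F \<in> carrier (hardy1 V)"
      unfolding hardy1_carrier
    proof (intro conjI allI impI)
      show "c \<odot>\<^bsub>bochner_L1 V\<^esub> F \<in> carrier (bochner_L1 V)" using F by (simp add: hardy1_carrier)
      fix e :: real assume "e > 0"
      then have e: "e / (cmod c + 1) > 0" by (simp add: add_nonneg_pos)
      obtain p where p: "p \<in> analytic_polys V" "nrm (bochner_L1 V) (F \<ominus>\<^bsub>bochner_L1 V\<^esub> p) < e / (cmod c + 1)"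
        using F e unfolding hardy1_carrier by blast
      have Fp: "F \<in> carrier (bochner_L1 V)" "p \<in> carrier (bochner_L1 V)"
        using F p pc by (auto simp: hardy1_carrier)
      have "nrm (bochner_L1 V) (c \<odot>\<^bsub>bochner_L1 V\<^esub> F \<ominus>\<^bsub>bochner_L1 V\<^esub> c \<odot>\<^bsub>bochner_L1 V\<^esub> p) =
          cmod c * nrm (bochner_L1 V) (F \<ominus>\<^bsub>bochner_L1 V\<^esub> p)"
        using Fp by (rule L.dist_smult)
      also have "\<dots> \<le> (cmod c + 1) * nrm (bochner_L1 V) (F \<ominus>\<^bsub>bochner_L1 V\<^esub> p)"
        using Fp by (intro mult_right_mono) auto
      also have "\<dots> < e" using p(2)
        by (metis add_nonneg_pos less_numeral_extra(1) mult.commute norm_ge_zero pos_less_divide_eq)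
      finally show "\<exists>r\<in>analytic_polys V. nrm (bochner_L1 V) (c \<odot>\<^bsub>bochner_L1 V\<^esub> F \<ominus>\<^bsub>bochner_L1 V\<^esub> r) < e"
        using analytic_polys_smult[OF p(1), of c] by blast
    qed
  qed
qed

lemma hardy1_eq: "hardy1 V = (bochner_L1 V)\<lparr>carrier := carrier (hardy1 V)\<rparr>"
  by (simp add: hardy1_def)

lemma hardy1_L1: "F \<in> carrier (hardy1 V) \<Longrightarrow> F \<in> carrier (bochner_L1 V)"
  by (simp add: hardy1_carrier)

lemma hardy1_normed: "normed (hardy1 V)"
proof -
  interpret L: normed "bochner_L1 V" by (rule bochner_L1_normed)
  interpret H: seminormed "hardy1 V"
    using L.sub_seminormed[OF hardy1_submodule] hardy1_eq by simp
  show ?thesis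
    by unfold_locales (simp add: hardy1_L1 L.nrm_eq_0)
qed

lemma hardy1_minus:
  "F \<in> carrier (hardy1 V) \<Longrightarrow> G \<in> carrier (hardy1 V) \<Longrightarrow> F \<ominus>\<^bsub>hardy1 V\<^esub> G = F \<ominus>\<^bsub>bochner_L1 V\<^esub> G"
proof -
  interpret L: normed "bochner_L1 V" by (rule bochner_L1_normed)
  show "F \<in> carrier (hardy1 V) \<Longrightarrow> G \<in> carrier (hardy1 V) \<Longrightarrow> F \<ominus>\<^bsub>hardy1 V\<^esub> G = F \<ominus>\<^bsub>bochner_L1 V\<^esub> G"
    using L.sub_minus[OF hardy1_submodule, of F G] hardy1_eq by simp
qed

lemma analytic_polys_hardy1: "analytic_polys V \<subseteq> carrier (hardy1 V)"
proof
  interpret L: normed "bochner_L1 V" by (rule bochner_L1_normed)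
  fix p assume p: "p \<in> analytic_polys V"
  then show "p \<in> carrier (hardy1 V)"
    unfolding hardy1_carrier using subsetD[OF analytic_polys_L1 p] by (auto intro!: bexI[of _ p])
qed

lemma analytic_poly_hardy1 [intro, simp]: "x \<in> {..n} \<rightarrow> carrier V \<Longrightarrow> analytic_poly V n x \<in> carrier (hardy1 V)"
  using analytic_polys_hardy1 unfolding analytic_polys_def by blast

lemma analytic_polys_dense: "dense_in (hardy1 V) (analytic_polys V)"
  unfolding dense_in_def
proof (intro conjI ballI allI impI analytic_polys_hardy1)
  fix F e assume F: "F \<in> carrier (hardy1 V)" and e: "(e::real) > 0"
  then obtain p where p: "p \<in> analytic_polys V" "nrm (bochner_L1 V) (F \<ominus>\<^bsub>bochner_L1 V\<^esub> p) < e"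
    unfolding hardy1_carrier by blast
  then show "\<exists>d\<in>analytic_polys V. nrm (hardy1 V) (F \<ominus>\<^bsub>hardy1 V\<^esub> d) < e"
    using F subsetD[OF analytic_polys_hardy1 p(1)] by (auto simp: hardy1_minus intro!: bexI[of _ p])
qed

end

lemma (in seminormed) summable_steps_cauchy:
  assumes s: "\<And>n. s n \<in> carrier V" and sum: "summable (\<lambda>n. nrm V (s n \<ominus> s (Suc n)))"
  shows "cauchy_in V s"
proof -
  have step: "nrm V (s m \<ominus> s n) \<le> (\<Sum>k=m..<n. nrm V (s k \<ominus> s (Suc k)))" if "m \<le> n" for m n
    using that
  proof (induction n rule: dec_induct)
    case (step n)
    have "nrm V (s m \<ominus> s (Suc n)) \<le> nrm V (s m \<ominus> s n) + nrm V (s n \<ominus> s (Suc n))"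
      using s by (intro dist_triangle)
    then show ?case using step by simp
  qed (use s in simp)
  show ?thesis
    unfolding cauchy_in_def
  proof (intro conjI allI impI s)
    fix e :: real assume "e > 0"
    then obtain N where N: "\<And>m n. m \<ge> N \<Longrightarrow> norm (\<Sum>k=m..<n. nrm V (s k \<ominus> s (Suc k))) < e"
      using sum unfolding summable_Cauchy by blast
    have *: "nrm V (s m \<ominus> s n) < e" if "m \<ge> N" "m \<le> n" for m n
      using step[OF that(2)] N[OF that(1), of n] by simp
    have "nrm V (s m \<ominus> s n) < e" if "m \<ge> N" "n \<ge> N" for m n
      using *[of m n] *[of n m] that nrm_minus_commute[OF s s, of m n] by (cases "m \<le> n") auto
    then show "\<exists>N. \<forall>m\<ge>N. \<forall>n\<ge>N. nrm V (s m \<ominus> s n) < e" by blast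
  qed
qed

lemma (in normed) poly_fun_diff:
  assumes "x \<in> {..n} \<rightarrow> carrier V" "y \<in> {..m} \<rightarrow> carrier V"
  obtains N t where "t \<in> {..N} \<rightarrow> carrier V" "\<And>z. poly_fun V n x z \<ominus> poly_fun V m y z = poly_fun V N t z"
proof -
  define N where "N = max n m"
  define x' where "x' k = (if k \<le> n then x k else \<zero>)" for k
  define y' where "y' k = (if k \<le> m then y k else \<zero>)" for k
  have x': "x' \<in> {..N} \<rightarrow> carrier V" "\<And>z. poly_fun V n x z = poly_fun V N x' z"
    using assms(1) poly_fun_pad[OF assms(1), of N] by (auto simp: x'_def[abs_def] N_def)
  have y': "y' \<in> {..N} \<rightarrow> carrier V" "\<And>z. poly_fun V m y z = poly_fun V N y' z"
    using assms(2) poly_fun_pad[OF assms(2), of N] by (auto simp: y'_def[abs_def] N_def)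
  have sy: "(\<lambda>k. (- 1) \<odot> y' k) \<in> {..N} \<rightarrow> carrier V" using y' by auto
  show thesis
  proof (rule that[of "\<lambda>k. x' k \<oplus> (- 1) \<odot> y' k" N])
    show "(\<lambda>k. x' k \<oplus> (- 1) \<odot> y' k) \<in> {..N} \<rightarrow> carrier V" using x' sy by auto
    show "poly_fun V n x z \<ominus> poly_fun V m y z = poly_fun V N (\<lambda>k. x' k \<oplus> (- 1) \<odot> y' k) z" for z
      using x' y' sy by (simp add: minus_smult poly_fun_smult poly_fun_add)
  qed
qed

text \<open>
  Completeness. It is enough to find the limit of a rapidly converging sequence of polynomials. Such a
  sequence converges almost everywhere; the limit is strongly measurable because polynomials are
  uniform limits of simple functions, and Fatou's lemma gives convergence in norm.
\<close>

lemma (in banach) hardy1_banach: "banach (hardy1 V)"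
proof (rule banach_if_dense[OF hardy1_normed analytic_polys_dense])
  interpret H: normed "hardy1 V" by (rule hardy1_normed)
  fix s assume s: "\<And>n. s n \<in> analytic_polys V"
    and fast: "\<And>n. nrm (hardy1 V) (s n \<ominus>\<^bsub>hardy1 V\<^esub> s (Suc n)) \<le> (1/2) ^ n"
  have "\<forall>n. \<exists>p. (\<exists>d x. x \<in> {..d} \<rightarrow> carrier V \<and> p = poly_fun V d x) \<and> s n = L1_class V p"
    using s unfolding analytic_polys_def analytic_poly_eq by blast
  from choice[OF this] obtain P where P: "\<And>n. \<exists>d x. x \<in> {..d} \<rightarrow> carrier V \<and> P n = poly_fun V d x"
      "\<And>n. s n = L1_class V (P n)"
    by blast
  have Pc: "P n z \<in> carrier V" for n z using P(1)[of n] poly_fun_closed by auto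
  have Pi: "bochner_integrable V (P n)" for n using P(1)[of n] poly_fun_integrable by auto
  have Pm: "(\<lambda>z. nrm V (P n z \<ominus> P m z)) \<in> borel_measurable haar_circle" for n m
  proof -
    obtain d x d' y where x: "x \<in> {..d} \<rightarrow> carrier V" "P n = poly_fun V d x"
      and y: "y \<in> {..d'} \<rightarrow> carrier V" "P m = poly_fun V d' y"
      using P(1)[of n] P(1)[of m] by blast
    obtain N t where t: "t \<in> {..N} \<rightarrow> carrier V" "\<And>z. P n z \<ominus> P m z = poly_fun V N t z"
      by (rule poly_fun_diff[OF x(1) y(1), folded x(2) y(2)]) (rule that)
    show ?thesis unfolding t(2) by (rule poly_fun_norm_measurable[OF t(1)])
  qed
  have sc: "s n \<in> carrier (hardy1 V)" for n using s analytic_polys_hardy1 by blast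
  have int_P: "(\<integral>\<^sup>+z. ennreal (nrm V (P n z \<ominus> P m z)) \<partial>haar_circle) = ennreal (nrm (hardy1 V) (s n \<ominus>\<^bsub>hardy1 V\<^esub> s m))" for n m
  proof -
    have "s n \<ominus>\<^bsub>hardy1 V\<^esub> s m = s n \<ominus>\<^bsub>bochner_L1 V\<^esub> s m" by (rule hardy1_minus[OF sc sc])
    also have "\<dots> = L1_class V (\<lambda>z. P n z \<ominus> P m z)" unfolding P(2) by (rule L1_class_minus[OF Pi Pi])
    finally show ?thesis
      using ennreal_nrm_L1_class[OF bochner_integrable_minus[OF Pi[of n] Pi[of m]]] by (simp add: bochner_norm_def)
  qed
  have "(\<integral>\<^sup>+z. suminf (\<lambda>n. ennreal (nrm V (P n z \<ominus> P (Suc n) z))) \<partial>haar_circle) =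
      suminf (\<lambda>n. \<integral>\<^sup>+z. ennreal (nrm V (P n z \<ominus> P (Suc n) z)) \<partial>haar_circle)"
    using Pm by (intro nn_integral_suminf) simp
  also have "\<dots> \<le> suminf (\<lambda>n. ennreal ((1/2) ^ n))"
    unfolding int_P using fast by (intro suminf_le ennreal_leI) auto
  also have "\<dots> = ennreal (suminf (\<lambda>n. (1/2) ^ n))"
    by (intro suminf_ennreal2) auto
  also have "\<dots> < \<infinity>" by simp
  finally have "AE z in haar_circle. suminf (\<lambda>n. ennreal (nrm V (P n z \<ominus> P (Suc n) z))) \<noteq> \<infinity>"
    using Pm by (intro nn_integral_noteq_infinite) auto
  then have conv: "AE z in haar_circle. \<exists>y\<in>carrier V. (\<lambda>n. nrm V (P n z \<ominus> y)) \<longlonglongrightarrow> 0"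
  proof eventually_elim
    case (elim z)
    have "summable (\<lambda>n. nrm V (P n z \<ominus> P (Suc n) z))"
      using elim Pc by (intro summable_suminf_not_top) auto
    then show ?case using complete summable_steps_cauchy[of "\<lambda>n. P n z"] Pc by blast
  qed
  \<comment> \<open>the pointwise limit, with value zero where there is none\<close>
  define f where "f z = (if \<exists>y\<in>carrier V. (\<lambda>n. nrm V (P n z \<ominus> y)) \<longlonglongrightarrow> 0
      then SOME y. y \<in> carrier V \<and> (\<lambda>n. nrm V (P n z \<ominus> y)) \<longlonglongrightarrow> 0 else \<zero>)" for z
  have f_some: "f z \<in> carrier V \<and> (\<lambda>n. nrm V (P n z \<ominus> f z)) \<longlonglongrightarrow> 0"
    if "\<exists>y\<in>carrier V. (\<lambda>n. nrm V (P n z \<ominus> y)) \<longlonglongrightarrow> 0" for z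
    using someI_ex[of "\<lambda>y. y \<in> carrier V \<and> (\<lambda>n. nrm V (P n z \<ominus> y)) \<longlonglongrightarrow> 0"] that
    by (auto simp: f_def)
  have fc: "f z \<in> carrier V" for z using f_some[of z] by (cases "\<exists>y\<in>carrier V. (\<lambda>n. nrm V (P n z \<ominus> y)) \<longlonglongrightarrow> 0") (auto simp: f_def)
  have f_lim: "AE z in haar_circle. (\<lambda>n. nrm V (P n z \<ominus> f z)) \<longlonglongrightarrow> 0"
    using conv by eventually_elim (use f_some in blast)
  have f_sm: "strongly_measurable V f"
  proof -
    have "\<exists>t. simple_function haar_circle t \<and> t \<in> circle \<rightarrow> carrier V \<and>
        (\<forall>z\<in>circle. nrm V (t z \<ominus> P n z) < inverse (real (Suc n)))" for n
    proof -
      obtain d x where dx: "x \<in> {..d} \<rightarrow> carrier V" "P n = poly_fun V d x" using P(1) by blast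
      have pos: "inverse (real (Suc n)) > 0" by simp
      obtain t where t: "simple_function haar_circle t" "t \<in> circle \<rightarrow> carrier V"
        "\<And>z. z \<in> circle \<Longrightarrow> nrm V (t z \<ominus> P n z) < inverse (real (Suc n))"
        by (rule poly_fun_simple_approx[OF dx(1) pos, folded dx(2)]) (rule that)
      show ?thesis by (intro exI[of _ t] conjI ballI t)
    qed
    then have "\<forall>n. \<exists>t. simple_function haar_circle t \<and> t \<in> circle \<rightarrow> carrier V \<and>
        (\<forall>z\<in>circle. nrm V (t z \<ominus> P n z) < inverse (real (Suc n)))" by (rule allI)
    from choice[OF this] obtain t where t: "\<And>n. simple_function haar_circle (t n)"
      "\<And>n. t n \<in> circle \<rightarrow> carrier V"
      "\<And>n z. z \<in> circle \<Longrightarrow> nrm V (t n z \<ominus> P n z) < inverse (real (Suc n))" by blast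
    show ?thesis
    proof (rule strongly_measurableI[of t, OF t(1,2)])
      show "AE z in haar_circle. (\<lambda>n. nrm V (t n z \<ominus> f z)) \<longlonglongrightarrow> 0"
        using f_lim AE_space[of haar_circle]
      proof eventually_elim
        case (elim z)
        then have z: "z \<in> circle" by simp
        have tc: "t n z \<in> carrier V" for n using t(2)[of n] z by auto
        show ?case
        proof (rule tendsto_sandwich[of "\<lambda>n. 0" _ _ "\<lambda>n. inverse (real (Suc n)) + nrm V (P n z \<ominus> f z)"])
          show "(\<lambda>n. inverse (real (Suc n)) + nrm V (P n z \<ominus> f z)) \<longlonglongrightarrow> 0"
            using tendsto_add[OF LIMSEQ_inverse_real_of_nat elim(1)] by simp
          have "nrm V (t n z \<ominus> f z) \<le> inverse (real (Suc n)) + nrm V (P n z \<ominus> f z)" for n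
            using dist_triangle[OF tc[of n] Pc[of n z] fc[of z]] t(3)[OF z, of n] by linarith
          then show "\<forall>\<^sub>F n in sequentially. nrm V (t n z \<ominus> f z) \<le> inverse (real (Suc n)) + nrm V (P n z \<ominus> f z)"
            by simp
        qed (use tc fc in auto)
      qed
    qed
  qed
  have dist_le: "bochner_norm V (\<lambda>z. P n z \<ominus> f z) \<le> ennreal (2 * (1/2) ^ n)" for n
  proof -
    have "bochner_norm V (\<lambda>z. P n z \<ominus> f z) = (\<integral>\<^sup>+z. liminf (\<lambda>m. ennreal (nrm V (P n z \<ominus> P m z))) \<partial>haar_circle)"
      unfolding bochner_norm_def
    proof (rule nn_integral_cong_AE)
      show "AE z in haar_circle. ennreal (nrm V (P n z \<ominus> f z)) = liminf (\<lambda>m. ennreal (nrm V (P n z \<ominus> P m z)))"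
        using f_lim
      proof eventually_elim
        case (elim z)
        have "(\<lambda>m. nrm V (P n z \<ominus> P m z)) \<longlonglongrightarrow> nrm V (P n z \<ominus> f z)"
        proof (rule limit_nrm)
          show "(\<lambda>m. nrm V ((P n z \<ominus> P m z) \<ominus> (P n z \<ominus> f z))) \<longlonglongrightarrow> 0"
          proof (rule tendsto_sandwich[OF _ _ tendsto_const elim])
            show "\<forall>\<^sub>F m in sequentially. nrm V ((P n z \<ominus> P m z) \<ominus> (P n z \<ominus> f z)) \<le> nrm V (P m z \<ominus> f z)"
              using dist_minus[OF Pc[of n z] Pc[of _ z] Pc[of n z] fc[of z]] Pc by simp
          qed (use Pc fc in auto)
        qed (use Pc fc in auto)
        then show ?case by (intro lim_imp_Liminf[symmetric] tendsto_ennrealI) auto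
      qed
    qed
    also have "\<dots> \<le> liminf (\<lambda>m. \<integral>\<^sup>+z. ennreal (nrm V (P n z \<ominus> P m z)) \<partial>haar_circle)"
      using Pm by (intro nn_integral_liminf) simp
    also have "\<dots> \<le> liminf (\<lambda>m. ennreal (2 * (1/2) ^ n))"
    proof (rule Liminf_mono)
      have "(\<integral>\<^sup>+z. ennreal (nrm V (P n z \<ominus> P m z)) \<partial>haar_circle) \<le> ennreal (2 * (1/2) ^ n)" if "m \<ge> n" for m
      proof -
        have "nrm (hardy1 V) (s n \<ominus>\<^bsub>hardy1 V\<^esub> s m) \<le> 2 * (1/2) ^ n - 2 * (1/2) ^ m"
          using H.fast_dist[OF sc fast that] .
        also have "\<dots> \<le> 2 * (1/2) ^ n" by simp
        finally show ?thesis unfolding int_P by (rule ennreal_leI)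
      qed
      then show "\<forall>\<^sub>F m in sequentially. (\<integral>\<^sup>+z. ennreal (nrm V (P n z \<ominus> P m z)) \<partial>haar_circle) \<le> ennreal (2 * (1/2) ^ n)"
        by (auto simp: eventually_sequentially)
    qed
    also have "\<dots> = ennreal (2 * (1/2) ^ n)" by (rule Liminf_const) simp
    finally show ?thesis .
  qed
  have sm: "strongly_measurable V (\<lambda>z. P n z \<ominus> f z)" for n
  proof (rule strongly_measurable_cong)
    show "strongly_measurable V (\<lambda>z. P n z \<oplus> (- 1) \<odot> f z)"
      using Pi[of n] f_sm Pc fc unfolding bochner_integrable_def
      by (intro strongly_measurable_add strongly_measurable_smult) auto
  qed (simp add: minus_smult Pc fc)
  have di: "bochner_integrable V (\<lambda>z. P n z \<ominus> f z)" for n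
    unfolding bochner_integrable_def using sm Pc fc le_less_trans[OF dist_le[of n]] by auto
  have fi: "bochner_integrable V f"
  proof (rule bochner_integrable_cong[OF bochner_integrable_minus[OF Pi[of 0] di[of 0]]])
    fix z
    have "P 0 z \<ominus> (P 0 z \<ominus> f z) = f z"
      using Pc[of 0 z] fc[of z] by (simp add: a_minus_def M.minus_add M.r_neg1 flip: M.a_assoc) (simp add: M.r_neg)
    then show "P 0 z \<ominus> (P 0 z \<ominus> f z) = f z" .
  qed
  define F where "F = L1_class V f"
  have F: "F \<in> carrier (bochner_L1 V)" using fi by (simp add: F_def)
  have dF: "nrm (bochner_L1 V) (s n \<ominus>\<^bsub>bochner_L1 V\<^esub> F) \<le> 2 * (1/2) ^ n" for n
  proof -
    have "nrm (bochner_L1 V) (s n \<ominus>\<^bsub>bochner_L1 V\<^esub> F) = enn2real (bochner_norm V (\<lambda>z. P n z \<ominus> f z))"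
      using Pi fi di by (simp add: F_def P(2) L1_class_minus nrm_L1_class)
    also have "\<dots> \<le> enn2real (ennreal (2 * (1/2) ^ n))"
      by (rule enn2real_mono[OF dist_le]) simp
    finally show ?thesis by simp
  qed
  interpret L: normed "bochner_L1 V" by (rule bochner_L1_normed)
  have lim0: "(\<lambda>n. 2 * (1/2) ^ n :: real) \<longlonglongrightarrow> 0"
    by (intro tendsto_mult_right_zero LIMSEQ_realpow_zero) auto
  have FH: "F \<in> carrier (hardy1 V)"
    unfolding hardy1_carrier
  proof (intro conjI allI impI F)
    fix e :: real assume "e > 0"
    then obtain n where "2 * (1/2) ^ n < e"
      using order_tendstoD(2)[OF lim0] by (auto simp: eventually_sequentially)
    then have "nrm (bochner_L1 V) (F \<ominus>\<^bsub>bochner_L1 V\<^esub> s n) < e"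
      using dF[of n] L.nrm_minus_commute[OF F hardy1_L1[OF sc[of n]]] by simp
    then show "\<exists>p\<in>analytic_polys V. nrm (bochner_L1 V) (F \<ominus>\<^bsub>bochner_L1 V\<^esub> p) < e" using s by blast
  qed
  have "(\<lambda>n. nrm (hardy1 V) (s n \<ominus>\<^bsub>hardy1 V\<^esub> F)) \<longlonglongrightarrow> 0"
    by (rule tendsto_sandwich[OF _ _ tendsto_const lim0])
       (use dF FH sc F in \<open>auto simp: hardy1_minus hardy1_L1\<close>)
  then show "\<exists>x\<in>carrier (hardy1 V). (\<lambda>n. nrm (hardy1 V) (s n \<ominus>\<^bsub>hardy1 V\<^esub> x)) \<longlonglongrightarrow> 0"
    using FH by blast
qed


section \<open>Fourier multipliers\<close>

text \<open>The Fejer multiplier. Subtraction of natural numbers makes it vanish for \<open>l \<ge> n\<close>.\<close>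

definition fejer :: "nat \<Rightarrow> nat \<Rightarrow> real" where
  "fejer n l = real (n - l) / real n"

text \<open>Orthogonality of characters on the group of roots of unity of order \<open>N\<close>.\<close>

lemma sum_cis_roots:
  fixes m :: int
  assumes "N > 0"
  shows "(\<Sum>j<N. cis (real j * (2 * pi * of_int m / real N))) = (if int N dvd m then of_nat N else 0)"
proof -
  define \<zeta> where "\<zeta> = cis (2 * pi * of_int m / real N)"
  have s: "(\<Sum>j<N. cis (real j * (2 * pi * of_int m / real N))) = (\<Sum>j<N. \<zeta> ^ j)"
    by (intro sum.cong refl) (simp add: \<zeta>_def Complex.DeMoivre)
  show ?thesis
  proof (cases "int N dvd m")
    case True
    then obtain k where "m = int N * k" by (auto simp: dvd_def)
    then have "2 * pi * of_int m / real N = 2 * pi * of_int k" using assms by simp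
    then have "\<zeta> = 1" by (simp add: \<zeta>_def)
    then show ?thesis using True s by simp
  next
    case False
    have "\<zeta> \<noteq> 1"
    proof
      assume "\<zeta> = 1"
      then have "cos (2 * pi * of_int m / real N) = 1"
        by (metis \<zeta>_def cis.simps(1) one_complex.simps(1))
      then obtain k :: int where "2 * pi * of_int m / real N = of_int k * 2 * pi"
        using cos_one_2pi_int by blast
      then have "real_of_int m = of_int (k * int N)" using assms by (simp add: field_simps)
      then have "m = k * int N" by linarith
      then show False using False by simp
    qed
    moreover have "\<zeta> ^ N = 1" using assms by (simp add: \<zeta>_def Complex.DeMoivre)
    ultimately show ?thesis using False s by (simp add: geometric_sum)
  qed
qed

context normed
begin

lemma nrm_rotate_poly:
  assumes x: "x \<in> {..n} \<rightarrow> carrier V" and w: "cmod w = 1"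
  shows "nrm (bochner_L1 V) (analytic_poly V n (\<lambda>l. (w ^ l) \<odot> x l)) = nrm (bochner_L1 V) (analytic_poly V n x)"
proof -
  have wx: "(\<lambda>l. (w ^ l) \<odot> x l) \<in> {..n} \<rightarrow> carrier V" using x by auto
  have "poly_fun V n (\<lambda>l. (w ^ l) \<odot> x l) z = poly_fun V n x (w * z)" for z
    unfolding poly_fun_def using x
    by (intro M.finsum_cong') (auto simp: smult_smult power_mult_distrib mult.commute Pi_iff)
  then have "bochner_norm V (poly_fun V n (\<lambda>l. (w ^ l) \<odot> x l)) = bochner_norm V (poly_fun V n x)"
    unfolding bochner_norm_def
    using nn_integral_rotate[OF _ w, of "\<lambda>z. ennreal (nrm V (poly_fun V n x z))"] poly_fun_norm_measurable[OF x]
    by simp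
  then show ?thesis
    unfolding analytic_poly_eq using poly_fun_integrable[OF x] poly_fun_integrable[OF wx]
    by (simp add: nrm_L1_class)
qed

text \<open>
  A multiplier \<open>l \<mapsto> \<Sum> a\<^sub>j w\<^sub>j\<^sup>l\<close> is a linear combination of rotations, so rotation invariance bounds it. For
  polynomials, finite averages of this kind replace convolution with a kernel, and no integral of a
  vector valued function is needed.
\<close>

lemma multiplier_bound:
  assumes x: "x \<in> {..n} \<rightarrow> carrier V" and "finite J" and w: "\<And>j. j \<in> J \<Longrightarrow> cmod (w j) = 1"
  shows "nrm (bochner_L1 V) (analytic_poly V n (\<lambda>l. (\<Sum>j\<in>J. a j * w j ^ l) \<odot> x l)) \<le>
     (\<Sum>j\<in>J. cmod (a j)) * nrm (bochner_L1 V) (analytic_poly V n x)"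
  using assms(2) w
proof (induction J rule: finite_induct)
  case empty
  interpret L: normed "bochner_L1 V" by (rule bochner_L1_normed)
  have "analytic_poly V n (\<lambda>l. 0 \<odot> x l) = 0 \<odot>\<^bsub>bochner_L1 V\<^esub> analytic_poly V n x"
    using analytic_poly_smult[OF x] by simp
  then show ?case using analytic_poly_closed[OF x] by simp
next
  case (insert i J)
  interpret L: normed "bochner_L1 V" by (rule bochner_L1_normed)
  have 1: "(\<lambda>l. (w i ^ l) \<odot> x l) \<in> {..n} \<rightarrow> carrier V" using x by auto
  have 2: "(\<lambda>l. (\<Sum>j\<in>J. a j * w j ^ l) \<odot> x l) \<in> {..n} \<rightarrow> carrier V" using x by auto
  have 3: "(\<lambda>l. a i \<odot> ((w i ^ l) \<odot> x l)) \<in> {..n} \<rightarrow> carrier V" using x by auto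
  have "analytic_poly V n (\<lambda>l. (\<Sum>j\<in>insert i J. a j * w j ^ l) \<odot> x l) =
      analytic_poly V n (\<lambda>l. a i \<odot> ((w i ^ l) \<odot> x l) \<oplus> (\<Sum>j\<in>J. a j * w j ^ l) \<odot> x l)"
    using x insert.hyps by (intro analytic_poly_cong) (auto simp: smult_add_left smult_smult Pi_iff)
  also have "\<dots> = a i \<odot>\<^bsub>bochner_L1 V\<^esub> analytic_poly V n (\<lambda>l. (w i ^ l) \<odot> x l) \<oplus>\<^bsub>bochner_L1 V\<^esub>
      analytic_poly V n (\<lambda>l. (\<Sum>j\<in>J. a j * w j ^ l) \<odot> x l)"
    using 1 2 3 by (simp add: analytic_poly_smult analytic_poly_add)
  finally have "nrm (bochner_L1 V) (analytic_poly V n (\<lambda>l. (\<Sum>j\<in>insert i J. a j * w j ^ l) \<odot> x l)) \<le>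
      cmod (a i) * nrm (bochner_L1 V) (analytic_poly V n (\<lambda>l. (w i ^ l) \<odot> x l)) +
      nrm (bochner_L1 V) (analytic_poly V n (\<lambda>l. (\<Sum>j\<in>J. a j * w j ^ l) \<odot> x l))"
    using L.nrm_triangle[of "a i \<odot>\<^bsub>bochner_L1 V\<^esub> analytic_poly V n (\<lambda>l. (w i ^ l) \<odot> x l)"
        "analytic_poly V n (\<lambda>l. (\<Sum>j\<in>J. a j * w j ^ l) \<odot> x l)"] analytic_poly_closed[OF 1] analytic_poly_closed[OF 2]
    by (simp add: L.nrm_smult)
  also have "\<dots> \<le> cmod (a i) * nrm (bochner_L1 V) (analytic_poly V n x) +
      (\<Sum>j\<in>J. cmod (a j)) * nrm (bochner_L1 V) (analytic_poly V n x)"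
    using insert nrm_rotate_poly[OF x, of "w i"] by (intro add_mono) auto
  finally show ?case using insert.hyps by (simp add: distrib_right)
qed

lemma nrm_monomial:
  assumes "y \<in> carrier V" "k \<le> n"
  shows "nrm (bochner_L1 V) (analytic_poly V n (\<lambda>l. if l = k then y else \<zero>)) = nrm V y"
proof -
  have c: "(\<lambda>l. if l = k then y else \<zero>) \<in> {..n} \<rightarrow> carrier V" using assms by auto
  have p: "poly_fun V n (\<lambda>l. if l = k then y else \<zero>) z = (z ^ k) \<odot> y" for z
  proof -
    have "poly_fun V n (\<lambda>l. if l = k then y else \<zero>) z = (\<Oplus>l\<in>{..n}. if k = l then (z ^ l) \<odot> y else \<zero>)"
      unfolding poly_fun_def using assms by (intro M.finsum_cong') auto
    also have "\<dots> = (z ^ k) \<odot> y"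
      using assms by (intro M.finsum_singleton) auto
    finally show ?thesis .
  qed
  have "bochner_norm V (poly_fun V n (\<lambda>l. if l = k then y else \<zero>)) = (\<integral>\<^sup>+z. ennreal (nrm V y) \<partial>haar_circle)"
    unfolding bochner_norm_def p using assms by (intro nn_integral_cong) (simp add: nrm_smult norm_power)
  then show ?thesis
    unfolding analytic_poly_eq using poly_fun_integrable[OF c] assms
    by (simp add: nrm_L1_class emeasure_haar_circle)
qed

text \<open>
  Averaging the rotations by the roots of unity of order \<open>n + 1\<close> against a character isolates one
  coefficient of a polynomial of degree at most \<open>n\<close>.
\<close>

lemma coefficient_bound:
  assumes x: "x \<in> {..n} \<rightarrow> carrier V" and k: "k \<le> n"
  shows "nrm V (x k) \<le> nrm (bochner_L1 V) (analytic_poly V n x)"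
proof -
  define N where "N = Suc n"
  have N: "N > 0" by (simp add: N_def)
  define w where "w j = cis (real j * (2 * pi / real N))" for j
  define a where "a j = cis (- real k * (real j * (2 * pi / real N))) / of_nat N" for j
  have m: "(\<Sum>j<N. a j * w j ^ l) = (if l = k then 1 else 0)" if "l \<le> n" for l
  proof -
    have "a j * w j ^ l = cis (real j * (2 * pi * of_int (int l - int k) / real N)) / of_nat N" for j
    proof -
      have "w j ^ l = cis (real l * (real j * (2 * pi / real N)))" by (simp only: w_def Complex.DeMoivre)
      then have "a j * w j ^ l = cis (- real k * (real j * (2 * pi / real N)) + real l * (real j * (2 * pi / real N))) / of_nat N"
        by (simp only: a_def times_divide_eq_left cis_mult)
      also have "- real k * (real j * (2 * pi / real N)) + real l * (real j * (2 * pi / real N)) =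
          real j * (2 * pi * of_int (int l - int k) / real N)"
        by (simp add: diff_divide_distrib algebra_simps)
      finally show ?thesis .
    qed
    then have "(\<Sum>j<N. a j * w j ^ l) = (\<Sum>j<N. cis (real j * (2 * pi * of_int (int l - int k) / real N))) / of_nat N"
      by (simp add: sum_divide_distrib)
    also have "\<dots> = (if int N dvd int l - int k then 1 else 0)"
      using N by (subst sum_cis_roots) auto
    also have "int N dvd int l - int k \<longleftrightarrow> l = k"
    proof
      assume dvd: "int N dvd int l - int k"
      have "\<bar>int l - int k\<bar> < int N" using that k by (simp add: N_def)
      then have "int l - int k = 0" using dvd zdvd_not_zless[of "\<bar>int l - int k\<bar>" "int N"] by auto
      then show "l = k" by simp
    qed simp
    finally show ?thesis .
  qed
  have "analytic_poly V n (\<lambda>l. (\<Sum>j<N. a j * w j ^ l) \<odot> x l) = analytic_poly V n (\<lambda>l. if l = k then x k else \<zero>)"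
    using x by (intro analytic_poly_cong) (auto simp: m Pi_iff)
  moreover have "(\<Sum>j<N. cmod (a j)) = 1" using N by (simp add: a_def norm_divide)
  ultimately show ?thesis
    using multiplier_bound[OF x, of "{..<N}" w a] nrm_monomial[of "x k" k n] funcset_mem[OF x, of k] k
    by (simp add: w_def)
qed

text \<open>
  The weights \<open>a j\<close> are values of the Fejer kernel \<open>\<bar>D\<bar>\<^sup>2 / n\<close> at the roots of unity, where \<open>D\<close> is a sum of
  \<open>n\<close> powers. They are nonnegative, so their sum is the value \<open>1\<close> of the multiplier at \<open>0\<close>.
\<close>

lemma fejer_contraction:
  assumes x: "x \<in> {..d} \<rightarrow> carrier V" and n: "n > 0"
  shows "nrm (bochner_L1 V) (analytic_poly V d (\<lambda>l. complex_of_real (fejer n l) \<odot> x l)) \<le>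
     nrm (bochner_L1 V) (analytic_poly V d x)"
proof -
  \<comment> \<open>Exponents \<open>p - q + l\<close> with \<open>p, q < n\<close> and \<open>l \<le> d\<close> are smaller than \<open>N\<close> in absolute value, so a multiple of \<open>N\<close> among them is zero.\<close>
  define N where "N = n + d"
  have N: "N > 0" using n by (simp add: N_def)
  define w where "w j = cis (real j * (2 * pi / real N))" for j
  define D where "D j = (\<Sum>a<n. w j ^ a)" for j
  define a where "a j = complex_of_real ((cmod (D j))\<^sup>2 / (real n * real N))" for j
  have prod: "w j ^ p * cnj (w j ^ q) * w j ^ l = cis (real j * (2 * pi * of_int (int p - int q + int l) / real N))" for j p q l
  proof -
    have "w j ^ p * cnj (w j ^ q) * w j ^ l = cis (real p * (real j * (2 * pi / real N)) +
        - (real q * (real j * (2 * pi / real N))) + real l * (real j * (2 * pi / real N)))"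
      by (simp only: w_def Complex.DeMoivre cis_cnj cis_mult)
    also have "real p * (real j * (2 * pi / real N)) + - (real q * (real j * (2 * pi / real N))) +
        real l * (real j * (2 * pi / real N)) = real j * (2 * pi * of_int (int p - int q + int l) / real N)"
      by (simp add: diff_divide_distrib add_divide_distrib algebra_simps)
    finally show ?thesis .
  qed
  have m: "(\<Sum>j<N. a j * w j ^ l) = of_real (fejer n l)" if "l \<le> d" for l
  proof -
    have "(\<Sum>j<N. a j * w j ^ l) = (\<Sum>j<N. \<Sum>p<n. \<Sum>q<n. w j ^ p * cnj (w j ^ q) * w j ^ l) / (of_nat n * of_nat N)"
    proof -
      have "a j * w j ^ l = (\<Sum>p<n. \<Sum>q<n. w j ^ p * cnj (w j ^ q) * w j ^ l) / (of_nat n * of_nat N)" for j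
      proof -
        have "a j = D j * cnj (D j) / (of_nat n * of_nat N)"
          by (simp add: a_def complex_norm_square[symmetric] flip: of_real_power)
        moreover have "D j * cnj (D j) = (\<Sum>p<n. \<Sum>q<n. w j ^ p * cnj (w j ^ q))"
          by (simp only: D_def cnj_sum sum_product)
        then have "D j * cnj (D j) * w j ^ l = (\<Sum>p<n. \<Sum>q<n. w j ^ p * cnj (w j ^ q) * w j ^ l)"
          by (simp only: sum_distrib_right)
        ultimately show ?thesis by (metis times_divide_eq_left)
      qed
      then show ?thesis by (simp add: sum_divide_distrib)
    qed
    also have "(\<Sum>j<N. \<Sum>p<n. \<Sum>q<n. w j ^ p * cnj (w j ^ q) * w j ^ l) =
        (\<Sum>p<n. \<Sum>q<n. \<Sum>j<N. w j ^ p * cnj (w j ^ q) * w j ^ l)"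
      by (subst sum.swap, rule sum.cong[OF refl], rule sum.swap)
    also have "\<dots> = (\<Sum>p<n. \<Sum>q<n. if q = p + l then of_nat N else 0)"
    proof (intro sum.cong refl)
      fix p q assume "p \<in> {..<n}" "q \<in> {..<n}"
      then have pq: "p < n" "q < n" by auto
      have "int N dvd int p - int q + int l \<longleftrightarrow> q = p + l"
      proof
        assume dvd: "int N dvd int p - int q + int l"
        have "\<bar>int p - int q + int l\<bar> < int N" using pq that by (simp add: N_def)
        then have "int p - int q + int l = 0" using dvd zdvd_not_zless[of "\<bar>int p - int q + int l\<bar>" "int N"] by auto
        then show "q = p + l" by simp
      qed simp
      then show "(\<Sum>j<N. w j ^ p * cnj (w j ^ q) * w j ^ l) = (if q = p + l then of_nat N else 0)"
        unfolding prod using sum_cis_roots[OF N, of "int p - int q + int l"] by simp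
    qed
    also have "\<dots> = (\<Sum>p<n. if p < n - l then of_nat N else 0)"
      by (intro sum.cong refl) (auto simp: sum.delta)
    also have "\<dots> = (\<Sum>p<n - l. of_nat N)"
      by (rule sum.mono_neutral_cong_right) auto
    also have "\<dots> / (of_nat n * of_nat N) = of_real (fejer n l)"
      using N by (simp add: fejer_def)
    finally show ?thesis .
  qed
  have "analytic_poly V d (\<lambda>l. (\<Sum>j<N. a j * w j ^ l) \<odot> x l) = analytic_poly V d (\<lambda>l. complex_of_real (fejer n l) \<odot> x l)"
    using x by (intro analytic_poly_cong) (auto simp: m)
  moreover have "(\<Sum>j<N. cmod (a j)) = 1"
  proof -
    have "cmod (a j) = (cmod (D j))\<^sup>2 / (real n * real N)" for j
      unfolding a_def norm_of_real by simp
    then have "complex_of_real (\<Sum>j<N. cmod (a j)) = (\<Sum>j<N. a j * w j ^ 0)"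
      by (simp add: a_def)
    also have "\<dots> = 1" using m[of 0] n by (simp add: fejer_def)
    finally show ?thesis using of_real_eq_1_iff by blast
  qed
  ultimately show ?thesis
    using multiplier_bound[OF x, of "{..<N}" w a] by (simp add: w_def)
qed

end

section \<open>The projective tensor product\<close>

lemma lookup_smult: "Poly_Mapping.lookup (Poly_Mapping.map ((*) c) u) p = c * Poly_Mapping.lookup u (p :: 'p) "
  for u :: "'p \<Rightarrow>\<^sub>0 complex"
  by (simp add: Poly_Mapping.map.rep_eq when_def)

lemma keys_smult: "Poly_Mapping.keys (Poly_Mapping.map ((*) c) u) \<subseteq> Poly_Mapping.keys u"
  for u :: "'p \<Rightarrow>\<^sub>0 complex"
  by (auto simp: in_keys_iff lookup_smult)

text \<open>Linear extension to the free space of a map on pairs.\<close>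

definition lin_ext :: "'z cspace \<Rightarrow> ('p \<Rightarrow> 'z) \<Rightarrow> ('p \<Rightarrow>\<^sub>0 complex) \<Rightarrow> 'z" where
  "lin_ext Z \<Phi> w = (\<Oplus>\<^bsub>Z\<^esub>p\<in>Poly_Mapping.keys w. Poly_Mapping.lookup w p \<odot>\<^bsub>Z\<^esub> \<Phi> p)"

lemma (in seminormed) lin_ext_superset:
  assumes "finite A" "Poly_Mapping.keys w \<subseteq> A" "\<Phi> \<in> A \<rightarrow> carrier V"
  shows "lin_ext V \<Phi> w = (\<Oplus>p\<in>A. Poly_Mapping.lookup w p \<odot> \<Phi> p)"
  unfolding lin_ext_def
  by (rule M.add.finprod_mono_neutral_cong_left)
     (use assms in \<open>auto simp: in_keys_iff Pi_iff\<close>)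

lemma (in seminormed) lin_ext_closed:
  "\<Phi> \<in> A \<rightarrow> carrier V \<Longrightarrow> Poly_Mapping.keys w \<subseteq> A \<Longrightarrow> lin_ext V \<Phi> w \<in> carrier V"
  unfolding lin_ext_def by (rule M.finsum_closed) auto

lemma (in seminormed) lin_ext_add:
  assumes "\<Phi> \<in> A \<rightarrow> carrier V" "Poly_Mapping.keys w \<subseteq> A" "Poly_Mapping.keys v \<subseteq> A"
  shows "lin_ext V \<Phi> (w + v) = lin_ext V \<Phi> w \<oplus> lin_ext V \<Phi> v"
proof -
  define B where "B = Poly_Mapping.keys w \<union> Poly_Mapping.keys v"
  have B: "finite B" "\<Phi> \<in> B \<rightarrow> carrier V" "Poly_Mapping.keys w \<subseteq> B" "Poly_Mapping.keys v \<subseteq> B"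
    "Poly_Mapping.keys (w + v) \<subseteq> B"
    using assms Poly_Mapping.keys_add[of w v] by (auto simp: B_def)
  have "lin_ext V \<Phi> (w + v) = (\<Oplus>p\<in>B. Poly_Mapping.lookup w p \<odot> \<Phi> p \<oplus> Poly_Mapping.lookup v p \<odot> \<Phi> p)"
    unfolding lin_ext_superset[OF B(1,5,2)] using B(2)
    by (intro M.finsum_cong') (auto simp: lookup_add smult_add_left Pi_iff)
  also have "\<dots> = lin_ext V \<Phi> w \<oplus> lin_ext V \<Phi> v"
    unfolding lin_ext_superset[OF B(1,3,2)] lin_ext_superset[OF B(1,4,2)] using B(2)
    by (intro M.finsum_addf) auto
  finally show ?thesis .
qed

lemma (in seminormed) lin_ext_smult:
  assumes "\<Phi> \<in> A \<rightarrow> carrier V" "Poly_Mapping.keys w \<subseteq> A"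
  shows "lin_ext V \<Phi> (Poly_Mapping.map ((*) c) w) = c \<odot> lin_ext V \<Phi> w"
proof -
  have B: "\<Phi> \<in> Poly_Mapping.keys w \<rightarrow> carrier V" using assms by auto
  have "lin_ext V \<Phi> (Poly_Mapping.map ((*) c) w) = (\<Oplus>p\<in>Poly_Mapping.keys w. c \<odot> (Poly_Mapping.lookup w p \<odot> \<Phi> p))"
    unfolding lin_ext_superset[OF finite_keys keys_smult B] using B
    by (intro M.finsum_cong') (auto simp: lookup_smult smult_smult Pi_iff)
  also have "\<dots> = c \<odot> lin_ext V \<Phi> w"
    unfolding lin_ext_def using B by (intro smult_finsum[symmetric]) auto
  finally show ?thesis .
qed

lemma (in seminormed) lin_ext_single:
  assumes "\<Phi> p \<in> carrier V"
  shows "lin_ext V \<Phi> (Poly_Mapping.single p c) = c \<odot> \<Phi> p"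
  using lin_ext_superset[of "{p}" "Poly_Mapping.single p c" \<Phi>] assms by simp

lemma bounded_op_lin_ext:
  assumes "bounded_op V W T" "\<Phi> \<in> Poly_Mapping.keys w \<rightarrow> carrier V"
  shows "T (lin_ext V \<Phi> w) = lin_ext W (\<lambda>p. T (\<Phi> p)) w"
proof -
  interpret T: bounded_op V W T by fact
  show ?thesis
    unfolding lin_ext_def using assms(2)
    by (subst T.finsum) (auto simp: Pi_iff T.smult intro!: T.W.finsum_cong')
qed

locale two_spaces = E: seminormed E + F: seminormed F for E :: "'a cspace" and F :: "'b cspace"
begin

lemma free_carrier: "u \<in> carrier (free_space E F) \<longleftrightarrow> Poly_Mapping.keys u \<subseteq> carrier E \<times> carrier F"
  by (simp add: free_space_def)

lemma free_ops:
  "u \<oplus>\<^bsub>free_space E F\<^esub> v = u + v" "\<zero>\<^bsub>free_space E F\<^esub> = 0"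
  "c \<odot>\<^bsub>free_space E F\<^esub> u = Poly_Mapping.map ((*) c) u"
  by (simp_all add: free_space_def)

lemma free_nrm_superset:
  assumes "finite A" "Poly_Mapping.keys u \<subseteq> A"
  shows "nrm (free_space E F) u = (\<Sum>p\<in>A. cmod (Poly_Mapping.lookup u p) * nrm E (fst p) * nrm F (snd p))"
  unfolding free_space_def
  by simp (rule sum.mono_neutral_left, use assms in \<open>auto simp: in_keys_iff\<close>)

lemma free_closed:
  "u \<in> carrier (free_space E F) \<Longrightarrow> v \<in> carrier (free_space E F) \<Longrightarrow> u + v \<in> carrier (free_space E F)"
  "u \<in> carrier (free_space E F) \<Longrightarrow> Poly_Mapping.map ((*) c) u \<in> carrier (free_space E F)"
  using Poly_Mapping.keys_add[of u v] keys_smult[of c u] by (auto simp: free_carrier)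

lemma free_module: "Module.module scalars (free_space E F)"
proof (rule moduleI)
  show "abelian_group (free_space E F)"
  proof (rule abelian_groupI)
    fix u assume u: "u \<in> carrier (free_space E F)"
    have "Poly_Mapping.map ((*) (-1)) u + u = 0"
      by (rule poly_mapping_eqI) (simp add: lookup_add lookup_smult)
    then show "\<exists>y\<in>carrier (free_space E F). y \<oplus>\<^bsub>free_space E F\<^esub> u = \<zero>\<^bsub>free_space E F\<^esub>"
      using free_closed(2)[OF u, of "-1"] by (auto simp: free_ops)
  qed (auto simp: free_ops free_closed ac_simps, simp add: free_carrier)
qed (auto simp: cring_scalars free_ops free_closed lookup_add lookup_smult algebra_simps
    intro!: poly_mapping_eqI)

lemma free_seminormed: "seminormed (free_space E F)"
proof (rule seminormed.intro[OF free_module], unfold_locales)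
  have nn: "0 \<le> nrm E (fst p) * nrm F (snd p)" if "p \<in> carrier E \<times> carrier F" for p
    using that by auto
  fix u assume u: "u \<in> carrier (free_space E F)"
  then have uk: "Poly_Mapping.keys u \<subseteq> carrier E \<times> carrier F" by (simp add: free_carrier)
  show "0 \<le> nrm (free_space E F) u"
    unfolding free_nrm_superset[OF finite_keys order_refl] using nn uk
    by (intro sum_nonneg) (auto simp: mult.assoc)
  show "nrm (free_space E F) (c \<odot>\<^bsub>free_space E F\<^esub> u) = cmod c * nrm (free_space E F) u" for c
  proof -
    have "nrm (free_space E F) (Poly_Mapping.map ((*) c) u) =
        (\<Sum>p\<in>Poly_Mapping.keys u. cmod (Poly_Mapping.lookup (Poly_Mapping.map ((*) c) u) p) * nrm E (fst p) * nrm F (snd p))"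
      by (rule free_nrm_superset[OF finite_keys keys_smult])
    then show ?thesis
      unfolding free_ops free_nrm_superset[OF finite_keys[of u] order_refl]
      by (simp add: lookup_smult norm_mult sum_distrib_left mult.assoc)
  qed
  fix v assume v: "v \<in> carrier (free_space E F)"
  then have vk: "Poly_Mapping.keys v \<subseteq> carrier E \<times> carrier F" by (simp add: free_carrier)
  define B where "B = Poly_Mapping.keys u \<union> Poly_Mapping.keys v"
  have B: "finite B" "Poly_Mapping.keys u \<subseteq> B" "Poly_Mapping.keys v \<subseteq> B" "Poly_Mapping.keys (u + v) \<subseteq> B"
    using Poly_Mapping.keys_add[of u v] by (auto simp: B_def)
  show "nrm (free_space E F) (u \<oplus>\<^bsub>free_space E F\<^esub> v) \<le> nrm (free_space E F) u + nrm (free_space E F) v"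
    unfolding free_ops free_nrm_superset[OF B(1,2)] free_nrm_superset[OF B(1,3)] free_nrm_superset[OF B(1,4)]
      sum.distrib[symmetric]
  proof (rule sum_mono)
    fix p assume "p \<in> B"
    then have p: "0 \<le> nrm E (fst p) * nrm F (snd p)" using uk vk nn by (auto simp: B_def)
    show "cmod (Poly_Mapping.lookup (u + v) p) * nrm E (fst p) * nrm F (snd p) \<le>
        cmod (Poly_Mapping.lookup u p) * nrm E (fst p) * nrm F (snd p) +
        cmod (Poly_Mapping.lookup v p) * nrm E (fst p) * nrm F (snd p)"
      using mult_right_mono[OF norm_triangle_ineq[of "Poly_Mapping.lookup u p" "Poly_Mapping.lookup v p"] p]
      by (simp add: lookup_add mult.assoc distrib_right)
  qed
qed

sublocale free: seminormed "free_space E F"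
  by (rule free_seminormed)

lemma free_minus:
  assumes "u \<in> carrier (free_space E F)" "v \<in> carrier (free_space E F)"
  shows "u \<ominus>\<^bsub>free_space E F\<^esub> v = u - v"
  unfolding free.minus_smult[OF assms] free_ops
  by (rule poly_mapping_eqI) (simp add: lookup_add lookup_smult lookup_minus)

lemma single_free [simp, intro]:
  "x \<in> carrier E \<Longrightarrow> y \<in> carrier F \<Longrightarrow> Poly_Mapping.single (x, y) c \<in> carrier (free_space E F)"
  by (simp add: free_carrier)

lemma free_diff_closed:
  assumes "u \<in> carrier (free_space E F)" "v \<in> carrier (free_space E F)"
  shows "u - v \<in> carrier (free_space E F)"
  using free.minus_in[OF assms] free_minus[OF assms] by simp

lemma relators_subset: "bilinear_relators E F \<subseteq> carrier (free_space E F)"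
  unfolding bilinear_relators_def Let_def by (auto intro!: free_diff_closed)

lemma tensor_relations_submodule: "submodule (tensor_relations E F) scalars (free_space E F)"
proof (rule free.submoduleI')
  have "submodule (carrier (free_space E F)) scalars (free_space E F)"
    by (rule free.carrier_is_submodule)
  then show "tensor_relations E F \<subseteq> carrier (free_space E F)"
    using relators_subset unfolding tensor_relations_def by blast
  have S: "\<zero>\<^bsub>free_space E F\<^esub> \<in> N \<and> (\<forall>u\<in>N. \<forall>v\<in>N. u \<oplus>\<^bsub>free_space E F\<^esub> v \<in> N) \<and>
      (\<forall>c. \<forall>u\<in>N. c \<odot>\<^bsub>free_space E F\<^esub> u \<in> N)"
    if N: "submodule N scalars (free_space E F)" for N
  proof -
    have c: "\<And>c u. u \<in> N \<Longrightarrow> c \<odot>\<^bsub>free_space E F\<^esub> u \<in> N"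
      using free.submoduleE(4)[OF N] by simp
    obtain u where "u \<in> N" "u \<in> carrier (free_space E F)" using free.submoduleE(1,2)[OF N] by blast
    then have "\<zero>\<^bsub>free_space E F\<^esub> \<in> N" using c[of u 0] by simp
    then show ?thesis using c free.submoduleE(5)[OF N] by blast
  qed
  show "\<zero>\<^bsub>free_space E F\<^esub> \<in> tensor_relations E F"
    unfolding tensor_relations_def using S by simp
  show "u \<oplus>\<^bsub>free_space E F\<^esub> v \<in> tensor_relations E F"
    if "u \<in> tensor_relations E F" "v \<in> tensor_relations E F" for u v
    using that S unfolding tensor_relations_def by simp
  show "c \<odot>\<^bsub>free_space E F\<^esub> u \<in> tensor_relations E F" if "u \<in> tensor_relations E F" for c u
    using that S unfolding tensor_relations_def by simp
qed

lemma relators_tensor_relations: "bilinear_relators E F \<subseteq> tensor_relations E F"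
  unfolding tensor_relations_def by blast

lemma tensor_relations_least:
  "submodule N scalars (free_space E F) \<Longrightarrow> bilinear_relators E F \<subseteq> N \<Longrightarrow> tensor_relations E F \<subseteq> N"
  unfolding tensor_relations_def by blast

sublocale alg: quot "free_space E F" "tensor_relations E F"
  by (intro quot.intro quot_axioms.intro free_seminormed tensor_relations_submodule)

lemma alg_eq: "quotient_space (free_space E F) (tensor_relations E F) = alg_tensor E F"
  by (simp add: alg_tensor_def)

lemma alg_seminormed: "seminormed (alg_tensor E F)"
  using alg.quo.seminormed_axioms unfolding alg_eq .

lemma proj_tensor_banach: "banach (proj_tensor E F)"
  unfolding proj_tensor_def by (rule seminormed.completion_banach[OF alg_seminormed])

text \<open>The element of the completed tensor product that is represented by an element of the free space.\<close>

definition tensor_class :: "('a \<times> 'b \<Rightarrow>\<^sub>0 complex) \<Rightarrow> (nat \<Rightarrow> ('a \<times> 'b \<Rightarrow>\<^sub>0 complex) set) set" where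
  "tensor_class w = completion_embed (alg_tensor E F) (tensor_relations E F +>\<^bsub>free_space E F\<^esub> w)"

lemma elem_tensor_eq: "elem_tensor E F x y = tensor_class (Poly_Mapping.single (x, y) 1)"
  by (simp add: elem_tensor_def tensor_class_def)

lemma bounded_op_tensor_class: "bounded_op (free_space E F) (proj_tensor E F) tensor_class"
proof -
  have "bounded_op (free_space E F) (alg_tensor E F) (\<lambda>w. tensor_relations E F +>\<^bsub>free_space E F\<^esub> w)"
    using alg.bounded_op_coset unfolding alg_eq .
  moreover have "bounded_op (alg_tensor E F) (proj_tensor E F) (completion_embed (alg_tensor E F))"
    unfolding proj_tensor_def by (rule seminormed.bounded_op_embed[OF alg_seminormed])
  ultimately show ?thesis unfolding tensor_class_def[abs_def] by (rule bounded_op_compose)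
qed

sublocale tc: bounded_op "free_space E F" "proj_tensor E F" tensor_class
  by (rule bounded_op_tensor_class)

lemma tensor_class_dense: "dense_in (proj_tensor E F) (tensor_class ` carrier (free_space E F))"
proof -
  have "tensor_class ` carrier (free_space E F) = completion_embed (alg_tensor E F) ` carrier (alg_tensor E F)"
    unfolding tensor_class_def image_image[symmetric] alg_eq[symmetric] alg.Q_carrier by (simp add: image_image)
  then show ?thesis
    unfolding proj_tensor_def using seminormed.embed_dense[OF alg_seminormed] by simp
qed

lemma nrm_tensor_class:
  assumes "w \<in> carrier (free_space E F)"
  shows "nrm (proj_tensor E F) (tensor_class w) = nrm (alg_tensor E F) (tensor_relations E F +>\<^bsub>free_space E F\<^esub> w)"
  unfolding proj_tensor_def tensor_class_def
  by (rule seminormed.nrm_embed[OF alg_seminormed]) (use assms alg.Q_coset alg_eq in auto)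

lemma nrm_tensor_class_le:
  assumes "w \<in> carrier (free_space E F)"
  shows "nrm (proj_tensor E F) (tensor_class w) \<le> nrm (free_space E F) w"
  using alg.nrm_Q_le[OF assms] nrm_tensor_class[OF assms] unfolding alg_eq by simp

lemma tensor_class_representative:
  assumes "w \<in> carrier (free_space E F)" "nrm (proj_tensor E F) (tensor_class w) < r"
  obtains v where "v \<in> carrier (free_space E F)" "tensor_class v = tensor_class w" "nrm (free_space E F) v < r"
    "v - w \<in> tensor_relations E F"
proof -
  have "nrm (quotient_space (free_space E F) (tensor_relations E F)) (alg.coset w) < r"
    using assms nrm_tensor_class unfolding alg_eq by simp
  then obtain v where v: "v \<in> carrier (free_space E F)" "alg.coset v = alg.coset w" "nrm (free_space E F) v < r"
    using alg.nrm_Q_less[OF assms(1)] by blast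
  have "v - w \<in> tensor_relations E F"
    using alg.coset_eq_iff[OF v(1) assms(1)] v(2) free_minus[OF v(1) assms(1)] by simp
  then show thesis using v that by (simp add: tensor_class_def)
qed

lemma tensor_class_eq_if_relator:
  assumes "u \<in> carrier (free_space E F)" "v \<in> carrier (free_space E F)" "u - v \<in> bilinear_relators E F"
  shows "tensor_class u = tensor_class v"
proof -
  have "u \<ominus>\<^bsub>free_space E F\<^esub> v \<in> tensor_relations E F"
    using assms(3) relators_tensor_relations free_minus[OF assms(1,2)] by auto
  then show ?thesis using alg.coset_eq_iff[OF assms(1,2)] by (simp add: tensor_class_def)
qed

lemma elem_tensor_closed [simp, intro]:
  "x \<in> carrier E \<Longrightarrow> y \<in> carrier F \<Longrightarrow> elem_tensor E F x y \<in> carrier (proj_tensor E F)"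
  by (simp add: elem_tensor_eq)

lemma tensor_class_single:
  assumes "x \<in> carrier E" "y \<in> carrier F"
  shows "tensor_class (Poly_Mapping.single (x, y) c) = c \<odot>\<^bsub>proj_tensor E F\<^esub> elem_tensor E F x y"
proof -
  have "Poly_Mapping.single (x, y) c = c \<odot>\<^bsub>free_space E F\<^esub> Poly_Mapping.single (x, y) 1"
    unfolding free_ops by (rule poly_mapping_eqI) (simp add: lookup_smult lookup_single when_def)
  then show ?thesis using assms by (simp add: tc.smult elem_tensor_eq)
qed

lemma elem_tensor_add_left:
  assumes "x \<in> carrier E" "x' \<in> carrier E" "y \<in> carrier F"
  shows "elem_tensor E F (x \<oplus>\<^bsub>E\<^esub> x') y = elem_tensor E F x y \<oplus>\<^bsub>proj_tensor E F\<^esub> elem_tensor E F x' y"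
proof -
  have "tensor_class (Poly_Mapping.single (x \<oplus>\<^bsub>E\<^esub> x', y) 1) =
      tensor_class (Poly_Mapping.single (x, y) 1 + Poly_Mapping.single (x', y) 1)"
  proof (rule tensor_class_eq_if_relator)
    show "Poly_Mapping.single (x \<oplus>\<^bsub>E\<^esub> x', y) 1 - (Poly_Mapping.single (x, y) 1 + Poly_Mapping.single (x', y) 1)
        \<in> bilinear_relators E F"
      unfolding bilinear_relators_def Let_def diff_diff_eq[symmetric] using assms by blast
  qed (use assms in \<open>auto intro: free_closed\<close>)
  then show ?thesis using assms tc.add[of "Poly_Mapping.single (x, y) 1" "Poly_Mapping.single (x', y) 1"]
    by (simp add: elem_tensor_eq free_ops)
qed

lemma elem_tensor_add_right:
  assumes "x \<in> carrier E" "y \<in> carrier F" "y' \<in> carrier F"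
  shows "elem_tensor E F x (y \<oplus>\<^bsub>F\<^esub> y') = elem_tensor E F x y \<oplus>\<^bsub>proj_tensor E F\<^esub> elem_tensor E F x y'"
proof -
  have "tensor_class (Poly_Mapping.single (x, y \<oplus>\<^bsub>F\<^esub> y') 1) =
      tensor_class (Poly_Mapping.single (x, y) 1 + Poly_Mapping.single (x, y') 1)"
  proof (rule tensor_class_eq_if_relator)
    show "Poly_Mapping.single (x, y \<oplus>\<^bsub>F\<^esub> y') 1 - (Poly_Mapping.single (x, y) 1 + Poly_Mapping.single (x, y') 1)
        \<in> bilinear_relators E F"
      unfolding bilinear_relators_def Let_def diff_diff_eq[symmetric] using assms by blast
  qed (use assms in \<open>auto intro: free_closed\<close>)
  then show ?thesis using assms tc.add[of "Poly_Mapping.single (x, y) 1" "Poly_Mapping.single (x, y') 1"]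
    by (simp add: elem_tensor_eq free_ops)
qed

lemma elem_tensor_smult_left:
  assumes "x \<in> carrier E" "y \<in> carrier F"
  shows "elem_tensor E F (c \<odot>\<^bsub>E\<^esub> x) y = c \<odot>\<^bsub>proj_tensor E F\<^esub> elem_tensor E F x y"
proof -
  have "tensor_class (Poly_Mapping.single (c \<odot>\<^bsub>E\<^esub> x, y) 1) = tensor_class (Poly_Mapping.single (x, y) c)"
  proof (rule tensor_class_eq_if_relator)
    show "Poly_Mapping.single (c \<odot>\<^bsub>E\<^esub> x, y) 1 - Poly_Mapping.single (x, y) c \<in> bilinear_relators E F"
      unfolding bilinear_relators_def Let_def using assms by blast
  qed (use assms in auto)
  then show ?thesis using assms by (simp add: tensor_class_single flip: elem_tensor_eq)
qed

lemma elem_tensor_smult_right: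
  assumes "x \<in> carrier E" "y \<in> carrier F"
  shows "elem_tensor E F x (c \<odot>\<^bsub>F\<^esub> y) = c \<odot>\<^bsub>proj_tensor E F\<^esub> elem_tensor E F x y"
proof -
  have "tensor_class (Poly_Mapping.single (x, c \<odot>\<^bsub>F\<^esub> y) 1) = tensor_class (Poly_Mapping.single (x, y) c)"
  proof (rule tensor_class_eq_if_relator)
    show "Poly_Mapping.single (x, c \<odot>\<^bsub>F\<^esub> y) 1 - Poly_Mapping.single (x, y) c \<in> bilinear_relators E F"
      unfolding bilinear_relators_def Let_def using assms by blast
  qed (use assms in auto)
  then show ?thesis using assms by (simp add: tensor_class_single flip: elem_tensor_eq)
qed

lemma nrm_elem_tensor_le:
  assumes "x \<in> carrier E" "y \<in> carrier F"
  shows "nrm (proj_tensor E F) (elem_tensor E F x y) \<le> nrm E x * nrm F y"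
proof -
  have "nrm (free_space E F) (Poly_Mapping.single (x, y) 1) = nrm E x * nrm F y"
    using free_nrm_superset[of "{(x, y)}" "Poly_Mapping.single (x, y) 1"] by simp
  then show ?thesis
    using nrm_tensor_class_le[of "Poly_Mapping.single (x, y) 1"] assms by (simp add: elem_tensor_eq)
qed

text \<open>Induction over the number of terms of an element of the free space.\<close>

lemma free_induct:
  assumes w: "w \<in> carrier (free_space E F)" and "P 0"
    and step: "\<And>x y c w. x \<in> carrier E \<Longrightarrow> y \<in> carrier F \<Longrightarrow> w \<in> carrier (free_space E F) \<Longrightarrow> P w \<Longrightarrow>
       P (Poly_Mapping.single (x, y) c + w)"
  shows "P w"
proof -
  have "\<forall>w. Poly_Mapping.keys w \<subseteq> A \<longrightarrow> P w" if "finite A" "A \<subseteq> carrier E \<times> carrier F" for A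
    using that
  proof (induction A rule: finite_induct)
    case empty
    then show ?case using \<open>P 0\<close> by simp
  next
    case (insert p A)
    show ?case
    proof (intro allI impI)
      fix w :: "'a \<times> 'b \<Rightarrow>\<^sub>0 complex"
      assume k: "Poly_Mapping.keys w \<subseteq> insert p A"
      obtain x y where p: "p = (x, y)" "x \<in> carrier E" "y \<in> carrier F" using insert.prems by auto
      define v where "v = w - Poly_Mapping.single p (Poly_Mapping.lookup w p)"
      have "Poly_Mapping.keys v \<subseteq> A"
        using k by (auto simp: v_def in_keys_iff lookup_minus lookup_single when_def split: if_splits)
      then have "P v" "v \<in> carrier (free_space E F)" using insert by (auto simp: free_carrier)
      from step[OF p(2,3) this(2,1), of "Poly_Mapping.lookup w p"] show "P w"
        by (simp add: v_def p(1))
    qed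
  qed
  from this[OF finite_keys[of w]] w show ?thesis by (auto simp: free_carrier)
qed

lemma tensor_class_lin_ext:
  assumes "w \<in> carrier (free_space E F)"
  shows "tensor_class w = lin_ext (proj_tensor E F) (\<lambda>p. elem_tensor E F (fst p) (snd p)) w"
  using assms
proof (rule free_induct)
  let ?\<Phi> = "\<lambda>p. elem_tensor E F (fst p) (snd p)"
  have \<Phi>: "?\<Phi> \<in> carrier E \<times> carrier F \<rightarrow> carrier (proj_tensor E F)" by auto
  show "tensor_class 0 = lin_ext (proj_tensor E F) ?\<Phi> 0"
    using tc.zero by (simp add: free_ops lin_ext_def)
  fix x y c w assume x: "x \<in> carrier E" and y: "y \<in> carrier F" and w: "w \<in> carrier (free_space E F)"
    and IH: "tensor_class w = lin_ext (proj_tensor E F) ?\<Phi> w"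
  have "tensor_class (Poly_Mapping.single (x, y) c + w) = tensor_class (Poly_Mapping.single (x, y) c) \<oplus>\<^bsub>proj_tensor E F\<^esub> tensor_class w"
    using tc.add[of "Poly_Mapping.single (x, y) c" w] x y w by (simp add: free_ops)
  also have "\<dots> = lin_ext (proj_tensor E F) ?\<Phi> (Poly_Mapping.single (x, y) c + w)"
    using x y w tc.W.lin_ext_single[of ?\<Phi> "(x, y)" c] tc.W.lin_ext_add[OF \<Phi>, of "Poly_Mapping.single (x, y) c" w]
    by (simp add: IH tensor_class_single free_carrier)
  finally show "tensor_class (Poly_Mapping.single (x, y) c + w) = lin_ext (proj_tensor E F) ?\<Phi> (Poly_Mapping.single (x, y) c + w)" .
qed

lemma bounded_op_tensor_class_eq:
  assumes "bounded_op (proj_tensor E F) Z T" "w \<in> carrier (free_space E F)"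
  shows "T (tensor_class w) = lin_ext Z (\<lambda>p. T (elem_tensor E F (fst p) (snd p))) w"
  unfolding tensor_class_lin_ext[OF assms(2)]
  by (rule bounded_op_lin_ext[OF assms(1)]) (use assms(2) in \<open>auto simp: free_carrier\<close>)

text \<open>A bounded operator on the tensor product is determined by its values on elementary tensors.\<close>

lemma tensor_agree:
  assumes "bounded_op (proj_tensor E F) Z T" "bounded_op (proj_tensor E F) Z S" "normed Z"
    and eq: "\<And>x y. x \<in> carrier E \<Longrightarrow> y \<in> carrier F \<Longrightarrow> T (elem_tensor E F x y) = S (elem_tensor E F x y)"
    and "u \<in> carrier (proj_tensor E F)"
  shows "T u = S u"
proof (rule agree_on_dense[OF assms(1-3) tensor_class_dense _ assms(5)])
  interpret T: bounded_op "proj_tensor E F" Z T by fact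
  fix d assume "d \<in> tensor_class ` carrier (free_space E F)"
  then obtain w where w: "w \<in> carrier (free_space E F)" "d = tensor_class w" by blast
  have "lin_ext Z (\<lambda>p. T (elem_tensor E F (fst p) (snd p))) w = lin_ext Z (\<lambda>p. S (elem_tensor E F (fst p) (snd p))) w"
    unfolding lin_ext_def using w eq
    by (intro T.W.finsum_cong') (auto simp: free_carrier simp flip: eq)
  then show "T d = S d" using w assms(1,2) by (simp add: bounded_op_tensor_class_eq)
qed

lemma nrm_lin_ext_le:
  assumes "seminormed Z" and \<Phi>: "\<And>x y. x \<in> carrier E \<Longrightarrow> y \<in> carrier F \<Longrightarrow> \<Phi> (x, y) \<in> carrier Z"
    and bound: "\<And>x y. x \<in> carrier E \<Longrightarrow> y \<in> carrier F \<Longrightarrow> nrm Z (\<Phi> (x, y)) \<le> K * (nrm E x * nrm F y)"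
    and w: "w \<in> carrier (free_space E F)"
  shows "nrm Z (lin_ext Z \<Phi> w) \<le> K * nrm (free_space E F) w"
proof -
  interpret Z: seminormed Z by fact
  have p: "\<Phi> p \<in> carrier Z" "nrm Z (\<Phi> p) \<le> K * (nrm E (fst p) * nrm F (snd p))"
    if "p \<in> Poly_Mapping.keys w" for p
    using that w \<Phi>[of "fst p" "snd p"] bound[of "fst p" "snd p"] by (auto simp: free_carrier)
  have "nrm Z (lin_ext Z \<Phi> w) \<le> (\<Sum>p\<in>Poly_Mapping.keys w. nrm Z (Poly_Mapping.lookup w p \<odot>\<^bsub>Z\<^esub> \<Phi> p))"
    unfolding lin_ext_def using p by (intro Z.nrm_finsum) auto
  also have "\<dots> \<le> (\<Sum>p\<in>Poly_Mapping.keys w. K * (cmod (Poly_Mapping.lookup w p) * nrm E (fst p) * nrm F (snd p)))"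
  proof (rule sum_mono)
    fix q assume q: "q \<in> Poly_Mapping.keys w"
    have "cmod (Poly_Mapping.lookup w q) * nrm Z (\<Phi> q) \<le>
        cmod (Poly_Mapping.lookup w q) * (K * (nrm E (fst q) * nrm F (snd q)))"
      by (rule mult_left_mono[OF p(2)[OF q]]) simp
    then show "nrm Z (Poly_Mapping.lookup w q \<odot>\<^bsub>Z\<^esub> \<Phi> q) \<le>
        K * (cmod (Poly_Mapping.lookup w q) * nrm E (fst q) * nrm F (snd q))"
      using p(1)[OF q] by (simp add: Z.nrm_smult mult_ac)
  qed
  also have "\<dots> = K * nrm (free_space E F) w"
    by (simp add: free_nrm_superset[OF finite_keys order_refl] sum_distrib_left)
  finally show ?thesis .
qed

text \<open>The universal property: a bounded bilinear map factors through the tensor product.\<close>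

lemma tensor_lift:
  assumes "banach Z" "K \<ge> 0"
    and closed: "\<And>x y. x \<in> carrier E \<Longrightarrow> y \<in> carrier F \<Longrightarrow> \<Phi> x y \<in> carrier Z"
    and add_left: "\<And>x x' y. x \<in> carrier E \<Longrightarrow> x' \<in> carrier E \<Longrightarrow> y \<in> carrier F \<Longrightarrow>
         \<Phi> (x \<oplus>\<^bsub>E\<^esub> x') y = \<Phi> x y \<oplus>\<^bsub>Z\<^esub> \<Phi> x' y"
    and add_right: "\<And>x y y'. x \<in> carrier E \<Longrightarrow> y \<in> carrier F \<Longrightarrow> y' \<in> carrier F \<Longrightarrow>
         \<Phi> x (y \<oplus>\<^bsub>F\<^esub> y') = \<Phi> x y \<oplus>\<^bsub>Z\<^esub> \<Phi> x y'"
    and smult_left: "\<And>c x y. x \<in> carrier E \<Longrightarrow> y \<in> carrier F \<Longrightarrow> \<Phi> (c \<odot>\<^bsub>E\<^esub> x) y = c \<odot>\<^bsub>Z\<^esub> \<Phi> x y"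
    and smult_right: "\<And>c x y. x \<in> carrier E \<Longrightarrow> y \<in> carrier F \<Longrightarrow> \<Phi> x (c \<odot>\<^bsub>F\<^esub> y) = c \<odot>\<^bsub>Z\<^esub> \<Phi> x y"
    and bound: "\<And>x y. x \<in> carrier E \<Longrightarrow> y \<in> carrier F \<Longrightarrow> nrm Z (\<Phi> x y) \<le> K * (nrm E x * nrm F y)"
  obtains T where "T \<in> extensional (carrier (proj_tensor E F))" "bounded_op (proj_tensor E F) Z T"
    "\<And>x y. x \<in> carrier E \<Longrightarrow> y \<in> carrier F \<Longrightarrow> T (elem_tensor E F x y) = \<Phi> x y"
    "\<And>u. u \<in> carrier (proj_tensor E F) \<Longrightarrow> nrm Z (T u) \<le> K * nrm (proj_tensor E F) u"
proof -
  interpret Z: banach Z by fact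
  define L where "L = lin_ext Z (\<lambda>p. \<Phi> (fst p) (snd p))"
  have \<Phi>: "(\<lambda>p. \<Phi> (fst p) (snd p)) \<in> carrier E \<times> carrier F \<rightarrow> carrier Z" using closed by auto
  have Lc: "L w \<in> carrier Z" if "w \<in> carrier (free_space E F)" for w
    unfolding L_def using that by (intro Z.lin_ext_closed[OF \<Phi>]) (simp add: free_carrier)
  have L_add: "L (v + w) = L v \<oplus>\<^bsub>Z\<^esub> L w" if "v \<in> carrier (free_space E F)" "w \<in> carrier (free_space E F)" for v w
    unfolding L_def using that by (intro Z.lin_ext_add[OF \<Phi>]) (simp_all add: free_carrier)
  have L_smult: "L (Poly_Mapping.map ((*) c) w) = c \<odot>\<^bsub>Z\<^esub> L w" if "w \<in> carrier (free_space E F)" for c w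
    unfolding L_def using that by (intro Z.lin_ext_smult[OF \<Phi>]) (simp add: free_carrier)
  have L_minus: "L (v - w) = L v \<ominus>\<^bsub>Z\<^esub> L w" if vw: "v \<in> carrier (free_space E F)" "w \<in> carrier (free_space E F)" for v w
  proof -
    have "v - w = v + Poly_Mapping.map ((*) (-1)) w"
      using free_minus[OF vw] free.minus_smult[OF vw] by (simp add: free_ops)
    then show ?thesis
      by (simp only: L_add[OF vw(1) free_closed(2)[OF vw(2)]] L_smult[OF vw(2)] Z.minus_smult[OF Lc[OF vw(1)] Lc[OF vw(2)]])
  qed
  have L_single: "L (Poly_Mapping.single (x, y) c) = c \<odot>\<^bsub>Z\<^esub> \<Phi> x y" if "x \<in> carrier E" "y \<in> carrier F" for x y c
    unfolding L_def using Z.lin_ext_single[of "\<lambda>p. \<Phi> (fst p) (snd p)" "(x, y)" c] closed that by simp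
  have L_0: "L 0 = \<zero>\<^bsub>Z\<^esub>" by (simp add: L_def lin_ext_def)
  have ker: "submodule {w \<in> carrier (free_space E F). L w = \<zero>\<^bsub>Z\<^esub>} scalars (free_space E F)"
    by (rule free.submoduleI')
       (auto simp: free_ops L_add L_smult L_0 free_closed, simp add: free_carrier)
  have "bilinear_relators E F \<subseteq> {w \<in> carrier (free_space E F). L w = \<zero>\<^bsub>Z\<^esub>}"
  proof
    fix r assume r: "r \<in> bilinear_relators E F"
    then have rc: "r \<in> carrier (free_space E F)" using relators_subset by blast
    have zz: "(a \<oplus>\<^bsub>Z\<^esub> b) \<ominus>\<^bsub>Z\<^esub> a \<ominus>\<^bsub>Z\<^esub> b = \<zero>\<^bsub>Z\<^esub>" if "a \<in> carrier Z" "b \<in> carrier Z" for a b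
      using that by (metis Z.a_comm Z.add_minus_cancel Z.minus_self)
    have "L r = \<zero>\<^bsub>Z\<^esub>"
      using r unfolding bilinear_relators_def Let_def
      by (auto simp: L_minus L_single free_diff_closed closed add_left add_right smult_left smult_right zz)
    then show "r \<in> {w \<in> carrier (free_space E F). L w = \<zero>\<^bsub>Z\<^esub>}" using rc by blast
  qed
  from tensor_relations_least[OF ker this]
  have L_rel: "L r = \<zero>\<^bsub>Z\<^esub>" if "r \<in> tensor_relations E F" for r using that by blast
  have L_bound: "nrm Z (L w) \<le> K * nrm (proj_tensor E F) (tensor_class w)" if w: "w \<in> carrier (free_space E F)" for w
  proof (rule field_le_epsilon)
    fix e :: real assume e: "e > 0"
    have "nrm (proj_tensor E F) (tensor_class w) < nrm (proj_tensor E F) (tensor_class w) + e / (K + 1)"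
      using e \<open>K \<ge> 0\<close> by simp
    then obtain v where v: "v \<in> carrier (free_space E F)"
        "nrm (free_space E F) v < nrm (proj_tensor E F) (tensor_class w) + e / (K + 1)"
        "v - w \<in> tensor_relations E F"
      using tensor_class_representative[OF w] by blast
    have "L v = L w"
      using L_rel[OF v(3)] L_minus[OF v(1) w] Lc v(1) w by (simp add: Z.minus_eq_zero_iff)
    moreover have "nrm Z (L v) \<le> K * nrm (free_space E F) v"
      unfolding L_def by (rule nrm_lin_ext_le[OF Z.seminormed_axioms _ _ v(1)]) (use closed bound in auto)
    moreover have "K * nrm (free_space E F) v \<le> K * (nrm (proj_tensor E F) (tensor_class w) + e / (K + 1))"
      using v(2) \<open>K \<ge> 0\<close> by (intro mult_left_mono) auto
    moreover have "K * (e / (K + 1)) \<le> e" using e \<open>K \<ge> 0\<close> by (simp add: field_simps)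
    ultimately show "nrm Z (L w) \<le> K * nrm (proj_tensor E F) (tensor_class w) + e"
      by (simp add: distrib_left)
  qed
  define R where "R = {(tensor_class w, L w) | w. w \<in> carrier (free_space E F)}"
  obtain T where T: "T \<in> extensional (carrier (proj_tensor E F))" "bounded_op (proj_tensor E F) Z T"
    "\<And>v w. (v, w) \<in> R \<Longrightarrow> T v = w"
    "\<And>u. u \<in> carrier (proj_tensor E F) \<Longrightarrow> nrm Z (T u) \<le> K * nrm (proj_tensor E F) u"
  proof (rule extension_exists[OF tc.W.seminormed_axioms Z.banach_axioms, of R K])
    show "R \<subseteq> carrier (proj_tensor E F) \<times> carrier Z" using Lc by (auto simp: R_def)
    have "Domain R = tensor_class ` carrier (free_space E F)" by (auto simp: R_def)
    then show "dense_in (proj_tensor E F) (Domain R)" using tensor_class_dense by simp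
    show "(v \<oplus>\<^bsub>proj_tensor E F\<^esub> v', w \<oplus>\<^bsub>Z\<^esub> w') \<in> R" if vw: "(v, w) \<in> R" "(v', w') \<in> R" for v w v' w'
    proof -
      obtain a b where a: "a \<in> carrier (free_space E F)" "v = tensor_class a" "w = L a"
        and b: "b \<in> carrier (free_space E F)" "v' = tensor_class b" "w' = L b"
        using vw by (auto simp: R_def)
      have "v \<oplus>\<^bsub>proj_tensor E F\<^esub> v' = tensor_class (a + b)" "w \<oplus>\<^bsub>Z\<^esub> w' = L (a + b)"
        using a b tc.add[OF a(1) b(1)] L_add[OF a(1) b(1)] by (simp_all add: free_ops)
      then show ?thesis using free_closed(1)[OF a(1) b(1)] by (auto simp: R_def)
    qed
    show "(c \<odot>\<^bsub>proj_tensor E F\<^esub> v, c \<odot>\<^bsub>Z\<^esub> w) \<in> R" if vw: "(v, w) \<in> R" for c v w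
    proof -
      obtain a where a: "a \<in> carrier (free_space E F)" "v = tensor_class a" "w = L a"
        using vw by (auto simp: R_def)
      have "c \<odot>\<^bsub>proj_tensor E F\<^esub> v = tensor_class (Poly_Mapping.map ((*) c) a)" "c \<odot>\<^bsub>Z\<^esub> w = L (Poly_Mapping.map ((*) c) a)"
        using a tc.smult[OF a(1), of c] L_smult[OF a(1), of c] by (simp_all add: free_ops)
      then show ?thesis using free_closed(2)[OF a(1), of c] by (auto simp: R_def)
    qed
    show "nrm Z w \<le> K * nrm (proj_tensor E F) v" if "(v, w) \<in> R" for v w
      using that L_bound by (auto simp: R_def)
  qed (use \<open>K \<ge> 0\<close> that in auto)
  have "T (elem_tensor E F x y) = \<Phi> x y" if "x \<in> carrier E" "y \<in> carrier F" for x y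
  proof -
    have "(elem_tensor E F x y, L (Poly_Mapping.single (x, y) 1)) \<in> R"
      unfolding R_def elem_tensor_eq using that by blast
    from T(3)[OF this] show ?thesis using that closed by (simp add: L_single)
  qed
  with T show thesis using that by blast
qed

text \<open>
  A bound on elementary tensors is a bound for an operator on the projective tensor product: the
  operator coincides with the factorization of the bilinear map that it defines.
\<close>

lemma tensor_bound:
  assumes "bounded_op (proj_tensor E F) Z T" "banach Z" "K \<ge> 0"
    and bound: "\<And>x y. x \<in> carrier E \<Longrightarrow> y \<in> carrier F \<Longrightarrow>
       nrm Z (T (elem_tensor E F x y)) \<le> K * (nrm E x * nrm F y)"
    and u: "u \<in> carrier (proj_tensor E F)"
  shows "nrm Z (T u) \<le> K * nrm (proj_tensor E F) u"
proof -
  interpret T: bounded_op "proj_tensor E F" Z T by fact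
  interpret Z: banach Z by fact
  obtain S where S: "bounded_op (proj_tensor E F) Z S"
    "\<And>x y. x \<in> carrier E \<Longrightarrow> y \<in> carrier F \<Longrightarrow> S (elem_tensor E F x y) = T (elem_tensor E F x y)"
    "\<And>u. u \<in> carrier (proj_tensor E F) \<Longrightarrow> nrm Z (S u) \<le> K * nrm (proj_tensor E F) u"
    by (rule tensor_lift[OF assms(2,3), of "\<lambda>x y. T (elem_tensor E F x y)"])
       (use bound that in \<open>auto simp: elem_tensor_add_left elem_tensor_add_right elem_tensor_smult_left
          elem_tensor_smult_right T.add T.smult\<close>)
  have "S u = T u" by (rule tensor_agree[OF S(1) assms(1) Z.normed_axioms S(2) u])
  then show ?thesis using S(3)[OF u] by simp
qed

end

section \<open>Operators on Hardy spaces\<close>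

interpretation Sc: banach scalars
  by (rule banach_scalars)

lemma finsum_scalars: "finite A \<Longrightarrow> finsum scalars f A = sum f A"
  by (induction A rule: finite_induct) (simp_all add: Pi_def)

lemma poly_fun_scalars: "poly_fun scalars n c z = (\<Sum>k\<le>n. z ^ k * c k)"
  by (simp add: poly_fun_def finsum_scalars)

lemma restrict_analytic_poly_bounded_op:
  assumes "normed X" "normed Y" "bounded_op X Y T" "a \<in> {..n} \<rightarrow> carrier X"
    and K: "K \<ge> 0" "\<And>x. x \<in> carrier X \<Longrightarrow> nrm Y (T x) \<le> K * nrm X x"
  shows "nrm (bochner_L1 Y) (analytic_poly Y n (T \<circ> a)) \<le> K * nrm (bochner_L1 X) (analytic_poly X n a)"
proof -
  interpret X: normed X by fact
  interpret Y: normed Y by fact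
  interpret T: bounded_op X Y T by fact
  have Ta: "T \<circ> a \<in> {..n} \<rightarrow> carrier Y" using assms(4) by (auto simp: Pi_iff)
  have p: "poly_fun Y n (T \<circ> a) z = T (poly_fun X n a z)" for z
  proof -
    have "T (poly_fun X n a z) = (\<Oplus>\<^bsub>Y\<^esub>k\<in>{..n}. T ((z ^ k) \<odot>\<^bsub>X\<^esub> a k))"
      unfolding poly_fun_def using assms(4) by (intro T.finsum) auto
    also have "\<dots> = poly_fun Y n (T \<circ> a) z"
      unfolding poly_fun_def using assms(4) by (intro Y.finsum_cong') (auto simp: T.smult Pi_iff)
    finally show ?thesis by simp
  qed
  have "bochner_norm Y (poly_fun Y n (T \<circ> a)) \<le> (\<integral>\<^sup>+z. ennreal K * ennreal (nrm X (poly_fun X n a z)) \<partial>haar_circle)"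
    unfolding bochner_norm_def p using K assms(4)
    by (intro nn_integral_mono) (auto simp flip: ennreal_mult'' intro!: ennreal_leI)
  also have "\<dots> = ennreal K * bochner_norm X (poly_fun X n a)"
    unfolding bochner_norm_def using X.poly_fun_norm_measurable[OF assms(4)] by (intro nn_integral_cmult) simp
  finally have le: "bochner_norm Y (poly_fun Y n (T \<circ> a)) \<le> ennreal K * bochner_norm X (poly_fun X n a)" .
  have "enn2real (bochner_norm Y (poly_fun Y n (T \<circ> a))) \<le> enn2real (ennreal K * bochner_norm X (poly_fun X n a))"
    by (rule enn2real_mono[OF le])
       (use X.poly_fun_integrable[OF assms(4)] in \<open>simp add: bochner_integrable_def ennreal_mult_less_top\<close>)
  then show ?thesis
    unfolding analytic_poly_eq
    using X.poly_fun_integrable[OF assms(4)] Y.poly_fun_integrable[OF Ta] K(1)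
    by (simp add: X.nrm_L1_class Y.nrm_L1_class enn2real_mult)
qed

lemma hardy_ext_exists:
  assumes "normed X" "banach Y" "bounded_op X Y T"
    and K: "K \<ge> 0" "\<And>x. x \<in> carrier X \<Longrightarrow> nrm Y (T x) \<le> K * nrm X x"
  obtains S where "S \<in> extensional (carrier (hardy1 X))" "bounded_op (hardy1 X) (hardy1 Y) S"
    "\<And>n a. a \<in> {..n} \<rightarrow> carrier X \<Longrightarrow> S (analytic_poly X n a) = analytic_poly Y n (T \<circ> a)"
    "\<And>F. F \<in> carrier (hardy1 X) \<Longrightarrow> nrm (hardy1 Y) (S F) \<le> K * nrm (hardy1 X) F"
proof -
  interpret X: normed X by fact
  interpret Y: banach Y by fact
  interpret T: bounded_op X Y T by fact
  interpret HX: normed "hardy1 X" by (rule X.hardy1_normed)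
  have Ta: "T \<circ> a \<in> {..n} \<rightarrow> carrier Y" if "a \<in> {..n} \<rightarrow> carrier X" for a n
    using that by (auto simp: Pi_iff)
  define R where "R = {(analytic_poly X n a, analytic_poly Y n (T \<circ> a)) | n a. a \<in> {..n} \<rightarrow> carrier X}"
  have RI: "(analytic_poly X n a, analytic_poly Y n (T \<circ> a)) \<in> R" if "a \<in> {..n} \<rightarrow> carrier X" for n a
    unfolding R_def using that by blast
  have RE: "\<exists>n a. a \<in> {..n} \<rightarrow> carrier X \<and> v = analytic_poly X n a \<and> w = analytic_poly Y n (T \<circ> a)"
    if "(v, w) \<in> R" for v w
    using that unfolding R_def by blast
  obtain S where S: "S \<in> extensional (carrier (hardy1 X))" "bounded_op (hardy1 X) (hardy1 Y) S"
    "\<And>v w. (v, w) \<in> R \<Longrightarrow> S v = w"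
    "\<And>F. F \<in> carrier (hardy1 X) \<Longrightarrow> nrm (hardy1 Y) (S F) \<le> K * nrm (hardy1 X) F"
  proof (rule extension_exists[OF HX.seminormed_axioms Y.hardy1_banach, of R K])
    show "R \<subseteq> carrier (hardy1 X) \<times> carrier (hardy1 Y)"
      unfolding R_def using Ta by auto
    have "Domain R = analytic_polys X" unfolding R_def analytic_polys_def by auto
    then show "dense_in (hardy1 X) (Domain R)" using X.analytic_polys_dense by simp
    show "(v \<oplus>\<^bsub>hardy1 X\<^esub> v', w \<oplus>\<^bsub>hardy1 Y\<^esub> w') \<in> R" if vw: "(v, w) \<in> R" "(v', w') \<in> R" for v w v' w'
    proof -
      obtain n a where a: "a \<in> {..n} \<rightarrow> carrier X" "v = analytic_poly X n a" "w = analytic_poly Y n (T \<circ> a)"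
        using RE[OF vw(1)] by blast
      obtain m b where b: "b \<in> {..m} \<rightarrow> carrier X" "v' = analytic_poly X m b" "w' = analytic_poly Y m (T \<circ> b)"
        using RE[OF vw(2)] by blast
      define N where "N = max n m"
      define a' where "a' k = (if k \<le> n then a k else \<zero>\<^bsub>X\<^esub>)" for k
      define b' where "b' k = (if k \<le> m then b k else \<zero>\<^bsub>X\<^esub>)" for k
      have a': "a' \<in> {..N} \<rightarrow> carrier X" and b': "b' \<in> {..N} \<rightarrow> carrier X"
        using a(1) b(1) by (auto simp: a'_def b'_def)
      have Ta': "T \<circ> a' = (\<lambda>k. if k \<le> n then (T \<circ> a) k else \<zero>\<^bsub>Y\<^esub>)"
        and Tb': "T \<circ> b' = (\<lambda>k. if k \<le> m then (T \<circ> b) k else \<zero>\<^bsub>Y\<^esub>)"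
        by (auto simp: a'_def b'_def)
      have va: "v = analytic_poly X N a'" "w = analytic_poly Y N (T \<circ> a')"
        using X.analytic_poly_pad[OF a(1), of N] Y.analytic_poly_pad[OF Ta[OF a(1)], of N]
        unfolding Ta' by (simp_all add: a N_def a'_def[abs_def])
      have vb: "v' = analytic_poly X N b'" "w' = analytic_poly Y N (T \<circ> b')"
        using X.analytic_poly_pad[OF b(1), of N] Y.analytic_poly_pad[OF Ta[OF b(1)], of N]
        unfolding Tb' by (simp_all add: b N_def b'_def[abs_def])
      have ab: "(\<lambda>k. a' k \<oplus>\<^bsub>X\<^esub> b' k) \<in> {..N} \<rightarrow> carrier X" using a' b' by auto
      have "w \<oplus>\<^bsub>hardy1 Y\<^esub> w' = analytic_poly Y N (\<lambda>k. (T \<circ> a') k \<oplus>\<^bsub>Y\<^esub> (T \<circ> b') k)"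
        using Y.analytic_poly_add[OF Ta[OF a'] Ta[OF b']] by (simp add: va vb)
      also have "\<dots> = analytic_poly Y N (T \<circ> (\<lambda>k. a' k \<oplus>\<^bsub>X\<^esub> b' k))"
        using a' b' by (intro Y.analytic_poly_cong) (auto simp: T.add Pi_iff)
      finally show ?thesis using RI[OF ab] X.analytic_poly_add[OF a' b'] by (simp add: va vb)
    qed
    show "(c \<odot>\<^bsub>hardy1 X\<^esub> v, c \<odot>\<^bsub>hardy1 Y\<^esub> w) \<in> R" if vw: "(v, w) \<in> R" for c v w
    proof -
      obtain n a where a: "a \<in> {..n} \<rightarrow> carrier X" "v = analytic_poly X n a" "w = analytic_poly Y n (T \<circ> a)"
        using RE[OF vw(1)] by blast
      have ca: "(\<lambda>k. c \<odot>\<^bsub>X\<^esub> a k) \<in> {..n} \<rightarrow> carrier X" using a by auto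
      have "c \<odot>\<^bsub>hardy1 Y\<^esub> w = analytic_poly Y n (\<lambda>k. c \<odot>\<^bsub>Y\<^esub> (T \<circ> a) k)"
        using Y.analytic_poly_smult[OF Ta[OF a(1)]] by (simp add: a)
      also have "\<dots> = analytic_poly Y n (T \<circ> (\<lambda>k. c \<odot>\<^bsub>X\<^esub> a k))"
        using a by (intro Y.analytic_poly_cong) (auto simp: T.smult Pi_iff)
      finally show ?thesis using RI[OF ca] X.analytic_poly_smult[OF a(1)] by (simp add: a)
    qed
    show "nrm (hardy1 Y) w \<le> K * nrm (hardy1 X) v" if "(v, w) \<in> R" for v w
      using RE[OF that] restrict_analytic_poly_bounded_op[OF X.normed_axioms Y.normed_axioms T.bounded_op_axioms _ K] by auto
  qed (use K that in auto)
  show thesis by (rule that[OF S(1,2) S(3)[OF RI] S(4)])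
qed

text \<open>The definite description \<open>hardy_ext\<close> denotes the extension of \<open>T\<close>, and every bound for \<open>T\<close> is one for it.\<close>

lemma hardy_ext_props:
  assumes "normed X" "banach Y" "bounded_op X Y T"
  shows "bounded_op (hardy1 X) (hardy1 Y) (hardy_ext X Y T)"
    and "\<And>n a. a \<in> {..n} \<rightarrow> carrier X \<Longrightarrow> hardy_ext X Y T (analytic_poly X n a) = analytic_poly Y n (T \<circ> a)"
    and "\<And>F K. F \<in> carrier (hardy1 X) \<Longrightarrow> K \<ge> 0 \<Longrightarrow> (\<And>x. x \<in> carrier X \<Longrightarrow> nrm Y (T x) \<le> K * nrm X x) \<Longrightarrow>
       nrm (hardy1 Y) (hardy_ext X Y T F) \<le> K * nrm (hardy1 X) F"
proof -
  interpret X: normed X by fact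
  interpret Y: banach Y by fact
  interpret T: bounded_op X Y T by fact
  interpret HX: normed "hardy1 X" by (rule X.hardy1_normed)
  interpret HY: banach "hardy1 Y" by (rule Y.hardy1_banach)
  have eq: "hardy_ext X Y T = S"
    if S: "S \<in> extensional (carrier (hardy1 X))" "bounded_op (hardy1 X) (hardy1 Y) S"
    "\<And>n a. a \<in> {..n} \<rightarrow> carrier X \<Longrightarrow> S (analytic_poly X n a) = analytic_poly Y n (T \<circ> a)" for S
    unfolding hardy_ext_def
  proof (rule the_equality)
    show "S \<in> extensional (carrier (hardy1 X)) \<and> bounded_operator (hardy1 X) (hardy1 Y) S \<and>
        (\<forall>n. \<forall>a\<in>{..n} \<rightarrow> carrier X. S (analytic_poly X n a) = analytic_poly Y n (T \<circ> a))"
      using S bounded_op.bounded by blast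
    fix S' assume S': "S' \<in> extensional (carrier (hardy1 X)) \<and> bounded_operator (hardy1 X) (hardy1 Y) S' \<and>
        (\<forall>n. \<forall>a\<in>{..n} \<rightarrow> carrier X. S' (analytic_poly X n a) = analytic_poly Y n (T \<circ> a))"
    then have b: "bounded_op (hardy1 X) (hardy1 Y) S'" by unfold_locales blast
    show "S' = S"
    proof (rule extensionalityI[of _ "carrier (hardy1 X)"])
      fix F assume F: "F \<in> carrier (hardy1 X)"
      show "S' F = S F"
      proof (rule agree_on_dense[OF b S(2) HY.normed_axioms X.analytic_polys_dense _ F])
        fix d assume "d \<in> analytic_polys X"
        then obtain n a where "a \<in> {..n} \<rightarrow> carrier X" "d = analytic_poly X n a"
          unfolding analytic_polys_def by blast
        then show "S' d = S d" using S' S(3) by simp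
      qed
    qed (use S S' in auto)
  qed
  obtain K where K: "K > 0" "\<And>x. x \<in> carrier X \<Longrightarrow> nrm Y (T x) \<le> K * nrm X x"
    by (rule T.bound_pos) (rule that)
  obtain S where S: "S \<in> extensional (carrier (hardy1 X))" "bounded_op (hardy1 X) (hardy1 Y) S"
    "\<And>n a. a \<in> {..n} \<rightarrow> carrier X \<Longrightarrow> S (analytic_poly X n a) = analytic_poly Y n (T \<circ> a)"
    by (rule hardy_ext_exists[OF assms less_imp_le[OF K(1)] K(2)]) (assumption, rule that)
  show "bounded_op (hardy1 X) (hardy1 Y) (hardy_ext X Y T)" using eq[OF S] S by simp
  show "hardy_ext X Y T (analytic_poly X n a) = analytic_poly Y n (T \<circ> a)" if "a \<in> {..n} \<rightarrow> carrier X" for n a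
    using eq[OF S] S(3)[OF that] by simp
  fix F K assume F: "F \<in> carrier (hardy1 X)" and K: "(K::real) \<ge> 0" "\<And>x. x \<in> carrier X \<Longrightarrow> nrm Y (T x) \<le> K * nrm X x"
  obtain S where S: "S \<in> extensional (carrier (hardy1 X))" "bounded_op (hardy1 X) (hardy1 Y) S"
    "\<And>n a. a \<in> {..n} \<rightarrow> carrier X \<Longrightarrow> S (analytic_poly X n a) = analytic_poly Y n (T \<circ> a)"
    "\<And>F. F \<in> carrier (hardy1 X) \<Longrightarrow> nrm (hardy1 Y) (S F) \<le> K * nrm (hardy1 X) F"
    by (rule hardy_ext_exists[OF assms K]) (assumption, rule that)
  show "nrm (hardy1 Y) (hardy_ext X Y T F) \<le> K * nrm (hardy1 X) F" using eq[OF S(1-3)] S(4)[OF F] by simp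
qed

text \<open>Two bounded operators on a Hardy space are compared on polynomials.\<close>

lemma hardy_ops_agree:
  assumes "normed X" "normed Z" "bounded_op (hardy1 X) Z S" "bounded_op (hardy1 X) Z T"
    and "\<And>n a. a \<in> {..n} \<rightarrow> carrier X \<Longrightarrow> S (analytic_poly X n a) = T (analytic_poly X n a)"
    and F: "F \<in> carrier (hardy1 X)"
  shows "S F = T F"
proof (rule agree_on_dense[OF assms(3,4,2) normed.analytic_polys_dense[OF assms(1)] _ F])
  fix d assume "d \<in> analytic_polys X"
  then show "S d = T d" using assms(5) unfolding analytic_polys_def by blast
qed

lemma hardy_ext_comp:
  assumes "normed X" "banach Y" "banach Z" "bounded_op X Y T" "bounded_op Y Z S" "F \<in> carrier (hardy1 X)"
  shows "hardy_ext Y Z S (hardy_ext X Y T F) = hardy_ext X Z (\<lambda>x. S (T x)) F"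
proof -
  interpret Y: banach Y by fact
  interpret Z: banach Z by fact
  interpret HZ: banach "hardy1 Z" by (rule Z.hardy1_banach)
  interpret T: bounded_op X Y T by fact
  note ST = bounded_op_compose[OF assms(4,5)]
  show ?thesis
  proof (rule hardy_ops_agree[OF assms(1) HZ.normed_axioms _ _ _ assms(6)])
    show "bounded_op (hardy1 X) (hardy1 Z) (\<lambda>F. hardy_ext Y Z S (hardy_ext X Y T F))"
      by (rule bounded_op_compose[OF hardy_ext_props(1)[OF assms(1,2,4)] hardy_ext_props(1)[OF Y.normed_axioms assms(3,5)]])
    show "bounded_op (hardy1 X) (hardy1 Z) (hardy_ext X Z (\<lambda>x. S (T x)))"
      by (rule hardy_ext_props(1)[OF assms(1,3) ST])
    fix n :: nat and a assume a: "a \<in> {..n} \<rightarrow> carrier X"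
    then have "T \<circ> a \<in> {..n} \<rightarrow> carrier Y" by (auto simp: Pi_iff)
    then show "hardy_ext Y Z S (hardy_ext X Y T (analytic_poly X n a)) = hardy_ext X Z (\<lambda>x. S (T x)) (analytic_poly X n a)"
      using a by (simp add: hardy_ext_props(2)[OF assms(1,2,4)] hardy_ext_props(2)[OF assms(1,3) ST]
          hardy_ext_props(2)[OF Y.normed_axioms assms(3,5)] comp_def)
  qed
qed

subsection \<open>Taylor coefficients\<close>

text \<open>The bounded operator that takes a function to its \<open>k\<close>-th Taylor coefficient.\<close>

definition hardy_coeff :: "'a cspace \<Rightarrow> nat \<Rightarrow> (complex \<Rightarrow> 'a) set \<Rightarrow> 'a" where
  "hardy_coeff X k = (SOME T. bounded_op (hardy1 X) X T \<and>
     (\<forall>n. \<forall>x\<in>{..n} \<rightarrow> carrier X. T (analytic_poly X n x) = (if k \<le> n then x k else \<zero>\<^bsub>X\<^esub>)))"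

lemma (in banach) hardy_coeff_props:
  shows "bounded_op (hardy1 V) V (hardy_coeff V k)"
    and "\<And>n x. x \<in> {..n} \<rightarrow> carrier V \<Longrightarrow>
       hardy_coeff V k (analytic_poly V n x) = (if k \<le> n then x k else \<zero>)"
proof -
  interpret H: normed "hardy1 V" by (rule hardy1_normed)
  define R where "R = {(analytic_poly V n x, x k) | n x. k \<le> n \<and> x \<in> {..n} \<rightarrow> carrier V}"
  have RI: "(analytic_poly V n x, x k) \<in> R" if "x \<in> {..n} \<rightarrow> carrier V" "k \<le> n" for n x
    unfolding R_def using that by blast
  have RE: "\<exists>n x. x \<in> {..n} \<rightarrow> carrier V \<and> k \<le> n \<and> v = analytic_poly V n x \<and> w = x k"
    if "(v, w) \<in> R" for v w
    using that unfolding R_def by blast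
  have pad: "(analytic_poly V n x, if k \<le> n then x k else \<zero>) \<in> R" if x: "x \<in> {..n} \<rightarrow> carrier V" for n x
  proof -
    have "(\<lambda>l. if l \<le> n then x l else \<zero>) \<in> {..max n k} \<rightarrow> carrier V" using x by auto
    from RI[OF this] show ?thesis using analytic_poly_pad[OF x, of "max n k"] by simp
  qed
  obtain T where T: "T \<in> extensional (carrier (hardy1 V))" "bounded_op (hardy1 V) V T" "\<And>v w. (v, w) \<in> R \<Longrightarrow> T v = w"
    "\<And>F. F \<in> carrier (hardy1 V) \<Longrightarrow> nrm V (T F) \<le> 1 * nrm (hardy1 V) F"
  proof (rule extension_exists[OF H.seminormed_axioms banach_axioms, of R 1])
    show "R \<subseteq> carrier (hardy1 V) \<times> carrier V" unfolding R_def by auto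
    have "analytic_polys V \<subseteq> Domain R" unfolding analytic_polys_def using pad by blast
    then show "dense_in (hardy1 V) (Domain R)"
      using analytic_polys_dense \<open>R \<subseteq> carrier (hardy1 V) \<times> carrier V\<close> unfolding dense_in_def by blast
    show "(v \<oplus>\<^bsub>hardy1 V\<^esub> v', w \<oplus> w') \<in> R" if vw: "(v, w) \<in> R" "(v', w') \<in> R" for v w v' w'
    proof -
      obtain n x where x: "x \<in> {..n} \<rightarrow> carrier V" "k \<le> n" "v = analytic_poly V n x" "w = x k"
        using RE[OF vw(1)] by blast
      obtain m y where y: "y \<in> {..m} \<rightarrow> carrier V" "k \<le> m" "v' = analytic_poly V m y" "w' = y k"
        using RE[OF vw(2)] by blast
      define N where "N = max n m"
      have x': "(\<lambda>l. if l \<le> n then x l else \<zero>) \<in> {..N} \<rightarrow> carrier V" using x by auto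
      have y': "(\<lambda>l. if l \<le> m then y l else \<zero>) \<in> {..N} \<rightarrow> carrier V" using y by auto
      have xy: "(\<lambda>l. (if l \<le> n then x l else \<zero>) \<oplus> (if l \<le> m then y l else \<zero>)) \<in> {..N} \<rightarrow> carrier V"
        using x' y' by auto
      have "k \<le> N" using x by (simp add: N_def)
      from RI[OF xy this] show ?thesis
        using analytic_poly_add[OF x' y'] analytic_poly_pad[OF x(1), of N] analytic_poly_pad[OF y(1), of N]
        by (simp add: x y N_def)
    qed
    show "(c \<odot>\<^bsub>hardy1 V\<^esub> v, c \<odot> w) \<in> R" if vw: "(v, w) \<in> R" for c v w
    proof -
      obtain n x where x: "x \<in> {..n} \<rightarrow> carrier V" "k \<le> n" "v = analytic_poly V n x" "w = x k"
        using RE[OF vw(1)] by blast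
      have "(\<lambda>l. c \<odot> x l) \<in> {..n} \<rightarrow> carrier V" using x by auto
      from RI[OF this x(2)] show ?thesis using analytic_poly_smult[OF x(1), of c] by (simp add: x)
    qed
    show "nrm V w \<le> 1 * nrm (hardy1 V) v" if "(v, w) \<in> R" for v w
      using RE[OF that] coefficient_bound by auto
  qed (use that in auto)
  have "\<exists>T. bounded_op (hardy1 V) V T \<and>
     (\<forall>n. \<forall>x\<in>{..n} \<rightarrow> carrier V. T (analytic_poly V n x) = (if k \<le> n then x k else \<zero>))"
    using T(2) T(3)[OF pad] by blast
  from someI_ex[OF this] show "bounded_op (hardy1 V) V (hardy_coeff V k)"
    "\<And>n x. x \<in> {..n} \<rightarrow> carrier V \<Longrightarrow> hardy_coeff V k (analytic_poly V n x) = (if k \<le> n then x k else \<zero>)"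
    unfolding hardy_coeff_def[symmetric] by blast+
qed


subsection \<open>Functions with values in a line\<close>

text \<open>The class of \<open>z \<mapsto> h(z) x\<close>, where \<open>h\<close> is any representative of the class \<open>F\<close>.\<close>

definition elem_fun :: "'a cspace \<Rightarrow> (complex \<Rightarrow> complex) set \<Rightarrow> 'a \<Rightarrow> (complex \<Rightarrow> 'a) set" where
  "elem_fun X F x = L1_class X (\<lambda>z. (SOME h. h \<in> F) z \<odot>\<^bsub>X\<^esub> x)"

context normed
begin

lemma bochner_norm_scalar:
  assumes h: "bochner_integrable scalars h" and x: "x \<in> carrier V"
  shows "bochner_norm V (\<lambda>z. h z \<odot> x) = ennreal (nrm V x) * bochner_norm scalars h"
proof -
  obtain g where g: "g \<in> borel_measurable haar_circle" "AE z in haar_circle. ennreal (nrm scalars (h z)) = g z"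
    using Sc.strongly_measurable_norm h unfolding bochner_integrable_def by blast
  have "bochner_norm V (\<lambda>z. h z \<odot> x) = (\<integral>\<^sup>+z. ennreal (nrm V x) * g z \<partial>haar_circle)"
    unfolding bochner_norm_def
  proof (rule nn_integral_cong_AE)
    show "AE z in haar_circle. ennreal (nrm V (h z \<odot> x)) = ennreal (nrm V x) * g z"
      using g(2) by eventually_elim (use x in \<open>simp add: nrm_smult ennreal_mult mult.commute\<close>)
  qed
  also have "\<dots> = ennreal (nrm V x) * bochner_norm scalars h"
    unfolding bochner_norm_def nn_integral_cong_AE[OF g(2)] using g(1) by (rule nn_integral_cmult)
  finally show ?thesis .
qed

lemma bochner_integrable_scalar:
  assumes h: "bochner_integrable scalars h" and x: "x \<in> carrier V"
  shows "bochner_integrable V (\<lambda>z. h z \<odot> x)"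
  using assms bochner_norm_scalar[OF assms] strongly_measurable_scalar[of h x]
  unfolding bochner_integrable_def by (auto simp: ennreal_mult_less_top)

lemma nrm_scalar_class:
  assumes h: "bochner_integrable scalars h" and x: "x \<in> carrier V"
  shows "nrm (bochner_L1 V) (L1_class V (\<lambda>z. h z \<odot> x)) = nrm (bochner_L1 scalars) (L1_class scalars h) * nrm V x"
  using bochner_norm_scalar[OF assms] bochner_integrable_scalar[OF assms] assms
  by (simp add: nrm_L1_class Sc.nrm_L1_class enn2real_mult mult.commute)

lemma elem_fun_L1_class:
  assumes h: "bochner_integrable scalars h" and x: "x \<in> carrier V"
  shows "elem_fun V (L1_class scalars h) x = L1_class V (\<lambda>z. h z \<odot> x)"
proof -
  interpret L: normed "bochner_L1 V" by (rule bochner_L1_normed)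
  interpret LS: normed "bochner_L1 scalars" by (rule Sc.bochner_L1_normed)
  define F where "F = L1_class scalars h"
  have F: "F \<in> carrier (bochner_L1 scalars)" using h by (simp add: F_def)
  define k where "k = (SOME h. h \<in> F)"
  have "\<exists>h. h \<in> F" using Sc.L1_classE[OF F] by blast
  then have "k \<in> F" unfolding k_def by (rule someI_ex)
  then have k: "bochner_integrable scalars k" "F = L1_class scalars k"
    using Sc.L1_class_member[OF F] by auto
  have hk: "bochner_integrable scalars (\<lambda>z. h z - k z)"
    using Sc.bochner_integrable_minus[OF h k(1)] by simp
  have "L1_class scalars (\<lambda>z. h z - k z) = F \<ominus>\<^bsub>bochner_L1 scalars\<^esub> F"
    using Sc.L1_class_minus[OF h k(1)] k(2) by (simp add: F_def)
  then have 0: "nrm (bochner_L1 scalars) (L1_class scalars (\<lambda>z. h z - k z)) = 0" using F by simp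
  have hx: "L1_class V (\<lambda>z. h z \<odot> x) \<in> carrier (bochner_L1 V)" "L1_class V (\<lambda>z. k z \<odot> x) \<in> carrier (bochner_L1 V)"
    using bochner_integrable_scalar h k x by auto
  have "L1_class V (\<lambda>z. h z \<odot> x) \<ominus>\<^bsub>bochner_L1 V\<^esub> L1_class V (\<lambda>z. k z \<odot> x) = L1_class V (\<lambda>z. (h z - k z) \<odot> x)"
    using bochner_integrable_scalar h k x by (simp add: L1_class_minus smult_minus_left)
  then have "nrm (bochner_L1 V) (L1_class V (\<lambda>z. h z \<odot> x) \<ominus>\<^bsub>bochner_L1 V\<^esub> L1_class V (\<lambda>z. k z \<odot> x)) = 0"
    using nrm_scalar_class[OF hk x] 0 by simp
  then have "L1_class V (\<lambda>z. h z \<odot> x) = L1_class V (\<lambda>z. k z \<odot> x)"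
    using L.nrm_eq_0[OF L.minus_in[OF hx]] L.minus_eq_zero_iff[OF hx] by simp
  then show ?thesis by (simp add: elem_fun_def k_def F_def)
qed

lemma elem_fun_L1:
  "F \<in> carrier (bochner_L1 scalars) \<Longrightarrow> x \<in> carrier V \<Longrightarrow> elem_fun V F x \<in> carrier (bochner_L1 V)"
  by (erule Sc.L1_classE) (simp add: elem_fun_L1_class bochner_integrable_scalar)

lemma nrm_elem_fun:
  "F \<in> carrier (bochner_L1 scalars) \<Longrightarrow> x \<in> carrier V \<Longrightarrow>
     nrm (bochner_L1 V) (elem_fun V F x) = nrm (bochner_L1 scalars) F * nrm V x"
  by (erule Sc.L1_classE) (simp add: elem_fun_L1_class nrm_scalar_class)

lemma elem_fun_add_left:
  assumes "F \<in> carrier (bochner_L1 scalars)" "G \<in> carrier (bochner_L1 scalars)" "x \<in> carrier V"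
  shows "elem_fun V (F \<oplus>\<^bsub>bochner_L1 scalars\<^esub> G) x = elem_fun V F x \<oplus>\<^bsub>bochner_L1 V\<^esub> elem_fun V G x"
proof -
  obtain f where f: "bochner_integrable scalars f" "F = L1_class scalars f"
    using Sc.L1_classE[OF assms(1)] by blast
  obtain g where g: "bochner_integrable scalars g" "G = L1_class scalars g"
    using Sc.L1_classE[OF assms(2)] by blast
  have fg: "bochner_integrable scalars (\<lambda>z. f z + g z)"
    using Sc.bochner_integrable_add[OF f(1) g(1)] by simp
  have "elem_fun V (F \<oplus>\<^bsub>bochner_L1 scalars\<^esub> G) x = L1_class V (\<lambda>z. (f z + g z) \<odot> x)"
    using Sc.L1_class_add[OF f(1) g(1)] elem_fun_L1_class[OF fg assms(3)] by (simp add: f g)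
  then show ?thesis
    using assms(3) f(1) g(1)
    by (simp add: smult_add_left f(2) g(2) elem_fun_L1_class L1_class_add bochner_integrable_scalar)
qed

lemma elem_fun_smult_left:
  assumes "F \<in> carrier (bochner_L1 scalars)" "x \<in> carrier V"
  shows "elem_fun V (c \<odot>\<^bsub>bochner_L1 scalars\<^esub> F) x = c \<odot>\<^bsub>bochner_L1 V\<^esub> elem_fun V F x"
proof -
  obtain f where f: "bochner_integrable scalars f" "F = L1_class scalars f"
    using Sc.L1_classE[OF assms(1)] by blast
  have cf: "bochner_integrable scalars (\<lambda>z. c * f z)"
    using Sc.bochner_integrable_smult[OF f(1), of c] by simp
  have "elem_fun V (c \<odot>\<^bsub>bochner_L1 scalars\<^esub> F) x = L1_class V (\<lambda>z. (c * f z) \<odot> x)"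
    using Sc.L1_class_smult[OF f(1), of c] elem_fun_L1_class[OF cf assms(2)] by (simp add: f)
  then show ?thesis
    using assms(2) f(1) by (simp add: f(2) elem_fun_L1_class L1_class_smult bochner_integrable_scalar smult_smult)
qed

lemma elem_fun_add_right:
  assumes "F \<in> carrier (bochner_L1 scalars)" "x \<in> carrier V" "y \<in> carrier V"
  shows "elem_fun V F (x \<oplus> y) = elem_fun V F x \<oplus>\<^bsub>bochner_L1 V\<^esub> elem_fun V F y"
  using assms
  by (elim Sc.L1_classE) (simp add: elem_fun_L1_class L1_class_add bochner_integrable_scalar smult_add_right)

lemma elem_fun_smult_right:
  assumes "F \<in> carrier (bochner_L1 scalars)" "x \<in> carrier V"
  shows "elem_fun V F (c \<odot> x) = c \<odot>\<^bsub>bochner_L1 V\<^esub> elem_fun V F x"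
  using assms
  by (elim Sc.L1_classE)
     (simp add: elem_fun_L1_class L1_class_smult bochner_integrable_scalar smult_smult mult.commute)

lemma elem_fun_poly:
  assumes x: "x \<in> carrier V"
  shows "elem_fun V (analytic_poly scalars n c) x = analytic_poly V n (\<lambda>k. c k \<odot> x)"
proof -
  have i: "bochner_integrable scalars (poly_fun scalars n c)" by (rule Sc.poly_fun_integrable) auto
  have "poly_fun scalars n c z \<odot> x = poly_fun V n (\<lambda>k. c k \<odot> x) z" for z
    unfolding poly_fun_scalars using x by (simp add: finsum_smult_left poly_fun_def smult_smult)
  then show ?thesis unfolding analytic_poly_eq using elem_fun_L1_class[OF i x] by simp
qed

lemma bounded_op_elem_fun_L1:
  assumes x: "x \<in> carrier V"
  shows "bounded_op (bochner_L1 scalars) (bochner_L1 V) (\<lambda>F. elem_fun V F x)"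
proof -
  interpret L: normed "bochner_L1 V" by (rule bochner_L1_normed)
  interpret LS: normed "bochner_L1 scalars" by (rule Sc.bochner_L1_normed)
  have "bounded_operator (bochner_L1 scalars) (bochner_L1 V) (\<lambda>F. elem_fun V F x)"
    by (rule bounded_operatorI[where K = "nrm V x"])
       (use x in \<open>simp_all add: elem_fun_L1 elem_fun_add_left elem_fun_smult_left nrm_elem_fun mult.commute\<close>)
  then show ?thesis by unfold_locales
qed

lemma elem_fun_hardy1 [simp, intro]:
  assumes F: "F \<in> carrier (hardy1 scalars)" and x: "x \<in> carrier V"
  shows "elem_fun V F x \<in> carrier (hardy1 V)"
proof -
  interpret L: normed "bochner_L1 V" by (rule bochner_L1_normed)
  interpret LS: normed "bochner_L1 scalars" by (rule Sc.bochner_L1_normed)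
  interpret T: bounded_op "bochner_L1 scalars" "bochner_L1 V" "\<lambda>F. elem_fun V F x" by (rule bounded_op_elem_fun_L1[OF x])
  have F1: "F \<in> carrier (bochner_L1 scalars)" using F by (rule Sc.hardy1_L1)
  show ?thesis
    unfolding hardy1_carrier
  proof (intro conjI allI impI elem_fun_L1 F1 x)
    fix e :: real assume e: "e > 0"
    have "nrm V x \<ge> 0" using x by simp
    then have "e / (nrm V x + 1) > 0" using e by simp
    then obtain p where p: "p \<in> analytic_polys scalars"
        "nrm (bochner_L1 scalars) (F \<ominus>\<^bsub>bochner_L1 scalars\<^esub> p) < e / (nrm V x + 1)"
      using F unfolding Sc.hardy1_carrier by blast
    have p1: "p \<in> carrier (bochner_L1 scalars)" using p(1) Sc.analytic_polys_L1 by blast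
    obtain n c where nc: "p = analytic_poly scalars n c" using p(1) unfolding analytic_polys_def by blast
    have "elem_fun V p x \<in> analytic_polys V"
      unfolding nc elem_fun_poly[OF x] analytic_polys_def using x by blast
    moreover have "nrm (bochner_L1 V) (elem_fun V F x \<ominus>\<^bsub>bochner_L1 V\<^esub> elem_fun V p x) < e"
    proof -
      have "nrm (bochner_L1 V) (elem_fun V F x \<ominus>\<^bsub>bochner_L1 V\<^esub> elem_fun V p x) =
          nrm (bochner_L1 scalars) (F \<ominus>\<^bsub>bochner_L1 scalars\<^esub> p) * nrm V x"
        using F1 p1 x by (simp add: nrm_elem_fun flip: T.minus)
      also have "\<dots> \<le> nrm (bochner_L1 scalars) (F \<ominus>\<^bsub>bochner_L1 scalars\<^esub> p) * (nrm V x + 1)"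
        using F1 p1 by (intro mult_left_mono) auto
      also have "\<dots> < e" using p(2) \<open>nrm V x \<ge> 0\<close> by (simp add: field_simps)
      finally show ?thesis .
    qed
    ultimately show "\<exists>q\<in>analytic_polys V. nrm (bochner_L1 V) (elem_fun V F x \<ominus>\<^bsub>bochner_L1 V\<^esub> q) < e" by blast
  qed
qed

lemma bounded_op_elem_fun:
  assumes x: "x \<in> carrier V"
  shows "bounded_op (hardy1 scalars) (hardy1 V) (\<lambda>F. elem_fun V F x)"
proof -
  interpret H: normed "hardy1 V" by (rule hardy1_normed)
  interpret HS: normed "hardy1 scalars" by (rule Sc.hardy1_normed)
  have "bounded_operator (hardy1 scalars) (hardy1 V) (\<lambda>F. elem_fun V F x)"
    by (rule bounded_operatorI[where K = "nrm V x"])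
       (use x Sc.hardy1_L1 in \<open>simp_all add: elem_fun_add_left elem_fun_smult_left nrm_elem_fun mult.commute\<close>)
  then show ?thesis by unfold_locales
qed

end

lemma hardy_coeff_elem_fun:
  assumes "banach X" "x \<in> carrier X" "F \<in> carrier (hardy1 scalars)"
  shows "hardy_coeff X k (elem_fun X F x) = hardy_coeff scalars k F \<odot>\<^bsub>X\<^esub> x"
proof -
  interpret X: banach X by fact
  interpret HS: normed "hardy1 scalars" by (rule Sc.hardy1_normed)
  interpret c: bounded_op "hardy1 scalars" scalars "hardy_coeff scalars k" by (rule Sc.hardy_coeff_props(1))
  obtain K where K: "K > 0" "\<And>F. F \<in> carrier (hardy1 scalars) \<Longrightarrow> nrm scalars (hardy_coeff scalars k F) \<le> K * nrm (hardy1 scalars) F"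
    by (rule c.bound_pos) (rule that)
  have "bounded_operator (hardy1 scalars) X (\<lambda>F. hardy_coeff scalars k F \<odot>\<^bsub>X\<^esub> x)"
  proof (rule bounded_operatorI[where K = "K * nrm X x"])
    fix F assume F: "F \<in> carrier (hardy1 scalars)"
    have "cmod (hardy_coeff scalars k F) * nrm X x \<le> (K * nrm (hardy1 scalars) F) * nrm X x"
      using K(2)[OF F] assms(2) by (intro mult_right_mono) auto
    then show "nrm X (hardy_coeff scalars k F \<odot>\<^bsub>X\<^esub> x) \<le> K * nrm X x * nrm (hardy1 scalars) F"
      using assms(2) by (simp add: X.nrm_smult mult_ac)
  qed (use assms(2) c.add c.smult in \<open>simp_all add: X.smult_add_left X.smult_smult\<close>)
  then have b: "bounded_op (hardy1 scalars) X (\<lambda>F. hardy_coeff scalars k F \<odot>\<^bsub>X\<^esub> x)" by unfold_locales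
  show ?thesis
  proof (rule hardy_ops_agree[OF Sc.normed_axioms X.normed_axioms _ b _ assms(3)])
    show "bounded_op (hardy1 scalars) X (\<lambda>F. hardy_coeff X k (elem_fun X F x))"
      by (rule bounded_op_compose[OF X.bounded_op_elem_fun[OF assms(2)] X.hardy_coeff_props(1)])
    fix n and a :: "nat \<Rightarrow> complex"
    have "(\<lambda>k. a k \<odot>\<^bsub>X\<^esub> x) \<in> {..n} \<rightarrow> carrier X" using assms(2) by auto
    then show "hardy_coeff X k (elem_fun X (analytic_poly scalars n a) x) =
        hardy_coeff scalars k (analytic_poly scalars n a) \<odot>\<^bsub>X\<^esub> x"
      using assms(2) by (simp add: X.elem_fun_poly X.hardy_coeff_props(2) Sc.hardy_coeff_props(2))
  qed
qed

lemma hardy_ext_elem_fun: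
  assumes "normed Y" "banach X" "bounded_op Y X \<rho>" "y \<in> carrier Y" "F \<in> carrier (hardy1 scalars)"
  shows "hardy_ext Y X \<rho> (elem_fun Y F y) = elem_fun X F (\<rho> y)"
proof -
  interpret Y: normed Y by fact
  interpret X: banach X by fact
  interpret \<rho>: bounded_op Y X \<rho> by fact
  interpret HX: banach "hardy1 X" by (rule X.hardy1_banach)
  note e = hardy_ext_props[OF assms(1-3)]
  show ?thesis
  proof (rule hardy_ops_agree[OF Sc.normed_axioms HX.normed_axioms _ _ _ assms(5)])
    show "bounded_op (hardy1 scalars) (hardy1 X) (\<lambda>F. hardy_ext Y X \<rho> (elem_fun Y F y))"
      by (rule bounded_op_compose[OF Y.bounded_op_elem_fun[OF assms(4)] e(1)])
    show "bounded_op (hardy1 scalars) (hardy1 X) (\<lambda>F. elem_fun X F (\<rho> y))"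
      using assms(4) by (intro X.bounded_op_elem_fun) simp
    fix n and a :: "nat \<Rightarrow> complex"
    have "(\<lambda>k. a k \<odot>\<^bsub>Y\<^esub> y) \<in> {..n} \<rightarrow> carrier Y" using assms(4) by auto
    then have "hardy_ext Y X \<rho> (elem_fun Y (analytic_poly scalars n a) y) = analytic_poly X n (\<rho> \<circ> (\<lambda>k. a k \<odot>\<^bsub>Y\<^esub> y))"
      using assms(4) by (simp add: Y.elem_fun_poly e(2))
    also have "\<dots> = analytic_poly X n (\<lambda>k. a k \<odot>\<^bsub>X\<^esub> \<rho> y)"
      using assms(4) by (intro X.analytic_poly_cong) (auto simp: \<rho>.smult)
    finally show "hardy_ext Y X \<rho> (elem_fun Y (analytic_poly scalars n a) y) = elem_fun X (analytic_poly scalars n a) (\<rho> y)"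
      using assms(4) by (simp add: X.elem_fun_poly)
  qed
qed


section \<open>The canonical map\<close>

text \<open>The definite description \<open>canonical_map\<close> denotes a contraction with \<open>F \<otimes> x \<mapsto> elem_fun X F x\<close>.\<close>

lemma canonical_map_props:
  assumes "banach X"
  shows "bounded_op (proj_tensor (hardy1 scalars) X) (hardy1 X) (canonical_map X)"
    and "\<And>F x. F \<in> carrier (hardy1 scalars) \<Longrightarrow> x \<in> carrier X \<Longrightarrow>
        canonical_map X (elem_tensor (hardy1 scalars) X F x) = elem_fun X F x"
    and "\<And>u. u \<in> carrier (proj_tensor (hardy1 scalars) X) \<Longrightarrow>
        nrm (hardy1 X) (canonical_map X u) \<le> nrm (proj_tensor (hardy1 scalars) X) u"
proof -
  interpret X: banach X by fact
  interpret HX: banach "hardy1 X" by (rule X.hardy1_banach)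
  interpret HS: normed "hardy1 scalars" by (rule Sc.hardy1_normed)
  interpret tp: two_spaces "hardy1 scalars" X
    by (intro two_spaces.intro HS.seminormed_axioms X.seminormed_axioms)
  interpret P: banach "proj_tensor (hardy1 scalars) X" by (rule tp.proj_tensor_banach)
  note L1 = Sc.hardy1_L1
  obtain J where J: "J \<in> extensional (carrier (proj_tensor (hardy1 scalars) X))"
    "bounded_op (proj_tensor (hardy1 scalars) X) (hardy1 X) J"
    "\<And>F x. F \<in> carrier (hardy1 scalars) \<Longrightarrow> x \<in> carrier X \<Longrightarrow> J (elem_tensor (hardy1 scalars) X F x) = elem_fun X F x"
    "\<And>u. u \<in> carrier (proj_tensor (hardy1 scalars) X) \<Longrightarrow>
        nrm (hardy1 X) (J u) \<le> 1 * nrm (proj_tensor (hardy1 scalars) X) u"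
  proof (rule tp.tensor_lift[OF HX.banach_axioms, of 1 "elem_fun X"])
  qed (use that in \<open>simp_all add: L1 X.elem_fun_add_left X.elem_fun_add_right X.elem_fun_smult_left
      X.elem_fun_smult_right X.nrm_elem_fun\<close>)
  have "canonical_map X = J"
    unfolding canonical_map_def
  proof (rule the_equality)
    have "J (elem_tensor (hardy1 scalars) X f x) = L1_class X (\<lambda>z. h z \<odot>\<^bsub>X\<^esub> x)"
      if "f \<in> carrier (hardy1 scalars)" "h \<in> f" "x \<in> carrier X" for f h x
      using J(3)[OF that(1,3)] Sc.L1_class_member[OF L1[OF that(1)] that(2)] X.elem_fun_L1_class[of h x] that(3)
      by simp
    then show "J \<in> extensional (carrier (proj_tensor (hardy1 scalars) X)) \<and>
        bounded_operator (proj_tensor (hardy1 scalars) X) (hardy1 X) J \<and>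
        (\<forall>f\<in>carrier (hardy1 scalars). \<forall>h\<in>f. \<forall>x\<in>carrier X.
           J (elem_tensor (hardy1 scalars) X f x) = L1_class X (\<lambda>z. h z \<odot>\<^bsub>X\<^esub> x))"
      using J(1) bounded_op.bounded[OF J(2)] by blast
    fix J' assume J': "J' \<in> extensional (carrier (proj_tensor (hardy1 scalars) X)) \<and>
        bounded_operator (proj_tensor (hardy1 scalars) X) (hardy1 X) J' \<and>
        (\<forall>f\<in>carrier (hardy1 scalars). \<forall>h\<in>f. \<forall>x\<in>carrier X.
           J' (elem_tensor (hardy1 scalars) X f x) = L1_class X (\<lambda>z. h z \<odot>\<^bsub>X\<^esub> x))"
    then have b: "bounded_op (proj_tensor (hardy1 scalars) X) (hardy1 X) J'" by unfold_locales blast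
    show "J' = J"
    proof (rule extensionalityI[of _ "carrier (proj_tensor (hardy1 scalars) X)"])
      fix u assume u: "u \<in> carrier (proj_tensor (hardy1 scalars) X)"
      show "J' u = J u"
      proof (rule tp.tensor_agree[OF b J(2) HX.normed_axioms _ u])
        fix f x assume f: "f \<in> carrier (hardy1 scalars)" and x: "x \<in> carrier X"
        obtain h where h: "bochner_integrable scalars h" "f = L1_class scalars h" "h \<in> f"
          using Sc.L1_classE[OF L1[OF f]] by blast
        then show "J' (elem_tensor (hardy1 scalars) X f x) = J (elem_tensor (hardy1 scalars) X f x)"
          using J' f x J(3)[OF f x] X.elem_fun_L1_class[OF h(1) x] by simp
      qed
    qed (use J J' in auto)
  qed
  then show "bounded_op (proj_tensor (hardy1 scalars) X) (hardy1 X) (canonical_map X)"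
    "\<And>F x. F \<in> carrier (hardy1 scalars) \<Longrightarrow> x \<in> carrier X \<Longrightarrow>
        canonical_map X (elem_tensor (hardy1 scalars) X F x) = elem_fun X F x"
    "\<And>u. u \<in> carrier (proj_tensor (hardy1 scalars) X) \<Longrightarrow>
        nrm (hardy1 X) (canonical_map X u) \<le> nrm (proj_tensor (hardy1 scalars) X) u"
    using J(2-4) by auto
qed

section \<open>Strong convergence of Fejer means\<close>

lemma bounded_op_zero:
  assumes "seminormed V" "seminormed W"
  shows "bounded_op V W (\<lambda>x. \<zero>\<^bsub>W\<^esub>)"
proof -
  interpret V: seminormed V by fact
  interpret W: seminormed W by fact
  have "bounded_operator V W (\<lambda>x. \<zero>\<^bsub>W\<^esub>)" by (rule bounded_operatorI[where K = 0]) auto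
  then show ?thesis by unfold_locales
qed

lemma bounded_op_smult:
  assumes "bounded_op V W T"
  shows "bounded_op V W (\<lambda>x. c \<odot>\<^bsub>W\<^esub> T x)"
proof -
  interpret T: bounded_op V W T by fact
  obtain K where K: "K > 0" "\<And>x. x \<in> carrier V \<Longrightarrow> nrm W (T x) \<le> K * nrm V x"
    by (rule T.bound_pos) (rule that)
  have "bounded_operator V W (\<lambda>x. c \<odot>\<^bsub>W\<^esub> T x)"
  proof (rule bounded_operatorI[where K = "cmod c * K"])
    fix x assume x: "x \<in> carrier V"
    show "nrm W (c \<odot>\<^bsub>W\<^esub> T x) \<le> cmod c * K * nrm V x"
      using mult_left_mono[OF K(2)[OF x], of "cmod c"] x by (simp add: T.W.nrm_smult mult.assoc)
  qed (simp_all add: T.add T.smult T.W.smult_add_right T.W.smult_smult mult.commute)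
  then show ?thesis by unfold_locales
qed

lemma bounded_op_add:
  assumes "bounded_op V W T" "bounded_op V W S"
  shows "bounded_op V W (\<lambda>x. T x \<oplus>\<^bsub>W\<^esub> S x)"
proof -
  interpret T: bounded_op V W T by fact
  interpret S: bounded_op V W S by fact
  obtain K where K: "K > 0" "\<And>x. x \<in> carrier V \<Longrightarrow> nrm W (T x) \<le> K * nrm V x"
    by (rule T.bound_pos) (rule that)
  obtain L where L: "L > 0" "\<And>x. x \<in> carrier V \<Longrightarrow> nrm W (S x) \<le> L * nrm V x"
    by (rule S.bound_pos) (rule that)
  have "bounded_operator V W (\<lambda>x. T x \<oplus>\<^bsub>W\<^esub> S x)"
  proof (rule bounded_operatorI[where K = "K + L"])
    fix x assume x: "x \<in> carrier V"
    show "nrm W (T x \<oplus>\<^bsub>W\<^esub> S x) \<le> (K + L) * nrm V x"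
      using T.W.nrm_triangle[of "T x" "S x"] K(2)[OF x] L(2)[OF x] x by (simp add: distrib_right)
  qed (simp_all add: T.add S.add T.smult S.smult T.W.smult_add_right T.W.a_ac)
  then show ?thesis by unfold_locales
qed

lemma bounded_op_finsum:
  assumes "seminormed V" "seminormed W" "finite A" "\<And>i. i \<in> A \<Longrightarrow> bounded_op V W (T i)"
  shows "bounded_op V W (\<lambda>x. \<Oplus>\<^bsub>W\<^esub>i\<in>A. T i x)"
  using assms(3,4)
proof (induction A rule: finite_induct)
  case empty
  interpret W: seminormed W by fact
  show ?case using bounded_op_zero[OF assms(1,2)] by simp
next
  case (insert i A)
  interpret W: seminormed W by fact
  have c: "T j x \<in> carrier W" if "x \<in> carrier V" "j \<in> insert i A" for x j
    using bounded_op.closed[OF insert.prems[OF that(2)] that(1)] .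
  have eq: "(\<Oplus>\<^bsub>W\<^esub>j\<in>insert i A. T j x) = T i x \<oplus>\<^bsub>W\<^esub> (\<Oplus>\<^bsub>W\<^esub>j\<in>A. T j x)" if "x \<in> carrier V" for x
    using insert.hyps c[OF that] by (intro W.finsum_insert) auto
  interpret S: bounded_op V W "\<lambda>x. T i x \<oplus>\<^bsub>W\<^esub> (\<Oplus>\<^bsub>W\<^esub>j\<in>A. T j x)"
    using insert by (intro bounded_op_add) auto
  have "bounded_operator V W (\<lambda>x. \<Oplus>\<^bsub>W\<^esub>j\<in>insert i A. T j x)"
    using S.bounded unfolding bounded_operator_def by (simp add: eq Pi_iff)
  then show ?case by (intro bounded_op.intro bounded_op_axioms.intro assms)
qed

text \<open>Contractions that converge to the identity on a dense set converge to it everywhere.\<close>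

lemma strong_limit_dense:
  assumes "seminormed V" "\<And>n. bounded_op V V (T n)" "dense_in V D"
    and contr: "\<And>n x. n > 0 \<Longrightarrow> x \<in> carrier V \<Longrightarrow> nrm V (T n x) \<le> nrm V x"
    and D: "\<And>d. d \<in> D \<Longrightarrow> (\<lambda>n. nrm V (T n d \<ominus>\<^bsub>V\<^esub> d)) \<longlonglongrightarrow> 0"
    and x: "x \<in> carrier V"
  shows "(\<lambda>n. nrm V (T n x \<ominus>\<^bsub>V\<^esub> x)) \<longlonglongrightarrow> 0"
proof (rule LIMSEQ_I)
  interpret V: seminormed V by fact
  fix e :: real assume "e > 0"
  then have e: "e / 3 > 0" by simp
  obtain d where d: "d \<in> D" "d \<in> carrier V" "nrm V (x \<ominus>\<^bsub>V\<^esub> d) < e / 3"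
    using dense_inE[OF assms(3) x e] by blast
  obtain N where N: "\<And>n. n \<ge> N \<Longrightarrow> nrm V (T n d \<ominus>\<^bsub>V\<^esub> d) < e / 3"
    using order_tendstoD(2)[OF D[OF d(1)] e] by (auto simp: eventually_sequentially)
  have "nrm V (T n x \<ominus>\<^bsub>V\<^esub> x) < e" if n: "n \<ge> max N 1" for n
  proof -
    interpret T: bounded_op V V "T n" by (rule assms(2))
    have "nrm V (T n x \<ominus>\<^bsub>V\<^esub> T n d) \<le> nrm V (x \<ominus>\<^bsub>V\<^esub> d)"
      using contr[of n "x \<ominus>\<^bsub>V\<^esub> d"] n x d by (simp add: T.minus)
    moreover have "nrm V (T n x \<ominus>\<^bsub>V\<^esub> x) \<le> nrm V (T n x \<ominus>\<^bsub>V\<^esub> T n d) + nrm V (T n d \<ominus>\<^bsub>V\<^esub> x)"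
      using x d by (intro V.dist_triangle) auto
    moreover have "nrm V (T n d \<ominus>\<^bsub>V\<^esub> x) \<le> nrm V (T n d \<ominus>\<^bsub>V\<^esub> d) + nrm V (d \<ominus>\<^bsub>V\<^esub> x)"
      using x d by (intro V.dist_triangle) auto
    moreover have "nrm V (T n d \<ominus>\<^bsub>V\<^esub> d) < e / 3" using N n by simp
    ultimately show ?thesis using d V.nrm_minus_commute[OF x d(2)] by linarith
  qed
  moreover have "T n x \<in> carrier V" for n using bounded_op.closed[OF assms(2) x] .
  ultimately show "\<exists>no. \<forall>n\<ge>no. norm (nrm V (T n x \<ominus>\<^bsub>V\<^esub> x) - 0) < e"
    using x by (intro exI[of _ "max N 1"]) simp
qed

text \<open>The class of \<open>z \<mapsto> z\<^sup>k\<close> in the scalar Hardy space.\<close>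

definition monomial :: "nat \<Rightarrow> (complex \<Rightarrow> complex) set" where
  "monomial k = analytic_poly scalars k (\<lambda>l. if l = k then 1 else 0)"

lemma monomial_hardy1 [simp, intro]: "monomial k \<in> carrier (hardy1 scalars)"
  unfolding monomial_def by (rule Sc.analytic_poly_hardy1) auto

lemma finsum_monomials:
  "(\<Oplus>\<^bsub>hardy1 scalars\<^esub>k\<in>{..N}. c k \<odot>\<^bsub>hardy1 scalars\<^esub> monomial k) = analytic_poly scalars N c"
proof -
  interpret HS: normed "hardy1 scalars" by (rule Sc.hardy1_normed)
  have m: "c k \<odot>\<^bsub>hardy1 scalars\<^esub> monomial k = analytic_poly scalars N (\<lambda>l. if l = k then c k else 0)" if "k \<le> N" for k N
  proof -
    have "c k \<odot>\<^bsub>hardy1 scalars\<^esub> monomial k = analytic_poly scalars k (\<lambda>l. c k * (if l = k then 1 else 0))"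
      unfolding monomial_def using Sc.analytic_poly_smult[of "\<lambda>l. if l = k then 1 else 0" k "c k"] by simp
    also have "\<dots> = analytic_poly scalars N (\<lambda>l. if l \<le> k then c k * (if l = k then 1 else 0) else 0)"
      using Sc.analytic_poly_pad[of "\<lambda>l. c k * (if l = k then 1 else 0)" k N] that by (simp cong: if_cong)
    also have "\<dots> = analytic_poly scalars N (\<lambda>l. if l = k then c k else 0)"
      by (rule arg_cong[of _ _ "analytic_poly scalars N"]) auto
    finally show ?thesis .
  qed
  show ?thesis
  proof (induction N)
    case 0
    have "(\<Oplus>\<^bsub>hardy1 scalars\<^esub>k\<in>{..0}. c k \<odot>\<^bsub>hardy1 scalars\<^esub> monomial k) = c 0 \<odot>\<^bsub>hardy1 scalars\<^esub> monomial 0"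
      by (simp del: hardy1_ops)
    also have "\<dots> = analytic_poly scalars 0 (\<lambda>l. if l = 0 then c 0 else 0)" by (rule m) simp
    also have "\<dots> = analytic_poly scalars 0 c" by (rule Sc.analytic_poly_cong) auto
    finally show ?case .
  next
    case (Suc N)
    have "(\<Oplus>\<^bsub>hardy1 scalars\<^esub>k\<in>{..Suc N}. c k \<odot>\<^bsub>hardy1 scalars\<^esub> monomial k) =
        c (Suc N) \<odot>\<^bsub>hardy1 scalars\<^esub> monomial (Suc N) \<oplus>\<^bsub>hardy1 scalars\<^esub> analytic_poly scalars N c"
      unfolding Suc.IH[symmetric] by (rule HS.finsum_Suc) (auto simp del: hardy1_ops)
    also have "\<dots> = analytic_poly scalars (Suc N) (\<lambda>l. (if l = Suc N then c (Suc N) else 0) + (if l \<le> N then c l else 0))"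
      using Sc.analytic_poly_add[of "\<lambda>l. if l = Suc N then c (Suc N) else 0" "Suc N" "\<lambda>l. if l \<le> N then c l else 0"]
        Sc.analytic_poly_pad[of c N "Suc N"] m[of "Suc N" "Suc N"] by (simp cong: if_cong)
    also have "\<dots> = analytic_poly scalars (Suc N) c"
      by (rule Sc.analytic_poly_cong) (auto simp: le_Suc_eq)
    finally show ?case .
  qed
qed

text \<open>The Fejer means on the scalar Hardy space.\<close>

definition fejer_mean :: "nat \<Rightarrow> (complex \<Rightarrow> complex) set \<Rightarrow> (complex \<Rightarrow> complex) set" where
  "fejer_mean n F = (\<Oplus>\<^bsub>hardy1 scalars\<^esub>k\<in>{..n}.
     (complex_of_real (fejer n k) * hardy_coeff scalars k F) \<odot>\<^bsub>hardy1 scalars\<^esub> monomial k)"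

lemma bounded_op_fejer_mean: "bounded_op (hardy1 scalars) (hardy1 scalars) (fejer_mean n)"
proof -
  interpret HS: normed "hardy1 scalars" by (rule Sc.hardy1_normed)
  have "bounded_op (hardy1 scalars) (hardy1 scalars)
      (\<lambda>F. (complex_of_real (fejer n k) * hardy_coeff scalars k F) \<odot>\<^bsub>hardy1 scalars\<^esub> monomial k)" for k
  proof -
    interpret c: bounded_op "hardy1 scalars" scalars "hardy_coeff scalars k" by (rule Sc.hardy_coeff_props(1))
    have "bounded_op scalars (hardy1 scalars) (\<lambda>a. a \<odot>\<^bsub>hardy1 scalars\<^esub> monomial k)"
    proof -
      have "bounded_operator scalars (hardy1 scalars) (\<lambda>a. a \<odot>\<^bsub>hardy1 scalars\<^esub> monomial k)"
        by (rule bounded_operatorI[where K = "nrm (hardy1 scalars) (monomial k)"])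
           (simp_all add: HS.smult_add_left HS.smult_smult HS.nrm_smult mult.commute del: hardy1_ops)
      then show ?thesis by unfold_locales
    qed
    from bounded_op_compose[OF bounded_op_smult[OF c.bounded_op_axioms, of "complex_of_real (fejer n k)"] this]
    show ?thesis by simp
  qed
  then show ?thesis
    unfolding fejer_mean_def[abs_def] by (intro bounded_op_finsum HS.seminormed_axioms) auto
qed

lemma fejer_mean_poly:
  "fejer_mean n (analytic_poly scalars d c) = analytic_poly scalars d (\<lambda>l. complex_of_real (fejer n l) * c l)"
proof -
  interpret HS: normed "hardy1 scalars" by (rule Sc.hardy1_normed)
  define N where "N = max n d"
  define b where "b k = complex_of_real (fejer n k) * (if k \<le> d then c k else 0)" for k
  have co: "hardy_coeff scalars k (analytic_poly scalars d c) = (if k \<le> d then c k else 0)" for k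
    using Sc.hardy_coeff_props(2)[of c d k] by simp
  have "fejer_mean n (analytic_poly scalars d c) = (\<Oplus>\<^bsub>hardy1 scalars\<^esub>k\<in>{..n}. b k \<odot>\<^bsub>hardy1 scalars\<^esub> monomial k)"
    by (simp only: fejer_mean_def co b_def)
  also have "\<dots> = (\<Oplus>\<^bsub>hardy1 scalars\<^esub>k\<in>{..N}. b k \<odot>\<^bsub>hardy1 scalars\<^esub> monomial k)"
  proof (rule HS.add.finprod_mono_neutral_cong_left)
    fix i assume "i \<in> {..N} - {..n}"
    then have "b i = 0" by (simp add: b_def fejer_def)
    then show "b i \<odot>\<^bsub>hardy1 scalars\<^esub> monomial i = \<zero>\<^bsub>hardy1 scalars\<^esub>"
      using HS.zero_smult[OF monomial_hardy1] by simp
  qed (auto simp: N_def simp del: hardy1_ops)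
  also have "\<dots> = analytic_poly scalars N b" by (rule finsum_monomials)
  also have "\<dots> = analytic_poly scalars N (\<lambda>k. if k \<le> d then complex_of_real (fejer n k) * c k else 0)"
    by (rule Sc.analytic_poly_cong) (auto simp: b_def)
  also have "\<dots> = analytic_poly scalars d (\<lambda>l. complex_of_real (fejer n l) * c l)"
    using Sc.analytic_poly_pad[of "\<lambda>l. complex_of_real (fejer n l) * c l" d N] by (simp add: N_def cong: if_cong)
  finally show ?thesis .
qed

lemma fejer_mean_contraction:
  assumes "n > 0" "F \<in> carrier (hardy1 scalars)"
  shows "nrm (hardy1 scalars) (fejer_mean n F) \<le> nrm (hardy1 scalars) F"
proof -
  have "nrm (hardy1 scalars) (fejer_mean n d) \<le> 1 * nrm (hardy1 scalars) d" if "d \<in> analytic_polys scalars" for d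
  proof -
    obtain m c where "d = analytic_poly scalars m c" using \<open>d \<in> analytic_polys scalars\<close> unfolding analytic_polys_def by blast
    then show ?thesis using Sc.fejer_contraction[of c m n] assms(1) by (simp add: fejer_mean_poly)
  qed
  from bound_on_dense[OF bounded_op_fejer_mean Sc.analytic_polys_dense this assms(2)] show ?thesis by simp
qed

lemma fejer_tendsto: "(\<lambda>n. fejer n l) \<longlonglongrightarrow> 1"
proof -
  have "(\<lambda>n. 1 - real l / real n) \<longlonglongrightarrow> 1 - 0"
    by (intro tendsto_diff tendsto_const lim_const_over_n)
  moreover have "\<forall>\<^sub>F n in sequentially. 1 - real l / real n = fejer n l"
    using eventually_ge_at_top[of "Suc l"]
    by eventually_elim (simp add: fejer_def of_nat_diff diff_divide_distrib)
  ultimately show ?thesis by (simp add: tendsto_cong)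
qed

lemma fejer_mean_tendsto:
  assumes "F \<in> carrier (hardy1 scalars)"
  shows "(\<lambda>n. nrm (hardy1 scalars) (fejer_mean n F \<ominus>\<^bsub>hardy1 scalars\<^esub> F)) \<longlonglongrightarrow> 0"
proof -
  interpret HS: normed "hardy1 scalars" by (rule Sc.hardy1_normed)
  show ?thesis
  proof (rule strong_limit_dense[OF HS.seminormed_axioms bounded_op_fejer_mean Sc.analytic_polys_dense
        fejer_mean_contraction _ assms])
    fix d assume "d \<in> analytic_polys scalars"
    then obtain m c where d: "d = analytic_poly scalars m c" unfolding analytic_polys_def by blast
    show "(\<lambda>n. nrm (hardy1 scalars) (fejer_mean n d \<ominus>\<^bsub>hardy1 scalars\<^esub> d)) \<longlonglongrightarrow> 0"
    proof (rule tendsto_sandwich[OF _ _ tendsto_const])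
      have "(\<lambda>n. \<Sum>l\<le>m. \<bar>fejer n l - 1\<bar> * cmod (c l)) \<longlonglongrightarrow> (\<Sum>l\<le>m. \<bar>1 - 1\<bar> * cmod (c l))"
        by (intro tendsto_sum tendsto_mult tendsto_const tendsto_rabs tendsto_diff fejer_tendsto)
      then show "(\<lambda>n. \<Sum>l\<le>m. \<bar>fejer n l - 1\<bar> * cmod (c l)) \<longlonglongrightarrow> 0" by simp
      have "nrm (hardy1 scalars) (fejer_mean n d \<ominus>\<^bsub>hardy1 scalars\<^esub> d) \<le> (\<Sum>l\<le>m. \<bar>fejer n l - 1\<bar> * cmod (c l))" for n
      proof -
        have "fejer_mean n d \<ominus>\<^bsub>hardy1 scalars\<^esub> d =
            analytic_poly scalars m (\<lambda>l. complex_of_real (fejer n l) * c l) \<ominus>\<^bsub>bochner_L1 scalars\<^esub> analytic_poly scalars m c"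
          unfolding d fejer_mean_poly by (rule Sc.hardy1_minus) auto
        also have "\<dots> = analytic_poly scalars m (\<lambda>l. complex_of_real (fejer n l) * c l - c l)"
          using Sc.analytic_poly_minus[of "\<lambda>l. complex_of_real (fejer n l) * c l" m c] by simp
        finally have "nrm (hardy1 scalars) (fejer_mean n d \<ominus>\<^bsub>hardy1 scalars\<^esub> d) \<le>
            (\<Sum>l\<le>m. cmod (complex_of_real (fejer n l) * c l - c l))"
          using Sc.nrm_analytic_poly_le[of "\<lambda>l. complex_of_real (fejer n l) * c l - c l" m] by simp
        moreover have "cmod (complex_of_real (fejer n l) * c l - c l) = \<bar>fejer n l - 1\<bar> * cmod (c l)" for l
        proof -
          have "complex_of_real (fejer n l) * c l - c l = complex_of_real (fejer n l - 1) * c l"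
            by (simp add: algebra_simps)
          then show ?thesis by (simp only: norm_mult norm_of_real)
        qed
        ultimately show ?thesis by simp
      qed
      then show "\<forall>\<^sub>F n in sequentially. nrm (hardy1 scalars) (fejer_mean n d \<ominus>\<^bsub>hardy1 scalars\<^esub> d) \<le> (\<Sum>l\<le>m. \<bar>fejer n l - 1\<bar> * cmod (c l))"
        by simp
      have "fejer_mean n d \<in> carrier (hardy1 scalars)" "d \<in> carrier (hardy1 scalars)" for n
        unfolding d fejer_mean_poly by auto
      then show "\<forall>\<^sub>F n in sequentially. 0 \<le> nrm (hardy1 scalars) (fejer_mean n d \<ominus>\<^bsub>hardy1 scalars\<^esub> d)"
        using HS.minus_in HS.nrm_ge_0 by (intro always_eventually allI) blast
    qed
  qed
qed

section \<open>Injectivity of the canonical map\<close>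

text \<open>
  A Banach space \<open>X\<close> with the projective tensor product \<open>P\<close> of the scalar Hardy space \<open>H\<close> and \<open>X\<close>, and the
  canonical map \<open>J\<close> from \<open>P\<close> to the Hardy space of \<open>X\<close>.
\<close>

locale tensor_H1 = X: banach X for X :: "'x cspace"
begin

abbreviation H where "H \<equiv> hardy1 scalars"
abbreviation P where "P \<equiv> proj_tensor (hardy1 scalars) X"
abbreviation J where "J \<equiv> canonical_map X"

sublocale HS: banach H by (rule Sc.hardy1_banach)
sublocale HX: banach "hardy1 X" by (rule X.hardy1_banach)
sublocale P: banach P
  by (intro two_spaces.proj_tensor_banach two_spaces.intro HS.seminormed_axioms X.seminormed_axioms)
sublocale tp: two_spaces H X
  by (intro two_spaces.intro HS.seminormed_axioms X.seminormed_axioms)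
sublocale J: bounded_op P "hardy1 X" J by (rule canonical_map_props(1)[OF X.banach_axioms])

lemma bounded_op_elem_tensor_right: "F \<in> carrier H \<Longrightarrow> bounded_op X P (elem_tensor H X F)"
proof -
  assume F: "F \<in> carrier H"
  have "bounded_operator X P (elem_tensor H X F)"
    by (rule bounded_operatorI[where K = "nrm H F"])
       (use F tp.nrm_elem_tensor_le in \<open>simp_all add: tp.elem_tensor_add_right tp.elem_tensor_smult_right del: hardy1_ops\<close>)
  then show ?thesis by unfold_locales
qed

lemma bounded_op_elem_tensor_left: "x \<in> carrier X \<Longrightarrow> bounded_op H P (\<lambda>F. elem_tensor H X F x)"
proof -
  assume x: "x \<in> carrier X"
  have "bounded_operator H P (\<lambda>F. elem_tensor H X F x)"
  proof (rule bounded_operatorI[where K = "nrm X x"])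
    fix F assume "F \<in> carrier H"
    then show "nrm P (elem_tensor H X F x) \<le> nrm X x * nrm H F"
      using tp.nrm_elem_tensor_le[of F x] x by (simp add: mult.commute del: hardy1_ops)
  qed (use x in \<open>simp_all add: tp.elem_tensor_add_left tp.elem_tensor_smult_left del: hardy1_ops\<close>)
  then show ?thesis by unfold_locales
qed

text \<open>
  The Fejer means of the first factor. They depend on a tensor through its image under the canonical
  map only.
\<close>

definition smooth :: "nat \<Rightarrow> (complex \<Rightarrow> 'x) set \<Rightarrow> (nat \<Rightarrow> ((complex \<Rightarrow> complex) set \<times> 'x \<Rightarrow>\<^sub>0 complex) set) set" where
  "smooth n G = (\<Oplus>\<^bsub>P\<^esub>k\<in>{..n}. complex_of_real (fejer n k) \<odot>\<^bsub>P\<^esub> elem_tensor H X (monomial k) (hardy_coeff X k G))"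

lemma bounded_op_smooth: "bounded_op (hardy1 X) P (smooth n)"
  unfolding smooth_def[abs_def]
  by (intro bounded_op_finsum bounded_op_smult bounded_op_compose[OF X.hardy_coeff_props(1) bounded_op_elem_tensor_right]
      HX.seminormed_axioms P.seminormed_axioms) auto

lemma smooth_elem:
  assumes F: "F \<in> carrier H" and x: "x \<in> carrier X"
  shows "smooth n (J (elem_tensor H X F x)) = elem_tensor H X (fejer_mean n F) x"
proof -
  interpret L: bounded_op H P "\<lambda>F. elem_tensor H X F x" by (rule bounded_op_elem_tensor_left[OF x])
  have J: "J (elem_tensor H X F x) = elem_fun X F x"
    by (rule canonical_map_props(2)[OF X.banach_axioms F x])
  have "elem_tensor H X (fejer_mean n F) x =
      (\<Oplus>\<^bsub>P\<^esub>k\<in>{..n}. elem_tensor H X ((complex_of_real (fejer n k) * hardy_coeff scalars k F) \<odot>\<^bsub>H\<^esub> monomial k) x)"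
    unfolding fejer_mean_def by (rule L.finsum) (auto simp del: hardy1_ops)
  also have "\<dots> = smooth n (elem_fun X F x)"
    unfolding smooth_def
  proof (rule P.finsum_cong'[OF refl])
    fix k
    have "elem_tensor H X ((complex_of_real (fejer n k) * hardy_coeff scalars k F) \<odot>\<^bsub>H\<^esub> monomial k) x =
        (complex_of_real (fejer n k) * hardy_coeff scalars k F) \<odot>\<^bsub>P\<^esub> elem_tensor H X (monomial k) x"
      by (rule tp.elem_tensor_smult_left[OF monomial_hardy1 x])
    also have "\<dots> = complex_of_real (fejer n k) \<odot>\<^bsub>P\<^esub> (hardy_coeff scalars k F \<odot>\<^bsub>P\<^esub> elem_tensor H X (monomial k) x)"
      using x by (intro P.smult_smult[symmetric] tp.elem_tensor_closed) auto
    also have "hardy_coeff scalars k F \<odot>\<^bsub>P\<^esub> elem_tensor H X (monomial k) x =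
        elem_tensor H X (monomial k) (hardy_coeff X k (elem_fun X F x))"
      unfolding hardy_coeff_elem_fun[OF X.banach_axioms x F]
      by (rule tp.elem_tensor_smult_right[symmetric, OF monomial_hardy1 x])
    finally show "elem_tensor H X ((complex_of_real (fejer n k) * hardy_coeff scalars k F) \<odot>\<^bsub>H\<^esub> monomial k) x =
        complex_of_real (fejer n k) \<odot>\<^bsub>P\<^esub> elem_tensor H X (monomial k) (hardy_coeff X k (elem_fun X F x))" .
  next
    have "hardy_coeff X k (elem_fun X F x) \<in> carrier X" for k
      using X.elem_fun_hardy1[OF F x] by (rule bounded_op.closed[OF X.hardy_coeff_props(1)])
    then show "(\<lambda>k. complex_of_real (fejer n k) \<odot>\<^bsub>P\<^esub> elem_tensor H X (monomial k) (hardy_coeff X k (elem_fun X F x)))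
        \<in> {..n} \<rightarrow> carrier P" by auto
  qed
  finally show ?thesis using J by simp
qed

lemma smooth_contraction:
  assumes "n > 0" "u \<in> carrier P"
  shows "nrm P (smooth n (J u)) \<le> nrm P u"
proof -
  have b: "bounded_op P P (\<lambda>u. smooth n (J u))" by (rule bounded_op_compose[OF J.bounded_op_axioms bounded_op_smooth])
  have "nrm P (smooth n (J u)) \<le> 1 * nrm P u"
  proof (rule tp.tensor_bound[OF b P.banach_axioms _ _ assms(2)])
    fix F x assume F: "F \<in> carrier H" and x: "x \<in> carrier X"
    have c: "fejer_mean n F \<in> carrier H" using F by (rule bounded_op.closed[OF bounded_op_fejer_mean])
    have "nrm P (elem_tensor H X (fejer_mean n F) x) \<le> nrm H (fejer_mean n F) * nrm X x"
      by (rule tp.nrm_elem_tensor_le[OF c x])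
    also have "\<dots> \<le> nrm H F * nrm X x"
      using fejer_mean_contraction[OF assms(1) F] x by (intro mult_right_mono) auto
    finally show "nrm P (smooth n (J (elem_tensor H X F x))) \<le> 1 * (nrm H F * nrm X x)"
      by (simp add: smooth_elem[OF F x] del: hardy1_ops)
  qed simp
  then show ?thesis by simp
qed

lemma smooth_tendsto:
  assumes "u \<in> carrier P"
  shows "(\<lambda>n. nrm P (smooth n (J u) \<ominus>\<^bsub>P\<^esub> u)) \<longlonglongrightarrow> 0"
proof (rule strong_limit_dense[OF P.seminormed_axioms bounded_op_compose[OF J.bounded_op_axioms bounded_op_smooth]
      tp.tensor_class_dense smooth_contraction _ assms])
  fix d assume "d \<in> tp.tensor_class ` carrier (free_space H X)"
  then obtain w where w: "w \<in> carrier (free_space H X)" "d = tp.tensor_class w" by blast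
  have b: "bounded_op P P (\<lambda>u. smooth n (J u))" for n by (rule bounded_op_compose[OF J.bounded_op_axioms bounded_op_smooth])
  have "(\<lambda>n. nrm P (smooth n (J (tp.tensor_class w)) \<ominus>\<^bsub>P\<^esub> tp.tensor_class w)) \<longlonglongrightarrow> 0"
    using w(1)
  proof (rule tp.free_induct)
    have "tp.tensor_class 0 = \<zero>\<^bsub>P\<^esub>" using tp.tc.zero by (simp add: tp.free_ops)
    then show "(\<lambda>n. nrm P (smooth n (J (tp.tensor_class 0)) \<ominus>\<^bsub>P\<^esub> tp.tensor_class 0)) \<longlonglongrightarrow> 0"
      using bounded_op.zero[OF b] by simp
    fix F x c w assume F: "F \<in> carrier H" and x: "x \<in> carrier X" and w: "w \<in> carrier (free_space H X)"
      and IH: "(\<lambda>n. nrm P (smooth n (J (tp.tensor_class w)) \<ominus>\<^bsub>P\<^esub> tp.tensor_class w)) \<longlonglongrightarrow> 0"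
    define v where "v = elem_tensor H X F x"
    have v: "v \<in> carrier P" unfolding v_def by (rule tp.elem_tensor_closed[OF F x])
    have cw: "tp.tensor_class (Poly_Mapping.single (F, x) c + w) = c \<odot>\<^bsub>P\<^esub> v \<oplus>\<^bsub>P\<^esub> tp.tensor_class w"
      using tp.tc.add[OF tp.single_free[OF F x, of c] w] tp.tensor_class_single[OF F x, of c]
      by (simp add: tp.free_ops v_def)
    have wc: "tp.tensor_class w \<in> carrier P" using w by (rule tp.tc.closed)
    have bc: "smooth n (J u) \<in> carrier P" if "u \<in> carrier P" for n u by (rule bounded_op.closed[OF b that])
    interpret L: bounded_op H P "\<lambda>F. elem_tensor H X F x" by (rule bounded_op_elem_tensor_left[OF x])
    have "(\<lambda>n. nrm P (smooth n (J v) \<ominus>\<^bsub>P\<^esub> v)) \<longlonglongrightarrow> 0"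
      unfolding v_def smooth_elem[OF F x]
      by (rule L.tendsto[OF bounded_op.closed[OF bounded_op_fejer_mean F] F fejer_mean_tendsto[OF F]])
    then have "(\<lambda>n. nrm P (c \<odot>\<^bsub>P\<^esub> smooth n (J v) \<ominus>\<^bsub>P\<^esub> c \<odot>\<^bsub>P\<^esub> v)) \<longlonglongrightarrow> 0"
      by (intro P.limit_smult bc v)
    then have "(\<lambda>n. nrm P ((c \<odot>\<^bsub>P\<^esub> smooth n (J v) \<oplus>\<^bsub>P\<^esub> smooth n (J (tp.tensor_class w))) \<ominus>\<^bsub>P\<^esub> (c \<odot>\<^bsub>P\<^esub> v \<oplus>\<^bsub>P\<^esub> tp.tensor_class w))) \<longlonglongrightarrow> 0"
      using IH by (intro P.limit_add P.smult_in bc v wc)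
    moreover have "smooth n (J (c \<odot>\<^bsub>P\<^esub> v \<oplus>\<^bsub>P\<^esub> tp.tensor_class w)) =
        c \<odot>\<^bsub>P\<^esub> smooth n (J v) \<oplus>\<^bsub>P\<^esub> smooth n (J (tp.tensor_class w))" for n
      using bounded_op.add[OF b P.smult_in[OF v] wc] bounded_op.smult[OF b v] by simp
    ultimately show "(\<lambda>n. nrm P (smooth n (J (tp.tensor_class (Poly_Mapping.single (F, x) c + w))) \<ominus>\<^bsub>P\<^esub>
        tp.tensor_class (Poly_Mapping.single (F, x) c + w))) \<longlonglongrightarrow> 0"
      by (simp add: cw)
  qed
  then show "(\<lambda>n. nrm P (smooth n (J d) \<ominus>\<^bsub>P\<^esub> d)) \<longlonglongrightarrow> 0" by (simp add: w(2))
qed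

text \<open>If \<open>J u = J v\<close>, then the smoothed tensors coincide, and they converge to \<open>u\<close> and to \<open>v\<close>.\<close>

lemma canonical_map_inj:
  assumes "u \<in> carrier P" "v \<in> carrier P" "J u = J v"
  shows "u = v"
  by (rule P.limit_unique[OF bounded_op.closed[OF bounded_op_smooth] assms(1,2) smooth_tendsto[OF assms(1)]])
     (use assms smooth_tendsto[OF assms(2)] in auto)

lemma canonical_map_bounded_below:
  assumes "H1_projective X"
  obtains C where "C > 0" "\<And>u. u \<in> carrier P \<Longrightarrow> nrm P u \<le> C * nrm (hardy1 X) (J u)"
proof -
  have "J ` carrier P = carrier (hardy1 X)" using assms unfolding H1_projective_def .
  then obtain C where C: "C > 0"
    "\<And>F. F \<in> carrier (hardy1 X) \<Longrightarrow> \<exists>u\<in>carrier P. J u = F \<and> nrm P u \<le> C * nrm (hardy1 X) F"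
    using open_mapping[OF P.banach_axioms HX.banach_axioms J.bounded_op_axioms] by blast
  have "nrm P u \<le> C * nrm (hardy1 X) (J u)" if u: "u \<in> carrier P" for u
  proof -
    obtain v where v: "v \<in> carrier P" "J v = J u" "nrm P v \<le> C * nrm (hardy1 X) (J u)"
      using C(2)[OF J.closed[OF u]] by blast
    then show ?thesis using canonical_map_inj[OF v(1) u v(2)] by simp
  qed
  then show thesis using that C(1) by blast
qed

text \<open>
  Tensors lift through an operator onto \<open>X\<close> term by term.
\<close>

lemma lift_canonical:
  assumes "banach Y" "bounded_op Y X \<rho>" "C \<ge> 0"
    and lift: "\<And>x. x \<in> carrier X \<Longrightarrow> \<exists>y\<in>carrier Y. \<rho> y = x \<and> nrm Y y \<le> C * nrm X x"
    and u: "u \<in> carrier P" and e: "e > 0"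
  obtains G where "G \<in> carrier (hardy1 Y)" "hardy_ext Y X \<rho> G = J u" "nrm (hardy1 Y) G \<le> C * nrm P u + e"
proof -
  interpret Y: banach Y by fact
  interpret \<rho>: bounded_op Y X \<rho> by fact
  interpret HY: banach "hardy1 Y" by (rule Y.hardy1_banach)
  note ext = hardy_ext_props[OF Y.normed_axioms X.banach_axioms \<rho>.bounded_op_axioms]
  have "\<forall>x\<in>carrier X. \<exists>y. y \<in> carrier Y \<and> \<rho> y = x \<and> nrm Y y \<le> C * nrm X x" using lift by blast
  from bchoice[OF this] obtain g where g: "\<And>x. x \<in> carrier X \<Longrightarrow> g x \<in> carrier Y"
    "\<And>x. x \<in> carrier X \<Longrightarrow> \<rho> (g x) = x" "\<And>x. x \<in> carrier X \<Longrightarrow> nrm Y (g x) \<le> C * nrm X x"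
    by blast
  have "\<exists>G\<in>carrier (hardy1 Y). hardy_ext Y X \<rho> G = J d \<and> nrm (hardy1 Y) G \<le> C * nrm P d + \<delta>"
    if d: "d \<in> tp.tensor_class ` carrier (free_space H X)" and \<delta>: "\<delta> > 0" for d \<delta>
  proof -
    obtain w where w: "w \<in> carrier (free_space H X)" "d = tp.tensor_class w" using d by blast
    have "nrm P (tp.tensor_class w) < nrm P d + \<delta> / (C + 1)" using w \<delta> \<open>C \<ge> 0\<close> by simp
    then obtain v where v: "v \<in> carrier (free_space H X)" "tp.tensor_class v = d"
        "nrm (free_space H X) v < nrm P d + \<delta> / (C + 1)"
      using tp.tensor_class_representative[OF w(1)] w(2) by metis
    define \<Phi> where "\<Phi> p = elem_fun Y (fst p) (g (snd p))" for p
    define G where "G = lin_ext (hardy1 Y) \<Phi> v"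
    have \<Phi>c: "\<Phi> p \<in> carrier (hardy1 Y)" if "p \<in> carrier H \<times> carrier X" for p
      unfolding \<Phi>_def using that g by (intro Y.elem_fun_hardy1) auto
    have kv: "Poly_Mapping.keys v \<subseteq> carrier H \<times> carrier X" using v(1) by (simp add: tp.free_carrier)
    have Gc: "G \<in> carrier (hardy1 Y)"
      unfolding G_def by (rule HY.lin_ext_closed[OF _ kv]) (use \<Phi>c in auto)
    have "hardy_ext Y X \<rho> G = lin_ext (hardy1 X) (\<lambda>p. hardy_ext Y X \<rho> (\<Phi> p)) v"
      unfolding G_def by (rule bounded_op_lin_ext[OF ext(1)]) (use \<Phi>c kv in auto)
    also have "\<dots> = lin_ext (hardy1 X) (\<lambda>p. J (elem_tensor H X (fst p) (snd p))) v"
      unfolding lin_ext_def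
    proof (rule HX.finsum_cong'[OF refl])
      show "(\<lambda>p. Poly_Mapping.lookup v p \<odot>\<^bsub>hardy1 X\<^esub> J (elem_tensor H X (fst p) (snd p))) \<in> Poly_Mapping.keys v \<rightarrow> carrier (hardy1 X)"
        using kv by (auto simp del: hardy1_ops)
      fix p assume "p \<in> Poly_Mapping.keys v"
      then have p: "fst p \<in> carrier H" "snd p \<in> carrier X" using kv by auto
      have "hardy_ext Y X \<rho> (\<Phi> p) = J (elem_tensor H X (fst p) (snd p))"
        unfolding \<Phi>_def hardy_ext_elem_fun[OF Y.normed_axioms X.banach_axioms \<rho>.bounded_op_axioms g(1)[OF p(2)] p(1)]
          canonical_map_props(2)[OF X.banach_axioms p] g(2)[OF p(2)] ..
      then show "Poly_Mapping.lookup v p \<odot>\<^bsub>hardy1 X\<^esub> hardy_ext Y X \<rho> (\<Phi> p) =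
          Poly_Mapping.lookup v p \<odot>\<^bsub>hardy1 X\<^esub> J (elem_tensor H X (fst p) (snd p))" by simp
    qed
    also have "\<dots> = J d" using tp.bounded_op_tensor_class_eq[OF J.bounded_op_axioms v(1)] v(2) by simp
    finally have 1: "hardy_ext Y X \<rho> G = J d" .
    have "nrm (hardy1 Y) G \<le> C * nrm (free_space H X) v"
      unfolding G_def
    proof (rule tp.nrm_lin_ext_le[OF HY.seminormed_axioms _ _ v(1)])
      fix F x assume F: "F \<in> carrier H" and x: "x \<in> carrier X"
      show "\<Phi> (F, x) \<in> carrier (hardy1 Y)" using \<Phi>c F x by simp
      have "nrm (hardy1 Y) (\<Phi> (F, x)) = nrm H F * nrm Y (g x)"
        using Y.nrm_elem_fun[OF Sc.hardy1_L1[OF F] g(1)[OF x]] by (simp add: \<Phi>_def)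
      also have "\<dots> \<le> nrm H F * (C * nrm X x)"
        by (rule mult_left_mono[OF g(3)[OF x] HS.nrm_ge_0[OF F]])
      finally show "nrm (hardy1 Y) (\<Phi> (F, x)) \<le> C * (nrm H F * nrm X x)" by (simp add: mult_ac)
    qed
    also have "\<dots> \<le> C * (nrm P d + \<delta> / (C + 1))" using v(3) \<open>C \<ge> 0\<close> by (intro mult_left_mono) auto
    also have "\<dots> \<le> C * nrm P d + \<delta>"
    proof -
      have "C * (\<delta> / (C + 1)) \<le> \<delta>" using \<delta> \<open>C \<ge> 0\<close> by (simp add: field_simps)
      then show ?thesis by (simp add: distrib_left)
    qed
    finally show ?thesis using 1 Gc by blast
  qed
  from lift_from_dense[OF J.bounded_op_axioms ext(1) HX.normed_axioms HY.banach_axioms tp.tensor_class_dense assms(3) this u e]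
  show thesis using that by blast
qed

end

section \<open>The space \<open>ell1 I\<close>\<close>

lemma ell1_carrier: "f \<in> carrier (ell1 I) \<longleftrightarrow> f \<in> extensional I \<and> (\<lambda>i. cmod (f i)) summable_on I"
  using abs_summable_equivalent[of f I]
  by (simp add: ell1_def Infinite_Set_Sum.abs_summable_on_def)

lemma ell1_ops:
  "\<zero>\<^bsub>ell1 I\<^esub> = (\<lambda>i\<in>I. 0)" "f \<oplus>\<^bsub>ell1 I\<^esub> g = (\<lambda>i\<in>I. f i + g i)" "c \<odot>\<^bsub>ell1 I\<^esub> f = (\<lambda>i\<in>I. c * f i)"
  by (simp_all add: ell1_def)

text \<open>The integral over counting measure is written as an unconditional sum.\<close>

lemma ell1_nrm:
  assumes "f \<in> carrier (ell1 I)"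
  shows "nrm (ell1 I) f = infsum (\<lambda>i. cmod (f i)) I"
proof -
  have "Infinite_Sum.abs_summable_on (\<lambda>i. cmod (f i)) I" using assms by (simp add: ell1_carrier)
  then have "Infinite_Set_Sum.abs_summable_on (\<lambda>i. cmod (f i)) I" by (simp add: abs_summable_equivalent)
  from infsetsum_infsum[OF this] show ?thesis by (simp add: ell1_def infsetsum_def)
qed

lemma ell1_nrm_finite:
  assumes "f \<in> extensional I" "finite A" "A \<subseteq> I" "\<And>i. i \<in> I - A \<Longrightarrow> f i = 0"
  shows "f \<in> carrier (ell1 I)" "nrm (ell1 I) f = (\<Sum>i\<in>A. cmod (f i))"
proof -
  have "(\<lambda>i. cmod (f i)) summable_on I \<longleftrightarrow> (\<lambda>i. cmod (f i)) summable_on A"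
    by (rule summable_on_cong_neutral) (use assms in auto)
  then show c: "f \<in> carrier (ell1 I)" using assms by (simp add: ell1_carrier)
  have "infsum (\<lambda>i. cmod (f i)) I = infsum (\<lambda>i. cmod (f i)) A"
    by (rule infsum_cong_neutral) (use assms in auto)
  then show "nrm (ell1 I) f = (\<Sum>i\<in>A. cmod (f i))" using assms by (simp add: ell1_nrm[OF c])
qed

lemma ell1_add_closed:
  assumes "f \<in> carrier (ell1 I)" "g \<in> carrier (ell1 I)"
  shows "f \<oplus>\<^bsub>ell1 I\<^esub> g \<in> carrier (ell1 I)"
proof -
  have "(\<lambda>i. cmod (f i) + cmod (g i)) summable_on I"
    using assms by (intro summable_on_add) (auto simp: ell1_carrier)
  then have "(\<lambda>i. cmod ((\<lambda>i\<in>I. f i + g i) i)) summable_on I"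
    by (rule summable_on_comparison_test) (auto intro: norm_triangle_ineq)
  then show ?thesis by (simp add: ell1_ops ell1_carrier)
qed

lemma ell1_smult_closed:
  assumes "f \<in> carrier (ell1 I)"
  shows "c \<odot>\<^bsub>ell1 I\<^esub> f \<in> carrier (ell1 I)"
proof -
  have "(\<lambda>i. cmod c * cmod (f i)) summable_on I"
    using assms by (intro summable_on_cmult_right) (auto simp: ell1_carrier)
  then have "(\<lambda>i. cmod ((\<lambda>i\<in>I. c * f i) i)) summable_on I"
    by (rule summable_on_comparison_test) (auto simp: norm_mult)
  then show ?thesis by (simp add: ell1_ops ell1_carrier)
qed

lemma ell1_module: "Module.module scalars (ell1 I)"
proof (rule moduleI)
  show "abelian_group (ell1 I)"
  proof (rule abelian_groupI)
    show "\<zero>\<^bsub>ell1 I\<^esub> \<in> carrier (ell1 I)"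
      unfolding ell1_ops by (rule ell1_nrm_finite(1)[of _ _ "{}"]) auto
    fix f assume f: "f \<in> carrier (ell1 I)"
    then have e: "f \<in> extensional I" by (simp add: ell1_carrier)
    show "\<zero>\<^bsub>ell1 I\<^esub> \<oplus>\<^bsub>ell1 I\<^esub> f = f"
      unfolding ell1_ops by (rule extensionalityI[OF _ e]) auto
    have "((- 1) \<odot>\<^bsub>ell1 I\<^esub> f) \<oplus>\<^bsub>ell1 I\<^esub> f = \<zero>\<^bsub>ell1 I\<^esub>"
      unfolding ell1_ops by (rule restrict_ext) simp
    then show "\<exists>g\<in>carrier (ell1 I). g \<oplus>\<^bsub>ell1 I\<^esub> f = \<zero>\<^bsub>ell1 I\<^esub>"
      using ell1_smult_closed[OF f] by blast
  next
    fix f g h assume "f \<in> carrier (ell1 I)" "g \<in> carrier (ell1 I)" "h \<in> carrier (ell1 I)"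
    show "f \<oplus>\<^bsub>ell1 I\<^esub> g \<oplus>\<^bsub>ell1 I\<^esub> h = f \<oplus>\<^bsub>ell1 I\<^esub> (g \<oplus>\<^bsub>ell1 I\<^esub> h)"
      unfolding ell1_ops by (rule restrict_ext) (simp add: add.assoc)
    show "f \<oplus>\<^bsub>ell1 I\<^esub> g = g \<oplus>\<^bsub>ell1 I\<^esub> f"
      unfolding ell1_ops by (rule restrict_ext) (simp add: add.commute)
  qed (rule ell1_add_closed)
  fix a b f g assume f: "f \<in> carrier (ell1 I)" and g: "g \<in> carrier (ell1 I)"
  then have e: "f \<in> extensional I" by (simp add: ell1_carrier)
  show "(a \<oplus>\<^bsub>scalars\<^esub> b) \<odot>\<^bsub>ell1 I\<^esub> f = a \<odot>\<^bsub>ell1 I\<^esub> f \<oplus>\<^bsub>ell1 I\<^esub> b \<odot>\<^bsub>ell1 I\<^esub> f"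
    unfolding ell1_ops by (rule restrict_ext) (simp add: distrib_right)
  show "a \<odot>\<^bsub>ell1 I\<^esub> (f \<oplus>\<^bsub>ell1 I\<^esub> g) = a \<odot>\<^bsub>ell1 I\<^esub> f \<oplus>\<^bsub>ell1 I\<^esub> a \<odot>\<^bsub>ell1 I\<^esub> g"
    unfolding ell1_ops by (rule restrict_ext) (simp add: distrib_left)
  show "(a \<otimes>\<^bsub>scalars\<^esub> b) \<odot>\<^bsub>ell1 I\<^esub> f = a \<odot>\<^bsub>ell1 I\<^esub> (b \<odot>\<^bsub>ell1 I\<^esub> f)"
    unfolding ell1_ops by (rule restrict_ext) (simp add: mult.assoc)
  show "\<one>\<^bsub>scalars\<^esub> \<odot>\<^bsub>ell1 I\<^esub> f = f"
    unfolding ell1_ops by (rule extensionalityI[OF _ e]) auto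
qed (auto simp: cring_scalars ell1_smult_closed)

lemma ell1_seminormed: "seminormed (ell1 I)"
proof (rule seminormed.intro[OF ell1_module], unfold_locales)
  fix f assume f: "f \<in> carrier (ell1 I)"
  then have sf: "(\<lambda>i. cmod (f i)) summable_on I" by (simp add: ell1_carrier)
  show "0 \<le> nrm (ell1 I) f" by (simp add: ell1_nrm[OF f] infsum_nonneg)
  show "nrm (ell1 I) (c \<odot>\<^bsub>ell1 I\<^esub> f) = cmod c * nrm (ell1 I) f" for c
  proof -
    have "nrm (ell1 I) (c \<odot>\<^bsub>ell1 I\<^esub> f) = infsum (\<lambda>i. cmod c * cmod (f i)) I"
      unfolding ell1_nrm[OF ell1_smult_closed[OF f]]
      by (rule infsum_cong) (simp add: ell1_ops norm_mult)
    then show ?thesis using sf by (simp add: infsum_cmult_right ell1_nrm[OF f])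
  qed
  fix g assume g: "g \<in> carrier (ell1 I)"
  then have sg: "(\<lambda>i. cmod (g i)) summable_on I" by (simp add: ell1_carrier)
  have s: "(\<lambda>i. cmod ((f \<oplus>\<^bsub>ell1 I\<^esub> g) i)) summable_on I"
    using ell1_add_closed[OF f g] by (simp add: ell1_carrier)
  have "nrm (ell1 I) (f \<oplus>\<^bsub>ell1 I\<^esub> g) \<le> infsum (\<lambda>i. cmod (f i) + cmod (g i)) I"
    unfolding ell1_nrm[OF ell1_add_closed[OF f g]]
    by (rule infsum_mono[OF s summable_on_add[OF sf sg]]) (simp add: ell1_ops norm_triangle_ineq)
  also have "\<dots> = nrm (ell1 I) f + nrm (ell1 I) g"
    using infsum_add[OF sf sg] by (simp add: ell1_nrm f g)
  finally show "nrm (ell1 I) (f \<oplus>\<^bsub>ell1 I\<^esub> g) \<le> nrm (ell1 I) f + nrm (ell1 I) g" .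
qed

lemma ell1_minus:
  assumes "f \<in> carrier (ell1 I)" "g \<in> carrier (ell1 I)"
  shows "f \<ominus>\<^bsub>ell1 I\<^esub> g = (\<lambda>i\<in>I. f i - g i)"
  using seminormed.minus_smult[OF ell1_seminormed assms]
  by (simp add: ell1_ops cong: restrict_cong)

lemma ell1_finite_sum_le:
  assumes "f \<in> carrier (ell1 I)" "finite A" "A \<subseteq> I"
  shows "(\<Sum>i\<in>A. cmod (f i)) \<le> nrm (ell1 I) f"
  unfolding ell1_nrm[OF assms(1)]
  by (rule finite_sum_le_infsum) (use assms in \<open>auto simp: ell1_carrier\<close>)

lemma ell1_normed: "normed (ell1 I)"
proof -
  interpret seminormed "ell1 I" by (rule ell1_seminormed)
  show ?thesis
  proof unfold_locales
    fix f assume f: "f \<in> carrier (ell1 I)" and 0: "nrm (ell1 I) f = 0"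
    then have e: "f \<in> extensional I" by (simp add: ell1_carrier)
    show "f = \<zero>\<^bsub>ell1 I\<^esub>"
      unfolding ell1_ops
    proof (rule extensionalityI[OF e])
      fix i assume "i \<in> I"
      then show "f i = (\<lambda>i\<in>I. 0) i" using ell1_finite_sum_le[OF f, of "{i}"] 0 by simp
    qed simp
  qed
qed

lemma ell1_banach: "banach (ell1 I)"
proof -
  interpret normed "ell1 I" by (rule ell1_normed)
  show ?thesis
  proof (rule banach_if_dense[OF normed_axioms, of "carrier (ell1 I)"])
    show "dense_in (ell1 I) (carrier (ell1 I))"
      unfolding dense_in_def by (auto intro!: bexI)
    fix s assume s: "\<And>n. s n \<in> carrier (ell1 I)"
      and fast: "\<And>n. nrm (ell1 I) (s n \<ominus>\<^bsub>ell1 I\<^esub> s (Suc n)) \<le> (1/2) ^ n"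
    have finite_le: "(\<Sum>i\<in>A. cmod (s n i - s m i)) \<le> 2 * (1/2) ^ n"
      if "finite A" "A \<subseteq> I" "n \<le> m" for A n m
    proof -
      have "(\<Sum>i\<in>A. cmod (s n i - s m i)) = (\<Sum>i\<in>A. cmod ((s n \<ominus>\<^bsub>ell1 I\<^esub> s m) i))"
        using that(2) by (intro sum.cong) (auto simp: ell1_minus s)
      also have "\<dots> \<le> nrm (ell1 I) (s n \<ominus>\<^bsub>ell1 I\<^esub> s m)"
        by (rule ell1_finite_sum_le[OF minus_in[OF s s] that(1,2)])
      also have "\<dots> \<le> 2 * (1/2) ^ n"
        using fast_dist[OF s fast that(3)] zero_le_power[of "1/2::real" m] by linarith
      finally show ?thesis .
    qed
    have "\<exists>x. (\<lambda>n. s n i) \<longlonglongrightarrow> x" if i: "i \<in> I" for i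
    proof -
      have "Cauchy (\<lambda>n. s n i)"
      proof (rule CauchyI)
        fix e :: real assume "e > 0"
        then obtain N where N: "\<And>m n. m \<ge> N \<Longrightarrow> n \<ge> N \<Longrightarrow> nrm (ell1 I) (s m \<ominus>\<^bsub>ell1 I\<^esub> s n) < e"
          using fast_cauchy[OF s fast] unfolding cauchy_in_def by blast
        have "norm (s m i - s n i) < e" if "m \<ge> N" "n \<ge> N" for m n
          using ell1_finite_sum_le[OF minus_in[OF s s], of "{i}" m n] N[OF that] i by (simp add: ell1_minus s)
        then show "\<exists>M. \<forall>m\<ge>M. \<forall>n\<ge>M. norm (s m i - s n i) < e" by blast
      qed
      then show ?thesis by (simp add: Cauchy_convergent_iff convergent_def)
    qed
    then have "\<forall>i\<in>I. \<exists>x. (\<lambda>n. s n i) \<longlonglongrightarrow> x" by blast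
    from bchoice[OF this] obtain g where g: "\<And>i. i \<in> I \<Longrightarrow> (\<lambda>n. s n i) \<longlonglongrightarrow> g i" by blast
    define f where "f = (\<lambda>i\<in>I. g i)"
    have lim_le: "(\<Sum>i\<in>A. cmod (s n i - f i)) \<le> 2 * (1/2) ^ n" if A: "finite A" "A \<subseteq> I" for A n
    proof (rule LIMSEQ_le_const2)
      show "(\<lambda>m. \<Sum>i\<in>A. cmod (s n i - s m i)) \<longlonglongrightarrow> (\<Sum>i\<in>A. cmod (s n i - f i))"
        using A(2) g by (intro tendsto_sum tendsto_norm tendsto_diff tendsto_const) (auto simp: f_def)
      show "\<exists>N. \<forall>m\<ge>N. (\<Sum>i\<in>A. cmod (s n i - s m i)) \<le> 2 * (1/2) ^ n"
        using finite_le[OF A] by blast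
    qed
    define d where "d n = (\<lambda>i\<in>I. s n i - f i)" for n
    have ds: "(\<lambda>i. cmod (d n i)) summable_on I" for n
    proof (rule nonneg_bounded_partial_sums_imp_summable_on)
      show "\<forall>\<^sub>F A in finite_subsets_at_top I. (\<Sum>i\<in>A. cmod (d n i)) \<le> 2 * (1/2) ^ n"
      proof (rule eventually_finite_subsets_at_top_weakI)
        fix A assume A: "finite A" "A \<subseteq> I"
        have "(\<Sum>i\<in>A. cmod (d n i)) = (\<Sum>i\<in>A. cmod (s n i - f i))"
          using A(2) by (intro sum.cong) (auto simp: d_def)
        then show "(\<Sum>i\<in>A. cmod (d n i)) \<le> 2 * (1/2) ^ n" using lim_le[OF A] by simp
      qed
    qed simp
    then have dc: "d n \<in> carrier (ell1 I)" for n by (simp add: ell1_carrier d_def)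
    have dn: "nrm (ell1 I) (d n) \<le> 2 * (1/2) ^ n" for n
      unfolding ell1_nrm[OF dc]
    proof (rule infsum_le_finite_sums[OF ds])
      fix A assume A: "finite A" "A \<subseteq> I"
      have "(\<Sum>i\<in>A. cmod (d n i)) = (\<Sum>i\<in>A. cmod (s n i - f i))"
        using A(2) by (intro sum.cong) (auto simp: d_def)
      then show "(\<Sum>i\<in>A. cmod (d n i)) \<le> 2 * (1/2) ^ n" using lim_le[OF A] by simp
    qed
    have "f = s 0 \<ominus>\<^bsub>ell1 I\<^esub> d 0"
      unfolding ell1_minus[OF s dc] by (simp add: d_def f_def cong: restrict_cong)
    then have fc: "f \<in> carrier (ell1 I)" using s dc by simp
    have "s n \<ominus>\<^bsub>ell1 I\<^esub> f = d n" for n unfolding ell1_minus[OF s fc] d_def ..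
    then have le: "nrm (ell1 I) (s n \<ominus>\<^bsub>ell1 I\<^esub> f) \<le> 2 * (1/2) ^ n" for n using dn by simp
    have "(\<lambda>n. nrm (ell1 I) (s n \<ominus>\<^bsub>ell1 I\<^esub> f)) \<longlonglongrightarrow> 0"
    proof (rule tendsto_sandwich[OF _ _ tendsto_const])
      show "(\<lambda>n. 2 * (1/2) ^ n :: real) \<longlonglongrightarrow> 0"
        by (intro tendsto_mult_right_zero LIMSEQ_realpow_zero) auto
    qed (use le s fc in auto)
    then show "\<exists>x\<in>carrier (ell1 I). (\<lambda>n. nrm (ell1 I) (s n \<ominus>\<^bsub>ell1 I\<^esub> x)) \<longlonglongrightarrow> 0"
      using fc by blast
  qed
qed

text \<open>The unit vector at the index \<open>i\<close>.\<close>

definition unit_vec :: "'i set \<Rightarrow> 'i \<Rightarrow> 'i \<Rightarrow> complex" where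
  "unit_vec I i = (\<lambda>j\<in>I. if j = i then 1 else 0)"

lemma unit_vec:
  assumes "i \<in> I"
  shows "unit_vec I i \<in> carrier (ell1 I)" "nrm (ell1 I) (unit_vec I i) = 1"
  using ell1_nrm_finite[of "unit_vec I i" I "{i}"] assms by (auto simp: unit_vec_def)

text \<open>The finitely supported elements, a dense subspace of \<open>ell1 I\<close>.\<close>

definition finite_support :: "'i set \<Rightarrow> ('i \<Rightarrow> complex) set" where
  "finite_support I = {f \<in> extensional I. \<exists>A. finite A \<and> A \<subseteq> I \<and> (\<forall>i\<in>I - A. f i = 0)}"

lemma finite_support_ell1: "finite_support I \<subseteq> carrier (ell1 I)"
  using ell1_nrm_finite(1) unfolding finite_support_def by blast

lemma finite_support_dense: "dense_in (ell1 I) (finite_support I)"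
  unfolding dense_in_def
proof (intro conjI ballI allI impI finite_support_ell1)
  interpret normed "ell1 I" by (rule ell1_normed)
  fix f e assume f: "f \<in> carrier (ell1 I)" and e: "(e::real) > 0"
  have sf: "(\<lambda>i. cmod (f i)) summable_on I" using f by (simp add: ell1_carrier)
  have "e / 2 > 0" using e by simp
  from infsum_finite_approximation[OF sf this] obtain A where A: "finite A" "A \<subseteq> I"
    "dist (\<Sum>i\<in>A. cmod (f i)) (infsum (\<lambda>i. cmod (f i)) I) \<le> e / 2" by blast
  define g where "g = (\<lambda>i\<in>I. if i \<in> A then f i else 0)"
  have g: "g \<in> finite_support I" using A by (auto simp: g_def finite_support_def)
  then have gc: "g \<in> carrier (ell1 I)" using finite_support_ell1 by blast
  have sd: "(\<lambda>i. cmod (f i)) summable_on (I - A)" by (rule summable_on_subset_banach[OF sf]) auto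
  have "infsum (\<lambda>i. cmod (f i)) (A \<union> (I - A)) = infsum (\<lambda>i. cmod (f i)) A + infsum (\<lambda>i. cmod (f i)) (I - A)"
    using A by (intro infsum_Un_disjoint sd) auto
  also have "A \<union> (I - A) = I" using A by auto
  finally have 1: "infsum (\<lambda>i. cmod (f i)) (I - A) \<le> e / 2"
    using A(1,3) by (simp add: dist_real_def)
  have "nrm (ell1 I) (f \<ominus>\<^bsub>ell1 I\<^esub> g) = infsum (\<lambda>i. cmod ((f \<ominus>\<^bsub>ell1 I\<^esub> g) i)) I"
    by (rule ell1_nrm[OF minus_in[OF f gc]])
  also have "\<dots> = infsum (\<lambda>i. cmod (f i)) (I - A)"
    unfolding ell1_minus[OF f gc] by (rule infsum_cong_neutral) (auto simp: g_def)
  finally have "nrm (ell1 I) (f \<ominus>\<^bsub>ell1 I\<^esub> g) < e" using 1 e by simp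
  then show "\<exists>g\<in>finite_support I. nrm (ell1 I) (f \<ominus>\<^bsub>ell1 I\<^esub> g) < e" using g by blast
qed

lemma ell1_finsum:
  assumes "finite A" "\<And>a. a \<in> A \<Longrightarrow> F a \<in> carrier (ell1 I)"
  shows "finsum (ell1 I) F A = (\<lambda>j\<in>I. \<Sum>a\<in>A. F a j)"
  using assms
proof (induction A rule: finite_induct)
  case empty
  interpret normed "ell1 I" by (rule ell1_normed)
  show ?case by (simp add: ell1_ops)
next
  case (insert a A)
  interpret normed "ell1 I" by (rule ell1_normed)
  have "finsum (ell1 I) F (insert a A) = F a \<oplus>\<^bsub>ell1 I\<^esub> finsum (ell1 I) F A"
    using insert by (intro finsum_insert) auto
  then show ?case using insert by (simp add: ell1_ops cong: restrict_cong)
qed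

lemma finite_support_expansion:
  assumes "f \<in> extensional I" "finite A" "A \<subseteq> I" "\<And>i. i \<in> I - A \<Longrightarrow> f i = 0"
  shows "f = (\<Oplus>\<^bsub>ell1 I\<^esub>i\<in>A. f i \<odot>\<^bsub>ell1 I\<^esub> unit_vec I i)"
proof -
  have c: "f i \<odot>\<^bsub>ell1 I\<^esub> unit_vec I i \<in> carrier (ell1 I)" if "i \<in> A" for i
    using that assms(3) by (intro ell1_smult_closed unit_vec(1)) auto
  have "(\<Oplus>\<^bsub>ell1 I\<^esub>i\<in>A. f i \<odot>\<^bsub>ell1 I\<^esub> unit_vec I i) = (\<lambda>j\<in>I. \<Sum>i\<in>A. (f i \<odot>\<^bsub>ell1 I\<^esub> unit_vec I i) j)"
    by (rule ell1_finsum[OF assms(2) c])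
  also have "\<dots> = f"
  proof (rule extensionalityI[OF _ assms(1)])
    fix j assume j: "j \<in> I"
    have "(\<Sum>i\<in>A. (f i \<odot>\<^bsub>ell1 I\<^esub> unit_vec I i) j) = (\<Sum>i\<in>A. if i = j then f i else 0)"
      using j by (intro sum.cong) (auto simp: ell1_ops unit_vec_def)
    also have "\<dots> = f j" using assms(2,4) j by (auto simp: sum.delta')
    finally show "(\<lambda>j\<in>I. \<Sum>i\<in>A. (f i \<odot>\<^bsub>ell1 I\<^esub> unit_vec I i) j) j = f j" using j by simp
  qed simp
  finally show ?thesis by simp
qed

text \<open>A family in the unit ball of a Banach space \<open>X\<close> extends to a contraction on \<open>ell1 I\<close>.\<close>

lemma ell1_extend:
  assumes "banach X" and x: "\<And>i. i \<in> I \<Longrightarrow> x i \<in> carrier X" "\<And>i. i \<in> I \<Longrightarrow> nrm X (x i) \<le> 1"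
  obtains \<sigma> where "bounded_op (ell1 I) X \<sigma>" "\<And>i. i \<in> I \<Longrightarrow> \<sigma> (unit_vec I i) = x i"
    "\<And>f. f \<in> carrier (ell1 I) \<Longrightarrow> nrm X (\<sigma> f) \<le> nrm (ell1 I) f"
proof -
  interpret X: banach X by fact
  interpret E: normed "ell1 I" by (rule ell1_normed)
  define S where "S A f = (\<Oplus>\<^bsub>X\<^esub>i\<in>A. f i \<odot>\<^bsub>X\<^esub> x i)" for A and f :: "'b \<Rightarrow> complex"
  define supp where "supp A f \<longleftrightarrow> finite A \<and> A \<subseteq> I \<and> f \<in> extensional I \<and> (\<forall>i\<in>I - A. f i = 0)" for A and f :: "'b \<Rightarrow> complex"
  define R where "R = {(f, S A f) | f A. supp A f}"
  have Sc: "S A f \<in> carrier X" if "A \<subseteq> I" for A f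
    unfolding S_def using that x by (intro X.finsum_closed) auto
  have S_super: "S B f = S A f" if "supp A f" "finite B" "A \<subseteq> B" "B \<subseteq> I" for A B f
    unfolding S_def
    by (rule X.add.finprod_mono_neutral_cong_right) (use that x in \<open>auto simp: supp_def\<close>)
  have RE: "\<exists>A. supp A f \<and> w = S A f" if "(f, w) \<in> R" for f w using that by (auto simp: R_def)
  have suppc: "f \<in> carrier (ell1 I)" "nrm (ell1 I) f = (\<Sum>i\<in>A. cmod (f i))" if "supp A f" for A f
    using ell1_nrm_finite[of f I A] that by (auto simp: supp_def)
  obtain \<sigma> where \<sigma>: "\<sigma> \<in> extensional (carrier (ell1 I))" "bounded_op (ell1 I) X \<sigma>" "\<And>f w. (f, w) \<in> R \<Longrightarrow> \<sigma> f = w"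
    "\<And>f. f \<in> carrier (ell1 I) \<Longrightarrow> nrm X (\<sigma> f) \<le> 1 * nrm (ell1 I) f"
  proof (rule extension_exists[OF E.seminormed_axioms X.banach_axioms, of R 1])
    show "R \<subseteq> carrier (ell1 I) \<times> carrier X"
      unfolding R_def using suppc(1) Sc by (auto simp: supp_def)
    have "Domain R = finite_support I" unfolding R_def supp_def finite_support_def by auto
    then show "dense_in (ell1 I) (Domain R)" using finite_support_dense by simp
    show "(f \<oplus>\<^bsub>ell1 I\<^esub> g, v \<oplus>\<^bsub>X\<^esub> w) \<in> R" if fg: "(f, v) \<in> R" "(g, w) \<in> R" for f v g w
    proof -
      obtain A B where A: "supp A f" "v = S A f" and B: "supp B g" "w = S B g" using RE[OF fg(1)] RE[OF fg(2)] by blast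
      define C where "C = A \<union> B"
      have C: "finite C" "C \<subseteq> I" "A \<subseteq> C" "B \<subseteq> C" using A B by (auto simp: C_def supp_def)
      have sC: "supp C (f \<oplus>\<^bsub>ell1 I\<^esub> g)" using A B by (auto simp: C_def supp_def ell1_ops)
      have "S C (f \<oplus>\<^bsub>ell1 I\<^esub> g) = (\<Oplus>\<^bsub>X\<^esub>i\<in>C. f i \<odot>\<^bsub>X\<^esub> x i \<oplus>\<^bsub>X\<^esub> g i \<odot>\<^bsub>X\<^esub> x i)"
        unfolding S_def using C x by (intro X.finsum_cong') (auto simp: ell1_ops X.smult_add_left)
      also have "\<dots> = S C f \<oplus>\<^bsub>X\<^esub> S C g"
        unfolding S_def using C x by (intro X.finsum_addf) auto
      also have "\<dots> = v \<oplus>\<^bsub>X\<^esub> w" using S_super[OF A(1) C(1,3,2)] S_super[OF B(1) C(1,4,2)] A B by simp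
      finally show ?thesis using sC unfolding R_def by (metis (mono_tags, lifting) mem_Collect_eq)
    qed
    show "(c \<odot>\<^bsub>ell1 I\<^esub> f, c \<odot>\<^bsub>X\<^esub> w) \<in> R" if fw: "(f, w) \<in> R" for c f w
    proof -
      obtain A where A: "supp A f" "w = S A f" using RE[OF fw] by blast
      have AI: "finite A" "A \<subseteq> I" using A by (auto simp: supp_def)
      have sA: "supp A (c \<odot>\<^bsub>ell1 I\<^esub> f)" using A by (auto simp: supp_def ell1_ops)
      have "S A (c \<odot>\<^bsub>ell1 I\<^esub> f) = (\<Oplus>\<^bsub>X\<^esub>i\<in>A. c \<odot>\<^bsub>X\<^esub> (f i \<odot>\<^bsub>X\<^esub> x i))"
        unfolding S_def using AI x by (intro X.finsum_cong') (auto simp: ell1_ops X.smult_smult)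
      also have "\<dots> = c \<odot>\<^bsub>X\<^esub> w"
        unfolding A(2) S_def using AI x by (intro X.smult_finsum[symmetric]) auto
      finally show ?thesis using sA unfolding R_def by (metis (mono_tags, lifting) mem_Collect_eq)
    qed
    show "nrm X w \<le> 1 * nrm (ell1 I) f" if fw: "(f, w) \<in> R" for f w
    proof -
      obtain A where A: "supp A f" "w = S A f" using RE[OF fw] by blast
      have AI: "finite A" "A \<subseteq> I" using A by (auto simp: supp_def)
      have "nrm X w \<le> (\<Sum>i\<in>A. nrm X (f i \<odot>\<^bsub>X\<^esub> x i))"
        unfolding A(2) S_def using AI x by (intro X.nrm_finsum) auto
      also have "\<dots> \<le> (\<Sum>i\<in>A. cmod (f i))"
      proof (rule sum_mono)
        fix i assume "i \<in> A"
        then have "i \<in> I" using AI by auto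
        then show "nrm X (f i \<odot>\<^bsub>X\<^esub> x i) \<le> cmod (f i)"
          using x by (simp add: X.nrm_smult mult_left_le)
      qed
      finally show ?thesis using suppc(2)[OF A(1)] by simp
    qed
  qed (use that in auto)
  have "\<sigma> (unit_vec I i) = x i" if i: "i \<in> I" for i
  proof -
    have "supp {i} (unit_vec I i)" using i by (auto simp: supp_def unit_vec_def)
    then have "(unit_vec I i, S {i} (unit_vec I i)) \<in> R" unfolding R_def by blast
    from \<sigma>(3)[OF this] show ?thesis using i x by (simp add: S_def unit_vec_def)
  qed
  then show thesis using that[of \<sigma>] \<sigma>(2,4) by simp
qed

lemma (in normed) analytic_poly_finsum:
  assumes "finite A" "\<And>a k. a \<in> A \<Longrightarrow> b a k \<in> carrier V"
  shows "(\<Oplus>\<^bsub>hardy1 V\<^esub>a\<in>A. analytic_poly V n (b a)) = analytic_poly V n (\<lambda>k. \<Oplus>a\<in>A. b a k)"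
  using assms
proof (induction A rule: finite_induct)
  case empty
  interpret HV: normed "hardy1 V" by (rule hardy1_normed)
  have "analytic_poly V n (\<lambda>k. \<zero>) = 0 \<odot>\<^bsub>hardy1 V\<^esub> analytic_poly V n (\<lambda>k. \<zero>)"
    using analytic_poly_smult[of "\<lambda>k. \<zero>" n 0] by simp
  also have "\<dots> = \<zero>\<^bsub>hardy1 V\<^esub>" by (rule HV.zero_smult) auto
  finally show ?case by simp
next
  case (insert a A)
  interpret HV: normed "hardy1 V" by (rule hardy1_normed)
  have c: "(\<lambda>k. \<Oplus>a\<in>A. b a k) \<in> {..n} \<rightarrow> carrier V" using insert by (auto intro!: M.finsum_closed)
  have ca: "b a \<in> {..n} \<rightarrow> carrier V" using insert by auto
  have "(\<Oplus>\<^bsub>hardy1 V\<^esub>a\<in>insert a A. analytic_poly V n (b a)) =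
      analytic_poly V n (b a) \<oplus>\<^bsub>hardy1 V\<^esub> (\<Oplus>\<^bsub>hardy1 V\<^esub>a\<in>A. analytic_poly V n (b a))"
    using insert by (intro HV.finsum_insert) auto
  also have "\<dots> = analytic_poly V n (\<lambda>k. b a k \<oplus> (\<Oplus>a\<in>A. b a k))"
    using insert analytic_poly_add[OF ca c] by simp
  also have "\<dots> = analytic_poly V n (\<lambda>k. \<Oplus>a\<in>insert a A. b a k)"
  proof (rule analytic_poly_cong)
    show "(\<lambda>k. b a k \<oplus> (\<Oplus>a\<in>A. b a k)) \<in> {..n} \<rightarrow> carrier V" using c ca by auto
    show "b a k \<oplus> (\<Oplus>a\<in>A. b a k) = (\<Oplus>a\<in>insert a A. b a k)" for k
      using insert by (intro M.finsum_insert[symmetric]) auto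
  qed
  finally show ?case .
qed

text \<open>
  Only finitely many coordinates occur, so the sum in the norm of \<open>ell1 I\<close> may be interchanged with the
  integral over the circle.
\<close>

lemma ell1_poly_nrm:
  assumes A: "finite A" "A \<subseteq> I" and b: "\<And>k. k \<le> n \<Longrightarrow> b k \<in> carrier (ell1 I)"
    and z: "\<And>k i. k \<le> n \<Longrightarrow> i \<in> I - A \<Longrightarrow> b k i = 0"
  shows "nrm (hardy1 (ell1 I)) (analytic_poly (ell1 I) n b) = (\<Sum>i\<in>A. nrm (hardy1 scalars) (analytic_poly scalars n (\<lambda>k. b k i)))"
proof -
  interpret E: normed "ell1 I" by (rule ell1_normed)
  have bn: "b \<in> {..n} \<rightarrow> carrier (ell1 I)" using b by auto
  have p: "poly_fun (ell1 I) n b w = (\<lambda>i\<in>I. \<Sum>k\<le>n. w ^ k * b k i)" for w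
  proof -
    have "poly_fun (ell1 I) n b w = (\<lambda>j\<in>I. \<Sum>k\<le>n. ((w ^ k) \<odot>\<^bsub>ell1 I\<^esub> b k) j)"
      unfolding poly_fun_def using b by (intro ell1_finsum) auto
    then show ?thesis by (simp add: ell1_ops cong: restrict_cong)
  qed
  have "nrm (ell1 I) (poly_fun (ell1 I) n b w) = (\<Sum>i\<in>A. cmod (poly_fun scalars n (\<lambda>k. b k i) w))" for w
  proof -
    have "nrm (ell1 I) (poly_fun (ell1 I) n b w) = (\<Sum>i\<in>A. cmod (poly_fun (ell1 I) n b w i))"
      by (rule ell1_nrm_finite(2)) (use A z in \<open>auto simp: p\<close>)
    also have "\<dots> = (\<Sum>i\<in>A. cmod (poly_fun scalars n (\<lambda>k. b k i) w))"
      using A(2) by (intro sum.cong) (auto simp: p poly_fun_scalars)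
    finally show ?thesis .
  qed
  then have "bochner_norm (ell1 I) (poly_fun (ell1 I) n b) =
      (\<integral>\<^sup>+w. (\<Sum>i\<in>A. ennreal (nrm scalars (poly_fun scalars n (\<lambda>k. b k i) w))) \<partial>haar_circle)"
    unfolding bochner_norm_def by simp
  also have "\<dots> = (\<Sum>i\<in>A. bochner_norm scalars (poly_fun scalars n (\<lambda>k. b k i)))"
    unfolding bochner_norm_def
    by (rule nn_integral_sum) (use Sc.poly_fun_norm_measurable in auto)
  also have "\<dots> = (\<Sum>i\<in>A. ennreal (nrm (hardy1 scalars) (analytic_poly scalars n (\<lambda>k. b k i))))"
    unfolding analytic_poly_eq using Sc.poly_fun_integrable
    by (intro sum.cong) (auto simp: Sc.ennreal_nrm_L1_class)
  also have "\<dots> = ennreal (\<Sum>i\<in>A. nrm (hardy1 scalars) (analytic_poly scalars n (\<lambda>k. b k i)))"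
    by (rule sum_ennreal) (use normed.axioms(1)[OF Sc.hardy1_normed] in \<open>auto intro!: seminormed.nrm_ge_0 simp del: hardy1_ops\<close>)
  finally show ?thesis
    using E.nrm_L1_class[OF E.poly_fun_integrable[OF bn]]
    by (simp add: analytic_poly_eq[of "ell1 I"] del: hardy1_ops)
       (simp add: sum_nonneg normed.axioms(1)[OF Sc.bochner_L1_normed] seminormed.nrm_ge_0 Sc.analytic_poly_closed)
qed

text \<open>
  \<open>hardy1 (ell1 I)\<close> is isometric to the projective tensor product of \<open>hardy1 scalars\<close> and \<open>ell1 I\<close>: for a polynomial
  with finitely supported coefficients, the norm is the sum of the norms of its coordinates.
\<close>

lemma (in tensor_H1) lift_ell1:
  assumes \<sigma>: "bounded_op (ell1 I) X \<sigma>" and \<sigma>1: "\<And>i. i \<in> I \<Longrightarrow> nrm X (\<sigma> (unit_vec I i)) \<le> 1"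
    and G: "G \<in> carrier (hardy1 (ell1 I))" and e: "e > 0"
  obtains u where "u \<in> carrier P" "J u = hardy_ext (ell1 I) X \<sigma> G" "nrm P u \<le> nrm (hardy1 (ell1 I)) G + e"
proof -
  interpret E: banach "ell1 I" by (rule ell1_banach)
  interpret HE: banach "hardy1 (ell1 I)" by (rule E.hardy1_banach)
  interpret \<sigma>: bounded_op "ell1 I" X \<sigma> by fact
  note ext = hardy_ext_props[OF E.normed_axioms X.banach_axioms \<sigma>]
  interpret ext: bounded_op "hardy1 (ell1 I)" "hardy1 X" "hardy_ext (ell1 I) X \<sigma>" by (rule ext(1))
  define D where "D = {analytic_poly (ell1 I) n b | n b. \<forall>k. b k \<in> finite_support I}"
  have D_dense: "dense_in (hardy1 (ell1 I)) D"
    unfolding dense_in_def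
  proof (intro conjI ballI allI impI)
    have "analytic_poly (ell1 I) n b \<in> carrier (hardy1 (ell1 I))" if "\<forall>k. b k \<in> finite_support I" for n b
      using that finite_support_ell1 by (intro E.analytic_poly_hardy1) blast
    then show "D \<subseteq> carrier (hardy1 (ell1 I))" unfolding D_def by blast
    fix F \<epsilon> assume F: "F \<in> carrier (hardy1 (ell1 I))" and \<epsilon>: "(\<epsilon>::real) > 0"
    have "\<epsilon> / 2 > 0" using \<epsilon> by simp
    then obtain p where p: "p \<in> analytic_polys (ell1 I)" "p \<in> carrier (hardy1 (ell1 I))"
      "nrm (hardy1 (ell1 I)) (F \<ominus>\<^bsub>hardy1 (ell1 I)\<^esub> p) < \<epsilon> / 2"
      using dense_inE[OF E.analytic_polys_dense F] by blast
    obtain n a where a: "a \<in> {..n} \<rightarrow> carrier (ell1 I)" "p = analytic_poly (ell1 I) n a"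
      using p(1) unfolding analytic_polys_def by blast
    define \<delta> where "\<delta> = \<epsilon> / (2 * real (Suc n))"
    have \<delta>: "\<delta> > 0" using \<epsilon> by (simp add: \<delta>_def)
    have "\<forall>k. \<exists>c. c \<in> finite_support I \<and> (k \<le> n \<longrightarrow> nrm (ell1 I) (a k \<ominus>\<^bsub>ell1 I\<^esub> c) < \<delta>)"
    proof
      fix k
      have "(\<lambda>i\<in>I. 0) \<in> finite_support I" by (auto simp: finite_support_def)
      moreover have "\<exists>c\<in>finite_support I. nrm (ell1 I) (a k \<ominus>\<^bsub>ell1 I\<^esub> c) < \<delta>" if "k \<le> n"
      proof -
        have "a k \<in> carrier (ell1 I)" using a(1) that by auto
        from dense_inE[OF finite_support_dense this \<delta>] show ?thesis by blast
      qed
      ultimately show "\<exists>c. c \<in> finite_support I \<and> (k \<le> n \<longrightarrow> nrm (ell1 I) (a k \<ominus>\<^bsub>ell1 I\<^esub> c) < \<delta>)"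
        by (cases "k \<le> n") auto
    qed
    from choice[OF this] obtain b where b: "\<And>k. b k \<in> finite_support I"
      "\<And>k. k \<le> n \<Longrightarrow> nrm (ell1 I) (a k \<ominus>\<^bsub>ell1 I\<^esub> b k) < \<delta>" by blast
    have bc: "b \<in> {..n} \<rightarrow> carrier (ell1 I)" using b(1) finite_support_ell1 by blast
    have ab: "(\<lambda>k. a k \<ominus>\<^bsub>ell1 I\<^esub> b k) \<in> {..n} \<rightarrow> carrier (ell1 I)" using a(1) bc by auto
    define q where "q = analytic_poly (ell1 I) n b"
    have qD: "q \<in> D" unfolding D_def q_def using b(1) by blast
    have qc: "q \<in> carrier (hardy1 (ell1 I))" unfolding q_def using bc by (rule E.analytic_poly_hardy1)
    have "p \<ominus>\<^bsub>hardy1 (ell1 I)\<^esub> q = analytic_poly (ell1 I) n (\<lambda>k. a k \<ominus>\<^bsub>ell1 I\<^esub> b k)"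
      using E.hardy1_minus[OF p(2) qc] E.analytic_poly_minus[OF a(1) bc] by (simp add: a(2) q_def)
    then have "nrm (hardy1 (ell1 I)) (p \<ominus>\<^bsub>hardy1 (ell1 I)\<^esub> q) \<le> (\<Sum>k\<le>n. nrm (ell1 I) (a k \<ominus>\<^bsub>ell1 I\<^esub> b k))"
      using E.nrm_analytic_poly_le[OF ab] by simp
    also have "\<dots> \<le> (\<Sum>k\<le>n. \<delta>)" using b(2) by (intro sum_mono less_imp_le) auto
    also have "\<dots> = \<epsilon> / 2" by (simp add: \<delta>_def field_simps)
    finally have "nrm (hardy1 (ell1 I)) (F \<ominus>\<^bsub>hardy1 (ell1 I)\<^esub> q) < \<epsilon>"
      using HE.dist_triangle[OF F p(2) qc] p(3) by linarith
    then show "\<exists>d\<in>D. nrm (hardy1 (ell1 I)) (F \<ominus>\<^bsub>hardy1 (ell1 I)\<^esub> d) < \<epsilon>" using qD by blast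
  qed
  have "\<exists>u\<in>carrier P. J u = hardy_ext (ell1 I) X \<sigma> d \<and> nrm P u \<le> 1 * nrm (hardy1 (ell1 I)) d + \<delta>"
    if d: "d \<in> D" and \<delta>: "\<delta> > 0" for d \<delta>
  proof -
    obtain n b where b: "\<And>k. b k \<in> finite_support I" "d = analytic_poly (ell1 I) n b"
      using d unfolding D_def by blast
    then have "\<forall>k. \<exists>A. finite A \<and> A \<subseteq> I \<and> (\<forall>i\<in>I - A. b k i = 0)" unfolding finite_support_def by blast
    from choice[OF this] obtain B where B: "\<And>k. finite (B k)" "\<And>k. B k \<subseteq> I" "\<And>k i. i \<in> I - B k \<Longrightarrow> b k i = 0"
      by blast
    define A where "A = (\<Union>k\<in>{..n}. B k)"
    have A: "finite A" "A \<subseteq> I" "\<And>k i. k \<le> n \<Longrightarrow> i \<in> I - A \<Longrightarrow> b k i = 0"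
      unfolding A_def using B by auto
    have bc: "b k \<in> carrier (ell1 I)" "b k \<in> extensional I" for k
      using b(1)[of k] finite_support_ell1 unfolding finite_support_def by blast+
    define q where "q i = analytic_poly scalars n (\<lambda>k. b k i)" for i
    have qc: "q i \<in> carrier H" for i unfolding q_def by (rule Sc.analytic_poly_hardy1) auto
    have uc: "unit_vec I i \<in> carrier (ell1 I)" if "i \<in> A" for i using that A(2) by (auto intro: unit_vec(1))
    have uv: "b k i \<odot>\<^bsub>ell1 I\<^esub> unit_vec I i \<in> carrier (ell1 I)" if "i \<in> A" for i k
      using uc[OF that] by simp
    have "(\<Oplus>\<^bsub>hardy1 (ell1 I)\<^esub>i\<in>A. elem_fun (ell1 I) (q i) (unit_vec I i)) =
        (\<Oplus>\<^bsub>hardy1 (ell1 I)\<^esub>i\<in>A. analytic_poly (ell1 I) n (\<lambda>k. b k i \<odot>\<^bsub>ell1 I\<^esub> unit_vec I i))"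
      using uv by (intro HE.finsum_cong') (auto simp: q_def E.elem_fun_poly uc)
    also have "\<dots> = analytic_poly (ell1 I) n (\<lambda>k. \<Oplus>\<^bsub>ell1 I\<^esub>i\<in>A. b k i \<odot>\<^bsub>ell1 I\<^esub> unit_vec I i)"
      by (rule E.analytic_poly_finsum[OF A(1) uv])
    also have "\<dots> = d"
      unfolding b(2)
    proof (rule E.analytic_poly_cong[symmetric])
      show "b \<in> {..n} \<rightarrow> carrier (ell1 I)" using bc by blast
      show "b k = (\<Oplus>\<^bsub>ell1 I\<^esub>i\<in>A. b k i \<odot>\<^bsub>ell1 I\<^esub> unit_vec I i)" if "k \<le> n" for k
        by (rule finite_support_expansion[OF bc(2) A(1,2) A(3)[OF that]])
    qed
    finally have d_eq: "d = (\<Oplus>\<^bsub>hardy1 (ell1 I)\<^esub>i\<in>A. elem_fun (ell1 I) (q i) (unit_vec I i))" by simp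
    define u where "u = (\<Oplus>\<^bsub>P\<^esub>i\<in>A. elem_tensor H X (q i) (\<sigma> (unit_vec I i)))"
    have ec: "elem_tensor H X (q i) (\<sigma> (unit_vec I i)) \<in> carrier P" if "i \<in> A" for i
      using qc uc[OF that] by (intro tp.elem_tensor_closed) auto
    have u: "u \<in> carrier P" unfolding u_def using ec by (intro P.finsum_closed) auto
    have "J u = (\<Oplus>\<^bsub>hardy1 X\<^esub>i\<in>A. J (elem_tensor H X (q i) (\<sigma> (unit_vec I i))))"
      unfolding u_def by (rule J.finsum[OF A(1)]) (use ec in auto)
    also have "\<dots> = (\<Oplus>\<^bsub>hardy1 X\<^esub>i\<in>A. hardy_ext (ell1 I) X \<sigma> (elem_fun (ell1 I) (q i) (unit_vec I i)))"
    proof (rule HX.finsum_cong'[OF refl])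
      show "(\<lambda>i. hardy_ext (ell1 I) X \<sigma> (elem_fun (ell1 I) (q i) (unit_vec I i))) \<in> A \<rightarrow> carrier (hardy1 X)"
        using qc uc by (intro Pi_I ext.closed E.elem_fun_hardy1)
      fix i assume i: "i \<in> A"
      show "J (elem_tensor H X (q i) (\<sigma> (unit_vec I i))) = hardy_ext (ell1 I) X \<sigma> (elem_fun (ell1 I) (q i) (unit_vec I i))"
        using hardy_ext_elem_fun[OF E.normed_axioms X.banach_axioms \<sigma> uc[OF i] qc]
          canonical_map_props(2)[OF X.banach_axioms qc \<sigma>.closed[OF uc[OF i]]] by simp
    qed
    also have "\<dots> = hardy_ext (ell1 I) X \<sigma> d"
      unfolding d_eq using qc uc by (intro ext.finsum[symmetric] A(1) Pi_I E.elem_fun_hardy1)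
    finally have Ju: "J u = hardy_ext (ell1 I) X \<sigma> d" .
    have "nrm P u \<le> (\<Sum>i\<in>A. nrm P (elem_tensor H X (q i) (\<sigma> (unit_vec I i))))"
      unfolding u_def using ec by (intro P.nrm_finsum A(1)) auto
    also have "\<dots> \<le> (\<Sum>i\<in>A. nrm H (q i))"
    proof (rule sum_mono)
      fix i assume i: "i \<in> A"
      have "nrm P (elem_tensor H X (q i) (\<sigma> (unit_vec I i))) \<le> nrm H (q i) * nrm X (\<sigma> (unit_vec I i))"
        using qc uc[OF i] by (intro tp.nrm_elem_tensor_le) auto
      also have "\<dots> \<le> nrm H (q i) * 1"
        using \<sigma>1[of i] i A(2) by (intro mult_left_mono HS.nrm_ge_0 qc) auto
      finally show "nrm P (elem_tensor H X (q i) (\<sigma> (unit_vec I i))) \<le> nrm H (q i)" by simp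
    qed
    also have "\<dots> = nrm (hardy1 (ell1 I)) d"
      unfolding b(2) q_def by (rule ell1_poly_nrm[OF A(1,2) bc(1) A(3), symmetric])
    finally show ?thesis using Ju u \<delta> by (intro bexI[of _ u]) auto
  qed
  from lift_from_dense[OF ext.bounded_op_axioms J.bounded_op_axioms HX.normed_axioms P.banach_axioms D_dense _ this G e]
  show thesis using that by auto
qed

section \<open>Transport along an injection\<close>

text \<open>The copy of \<open>V\<close> on the image of its carrier under an injective map.\<close>

definition copy_space :: "('a \<Rightarrow> 'b) \<Rightarrow> 'a cspace \<Rightarrow> 'b cspace" where
  "copy_space \<phi> V =
     \<lparr>carrier = \<phi> ` carrier V, mult = undefined, one = undefined,
      zero = \<phi> \<zero>\<^bsub>V\<^esub>, add = (\<lambda>a b. \<phi> (the_inv \<phi> a \<oplus>\<^bsub>V\<^esub> the_inv \<phi> b)), smult = (\<lambda>c a. \<phi> (c \<odot>\<^bsub>V\<^esub> the_inv \<phi> a)),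
      nrm = (\<lambda>a. nrm V (the_inv \<phi> a))\<rparr>"

lemma copy_space_banach:
  assumes "banach V" "inj \<phi>"
  shows "banach (copy_space \<phi> V)" "bounded_op (copy_space \<phi> V) V (the_inv \<phi>)"
proof -
  interpret V: banach V by fact
  have i [simp]: "the_inv \<phi> (\<phi> x) = x" for x using assms(2) by (rule the_inv_f_f)
  have ops [simp]: "carrier (copy_space \<phi> V) = \<phi> ` carrier V" "\<zero>\<^bsub>copy_space \<phi> V\<^esub> = \<phi> \<zero>\<^bsub>V\<^esub>"
    "\<phi> x \<oplus>\<^bsub>copy_space \<phi> V\<^esub> \<phi> y = \<phi> (x \<oplus>\<^bsub>V\<^esub> y)" "c \<odot>\<^bsub>copy_space \<phi> V\<^esub> \<phi> x = \<phi> (c \<odot>\<^bsub>V\<^esub> x)"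
    "nrm (copy_space \<phi> V) (\<phi> x) = nrm V x" for x y c
    by (simp_all add: copy_space_def)
  have "Module.module scalars (copy_space \<phi> V)"
  proof (rule moduleI)
    show "abelian_group (copy_space \<phi> V)"
    proof (rule abelian_groupI)
      fix a assume "a \<in> carrier (copy_space \<phi> V)"
      then obtain x where x: "x \<in> carrier V" "a = \<phi> x" by auto
      show "\<exists>b\<in>carrier (copy_space \<phi> V). b \<oplus>\<^bsub>copy_space \<phi> V\<^esub> a = \<zero>\<^bsub>copy_space \<phi> V\<^esub>"
        using x by (intro bexI[of _ "\<phi> (\<ominus>\<^bsub>V\<^esub> x)"]) (auto simp: V.l_neg)
    qed (auto simp: V.a_ac)
  qed (auto simp: cring_scalars V.smult_add_left V.smult_add_right V.smult_smult)
  then interpret C: Module.module scalars "copy_space \<phi> V" .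
  interpret C: normed "copy_space \<phi> V"
    by unfold_locales (auto simp: V.nrm_smult V.nrm_triangle V.nrm_eq_0_iff)
  have minus: "\<phi> x \<ominus>\<^bsub>copy_space \<phi> V\<^esub> \<phi> y = \<phi> (x \<ominus>\<^bsub>V\<^esub> y)" if "x \<in> carrier V" "y \<in> carrier V" for x y
    using that by (simp add: C.minus_smult V.minus_smult)
  show "banach (copy_space \<phi> V)"
  proof unfold_locales
    fix s assume s: "cauchy_in (copy_space \<phi> V) s"
    then have "\<forall>n. \<exists>x. x \<in> carrier V \<and> s n = \<phi> x" by (auto simp: cauchy_in_def)
    from choice[OF this] obtain t where t: "\<And>n. t n \<in> carrier V" "\<And>n. s n = \<phi> (t n)" by blast
    have "cauchy_in V t" using s t(1) by (simp add: cauchy_in_def t(2) minus)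
    then obtain x where "x \<in> carrier V" "(\<lambda>n. nrm V (t n \<ominus>\<^bsub>V\<^esub> x)) \<longlonglongrightarrow> 0" using V.complete by blast
    then show "\<exists>x\<in>carrier (copy_space \<phi> V). (\<lambda>n. nrm (copy_space \<phi> V) (s n \<ominus>\<^bsub>copy_space \<phi> V\<^esub> x)) \<longlonglongrightarrow> 0"
      using t(1) by (intro bexI[of _ "\<phi> x"]) (simp_all add: t(2) minus)
  qed
  have "bounded_operator (copy_space \<phi> V) V (the_inv \<phi>)"
    by (rule bounded_operatorI[where K = 1]) auto
  then show "bounded_op (copy_space \<phi> V) V (the_inv \<phi>)" by unfold_locales
qed


section \<open>The equivalence of the three conditions\<close>

lemma op_norm_upper:
  assumes "bounded_op V W T" "x \<in> carrier V" "nrm V x \<le> 1"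
  shows "nrm W (T x) \<le> op_norm V W T"
proof -
  interpret T: bounded_op V W T by fact
  obtain K where K: "K > 0" "\<And>x. x \<in> carrier V \<Longrightarrow> nrm W (T x) \<le> K * nrm V x"
    by (rule T.bound_pos) (rule that)
  have "nrm W (T y) \<le> K" if "y \<in> carrier V" "nrm V y \<le> 1" for y
  proof -
    have "K * nrm V y \<le> K * 1" using that(2) K(1) by (intro mult_left_mono) auto
    then show ?thesis using K(2)[OF that(1)] by simp
  qed
  then have "bdd_above {nrm W (T x) | x. x \<in> carrier V \<and> nrm V x \<le> 1}"
    by (intro bdd_aboveI[of _ K]) auto
  then show ?thesis
    unfolding op_norm_def using assms(2,3) by (intro cSup_upper) auto
qed

lemma op_norm_eq_1:
  assumes "seminormed V" "\<And>x. x \<in> carrier V \<Longrightarrow> nrm W (T x) \<le> nrm V x"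
    and "x \<in> carrier V" "nrm V x \<le> 1" "nrm W (T x) = 1"
  shows "op_norm V W T = 1"
  unfolding op_norm_def
proof (rule cSup_eq_maximum)
  show "1 \<in> {nrm W (T x) | x. x \<in> carrier V \<and> nrm V x \<le> 1}" using assms(3-5) by force
  fix t assume "t \<in> {nrm W (T x) | x. x \<in> carrier V \<and> nrm V x \<le> 1}"
  then show "t \<le> 1" using assms(2) by force
qed

text \<open>The vectors of norm one.\<close>

definition unit_sphere :: "'x cspace \<Rightarrow> 'x set" where
  "unit_sphere X = {x \<in> carrier X. nrm X x = 1}"

text \<open>
  The canonical quotient map of \<open>ell1\<close> of the unit sphere, indexed by any injective image of the sphere.
\<close>

lemma canonical_quotient:
  fixes \<iota> :: "'x \<Rightarrow> 'i"
  assumes "banach X" "inj \<iota>"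
  obtains \<sigma> where "bounded_op (ell1 (\<iota> ` unit_sphere X)) X \<sigma>"
    "\<And>x. x \<in> unit_sphere X \<Longrightarrow> \<sigma> (unit_vec (\<iota> ` unit_sphere X) (\<iota> x)) = x"
    "\<And>f. f \<in> carrier (ell1 (\<iota> ` unit_sphere X)) \<Longrightarrow> nrm X (\<sigma> f) \<le> nrm (ell1 (\<iota> ` unit_sphere X)) f"
    "\<And>x. x \<in> carrier X \<Longrightarrow> \<exists>f\<in>carrier (ell1 (\<iota> ` unit_sphere X)). \<sigma> f = x \<and> nrm (ell1 (\<iota> ` unit_sphere X)) f \<le> 1 * nrm X x"
proof -
  interpret X: banach X by fact
  define I where "I = \<iota> ` unit_sphere X"
  interpret E: banach "ell1 I" by (rule ell1_banach)
  have inv: "the_inv \<iota> (\<iota> x) = x" for x using assms(2) by (rule the_inv_f_f)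
  obtain \<sigma> where \<sigma>: "bounded_op (ell1 I) X \<sigma>" "\<And>i. i \<in> I \<Longrightarrow> \<sigma> (unit_vec I i) = the_inv \<iota> i"
    "\<And>f. f \<in> carrier (ell1 I) \<Longrightarrow> nrm X (\<sigma> f) \<le> nrm (ell1 I) f"
  proof (rule ell1_extend[OF assms(1), of I "the_inv \<iota>"])
    show "the_inv \<iota> i \<in> carrier X" "nrm X (the_inv \<iota> i) \<le> 1" if "i \<in> I" for i
      using that by (auto simp: I_def unit_sphere_def inv)
  qed (rule that)
  interpret \<sigma>: bounded_op "ell1 I" X \<sigma> by (rule \<sigma>(1))
  have unit: "\<sigma> (unit_vec I (\<iota> x)) = x" if "x \<in> unit_sphere X" for x
    using \<sigma>(2)[of "\<iota> x"] that by (simp add: I_def inv)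
  have lift: "\<exists>f\<in>carrier (ell1 I). \<sigma> f = x \<and> nrm (ell1 I) f \<le> 1 * nrm X x" if x: "x \<in> carrier X" for x
  proof (cases "nrm X x = 0")
    case True
    then have "x = \<zero>\<^bsub>X\<^esub>" using x X.nrm_eq_0 by blast
    then show ?thesis by (intro bexI[of _ "\<zero>\<^bsub>ell1 I\<^esub>"]) auto
  next
    case False
    define s where "s = complex_of_real (1 / nrm X x) \<odot>\<^bsub>X\<^esub> x"
    have pos: "nrm X x > 0" using False X.nrm_ge_0[OF x] by linarith
    have s: "s \<in> unit_sphere X" using x pos by (simp add: s_def unit_sphere_def X.nrm_smult norm_divide)
    then have sI: "\<iota> s \<in> I" by (simp add: I_def)
    define f where "f = complex_of_real (nrm X x) \<odot>\<^bsub>ell1 I\<^esub> unit_vec I (\<iota> s)"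
    have fc: "f \<in> carrier (ell1 I)" using unit_vec(1)[OF sI] by (simp add: f_def)
    have "\<sigma> f = complex_of_real (nrm X x) \<odot>\<^bsub>X\<^esub> s"
      using unit_vec(1)[OF sI] unit[OF s] by (simp add: f_def \<sigma>.smult)
    also have "\<dots> = x" using x pos by (simp add: s_def X.smult_smult flip: of_real_mult)
    finally have "\<sigma> f = x" .
    moreover have "nrm (ell1 I) f = nrm X x"
      using unit_vec[OF sI] pos by (simp add: f_def E.nrm_smult)
    ultimately show ?thesis using fc by (intro bexI[of _ f]) auto
  qed
  show thesis using that[of \<sigma>] \<sigma>(1,3) unit lift by (simp add: I_def)
qed

context tensor_H1
begin

lemma H1_projectiveE:
  assumes "H1_projective X" "F \<in> carrier (hardy1 X)"
  obtains u where "u \<in> carrier P" "J u = F"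
proof -
  have "F \<in> J ` carrier P" using assms by (simp add: H1_projective_def)
  then show thesis using that by blast
qed

text \<open>It is enough to find preimages in the open unit ball.\<close>

lemma H1_projective_if_scaled:
  assumes "\<And>F. F \<in> carrier (hardy1 X) \<Longrightarrow> nrm (hardy1 X) F < 1 \<Longrightarrow> \<exists>u\<in>carrier P. J u = F"
  shows "H1_projective X"
  unfolding H1_projective_def
proof (intro equalityI subsetI)
  fix F assume F: "F \<in> carrier (hardy1 X)"
  define t where "t = nrm (hardy1 X) F + 1"
  have t: "t > 0" using HX.nrm_ge_0[OF F] by (simp add: t_def)
  have c: "complex_of_real (1 / t) \<odot>\<^bsub>hardy1 X\<^esub> F \<in> carrier (hardy1 X)" by (rule HX.smult_in[OF F])
  have "nrm (hardy1 X) (complex_of_real (1 / t) \<odot>\<^bsub>hardy1 X\<^esub> F) = nrm (hardy1 X) F / t"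
    unfolding HX.nrm_smult[OF F] norm_of_real using t by simp
  also have "\<dots> < 1" using t by (simp add: t_def)
  finally obtain u where u: "u \<in> carrier P" "J u = complex_of_real (1 / t) \<odot>\<^bsub>hardy1 X\<^esub> F"
    using assms[OF c] by blast
  have "J (complex_of_real t \<odot>\<^bsub>P\<^esub> u) = complex_of_real t \<odot>\<^bsub>hardy1 X\<^esub> (complex_of_real (1 / t) \<odot>\<^bsub>hardy1 X\<^esub> F)"
    unfolding J.smult[OF u(1)] u(2) ..
  also have "\<dots> = (complex_of_real t * complex_of_real (1 / t)) \<odot>\<^bsub>hardy1 X\<^esub> F" by (rule HX.smult_smult[OF F])
  also have "complex_of_real t * complex_of_real (1 / t) = 1" using t by (simp flip: of_real_mult)
  also have "1 \<odot>\<^bsub>hardy1 X\<^esub> F = F" by (rule HX.one_smult[OF F])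
  finally show "F \<in> J ` carrier P" using P.smult_in[OF u(1)] by (metis image_eqI)
qed auto

text \<open>The constant \<open>eta X\<close> is an attained infimum.\<close>

lemma eta_props:
  assumes "H1_projective X" "carrier X \<noteq> {\<zero>\<^bsub>X\<^esub>}"
  shows "\<And>u. u \<in> carrier P \<Longrightarrow> nrm P u \<le> eta X * nrm (hardy1 X) (J u)"
    and "\<And>c. (\<And>u. u \<in> carrier P \<Longrightarrow> nrm P u \<le> c * nrm (hardy1 X) (J u)) \<Longrightarrow> eta X \<le> c"
    and "eta X \<ge> 1"
proof -
  define S where "S = {c. \<forall>u\<in>carrier P. nrm P u \<le> c * nrm (hardy1 X) (J u)}"
  obtain C where "\<And>u. u \<in> carrier P \<Longrightarrow> nrm P u \<le> C * nrm (hardy1 X) (J u)"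
    by (rule canonical_map_bounded_below[OF assms(1)]) (rule that)
  then have "C \<in> S" by (simp add: S_def del: hardy1_ops)
  obtain x where x: "x \<in> carrier X" "x \<noteq> \<zero>\<^bsub>X\<^esub>" using assms(2) X.zero_closed by blast
  have nx: "nrm X x > 0" using X.nrm_eq_0[OF x(1)] X.nrm_ge_0[OF x(1)] x(2) by linarith
  have n1: "nrm H (monomial 0) = 1"
    using Sc.nrm_monomial[of 1 0 0] by (simp add: monomial_def cong: if_cong)
  define v where "v = elem_tensor H X (monomial 0) x"
  have v: "v \<in> carrier P" unfolding v_def by (rule tp.elem_tensor_closed[OF monomial_hardy1 x(1)])
  have Jv: "nrm (hardy1 X) (J v) = nrm X x"
    using canonical_map_props(2)[OF X.banach_axioms monomial_hardy1 x(1)]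
      X.nrm_elem_fun[OF Sc.hardy1_L1[OF monomial_hardy1] x(1)] n1 by (simp add: v_def)
  have S1: "1 \<le> c" if "c \<in> S" for c
  proof -
    have "nrm (hardy1 X) (J v) \<le> nrm P v" by (rule canonical_map_props(3)[OF X.banach_axioms v])
    also have "\<dots> \<le> c * nrm (hardy1 X) (J v)" using that v by (simp add: S_def del: hardy1_ops)
    finally show ?thesis using nx unfolding Jv by simp
  qed
  have bdd: "bdd_below S" using S1 by (rule bdd_belowI)
  have inf: "Inf S \<in> S"
    unfolding S_def mem_Collect_eq
  proof
    fix u assume u: "u \<in> carrier P"
    have b: "nrm P u \<le> c * nrm (hardy1 X) (J u)" if "c \<in> S" for c
      using that u by (simp add: S_def del: hardy1_ops)
    show "nrm P u \<le> Inf {c. \<forall>u\<in>carrier P. nrm P u \<le> c * nrm (hardy1 X) (J u)} * nrm (hardy1 X) (J u)"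
      unfolding S_def[symmetric]
    proof (cases "nrm (hardy1 X) (J u) = 0")
      case True
      then show "nrm P u \<le> Inf S * nrm (hardy1 X) (J u)" using b[OF \<open>C \<in> S\<close>] by simp
    next
      case False
      then have pos: "nrm (hardy1 X) (J u) > 0" using HX.nrm_ge_0[OF J.closed[OF u]] by linarith
      have "nrm P u / nrm (hardy1 X) (J u) \<le> Inf S"
        using \<open>C \<in> S\<close> b pos by (intro cInf_greatest) (auto simp: divide_le_eq)
      then show "nrm P u \<le> Inf S * nrm (hardy1 X) (J u)" using pos by (simp add: divide_le_eq)
    qed
  qed
  have "eta X = Inf S"
    unfolding eta_def
  proof (rule Least_equality)
    show "\<forall>u\<in>carrier P. nrm P u \<le> Inf S * nrm (hardy1 X) (J u)" using inf by (simp add: S_def del: hardy1_ops)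
    show "Inf S \<le> c" if "\<forall>u\<in>carrier P. nrm P u \<le> c * nrm (hardy1 X) (J u)" for c
      by (rule cInf_lower[OF _ bdd]) (use that in \<open>simp add: S_def del: hardy1_ops\<close>)
  qed
  then have eta: "eta X \<in> S" "\<And>c. c \<in> S \<Longrightarrow> eta X \<le> c" using inf cInf_lower[OF _ bdd] by auto
  show "nrm P u \<le> eta X * nrm (hardy1 X) (J u)" if "u \<in> carrier P" for u
    using eta(1) that by (simp add: S_def del: hardy1_ops)
  show "eta X \<le> c" if "\<And>u. u \<in> carrier P \<Longrightarrow> nrm P u \<le> c * nrm (hardy1 X) (J u)" for c
    using eta(2)[of c] that by (simp add: S_def del: hardy1_ops)
  show "eta X \<ge> 1" by (rule S1[OF eta(1)])
qed

text \<open>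
  A surjection constant \<open>r\<close> of the extension of \<open>\<sigma>\<close> bounds the inverse of the canonical map, by
  \<open>lift_ell1\<close> and injectivity.
\<close>

lemma lifts_from_ell1_imp:
  assumes "metric_surjection (ell1 I) X \<sigma>"
    and "lambda_surjection r (hardy1 (ell1 I)) (hardy1 X) (hardy_ext (ell1 I) X \<sigma>)"
    and "carrier X \<noteq> {\<zero>\<^bsub>X\<^esub>}"
  shows "H1_projective X" "eta X \<le> r"
proof -
  interpret E: banach "ell1 I" by (rule ell1_banach)
  interpret HE: banach "hardy1 (ell1 I)" by (rule E.hardy1_banach)
  have "lambda_surjection (1 + 1) (ell1 I) X \<sigma>"
    using assms(1) unfolding metric_surjection_def by (metis zero_less_one)
  then have \<sigma>: "bounded_operator (ell1 I) X \<sigma>" "op_norm (ell1 I) X \<sigma> = 1"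
    unfolding lambda_surjection_def by auto
  interpret \<sigma>: bounded_op "ell1 I" X \<sigma> by unfold_locales (rule \<sigma>(1))
  have \<sigma>1: "nrm X (\<sigma> (unit_vec I i)) \<le> 1" if "i \<in> I" for i
    using op_norm_upper[OF \<sigma>.bounded_op_axioms unit_vec(1)[OF that]] unit_vec(2)[OF that] \<sigma>(2) by simp
  have lift: "\<exists>u\<in>carrier P. J u = F \<and> nrm P u < r" if F: "F \<in> carrier (hardy1 X)" "nrm (hardy1 X) F < 1" for F
  proof -
    obtain G where G: "G \<in> carrier (hardy1 (ell1 I))" "nrm (hardy1 (ell1 I)) G < r"
      "hardy_ext (ell1 I) X \<sigma> G = F"
      using assms(2) F unfolding lambda_surjection_def by blast
    have pos: "(r - nrm (hardy1 (ell1 I)) G) / 2 > 0" using G(2) by simp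
    obtain u where u: "u \<in> carrier P" "J u = hardy_ext (ell1 I) X \<sigma> G"
      "nrm P u \<le> nrm (hardy1 (ell1 I)) G + (r - nrm (hardy1 (ell1 I)) G) / 2"
      by (rule lift_ell1[OF \<sigma>.bounded_op_axioms \<sigma>1 G(1) pos]) (assumption, rule that)
    have "a + (r - a) / 2 < r" if "a < r" for a :: real using that by (simp add: field_simps)
    from this[OF G(2)] have "nrm P u < r" using u(3) by (rule le_less_trans[rotated])
    then show ?thesis using u(1,2) G(3) by blast
  qed
  show proj: "H1_projective X" by (rule H1_projective_if_scaled) (use lift in blast)
  have r: "r > 0"
  proof -
    have "nrm (hardy1 X) \<zero>\<^bsub>hardy1 X\<^esub> < 1" using HX.nrm_zero by simp
    from lift[OF HX.zero_closed this] obtain u where "u \<in> carrier P" "nrm P u < r" by blast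
    then show ?thesis using P.nrm_ge_0[of u] by linarith
  qed
  show "eta X \<le> r"
  proof (rule eta_props(2)[OF proj assms(3)])
    fix u assume u: "u \<in> carrier P"
    show "nrm P u \<le> r * nrm (hardy1 X) (J u)"
    proof (rule field_le_epsilon)
      fix e :: real assume e: "e > 0"
      define t where "t = nrm (hardy1 X) (J u) + e / r"
      have t: "t > 0" "nrm (hardy1 X) (J u) < t"
        using HX.nrm_ge_0[OF J.closed[OF u]] e r by (auto simp: t_def intro: add_nonneg_pos)
      define w where "w = complex_of_real (1 / t) \<odot>\<^bsub>P\<^esub> u"
      have w: "w \<in> carrier P" unfolding w_def by (rule P.smult_in[OF u])
      have "nrm (hardy1 X) (J w) = nrm (hardy1 X) (J u) / t"
        unfolding w_def J.smult[OF u] HX.nrm_smult[OF J.closed[OF u]] norm_of_real using t(1) by simp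
      also have "\<dots> < 1" using t by simp
      finally obtain v where v: "v \<in> carrier P" "J v = J w" "nrm P v < r" using lift[OF J.closed[OF w]] by blast
      then have "nrm P w < r" using canonical_map_inj[OF v(1) w v(2)] by simp
      moreover have "nrm P w = nrm P u / t"
        unfolding w_def P.nrm_smult[OF u] norm_of_real using t(1) by simp
      ultimately have "nrm P u \<le> r * t" using t(1) by (simp add: divide_less_eq)
      also have "\<dots> = r * nrm (hardy1 X) (J u) + e" using r by (simp add: t_def distrib_left)
      finally show "nrm P u \<le> r * nrm (hardy1 X) (J u) + e" .
    qed
  qed
qed

text \<open>
  For the canonical quotient map, preimages of norm \<open>nrm X x\<close> exist, so nothing is lost in
  \<open>lift_canonical\<close> and the constant is \<open>eta X\<close>.
\<close>

lemma H1_projective_imp_lifts_from_ell1: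
  fixes \<iota> :: "'x \<Rightarrow> 'i"
  assumes proj: "H1_projective X" and X0: "carrier X \<noteq> {\<zero>\<^bsub>X\<^esub>}" and \<iota>: "inj \<iota>"
  obtains I :: "'i set" and \<sigma> where "metric_surjection (ell1 I) X \<sigma>"
    "lambda_surjection (eta X) (hardy1 (ell1 I)) (hardy1 X) (hardy_ext (ell1 I) X \<sigma>)"
proof -
  define I where "I = \<iota> ` unit_sphere X"
  interpret E: banach "ell1 I" by (rule ell1_banach)
  interpret HE: banach "hardy1 (ell1 I)" by (rule E.hardy1_banach)
  obtain \<sigma> where \<sigma>: "bounded_op (ell1 I) X \<sigma>"
    "\<And>x. x \<in> unit_sphere X \<Longrightarrow> \<sigma> (unit_vec I (\<iota> x)) = x"
    "\<And>f. f \<in> carrier (ell1 I) \<Longrightarrow> nrm X (\<sigma> f) \<le> nrm (ell1 I) f"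
    "\<And>x. x \<in> carrier X \<Longrightarrow> \<exists>f\<in>carrier (ell1 I). \<sigma> f = x \<and> nrm (ell1 I) f \<le> 1 * nrm X x"
    by (rule canonical_quotient[OF X.banach_axioms \<iota>, folded I_def]) (rule that)
  interpret \<sigma>: bounded_op "ell1 I" X \<sigma> by (rule \<sigma>(1))
  note ext = hardy_ext_props[OF E.normed_axioms X.banach_axioms \<sigma>(1)]
  obtain x where x: "x \<in> carrier X" "x \<noteq> \<zero>\<^bsub>X\<^esub>" using X0 X.zero_closed by blast
  have nx: "nrm X x > 0" using X.nrm_eq_0[OF x(1)] X.nrm_ge_0[OF x(1)] x(2) by linarith
  define s where "s = complex_of_real (1 / nrm X x) \<odot>\<^bsub>X\<^esub> x"
  have s: "s \<in> unit_sphere X" "s \<in> carrier X" "nrm X s = 1"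
    using x nx by (simp_all add: s_def unit_sphere_def X.nrm_smult norm_divide)
  have sI: "\<iota> s \<in> I" using s by (simp add: I_def)
  note us = unit_vec[OF sI] \<sigma>(2)[OF s(1)]
  show thesis
  proof (rule that[of I \<sigma>])
    have "op_norm (ell1 I) X \<sigma> = 1"
      by (rule op_norm_eq_1[OF E.seminormed_axioms \<sigma>(3) us(1)]) (use us s in auto)
    moreover have "\<exists>f\<in>carrier (ell1 I). nrm (ell1 I) f < 1 + \<epsilon> \<and> \<sigma> f = y"
      if y: "\<epsilon> > 0" "y \<in> carrier X" "nrm X y < 1" for \<epsilon> y
    proof -
      obtain f where f: "f \<in> carrier (ell1 I)" "\<sigma> f = y" "nrm (ell1 I) f \<le> 1 * nrm X y"
        using \<sigma>(4)[OF y(2)] by blast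
      then show ?thesis using y(1,3) by (intro bexI[of _ f]) auto
    qed
    ultimately show "metric_surjection (ell1 I) X \<sigma>"
      unfolding metric_surjection_def lambda_surjection_def using \<sigma>.bounded by blast
    \<comment> \<open>a constant function shows that the extension of \<open>\<sigma>\<close> has norm one\<close>
    define F where "F = analytic_poly (ell1 I) 0 (\<lambda>l. if l = 0 then unit_vec I (\<iota> s) else \<zero>\<^bsub>ell1 I\<^esub>)"
    have F: "F \<in> carrier (hardy1 (ell1 I))" unfolding F_def using us(1) by (intro E.analytic_poly_hardy1) auto
    have "nrm (hardy1 (ell1 I)) F = 1" using E.nrm_monomial[OF us(1), of 0 0] us(2) by (simp add: F_def)
    moreover have "nrm (hardy1 X) (hardy_ext (ell1 I) X \<sigma> F) = 1"
    proof -
      have "hardy_ext (ell1 I) X \<sigma> F = analytic_poly X 0 (\<sigma> \<circ> (\<lambda>l. if l = 0 then unit_vec I (\<iota> s) else \<zero>\<^bsub>ell1 I\<^esub>))"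
        unfolding F_def using us(1) by (intro ext(2)) auto
      also have "\<sigma> \<circ> (\<lambda>l. if l = 0 then unit_vec I (\<iota> s) else \<zero>\<^bsub>ell1 I\<^esub>) = (\<lambda>l. if l = 0 then s else \<zero>\<^bsub>X\<^esub>)"
        using us(3) by auto
      finally show ?thesis using X.nrm_monomial[OF s(2), of 0 0] s(3) by simp
    qed
    moreover have "nrm (hardy1 X) (hardy_ext (ell1 I) X \<sigma> G) \<le> nrm (hardy1 (ell1 I)) G"
      if "G \<in> carrier (hardy1 (ell1 I))" for G
      using ext(3)[OF that, of 1] \<sigma>(3) by simp
    ultimately have on: "op_norm (hardy1 (ell1 I)) (hardy1 X) (hardy_ext (ell1 I) X \<sigma>) = 1"
      using F by (intro op_norm_eq_1[OF HE.seminormed_axioms, of _ _ F]) auto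
    have "\<exists>G\<in>carrier (hardy1 (ell1 I)). nrm (hardy1 (ell1 I)) G < eta X \<and> hardy_ext (ell1 I) X \<sigma> G = K"
      if K: "K \<in> carrier (hardy1 X)" "nrm (hardy1 X) K < 1" for K
    proof -
      obtain u where u: "u \<in> carrier P" "J u = K" using H1_projectiveE[OF proj K(1)] by blast
      have "eta X * nrm (hardy1 X) K < eta X * 1"
        using K(2) eta_props(3)[OF proj X0] by (intro mult_strict_left_mono) auto
      then have lt: "nrm P u < eta X" using eta_props(1)[OF proj X0 u(1)] unfolding u(2) by linarith
      then have "(eta X - nrm P u) / 2 > 0" by simp
      then obtain G where G: "G \<in> carrier (hardy1 (ell1 I))" "hardy_ext (ell1 I) X \<sigma> G = J u"
        "nrm (hardy1 (ell1 I)) G \<le> 1 * nrm P u + (eta X - nrm P u) / 2"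
        using lift_canonical[OF E.banach_axioms \<sigma>(1) zero_le_one \<sigma>(4) u(1)] by blast
      have "1 * a + (b - a) / 2 < b" if "a < b" for a b :: real using that by (simp add: field_simps)
      from this[OF lt] have "nrm (hardy1 (ell1 I)) G < eta X" using G(3) by (rule le_less_trans[rotated])
      then show ?thesis using G(1,2) u(2) by blast
    qed
    then show "lambda_surjection (eta X) (hardy1 (ell1 I)) (hardy1 X) (hardy_ext (ell1 I) X \<sigma>)"
      unfolding lambda_surjection_def using on bounded_op.bounded[OF ext(1)] by blast
  qed
qed

text \<open>By the open mapping theorem, vectors have preimages under \<open>\<rho>\<close> of comparable norm.\<close>

lemma H1_projective_imp_lifts_surjection:
  assumes proj: "H1_projective X" and "banach Y" "surjective_operator Y X \<rho>"
  shows "surjective_operator (hardy1 Y) (hardy1 X) (hardy_ext Y X \<rho>)"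
proof -
  interpret Y: banach Y by fact
  interpret \<rho>: bounded_op Y X \<rho>
    by unfold_locales (use assms(3) in \<open>simp add: surjective_operator_def\<close>)
  have "\<rho> ` carrier Y = carrier X" using assms(3) by (simp add: surjective_operator_def)
  then obtain C where C: "C > 0" "\<And>x. x \<in> carrier X \<Longrightarrow> \<exists>y\<in>carrier Y. \<rho> y = x \<and> nrm Y y \<le> C * nrm X x"
    using open_mapping[OF Y.banach_axioms X.banach_axioms \<rho>.bounded_op_axioms] by blast
  note ext = hardy_ext_props(1)[OF Y.normed_axioms X.banach_axioms \<rho>.bounded_op_axioms]
  have "K \<in> hardy_ext Y X \<rho> ` carrier (hardy1 Y)" if K: "K \<in> carrier (hardy1 X)" for K
  proof -
    obtain u where u: "u \<in> carrier P" "J u = K" using H1_projectiveE[OF proj K] by blast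
    obtain G where G: "G \<in> carrier (hardy1 Y)" "hardy_ext Y X \<rho> G = J u"
      by (rule lift_canonical[OF Y.banach_axioms \<rho>.bounded_op_axioms less_imp_le[OF C(1)] C(2) u(1) zero_less_one])
        (assumption, rule that)
    show ?thesis by (rule image_eqI[of _ _ G]) (simp_all add: G u(2))
  qed
  then show ?thesis
    unfolding surjective_operator_def using bounded_op.bounded[OF ext] bounded_op.closed[OF ext] by blast
qed

text \<open>The hypothesis is applied to one space: a copy, by an injection \<open>\<phi>\<close>, of \<open>ell1\<close> of the unit sphere of \<open>X\<close>.\<close>

lemma lifts_all_surjections_imp:
  fixes \<phi> :: "('x \<Rightarrow> complex) \<Rightarrow> 'y"
  assumes "inj \<phi>"
    and "\<And>(Y :: 'y cspace) \<rho>. banach Y \<Longrightarrow> surjective_operator Y X \<rho> \<Longrightarrow>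
       surjective_operator (hardy1 Y) (hardy1 X) (hardy_ext Y X \<rho>)"
  shows "H1_projective X"
proof -
  define I where "I = id ` unit_sphere X"
  interpret E: banach "ell1 I" by (rule ell1_banach)
  define Y where "Y = copy_space \<phi> (ell1 I)"
  have Y: "banach Y" "bounded_op Y (ell1 I) (the_inv \<phi>)"
    unfolding Y_def by (rule copy_space_banach[OF E.banach_axioms assms(1)])+
  interpret Y: banach Y by (rule Y(1))
  interpret \<phi>: bounded_op Y "ell1 I" "the_inv \<phi>" by (rule Y(2))
  obtain \<sigma> where \<sigma>: "bounded_op (ell1 I) X \<sigma>"
    "\<And>x. x \<in> unit_sphere X \<Longrightarrow> \<sigma> (unit_vec I (id x)) = x"
    "\<And>f. f \<in> carrier (ell1 I) \<Longrightarrow> nrm X (\<sigma> f) \<le> nrm (ell1 I) f"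
    "\<And>x. x \<in> carrier X \<Longrightarrow> \<exists>f\<in>carrier (ell1 I). \<sigma> f = x \<and> nrm (ell1 I) f \<le> 1 * nrm X x"
    by (rule canonical_quotient[OF X.banach_axioms inj_on_id, folded I_def]) (rule that)
  interpret \<rho>: bounded_op Y X "\<lambda>y. \<sigma> (the_inv \<phi> y)" by (rule bounded_op_compose[OF Y(2) \<sigma>(1)])
  have "x \<in> (\<lambda>y. \<sigma> (the_inv \<phi> y)) ` carrier Y" if x: "x \<in> carrier X" for x
  proof -
    obtain f where f: "f \<in> carrier (ell1 I)" "\<sigma> f = x" using \<sigma>(4)[OF x] by blast
    then have "\<phi> f \<in> carrier Y" "\<sigma> (the_inv \<phi> (\<phi> f)) = x" using assms(1) by (simp_all add: Y_def copy_space_def the_inv_f_f)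
    then show ?thesis by (intro image_eqI[of _ _ "\<phi> f"]) simp_all
  qed
  then have "surjective_operator Y X (\<lambda>y. \<sigma> (the_inv \<phi> y))"
    unfolding surjective_operator_def using \<rho>.bounded \<rho>.closed by blast
  from assms(2)[OF Y(1) this]
  have onto: "hardy_ext Y X (\<lambda>y. \<sigma> (the_inv \<phi> y)) ` carrier (hardy1 Y) = carrier (hardy1 X)"
    by (simp add: surjective_operator_def)
  have \<sigma>1: "nrm X (\<sigma> (unit_vec I i)) \<le> 1" if "i \<in> I" for i
    using \<sigma>(3)[OF unit_vec(1)[OF that]] unit_vec(2)[OF that] by simp
  show ?thesis
  proof (rule H1_projective_if_scaled)
    fix K assume K: "K \<in> carrier (hardy1 X)"
    then have "K \<in> hardy_ext Y X (\<lambda>y. \<sigma> (the_inv \<phi> y)) ` carrier (hardy1 Y)" by (simp add: onto)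
    then obtain G where G: "G \<in> carrier (hardy1 Y)" "hardy_ext Y X (\<lambda>y. \<sigma> (the_inv \<phi> y)) G = K"
      by blast
    have G': "hardy_ext Y (ell1 I) (the_inv \<phi>) G \<in> carrier (hardy1 (ell1 I))"
      by (rule bounded_op.closed[OF hardy_ext_props(1)[OF Y.normed_axioms E.banach_axioms Y(2)] G(1)])
    obtain u where "u \<in> carrier P" "J u = hardy_ext (ell1 I) X \<sigma> (hardy_ext Y (ell1 I) (the_inv \<phi>) G)"
      by (rule lift_ell1[OF \<sigma>(1) \<sigma>1 G' zero_less_one]) (assumption, rule that)
    then show "\<exists>u\<in>carrier P. J u = K"
      using hardy_ext_comp[OF Y.normed_axioms E.banach_axioms X.banach_axioms Y(2) \<sigma>(1) G(1)] G(2) by auto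
  qed
qed

end

theorem proposition2p2:
  fixes X :: "'x cspace"
  assumes "complex_banach_space X"
    and "carrier X \<noteq> {\<zero>\<^bsub>X\<^esub>}"
  shows "(H1_projective X \<longleftrightarrow> (\<exists>r. lifts_from_ell1 TYPE(('u, 'x) universe) X r)) \<and>
         (H1_projective X \<longleftrightarrow> lifts_all_surjections TYPE(('u, 'x) universe) X) \<and>
         (H1_projective X \<longrightarrow>
            lifts_from_ell1 TYPE(('u, 'x) universe) X (eta X) \<and>
            (\<forall>r. lifts_from_ell1 TYPE(('u, 'x) universe) X r \<longrightarrow> eta X \<le> r))"
proof -
  interpret X: banach X using assms(1) by (simp add: complex_banach_space_iff)
  interpret tensor_H1 X by unfold_locales
  \<comment> \<open>indicator functions embed \<open>X\<close> into the universe\<close>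
  define \<iota> :: "'x \<Rightarrow> ('u, 'x) universe" where "\<iota> x = Inr (\<lambda>y. if y = x then 1 else 0)" for x
  have "inj \<iota>"
  proof (rule injI)
    fix x y assume "\<iota> x = \<iota> y"
    then have "(\<lambda>z. if z = x then 1 else 0 :: complex) = (\<lambda>z. if z = y then 1 else 0)" by (simp add: \<iota>_def)
    from fun_cong[OF this, of x] show "x = y" by (simp split: if_splits)
  qed
  have 1: "lifts_from_ell1 TYPE(('u, 'x) universe) X (eta X)" if "H1_projective X"
    using H1_projective_imp_lifts_from_ell1[OF that assms(2) \<open>inj \<iota>\<close>] unfolding lifts_from_ell1_def by blast
  have 2: "H1_projective X" "eta X \<le> r" if "lifts_from_ell1 TYPE(('u, 'x) universe) X r" for r
    using that lifts_from_ell1_imp[OF _ _ assms(2)] unfolding lifts_from_ell1_def by blast+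
  have 3: "lifts_all_surjections TYPE(('u, 'x) universe) X" if "H1_projective X"
    using H1_projective_imp_lifts_surjection[OF that]
    unfolding lifts_all_surjections_def complex_banach_space_iff by blast
  have 4: "H1_projective X" if "lifts_all_surjections TYPE(('u, 'x) universe) X"
  proof (rule lifts_all_surjections_imp)
    show "inj (Inr :: ('x \<Rightarrow> complex) \<Rightarrow> ('u, 'x) universe)" by simp
    show "surjective_operator (hardy1 Y) (hardy1 X) (hardy_ext Y X \<rho>)"
      if "banach Y" "surjective_operator Y X \<rho>" for Y :: "('u, 'x) universe cspace" and \<rho>
      using that \<open>lifts_all_surjections TYPE(('u, 'x) universe) X\<close>
      unfolding lifts_all_surjections_def complex_banach_space_iff by blast
  qed
  show ?thesis using 1 2 3 4 by blast
qed

end
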